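(* Let $\Gamma_1,\Gamma_2$ be two locally perturbed sound-soft surfaces (Dirichlet boundary condition) and fix the wave number $k>0$. If $u^{sc}_{1,\infty}(\hat x;d)=u^{sc}_{2,\infty}(\hat x;d)$ for all $\hat x\in\mathbb S^2_+$ and all $d\in\mathbb S^2_-$, then $\Gamma_1=\Gamma_2$.
   Context: Fix a wave number $k>0$. Write $x=(\tilde x,x_3)\in\mathbb R^3$ with $\tilde x=(x_1,x_2)$, and $\mathbb S^2_\pm=\{x\in\mathbb R^3:|x|=1,\ \pm x_3>0\}$. A locally perturbed surface is $\Gamma=\{(\tilde x,f(\tilde x)):\tilde x\in\mathbb R^2\}$, where $f:\mathbb R^2\to\mathbb R$ is Lipschitz continuous and $f(\tilde x)=0$ for $|\tilde x|>R$ for some $R>\max|f|$; $\Omega=\{x:x_3>f(\tilde x)\}$ is the region above $\Gamma$ and $\nu$ is the unit normal on $\Gamma$ pointing into $\Omega$. For $d=(\alpha,\beta,-\gamma)\in\mathbb S^2_-$ the incident plane wave is $u^{in}(x;d)=e^{ikx\cdot d}$ and its reflected wave from the flat plane $\{x_3=0\}$ is $u^{re}(x;d)=-e^{ik(\alpha x_1+\beta x_2+\gamma x_3)}$ in the Dirichlet case and $u^{re}(x;d)=+e^{ik(\alpha x_1+\beta x_2+\gamma x_3)}$ in the Neumann case. The total field is $u=u^{in}+u^{re}+u^{sc}$, where $u$ satisfies $\Delta u+k^2u=0$ in $\Omega$, the boundary condition $u=0$ on $\Gamma$ (sound-soft/Dirichlet) or $\partial_\nu u=0$ on $\Gamma$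 (sound-hard/Neumann), and the scattered field $u^{sc}$ satisfies the Sommerfeld radiation condition $\lim_{r\to\infty}r(\partial_ru^{sc}-iku^{sc})=0$, $r=|x|$, $x\in\Omega$; this problem is uniquely solvable. Then $u^{sc}(x;d)=\frac{e^{ik|x|}}{|x|}\{u^{sc}_\infty(\hat x;d)+O(1/|x|)\}$ as $|x|\to\infty$ in $\Omega$, $\hat x=x/|x|\in\mathbb S^2_+$, and $u^{sc}_\infty(\cdot;d)$ is the far-field pattern. Quantities associated with a surface $\Gamma_j=\{x_3=f_j(\tilde x)\}$ carry the index $j$. *)

theory Defs
  imports "HOL-Analysis.Analysis"
begin

definition tild :: "real^3 \<Rightarrow> real^2" where
  "tild x = vector [x$1, x$2]"

definition Omega :: "(real^2 \<Rightarrow> real) \<Rightarrow> (real^3) set" where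
  "Omega f = {x. x$3 > f (tild x)}"

definition Gamma :: "(real^2 \<Rightarrow> real) \<Rightarrow> (real^3) set" where
  "Gamma f = {x. x$3 = f (tild x)}"

definition locally_perturbed :: "(real^2 \<Rightarrow> real) \<Rightarrow> bool" where
  "locally_perturbed f \<longleftrightarrow>
     (\<exists>L. L-lipschitz_on UNIV f) \<and>
     (\<exists>R. (\<forall>y. norm y > R \<longrightarrow> f y = 0) \<and> (\<forall>y. \<bar>f y\<bar> < R))"

definition S2plus :: "(real^3) set" where
  "S2plus = {x. norm x = 1 \<and> x$3 > 0}"

definition S2minus :: "(real^3) set" where
  "S2minus = {x. norm x = 1 \<and> x$3 < 0}"

definition pdiff :: "3 \<Rightarrow> (real^3 \<Rightarrow> complex) \<Rightarrow> real^3 \<Rightarrow> complex" where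
  "pdiff i u x = vector_derivative (\<lambda>t. u (x + t *\<^sub>R axis i 1)) (at 0)"

definition helmholtz_on :: "(real^3) set \<Rightarrow> real \<Rightarrow> (real^3 \<Rightarrow> complex) \<Rightarrow> bool" where
  "helmholtz_on S k u \<longleftrightarrow>
     (\<forall>x\<in>S. u differentiable (at x) \<and> (\<forall>i. pdiff i u differentiable (at x)) \<and>
        (\<Sum>i\<in>UNIV. pdiff i (pdiff i u) x) + complex_of_real (k^2) * u x = 0)"

text \<open>Incident plane wave and its reflection (Dirichlet case) from the plane x_3 = 0,
  for d = (alpha, beta, -gamma).\<close>
definition u_in :: "real \<Rightarrow> real^3 \<Rightarrow> real^3 \<Rightarrow> complex" where
  "u_in k d x = exp (\<i> * complex_of_real (k * (x \<bullet> d)))"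

definition u_re_D :: "real \<Rightarrow> real^3 \<Rightarrow> real^3 \<Rightarrow> complex" where
  "u_re_D k d x = - exp (\<i> * complex_of_real (k * (d$1 * x$1 + d$2 * x$2 - d$3 * x$3)))"

definition radiating :: "real \<Rightarrow> (real^3) set \<Rightarrow> (real^3 \<Rightarrow> complex) \<Rightarrow> bool" where
  "radiating k S v \<longleftrightarrow>
     (\<forall>x\<in>S. v differentiable (at x)) \<and>
     (\<forall>e>0. \<exists>R0. \<forall>x\<in>S. norm x \<ge> R0 \<longrightarrow>
        norm x * cmod (frechet_derivative v (at x) (x /\<^sub>R norm x) - \<i> * complex_of_real k * v x) \<le> e)"

definition dirichlet_total_field ::
  "real \<Rightarrow> (real^2 \<Rightarrow> real) \<Rightarrow> real^3 \<Rightarrow> (real^3 \<Rightarrow> complex) \<Rightarrow> bool" where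
  "dirichlet_total_field k f d u \<longleftrightarrow>
     continuous_on (closure (Omega f)) u \<and>
     helmholtz_on (Omega f) k u \<and>
     (\<forall>x\<in>Gamma f. u x = 0) \<and>
     radiating k (Omega f) (\<lambda>x. u x - u_in k d x - u_re_D k d x)"

definition far_field :: "real \<Rightarrow> (real^3) set \<Rightarrow> (real^3 \<Rightarrow> complex) \<Rightarrow> (real^3 \<Rightarrow> complex) \<Rightarrow> bool" where
  "far_field k S v F \<longleftrightarrow>
     (\<exists>C R0. \<forall>x\<in>S. norm x \<ge> R0 \<longrightarrow>
        cmod (v x - exp (\<i> * complex_of_real (k * norm x)) / complex_of_real (norm x) * F (x /\<^sub>R norm x))
          \<le> C / (norm x)^2)"

end

theory Submission
  imports Defs "HOL-Complex_Analysis.Complex_Analysis"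
begin

text \<open>
  If the two far fields agree, the difference of the total fields decays like \<open>1 / |x|\<^sup>2\<close> and, by odd
  reflection in the plane, satisfies the Helmholtz equation outside a ball. It is then zero there
  (Rellich), and the two fields agree wherever both are defined, by analyticity on vertical lines.
  Suppose now that \<open>f1 < f2\<close> somewhere. On the bounded set \<open>D\<close> between the surfaces each total field
  of the first surface solves the Helmholtz equation and vanishes on the boundary. Such functions form
  a finite-dimensional space: for \<open>w\<close> in it, the extension by zero of \<open>|w|\<close> is a weak subsolution, so
  the sup norm is bounded by the \<open>L\<^sup>2\<close> norm, and integrating the sum of squares of an orthonormal
  system bounds its size. But the fields of infinitely many directions of incidence are linearly
  independent: a vanishing combination persists on a vertical ray, where the scattered fields decay
  and the incident and reflected fields are multiples of \<open>sin (k \<gamma> x\<^sub>3)\<close> with different \<open>\<gamma>\<close>.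

  Neither Green's formula nor special functions are needed. A weak solution equals its convolution
  with an explicit smooth, compactly supported kernel up to a constant factor, which gives analyticity
  on lines. Outside a ball it is likewise a sum of an outgoing and an incoming field, and comparing
  the growth of their holomorphic continuations along rays leaves no room for decay like
  \<open>1 / |x|\<^sup>2\<close>.
\<close>

section \<open>Interior estimates for second differences\<close>

text \<open>This is Schiffer's uniqueness argument, and three obstacles shape it. Difference
  Laplacians replace it: they are symmetric because Lebesgue measure is translation invariant, and
  on solutions they are locally bounded by the maximum principle. Next, the region between two
  Lipschitz graphs can have cusps, and k^2 may be a Dirichlet eigenvalue of it. So no boundary
  regularity is at hand and a single field need not vanish there; only a dimension count can give
  the contradiction. Finally, the difference of two fields is known to be continuous up to the plane
  and no more, so the reflected function is shown to be a solution in the weak sense. In the Rellich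
  step, decay like 1 / |x|^2 removes the contribution of large spheres for the outgoing and for the
  incoming kernel alike. Having both representations at once is what forces the field to
  vanish.\<close>

lemma has_vector_derivative_reflect:
  fixes f :: "real \<Rightarrow> 'a::real_normed_vector"
  assumes "(f has_vector_derivative D) (at (- t))"
  shows "((\<lambda>t. f (- t)) has_vector_derivative - D) (at t)"
proof -
  have "(uminus has_vector_derivative (- 1::real)) (at t)" by (auto intro!: derivative_eq_intros)
  from vector_diff_chain_at[OF this assms] show ?thesis by (simp add: o_def)
qed

text \<open>\<open>D\<close> is the derivative of \<open>f'\<close> at the single point 0; no second
  derivative elsewhere is available. Subtracting the parabola leaves an even remainder whose
  derivative is o(t) by that differentiability, and the mean value inequality on the segment from 0
  to \<open>h\<close> turns this into o(h^2).\<close>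

lemma second_difference_tendsto:
  fixes f :: "real \<Rightarrow> 'a::real_normed_vector"
  assumes "d > 0" and der: "\<And>t. \<bar>t\<bar> < d \<Longrightarrow> (f has_vector_derivative f' t) (at t)"
    and der2: "(f' has_vector_derivative D) (at 0)"
  shows "((\<lambda>h. (f h + f (-h) - 2 *\<^sub>R f 0) /\<^sub>R h\<^sup>2) \<longlongrightarrow> D) (at 0)"
proof (rule LIM_I)
  fix e :: real assume "e > 0"
  have "(\<lambda>t. norm (f' t - f' 0 - t *\<^sub>R D) / norm t) \<midarrow>0\<rightarrow> 0"
    using der2 unfolding has_vector_derivative_def has_derivative_at by simp
  from LIM_D[OF this, of "e/4"] \<open>e > 0\<close> obtain s where "s > 0"
    and s: "\<And>t. t \<noteq> 0 \<Longrightarrow> \<bar>t\<bar> < s \<Longrightarrow> norm (f' t - f' 0 - t *\<^sub>R D) / \<bar>t\<bar> < e/4" by auto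
  have s': "norm (f' t - f' 0 - t *\<^sub>R D) \<le> e/4 * \<bar>t\<bar>" if "\<bar>t\<bar> < s" for t
    using s[of t] that by (cases "t = 0") (auto simp: field_simps)
  show "\<exists>s>0. \<forall>x. x \<noteq> 0 \<and> norm (x - 0) < s \<longrightarrow>
         norm ((f x + f (- x) - 2 *\<^sub>R f 0) /\<^sub>R x\<^sup>2 - D) < e"
  proof (intro exI[of _ "min s d"] conjI allI impI)
    show "0 < min s d" using \<open>s > 0\<close> \<open>d > 0\<close> by simp
    fix h :: real assume h: "h \<noteq> 0 \<and> norm (h - 0) < min s d"
    define r where "r t = f t + f (- t) - 2 *\<^sub>R f 0 - t\<^sup>2 *\<^sub>R D" for t
    define r' where "r' t = f' t - f' (- t) - (2 * t) *\<^sub>R D" for t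
    have abs_le: "\<bar>t\<bar> \<le> \<bar>h\<bar>" if "t \<in> closed_segment 0 h" for t
      using that by (auto simp: closed_segment_eq_real_ivl split: if_splits)
    have dr: "(r has_vector_derivative r' t) (at t within closed_segment 0 h)"
      if "t \<in> closed_segment 0 h" for t
    proof -
      have t: "\<bar>t\<bar> < d" "\<bar>-t\<bar> < d" using abs_le[OF that] h by auto
      have "((\<lambda>t. f (-t)) has_vector_derivative - f' (-t)) (at t)"
        by (rule has_vector_derivative_reflect[OF der[OF t(2)]])
      then have "(r has_vector_derivative r' t) (at t)"
        unfolding r_def r'_def using der[OF t(1)]
        by (auto intro!: derivative_eq_intros simp: algebra_simps scaleR_2)
      then show ?thesis by (rule has_vector_derivative_at_within)
    qed
    have r'b: "norm (r' t) \<le> e/2 * \<bar>h\<bar>" if "t \<in> closed_segment 0 h" for t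
    proof -
      have t: "\<bar>t\<bar> < s" "\<bar>-t\<bar> < s" using abs_le[OF that] h by auto
      have "r' t = (f' t - f' 0 - t *\<^sub>R D) - (f' (-t) - f' 0 - (-t) *\<^sub>R D)"
        using scaleR_left_distrib[of t t D] by (simp add: r'_def)
      also have "norm \<dots> \<le> e/4 * \<bar>t\<bar> + e/4 * \<bar>-t\<bar>"
        by (rule order_trans[OF norm_triangle_ineq4 add_mono[OF s'[OF t(1)] s'[OF t(2)]]])
      also have "\<dots> \<le> e/2 * \<bar>h\<bar>" using abs_le[OF that] \<open>e > 0\<close> by (simp add: field_simps)
      finally show ?thesis .
    qed
    have r0: "r' 0 = 0" "r 0 = 0" by (auto simp: r'_def r_def scaleR_2)
    have "norm (r h - r 0 - (h - 0) *\<^sub>R r' 0) \<le> norm (h - 0) * (e/2 * \<bar>h\<bar>)"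
      by (rule vector_differentiable_bound_linearization[where S="closed_segment 0 h"])
         (use dr r'b r0 in auto)
    then have "norm (r h) \<le> e/2 * h\<^sup>2" by (simp add: r0 power2_eq_square algebra_simps)
    moreover have "(f h + f (- h) - 2 *\<^sub>R f 0) /\<^sub>R h\<^sup>2 - D = r h /\<^sub>R h\<^sup>2"
      using h by (simp add: r_def scaleR_diff_right)
    ultimately have "norm ((f h + f (- h) - 2 *\<^sub>R f 0) /\<^sub>R h\<^sup>2 - D) \<le> e/2"
      using h by (simp add: field_simps)
    then show "norm ((f h + f (- h) - 2 *\<^sub>R f 0) /\<^sub>R h\<^sup>2 - D) < e" using \<open>e > 0\<close> by simp
  qed
qed

text \<open>Uniformity in \<open>h\<close> is the point: it supplies the dominating constant for
  difference quotients of test functions. The factor 4 is generous.\<close>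

lemma second_difference_bound:
  fixes f :: "real \<Rightarrow> 'a::real_normed_vector"
  assumes der: "\<And>t. (f has_vector_derivative f' t) (at t)"
    and der2: "\<And>t. (f' has_vector_derivative f'' t) (at t)"
    and M: "\<And>t. norm (f'' t) \<le> M"
  shows "norm (f h + f (-h) - 2 *\<^sub>R f 0) \<le> 4 * M * h\<^sup>2"
proof -
  have "M \<ge> 0" using M[of 0] norm_ge_zero order_trans by blast
  have lip: "norm (f' b - f' a) \<le> 2 * M * \<bar>b - a\<bar>" for a b
  proof -
    have "norm (f' b - f' a) \<le> M * norm (b - a)"
      by (rule differentiable_bound[where S=UNIV and f'="\<lambda>x t. t *\<^sub>R f'' x"])
         (use der2 M in \<open>auto simp: has_vector_derivative_def onorm_scaleR_left onorm_id\<close>)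
    also have "\<dots> \<le> 2 * M * \<bar>b - a\<bar>" using \<open>M \<ge> 0\<close> by (simp add: mult_right_mono)
    finally show ?thesis .
  qed
  define g where "g t = f t + f (- t)" for t
  have dg: "(g has_vector_derivative f' t - f' (-t)) (at t)" for t
  proof -
    have "((\<lambda>t. f (-t)) has_vector_derivative - f' (-t)) (at t)"
      by (rule has_vector_derivative_reflect[OF der])
    then show ?thesis unfolding g_def using der by (auto intro!: derivative_eq_intros)
  qed
  have "norm (g h - g 0 - (h - 0) *\<^sub>R (f' 0 - f' (- 0))) \<le> norm (h - 0) * (4 * M * \<bar>h\<bar>)"
  proof (rule vector_differentiable_bound_linearization[where S="closed_segment 0 h" and f'="\<lambda>t. f' t - f' (- t)"])
    fix x assume "x \<in> closed_segment 0 h"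
    then have "\<bar>x\<bar> \<le> \<bar>h\<bar>" by (auto simp: closed_segment_eq_real_ivl split: if_splits)
    have "norm (f' x - f' (- x) - (f' 0 - f' (- 0))) \<le> 2 * M * \<bar>x - - x\<bar>" using lip[of x "-x"] by simp
    also have "\<dots> = 4 * M * \<bar>x\<bar>" by (simp add: abs_mult)
    also have "\<dots> \<le> 4 * M * \<bar>h\<bar>" using \<open>M \<ge> 0\<close> \<open>\<bar>x\<bar> \<le> \<bar>h\<bar>\<close> by (intro mult_left_mono) auto
    finally show "norm (f' x - f' (- x) - (f' 0 - f' (- 0))) \<le> 4 * M * \<bar>h\<bar>" .
  qed (use dg in \<open>auto intro: has_vector_derivative_at_within\<close>)
  then show ?thesis by (simp add: g_def power2_eq_square algebra_simps scaleR_2)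
qed

lemma second_derivative_nonpos_at_max:
  fixes f :: "real \<Rightarrow> real"
  assumes "d > 0" and "\<And>t. \<bar>t\<bar> < d \<Longrightarrow> (f has_vector_derivative f' t) (at t)"
    and "(f' has_vector_derivative D) (at 0)" and max: "\<And>t. \<bar>t\<bar> < d \<Longrightarrow> f t \<le> f 0"
  shows "D \<le> 0"
proof (rule tendsto_upperbound[OF second_difference_tendsto[OF assms(1-3)]])
  show "\<forall>\<^sub>F h in at 0. (f h + f (- h) - 2 *\<^sub>R f 0) /\<^sub>R h\<^sup>2 \<le> 0"
    unfolding eventually_at
  proof (intro exI[of _ d] conjI ballI impI)
    fix h :: real assume "h \<noteq> 0 \<and> dist h 0 < d"
    then have "f h \<le> f 0" "f (-h) \<le> f 0" using max[of h] max[of "-h"] by (auto simp: dist_real_def)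
    then show "(f h + f (- h) - 2 *\<^sub>R f 0) /\<^sub>R h\<^sup>2 \<le> 0"
      by (auto simp: divide_inverse mult_le_0_iff)
  qed (use \<open>d > 0\<close> in auto)
qed auto

text \<open>Just the data that enter a Laplacian: a derivative along each axis, and its derivative
  along the same axis. \<open>G\<close> and \<open>H\<close> are carried explicitly, so transformed
  functions come with explicit derivatives, and nothing is said about joint differentiability or
  about continuity of \<open>H\<close>.\<close>

definition axis2 ::
  "(real^3) set \<Rightarrow> (real^3 \<Rightarrow> 'a::real_normed_vector) \<Rightarrow> (3 \<Rightarrow> real^3 \<Rightarrow> 'a) \<Rightarrow> (3 \<Rightarrow> real^3 \<Rightarrow> 'a) \<Rightarrow> bool"
  where "axis2 S u G H \<longleftrightarrow> (\<forall>x\<in>S. \<forall>i.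
     ((\<lambda>t. u (x + t *\<^sub>R axis i 1)) has_vector_derivative G i x) (at 0) \<and>
     ((\<lambda>t. G i (x + t *\<^sub>R axis i 1)) has_vector_derivative H i x) (at 0))"

lemma has_vector_derivative_line_shift:
  fixes u :: "real^3 \<Rightarrow> 'a::real_normed_vector"
  assumes "((\<lambda>s. u ((x + t *\<^sub>R e) + s *\<^sub>R e)) has_vector_derivative D) (at 0)"
  shows "((\<lambda>s. u (x + s *\<^sub>R e)) has_vector_derivative D) (at t)"
proof -
  have "((\<lambda>s. u ((x + t *\<^sub>R e) + s *\<^sub>R e)) has_vector_derivative D) (at (t - t))" using assms by simp
  moreover have "((\<lambda>s. s - t) has_vector_derivative 1) (at t)"
    by (auto intro!: derivative_eq_intros)
  ultimately show ?thesis
    using vector_diff_chain_at[of "\<lambda>s. s - t" 1 t "\<lambda>s. u ((x + t *\<^sub>R e) + s *\<^sub>R e)" D]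
    by (simp add: o_def scaleR_left_diff_distrib)
qed

lemma axis2_D1:
  assumes "axis2 S u G H" "x + t *\<^sub>R axis i 1 \<in> S"
  shows "((\<lambda>s. u (x + s *\<^sub>R axis i 1)) has_vector_derivative G i (x + t *\<^sub>R axis i 1)) (at t)"
  by (rule has_vector_derivative_line_shift[where u=u]) (use assms in \<open>simp add: axis2_def\<close>)

lemma axis2_D2:
  assumes "axis2 S u G H" "x + t *\<^sub>R axis i 1 \<in> S"
  shows "((\<lambda>s. G i (x + s *\<^sub>R axis i 1)) has_vector_derivative H i (x + t *\<^sub>R axis i 1)) (at t)"
  by (rule has_vector_derivative_line_shift[where u="G i"]) (use assms in \<open>simp add: axis2_def\<close>)

lemma axis2_subset: "axis2 S u G H \<Longrightarrow> T \<subseteq> S \<Longrightarrow> axis2 T u G H"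
  by (auto simp: axis2_def)

lemma axis2_linear:
  assumes "bounded_linear L" "axis2 S u G H"
  shows "axis2 S (\<lambda>x. L (u x)) (\<lambda>i x. L (G i x)) (\<lambda>i x. L (H i x))"
  unfolding axis2_def
proof (intro ballI allI conjI)
  fix x i assume "x \<in> S"
  then show "((\<lambda>t. L (u (x + t *\<^sub>R axis i 1))) has_vector_derivative L (G i x)) (at 0)"
    "((\<lambda>t. L (G i (x + t *\<^sub>R axis i 1))) has_vector_derivative L (H i x)) (at 0)"
    using bounded_linear.has_vector_derivative[OF assms(1), of "\<lambda>t. u (x + t *\<^sub>R axis i 1)"]
      bounded_linear.has_vector_derivative[OF assms(1), of "\<lambda>t. G i (x + t *\<^sub>R axis i 1)"] assms(2)
    by (simp_all add: axis2_def)
qed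

lemma axis2_add:
  assumes "axis2 S u G H" "axis2 S v G' H'"
  shows "axis2 S (\<lambda>x. u x + v x) (\<lambda>i x. G i x + G' i x) (\<lambda>i x. H i x + H' i x)"
  unfolding axis2_def
  by (intro ballI allI conjI has_vector_derivative_add) (use assms in \<open>simp_all add: axis2_def\<close>)

lemma axis2_diff:
  assumes "axis2 S u G H" "axis2 S v G' H'"
  shows "axis2 S (\<lambda>x. u x - v x) (\<lambda>i x. G i x - G' i x) (\<lambda>i x. H i x - H' i x)"
  unfolding axis2_def
  by (intro ballI allI conjI has_vector_derivative_diff) (use assms in \<open>simp_all add: axis2_def\<close>)

lemma axis2_translate:
  assumes "axis2 S u G H" "\<And>x. x \<in> T \<Longrightarrow> x + a \<in> S"
  shows "axis2 T (\<lambda>x. u (x + a)) (\<lambda>i x. G i (x + a)) (\<lambda>i x. H i (x + a))"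
proof -
  have "x + t *\<^sub>R axis i 1 + a = (x + a) + t *\<^sub>R axis i 1" for x t i by simp
  then show ?thesis using assms unfolding axis2_def by (simp only:) blast
qed

definition mirror :: "3 \<Rightarrow> real^3 \<Rightarrow> real^3 \<Rightarrow> real^3" where
  "mirror j y x = x - (2 * (x$j - y$j)) *\<^sub>R axis j 1"

lemma mirror_axis: "mirror j y (x + t *\<^sub>R axis i 1) = mirror j y x + ((if i = j then -1 else 1) * t) *\<^sub>R axis i 1"
proof (cases "i = j")
  case True
  then have "(x + t *\<^sub>R axis i 1) $ j = x $ j + t" by simp
  then show ?thesis using True by (simp add: mirror_def algebra_simps flip: scaleR_left_distrib)
next
  case False
  then have "(x + t *\<^sub>R axis i 1) $ j = x $ j" by (simp add: axis_def)
  then show ?thesis using False by (simp add: mirror_def)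
qed

text \<open>The sign from the chain rule appears in the first derivative and squares away in the
  second, so the Laplacian commutes with the reflection.\<close>

lemma axis2_mirror:
  assumes "axis2 S u G H" "\<And>x. x \<in> T \<Longrightarrow> mirror j y x \<in> S"
  shows "axis2 T (\<lambda>x. u (mirror j y x)) (\<lambda>i x. (if i = j then -1 else 1) *\<^sub>R G i (mirror j y x))
           (\<lambda>i x. H i (mirror j y x))"
  unfolding axis2_def
proof (intro ballI allI conjI)
  fix x i assume "x \<in> T"
  let ?z = "mirror j y x"
  let ?s = "if i = j then -1 else 1 :: real"
  have z: "?z \<in> S" using assms \<open>x \<in> T\<close> by auto
  have s: "((\<lambda>t. ?s * t) has_vector_derivative ?s) (at 0)" by (auto intro!: derivative_eq_intros)
  have 1: "((\<lambda>t. u (?z + t *\<^sub>R axis i 1)) has_vector_derivative G i ?z) (at (?s * 0))"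
    and 2: "((\<lambda>t. G i (?z + t *\<^sub>R axis i 1)) has_vector_derivative H i ?z) (at (?s * 0))"
    using assms(1) z by (auto simp: axis2_def)
  show "((\<lambda>t. u (mirror j y (x + t *\<^sub>R axis i 1))) has_vector_derivative ?s *\<^sub>R G i ?z) (at 0)"
    unfolding mirror_axis using vector_diff_chain_at[OF s 1] by (simp add: o_def)
  have "((\<lambda>t. G i (?z + (?s * t) *\<^sub>R axis i 1)) has_vector_derivative ?s *\<^sub>R H i ?z) (at 0)"
    using vector_diff_chain_at[OF s 2] by (simp add: o_def)
  from bounded_linear.has_vector_derivative[OF bounded_linear_scaleR_right this, of ?s]
  show "((\<lambda>t. ?s *\<^sub>R G i (mirror j y (x + t *\<^sub>R axis i 1))) has_vector_derivative H i ?z) (at 0)"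
    unfolding mirror_axis by (cases "i = j") simp_all
qed

section \<open>Maximum principle and interior difference estimates\<close>

lemma maximum_principle_strict:
  fixes w :: "real^3 \<Rightarrow> real"
  assumes "open Q" "bounded Q" "continuous_on (closure Q) w" "axis2 Q w G H"
    and pos: "\<And>x. x \<in> Q \<Longrightarrow> (\<Sum>i\<in>UNIV. H i x) > 0"
    and bd: "\<And>x. x \<in> closure Q \<Longrightarrow> x \<notin> Q \<Longrightarrow> w x \<le> m" and "x \<in> Q"
  shows "w x \<le> m"
proof (rule ccontr)
  assume "\<not> w x \<le> m"
  have "compact (closure Q)" "closure Q \<noteq> {}" using \<open>bounded Q\<close> \<open>x \<in> Q\<close> by auto
  from continuous_attains_sup[OF this assms(3)] obtain z where z: "z \<in> closure Q"
    "\<And>y. y \<in> closure Q \<Longrightarrow> w y \<le> w z" by auto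
  then have "w x \<le> w z" using \<open>x \<in> Q\<close> closure_subset by auto
  then have "z \<in> Q" using bd[OF z(1)] \<open>\<not> w x \<le> m\<close> by linarith
  then obtain d where d: "d > 0" "ball z d \<subseteq> Q" using \<open>open Q\<close> by (auto simp: open_contains_ball)
  have inb: "z + t *\<^sub>R axis i 1 \<in> Q" if "\<bar>t\<bar> < d" for t i
    using that by (intro subsetD[OF d(2)]) (simp add: dist_norm norm_axis_1)
  have "H i z \<le> 0" for i
  proof (rule second_derivative_nonpos_at_max[OF d(1)])
    fix t assume t: "\<bar>t\<bar> < d"
    show "((\<lambda>s. w (z + s *\<^sub>R axis i 1)) has_vector_derivative G i (z + t *\<^sub>R axis i 1)) (at t)"
      by (rule axis2_D1[OF assms(4) inb[OF t]])
    show "w (z + t *\<^sub>R axis i 1) \<le> w (z + 0 *\<^sub>R axis i 1)"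
      using z(2)[of "z + t *\<^sub>R axis i 1"] inb[OF t] closure_subset[of Q] by auto
  next
    show "((\<lambda>s. G i (z + s *\<^sub>R axis i 1)) has_vector_derivative H i z) (at 0)"
      using assms(4) \<open>z \<in> Q\<close> by (auto simp: axis2_def)
  qed
  then have "(\<Sum>i\<in>UNIV. H i z) \<le> 0" by (simp add: sum_nonpos)
  then show False using pos[OF \<open>z \<in> Q\<close>] by simp
qed

abbreviation cube :: "real^3 \<Rightarrow> real \<Rightarrow> (real^3) set" where
  "cube y d \<equiv> cbox (\<chi> i. y$i - d) (\<chi> i. y$i + d)"

lemma mem_cube: "x \<in> cube y d \<longleftrightarrow> (\<forall>i. \<bar>x$i - y$i\<bar> \<le> d)"
  by (auto simp: mem_box_cart abs_le_iff algebra_simps)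

text \<open>The factor 3 is the dimension, from comparing the Euclidean norm with the l1
  norm.\<close>

lemma cube_subset_cball: "cube y d \<subseteq> cball y (3 * d)"
proof
  fix x assume "x \<in> cube y d"
  then have *: "\<bar>(x - y)$i\<bar> \<le> d" for i by (simp add: mem_cube)
  have "norm (x - y) \<le> (\<Sum>i\<in>UNIV. \<bar>(x - y)$i\<bar>)" by (rule norm_le_l1_cart)
  also have "\<dots> \<le> (\<Sum>i\<in>(UNIV::3 set). d)" by (rule sum_mono) (rule *)
  also have "\<dots> = 3 * d" by simp
  finally show "x \<in> cball y (3 * d)" by (simp add: dist_norm norm_minus_commute)
qed

lemma cube_diff_axis:
  assumes "\<bar>t\<bar> \<le> d" "x \<in> cube y e"
  shows "x + t *\<^sub>R axis i 1 \<in> cube y (e + d)"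
  unfolding mem_cube
proof
  fix j
  have "\<bar>x$j - y$j\<bar> \<le> e" using assms by (simp add: mem_cube)
  moreover have "\<bar>(t *\<^sub>R axis i 1 :: real^3) $ j\<bar> \<le> d" using assms by (auto simp: axis_def)
  ultimately show "\<bar>(x + t *\<^sub>R axis i 1) $ j - y $ j\<bar> \<le> e + d"
    unfolding vector_add_component by linarith
qed

text \<open>The comparison function is Gilbarg and Trudinger's barrier for the interior gradient
  estimate: it is nonnegative on the symmetry plane of the cube, at least M on the other
  faces of the half cube, and its Laplacian is -N.\<close>

lemma difference_bound_real:
  fixes w :: "real^3 \<Rightarrow> real"
  assumes "d > 0" "axis2 (cube y d) w G H" "continuous_on (cube y d) w"
    and N: "\<And>x. x \<in> cube y d \<Longrightarrow> \<bar>\<Sum>i\<in>UNIV. H i x\<bar> \<le> N" and "N < N'"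
    and M: "\<And>x. x \<in> cube y d \<Longrightarrow> \<bar>w x\<bar> \<le> M" and t: "0 \<le> t" "t \<le> d"
  shows "w (y + t *\<^sub>R axis j 1) - w (y - t *\<^sub>R axis j 1) \<le> t * (6 * M / d + N' * d)"
proof -
  \<comment> \<open>\<open>\<xi>\<close> is the signed distance from the symmetry plane of the cube
    and \<open>b i\<close> its derivative along axis \<open>i\<close>.\<close>
  define \<xi> where "\<xi> x = x$j - y$j" for x :: "real^3"
  define b where "b i = (if i = j then 1 else 0 :: real)" for i
  define psi where "psi x = M / d\<^sup>2 * ((x - y) \<bullet> (x - y) + 3 * d * \<xi> x - 3 * (\<xi> x)\<^sup>2)
      + N' / 2 * (\<xi> x * d - (\<xi> x)\<^sup>2)" for x
  define Gp where "Gp i x = M / d\<^sup>2 * (2 * (x$i - y$i) + 3 * d * b i - 6 * \<xi> x * b i)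
      + N' / 2 * (b i * d - 2 * \<xi> x * b i)" for i and x :: "real^3"
  define Hp where "Hp i x = M / d\<^sup>2 * (2 - 6 * b i) - N' * b i" for i and x :: "real^3"
  have "y \<in> cube y d" using \<open>d > 0\<close> by (simp add: mem_cube)
  then have "N \<ge> 0" "M \<ge> 0" using N[of y] M[of y] by linarith+
  have \<xi>_line: "\<xi> (x + s *\<^sub>R axis i 1) = \<xi> x + s * b i" for x s i
    by (simp add: \<xi>_def b_def axis_def)
  have psi_ax: "axis2 UNIV psi Gp Hp"
    unfolding axis2_def
  proof (intro ballI allI conjI)
    fix x i
    have q: "(x + s *\<^sub>R axis i 1 - y) \<bullet> (x + s *\<^sub>R axis i 1 - y)
        = (x - y) \<bullet> (x - y) + 2 * s * (x$i - y$i) + s\<^sup>2" for s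
    proof -
      have e: "x + s *\<^sub>R axis i 1 - y = (x - y) + s *\<^sub>R axis i 1" by simp
      have "axis i (1::real) \<bullet> axis i 1 = (1::real)" by (simp add: inner_axis_axis)
      then show ?thesis unfolding e
        by (simp add: inner_add_left inner_add_right inner_axis inner_axis' power2_eq_square algebra_simps)
    qed
    have bb: "b i * b i = b i" by (simp add: b_def)
    have "((\<lambda>s. M / d\<^sup>2 * ((x - y) \<bullet> (x - y) + 2 * s * (x$i - y$i) + s\<^sup>2 + 3 * d * (\<xi> x + s * b i)
        - 3 * (\<xi> x + s * b i)\<^sup>2) + N' / 2 * ((\<xi> x + s * b i) * d - (\<xi> x + s * b i)\<^sup>2))
        has_real_derivative Gp i x) (at 0)"
      unfolding Gp_def by (rule derivative_eq_intros refl | simp)+ (simp add: mult.commute mult.left_commute)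
    then show "((\<lambda>s. psi (x + s *\<^sub>R axis i 1)) has_vector_derivative Gp i x) (at 0)"
      unfolding psi_def \<xi>_line q has_real_derivative_iff_has_vector_derivative .
    have l: "(x + s *\<^sub>R axis i 1) $ i = x $ i + s" for s by simp
    have "((\<lambda>s. M / d\<^sup>2 * (2 * (x$i + s - y$i) + 3 * d * b i - 6 * (\<xi> x + s * b i) * b i)
      + N' / 2 * (b i * d - 2 * (\<xi> x + s * b i) * b i)) has_real_derivative
        M / d\<^sup>2 * (2 - 6 * (b i * b i)) - N' * (b i * b i)) (at 0)"
      by (rule derivative_eq_intros refl | simp)+
    then show "((\<lambda>s. Gp i (x + s *\<^sub>R axis i 1)) has_vector_derivative Hp i x) (at 0)"
      unfolding Gp_def Hp_def \<xi>_line l bb has_real_derivative_iff_has_vector_derivative .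
  qed
  have psi_sum: "(\<Sum>i\<in>UNIV. Hp i x) = - N'" for x
  proof -
    have "(\<Sum>i\<in>UNIV. b i) = 1" by (simp add: b_def)
    moreover have "(\<Sum>i\<in>UNIV. Hp i x) = (\<Sum>i\<in>(UNIV::3 set). M / d\<^sup>2 * 2) - (6 * (M / d\<^sup>2) + N') * (\<Sum>i\<in>UNIV. b i)"
      unfolding Hp_def sum_distrib_left sum_subtractf[symmetric] by (simp add: algebra_simps)
    ultimately show ?thesis by simp
  qed
  define P where "P = {x. y$j < x$j} \<inter> (\<Inter>i. {x. \<bar>x$i - y$i\<bar> < d})"
  have "open P" unfolding P_def
    by (intro open_Int open_INT open_Collect_less continuous_intros ballI) auto
  have Pc: "P \<subseteq> cube y d" by (force simp: P_def mem_cube intro: less_imp_le)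
  then have "bounded P" using bounded_cbox bounded_subset by blast
  have clP: "closure P \<subseteq> cube y d \<inter> {x. y$j \<le> x$j}"
    by (rule closure_minimal)
       (use Pc in \<open>auto simp: P_def intro!: closed_Int closed_Collect_le continuous_intros\<close>)
  have mc: "mirror j y x \<in> cube y d" if "x \<in> cube y d" for x
    unfolding mem_cube
  proof
    fix i show "\<bar>mirror j y x $ i - y $ i\<bar> \<le> d"
      using that[unfolded mem_cube, rule_format, of i]
      by (cases "i = j") (auto simp: mirror_def axis_def)
  qed
  \<comment> \<open>The odd part of \<open>w\<close> under the reflection vanishes on the symmetry
    plane and is at most \<open>M\<close> in modulus, so the barrier has to reach \<open>M\<close>
    only on the other faces of the half cube \<open>P\<close>.\<close>
  define phi where "phi x = (1/2) * (w x - w (mirror j y x)) - psi x" for x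
  have ax: "axis2 (cube y d) phi
     (\<lambda>i x. (1/2) * (G i x - (if i = j then -1 else 1) *\<^sub>R G i (mirror j y x)) - Gp i x)
     (\<lambda>i x. (1/2) * (H i x - H i (mirror j y x)) - Hp i x)"
    unfolding phi_def
    by (intro axis2_diff axis2_linear[OF bounded_linear_mult_right] axis2_mirror[OF assms(2) mc]
         axis2_subset[OF psi_ax] assms(2)) auto
  \<comment> \<open>The odd part contributes at least \<open>- N\<close> to the Laplacian of
    \<open>phi\<close> and the barrier contributes \<open>N'\<close>. The strict gap between them
    makes the maximum principle applicable.\<close>
  have pos: "0 < s" if "s = (1/2) * (a - b) + N'" "\<bar>a\<bar> \<le> N" "\<bar>b\<bar> \<le> N" for a b s :: real
  proof -
    have "- N \<le> a" "b \<le> N" using that(2,3) by (auto simp: abs_le_iff)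
    then have "- (2 * N) \<le> a - b" by simp
    moreover have "2 * s = a - b + 2 * N'" using that(1) by (simp add: field_simps)
    ultimately show ?thesis using \<open>N < N'\<close> by simp
  qed
  have comp: "phi x \<le> 0" if "x \<in> P" for x
  proof (rule maximum_principle_strict[OF \<open>open P\<close> \<open>bounded P\<close> _ axis2_subset[OF ax Pc] _ _ that])
    have "continuous_on UNIV (mirror j y)" unfolding mirror_def by (intro continuous_intros)
    then have "continuous_on (cube y d) (\<lambda>x. w (mirror j y x))"
      by (intro continuous_on_compose2[OF assms(3)]) (auto intro: continuous_on_subset mc)
    then have "continuous_on (cube y d) phi"
      unfolding phi_def psi_def \<xi>_def by (intro continuous_intros assms(3))
    then show "continuous_on (closure P) phi" using clP continuous_on_subset by blast
    fix x assume "x \<in> P"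
    then have x: "x \<in> cube y d" "mirror j y x \<in> cube y d" using Pc mc by auto
    have "(\<Sum>i\<in>UNIV. (1/2) * (H i x - H i (mirror j y x)) - Hp i x) =
       (1/2) * ((\<Sum>i\<in>UNIV. H i x) - (\<Sum>i\<in>UNIV. H i (mirror j y x))) + N'"
      unfolding sum_subtractf sum_distrib_left[symmetric] psi_sum by simp
    then show "0 < (\<Sum>i\<in>UNIV. (1/2) * (H i x - H i (mirror j y x)) - Hp i x)"
      by (rule pos) (rule N[OF x(1)] N[OF x(2)])+
  next
    fix x assume x: "x \<in> closure P" "x \<notin> P"
    then have xc: "x \<in> cube y d" and \<xi>0: "\<xi> x \<ge> 0" using clP by (auto simp: \<xi>_def)
    have comps: "\<bar>x$i - y$i\<bar> \<le> d" for i using xc by (simp add: mem_cube)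
    have \<xi>d: "\<xi> x \<le> d" using comps[of j] by (simp add: \<xi>_def)
    have norm_ge: "(x - y) \<bullet> (x - y) = (\<Sum>i\<in>UNIV. (x$i - y$i)\<^sup>2)"
      by (simp add: inner_vec_def power2_eq_square)
    have ge_xi: "(x - y) \<bullet> (x - y) \<ge> (\<xi> x)\<^sup>2" unfolding norm_ge \<xi>_def
      by (rule member_le_sum) auto
    have N1: "N' / 2 * (\<xi> x * d - (\<xi> x)\<^sup>2) \<ge> 0"
      using \<xi>0 \<xi>d \<open>N \<ge> 0\<close> \<open>N < N'\<close> by (auto simp: power2_eq_square intro!: mult_nonneg_nonneg mult_left_mono)
    have xid: "(\<xi> x)\<^sup>2 \<le> d * \<xi> x" using \<xi>0 \<xi>d by (simp add: power2_eq_square mult_right_mono)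
    show "phi x \<le> 0"
    proof (cases "\<xi> x = 0")
      case True
      then have "mirror j y x = x" by (simp add: mirror_def \<xi>_def)
      moreover have "psi x \<ge> 0" using True \<open>M \<ge> 0\<close> by (simp add: psi_def)
      ultimately show ?thesis by (simp add: phi_def)
    next
      case False
      then have "y$j < x$j" using \<xi>0 by (simp add: \<xi>_def)
      then obtain i where "\<not> \<bar>x$i - y$i\<bar> < d" using x(2) by (auto simp: P_def)
      then have i: "(x$i - y$i)\<^sup>2 = d\<^sup>2" using comps[of i] \<open>d > 0\<close>
        by (metis abs_of_pos less_eq_real_def power2_abs)
      \<comment> \<open>On the face opposite the symmetry plane \<open>\<xi> x = d\<close> and the
        last two terms cancel. On a lateral face the coordinate \<open>i\<close> alone contributes
        the square of \<open>d\<close>, and the last two terms together are nonnegative.\<close>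
      have "(x - y) \<bullet> (x - y) + 3 * d * \<xi> x - 3 * (\<xi> x)\<^sup>2 \<ge> d\<^sup>2"
      proof (cases "i = j")
        case True
        then have "\<xi> x = d" using i \<xi>0 \<open>d > 0\<close> by (simp add: \<xi>_def)
        then show ?thesis using ge_xi by (simp add: power2_eq_square)
      next
        case False
        have "(\<Sum>l\<in>{i,j}. (x$l - y$l)\<^sup>2) \<le> (x - y) \<bullet> (x - y)" unfolding norm_ge
          by (rule sum_mono2) auto
        then have "d\<^sup>2 + (\<xi> x)\<^sup>2 \<le> (x - y) \<bullet> (x - y)" using False i by (simp add: \<xi>_def)
        moreover have "0 \<le> (\<xi> x)\<^sup>2" by simp
        ultimately show ?thesis using xid by linarith
      qed
      then have "M / d\<^sup>2 * d\<^sup>2 \<le> M / d\<^sup>2 * ((x - y) \<bullet> (x - y) + 3 * d * \<xi> x - 3 * (\<xi> x)\<^sup>2)"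
        using \<open>M \<ge> 0\<close> by (intro mult_left_mono) auto
      then have "psi x \<ge> M" using N1 \<open>d > 0\<close> by (simp add: psi_def)
      then show ?thesis using M[OF xc] M[OF mc[OF xc]] by (simp add: phi_def)
    qed
  qed
  have main: "w (y + t *\<^sub>R axis j 1) - w (y - t *\<^sub>R axis j 1) \<le> t * (6 * M / d + N' * d)" if "0 < t" "t < d" for t
  proof -
    define x where "x = y + t *\<^sub>R axis j (1::real)"
    have xi: "\<xi> x = t" by (simp add: x_def \<xi>_def)
    have "x \<in> P" using that by (auto simp: P_def x_def axis_def)
    moreover have "mirror j y x = y - t *\<^sub>R axis j 1"
      by (simp add: mirror_def x_def algebra_simps flip: scaleR_left_distrib)
    moreover have "(x - y) \<bullet> (x - y) = t\<^sup>2"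
      by (simp add: x_def inner_axis_axis power2_eq_square)
    ultimately have "w x - w (y - t *\<^sub>R axis j 1)
        \<le> 2 * (M / d\<^sup>2 * (t\<^sup>2 + 3 * d * t - 3 * t\<^sup>2) + N' / 2 * (t * d - t\<^sup>2))"
      using comp[of x] by (simp add: phi_def psi_def xi mult.commute mult.left_commute)
    also have "\<dots> \<le> 2 * (M / d\<^sup>2 * (3 * d * t) + N' / 2 * (t * d))"
      using \<open>M \<ge> 0\<close> \<open>N \<ge> 0\<close> \<open>N < N'\<close> by (intro mult_left_mono add_mono) auto
    also have "\<dots> = t * (6 * M / d + N' * d)" using \<open>d > 0\<close> by (simp add: field_simps power2_eq_square)
    finally show ?thesis by (simp add: x_def)
  qed
  consider "t = 0" | "0 < t" "t < d" | "t = d" using t by linarith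
  then show ?thesis
  proof cases
    \<comment> \<open>For \<open>t = d\<close> the point is no longer in the open half cube, but
      then the trivial bound \<open>2 * M\<close> is enough.\<close>
    case 3
    have "y + t *\<^sub>R axis j 1 \<in> cube y d" "y + (-t) *\<^sub>R axis j 1 \<in> cube y d"
      using cube_diff_axis[of t d y y 0 j] cube_diff_axis[of "-t" d y y 0 j] t by (auto simp: mem_cube)
    from M[OF this(1)] M[OF this(2)]
    have "w (y + t *\<^sub>R axis j 1) - w (y - t *\<^sub>R axis j 1) \<le> 2 * M" by simp
    also have "\<dots> \<le> t * (6 * M / d)" using 3 \<open>M \<ge> 0\<close> \<open>d > 0\<close> by simp
    also have "\<dots> \<le> t * (6 * M / d + N' * d)"
      using t \<open>N \<ge> 0\<close> \<open>N < N'\<close> by (intro mult_left_mono) auto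
    finally show ?thesis .
  qed (use main in auto)
qed

text \<open>Continuity is a separate clause because axis derivatives do not imply it, and the
  maximum principle needs it on closed cubes. The existential over the derivatives lets sums,
  translates and reflections of solutions be handled without computing \<open>pdiff\<close>.\<close>

definition helm :: "real \<Rightarrow> (real^3) set \<Rightarrow> (real^3 \<Rightarrow> complex) \<Rightarrow> bool" where
  "helm k S u \<longleftrightarrow> continuous_on S u \<and>
     (\<exists>G H. axis2 S u G H \<and> (\<forall>x\<in>S. (\<Sum>i\<in>UNIV. H i x) + complex_of_real (k\<^sup>2) * u x = 0))"

lemma helm_subset: "helm k S u \<Longrightarrow> T \<subseteq> S \<Longrightarrow> helm k T u"
  unfolding helm_def by (meson axis2_subset continuous_on_subset subsetD)

lemma helm_diff:
  assumes "helm k S u" "helm k S v"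
  shows "helm k S (\<lambda>x. u x - v x)"
proof -
  obtain G H G' H' where *: "axis2 S u G H" "axis2 S v G' H'"
    "\<forall>x\<in>S. (\<Sum>i\<in>UNIV. H i x) + complex_of_real (k\<^sup>2) * u x = 0"
    "\<forall>x\<in>S. (\<Sum>i\<in>UNIV. H' i x) + complex_of_real (k\<^sup>2) * v x = 0"
    using assms by (auto simp: helm_def)
  have "\<forall>x\<in>S. (\<Sum>i\<in>UNIV. H i x - H' i x) + complex_of_real (k\<^sup>2) * (u x - v x) = 0"
  proof
    fix x assume "x \<in> S"
    with *(3,4) have "((\<Sum>i\<in>UNIV. H i x) + complex_of_real (k\<^sup>2) * u x) -
      ((\<Sum>i\<in>UNIV. H' i x) + complex_of_real (k\<^sup>2) * v x) = 0" by simp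
    then show "(\<Sum>i\<in>UNIV. H i x - H' i x) + complex_of_real (k\<^sup>2) * (u x - v x) = 0"
      by (simp add: sum_subtractf algebra_simps)
  qed
  with axis2_diff[OF *(1,2)] assms show ?thesis
    unfolding helm_def by (blast intro: continuous_on_diff)
qed

lemma helm_translate:
  assumes "helm k S u" "\<And>x. x \<in> T \<Longrightarrow> x + a \<in> S"
  shows "helm k T (\<lambda>x. u (x + a))"
proof -
  obtain G H where *: "axis2 S u G H"
    "\<forall>x\<in>S. (\<Sum>i\<in>UNIV. H i x) + complex_of_real (k\<^sup>2) * u x = 0" "continuous_on S u"
    using assms by (auto simp: helm_def)
  have "continuous_on T (\<lambda>x. u (x + a))"
    by (rule continuous_on_compose2[OF *(3)]) (use assms(2) in \<open>auto intro!: continuous_intros\<close>)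
  moreover have "axis2 T (\<lambda>x. u (x + a)) (\<lambda>i x. G i (x + a)) (\<lambda>i x. H i (x + a))"
    by (rule axis2_translate[OF *(1) assms(2)])
  moreover have "\<forall>x\<in>T. (\<Sum>i\<in>UNIV. H i (x + a)) + complex_of_real (k\<^sup>2) * u (x + a) = 0"
    using *(2) assms(2) by blast
  ultimately show ?thesis unfolding helm_def
    by (intro conjI exI[of _ "\<lambda>i x. G i (x + a)"] exI[of _ "\<lambda>i x. H i (x + a)"]) auto
qed

text \<open>Multiplication by a constant of modulus at most 1 turns the difference into its modulus,
  so the real estimate applies to the real part of the rotated solution, whose Laplacian is at most
  k^2 M in modulus. The 1 in k^2 + 1 provides the strict inequality \<open>N < N'\<close> of that
  estimate.\<close>

lemma helm_difference_bound:
  fixes u :: "real^3 \<Rightarrow> complex"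
  assumes "d > 0" "helm k (cube y d) u" "M > 0"
    and M: "\<And>x. x \<in> cube y d \<Longrightarrow> norm (u x) \<le> M" and t: "0 \<le> t" "t \<le> d"
  shows "norm (u (y + t *\<^sub>R axis j 1) - u (y - t *\<^sub>R axis j 1)) \<le> t * ((6 / d + (k\<^sup>2 + 1) * d) * M)"
proof -
  obtain G H where *: "axis2 (cube y d) u G H"
    "\<And>x. x \<in> cube y d \<Longrightarrow> (\<Sum>i\<in>UNIV. H i x) + complex_of_real (k\<^sup>2) * u x = 0" "continuous_on (cube y d) u"
    using assms by (auto simp: helm_def)
  define D where "D = u (y + t *\<^sub>R axis j 1) - u (y - t *\<^sub>R axis j 1)"
  define a where "a = cnj (sgn D)"
  have a: "norm a \<le> 1" by (simp add: a_def norm_sgn)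
  have lin: "bounded_linear (\<lambda>z. Re (a * z))"
    by (rule bounded_linear_compose[OF bounded_linear_Re bounded_linear_mult_right])
  have Re_le: "\<bar>Re (a * z)\<bar> \<le> norm z" for z
  proof -
    have "\<bar>Re (a * z)\<bar> \<le> norm a * norm z" by (metis abs_Re_le_cmod norm_mult)
    also have "\<dots> \<le> 1 * norm z" by (rule mult_right_mono[OF a]) simp
    finally show ?thesis by simp
  qed
  have "Re (a * u (y + t *\<^sub>R axis j 1)) - Re (a * u (y - t *\<^sub>R axis j 1)) \<le> t * (6 * M / d + ((k\<^sup>2 + 1) * M) * d)"
  proof (rule difference_bound_real[OF \<open>d > 0\<close> axis2_linear[OF lin *(1)]])
    show "continuous_on (cube y d) (\<lambda>x. Re (a * u x))" by (intro continuous_intros *(3))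
    show "k\<^sup>2 * M < (k\<^sup>2 + 1) * M" using \<open>M > 0\<close> by (simp add: algebra_simps)
  next
    fix x assume x: "x \<in> cube y d"
    have "(\<Sum>i\<in>UNIV. H i x) = - (complex_of_real (k\<^sup>2) * u x)" using *(2)[OF x] by (simp add: eq_neg_iff_add_eq_0)
    then have "norm (\<Sum>i\<in>UNIV. H i x) = k\<^sup>2 * norm (u x)" by (simp add: norm_mult del: of_real_power)
    also have "\<dots> \<le> k\<^sup>2 * M" using M[OF x] by (intro mult_left_mono) auto
    finally have "norm (\<Sum>i\<in>UNIV. H i x) \<le> k\<^sup>2 * M" .
    moreover have "(\<Sum>i\<in>UNIV. Re (a * H i x)) = Re (a * (\<Sum>i\<in>UNIV. H i x))"
      by (simp add: sum_distrib_left Re_sum[symmetric])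
    ultimately show "\<bar>\<Sum>i\<in>UNIV. Re (a * H i x)\<bar> \<le> k\<^sup>2 * M" using Re_le order_trans by metis
    show "\<bar>Re (a * u x)\<bar> \<le> M" using Re_le M[OF x] order_trans by blast
  qed (use t in auto)
  moreover have "Re (a * u (y + t *\<^sub>R axis j 1)) - Re (a * u (y - t *\<^sub>R axis j 1)) = norm D"
  proof -
    have "a * D = of_real (norm D)"
    proof (cases "D = 0")
      case False
      have "cnj D * D = of_real (norm D) * of_real (norm D)"
        by (metis complex_norm_square mult.commute of_real_mult power2_eq_square)
      then show ?thesis using False
        by (simp add: a_def sgn_eq)
    qed (simp add: a_def)
    then have "Re (a * D) = norm D" by simp
    then show ?thesis by (simp add: D_def algebra_simps)
  qed
  ultimately show ?thesis using \<open>d > 0\<close> by (simp add: D_def algebra_simps)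
qed

text \<open>A symmetric first difference of a solution is again a solution, and by the first
  estimate it has size (h/2) C M. Applying the same estimate to it bounds the second difference of
  the original, without any information on the second derivatives.\<close>

lemma helm_second_difference_bound:
  fixes u :: "real^3 \<Rightarrow> complex"
  assumes "d > 0" "helm k (cube y (2 * d)) u" "M > 0"
    and M: "\<And>x. x \<in> cube y (2 * d) \<Longrightarrow> norm (u x) \<le> M" and h: "0 < h" "h \<le> d"
  shows "norm (u (y + h *\<^sub>R axis j 1) + u (y - h *\<^sub>R axis j 1) - 2 *\<^sub>R u y) \<le> (6 / d + (k\<^sup>2 + 1) * d)\<^sup>2 * M * h\<^sup>2"
proof -
  define C where "C = 6 / d + (k\<^sup>2 + 1) * d"
  have "C > 0" unfolding C_def using \<open>d > 0\<close> by (simp add: add_pos_pos pos_add_strict add_nonneg_pos)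
  define v where "v x = u (x + (h/2) *\<^sub>R axis j 1) - u (x + (-h/2) *\<^sub>R axis j 1)" for x
  have sub: "cube x d \<subseteq> cube y (2 * d)" if "x \<in> cube y d" for x
  proof
    fix z assume "z \<in> cube x d"
    show "z \<in> cube y (2 * d)" unfolding mem_cube
    proof
      fix i
      have "\<bar>z$i - x$i\<bar> \<le> d" "\<bar>x$i - y$i\<bar> \<le> d" using that \<open>z \<in> cube x d\<close> by (simp_all add: mem_cube)
      then show "\<bar>z$i - y$i\<bar> \<le> 2 * d" by linarith
    qed
  qed
  have "helm k (cube y d) v" unfolding v_def
  proof (intro helm_diff helm_translate[OF assms(2)])
    fix x assume "x \<in> cube y d"
    then show "x + (h/2) *\<^sub>R axis j 1 \<in> cube y (2 * d)" "x + (-h/2) *\<^sub>R axis j 1 \<in> cube y (2 * d)"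
      using cube_diff_axis[of "h/2" d x y d j, folded mult_2]
        cube_diff_axis[of "-h/2" d x y d j, folded mult_2] h by linarith+
  qed
  moreover have "norm (v x) \<le> (h/2) * (C * M)" if "x \<in> cube y d" for x
    using helm_difference_bound[OF \<open>d > 0\<close> helm_subset[OF assms(2) sub[OF that]] \<open>M > 0\<close> M[OF subsetD[OF sub[OF that]]], of "h/2" j] h
    by (simp add: v_def C_def)
  ultimately have "norm (v (y + (h/2) *\<^sub>R axis j 1) - v (y - (h/2) *\<^sub>R axis j 1)) \<le> (h/2) * (C * ((h/2) * (C * M)))"
    unfolding C_def using h \<open>M > 0\<close> \<open>C > 0\<close>[unfolded C_def]
    by (intro helm_difference_bound \<open>d > 0\<close>) auto
  moreover have "v (y + (h/2) *\<^sub>R axis j 1) - v (y - (h/2) *\<^sub>R axis j 1)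
      = u (y + h *\<^sub>R axis j 1) + u (y - h *\<^sub>R axis j 1) - 2 *\<^sub>R u y"
  proof -
    have "(h/2) *\<^sub>R axis j (1::real) + (h/2) *\<^sub>R axis j 1 = h *\<^sub>R (axis j 1 :: real^3)"
      by (simp flip: scaleR_left_distrib)
    then show ?thesis unfolding v_def by (simp add: scaleR_2 add.assoc diff_diff_eq)
  qed
  moreover have "(h/2) * (C * ((h/2) * (C * M))) \<le> C\<^sup>2 * M * h\<^sup>2"
  proof -
    have "0 \<le> C\<^sup>2 * M * h\<^sup>2" using \<open>M > 0\<close> by simp
    then show ?thesis by (simp add: power2_eq_square algebra_simps)
  qed
  ultimately show ?thesis unfolding C_def by simp
qed

section \<open>Weak solutions\<close>

text \<open>Borel measurable, bounded, with bounded support. Bound and radius stay existential, so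
  that products, sums and translates remain in the class without bookkeeping.\<close>

definition bcs :: "(real^3 \<Rightarrow> complex) \<Rightarrow> bool" where
  "bcs f \<longleftrightarrow> f \<in> borel_measurable borel \<and> (\<exists>M. \<forall>x. norm (f x) \<le> M) \<and> (\<exists>R. \<forall>x. norm x > R \<longrightarrow> f x = 0)"

lemma bcs_integrable: assumes "bcs f" shows "integrable lborel f"
proof -
  obtain M R where *: "\<And>x. norm (f x) \<le> M" "\<And>x. norm x > R \<Longrightarrow> f x = 0" "f \<in> borel_measurable borel"
    using assms by (auto simp: bcs_def)
  show ?thesis
    by (rule integrableI_bounded_set[where A="cball 0 R" and B=M])
       (use * emeasure_compact_finite[OF compact_cball, of 0 R] in auto)
qed

lemma bcs_mult: assumes "bcs f" "bcs g" shows "bcs (\<lambda>x. f x * g x)"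
proof -
  obtain M R where f: "\<And>x. norm (f x) \<le> M" "\<And>x. norm x > R \<Longrightarrow> f x = 0" "f \<in> borel_measurable borel"
    using assms by (auto simp: bcs_def)
  obtain N where g: "\<And>x. norm (g x) \<le> N" "g \<in> borel_measurable borel"
    using assms by (auto simp: bcs_def)
  have "norm (f x * g x) \<le> M * N" for x
    unfolding norm_mult using f(1)[of x] g(1)[of x] by (intro mult_mono) (auto intro: order_trans[OF norm_ge_zero])
  moreover have "(\<lambda>x. f x * g x) \<in> borel_measurable borel" using f(3) g(2) by measurable
  ultimately show ?thesis using f(2) unfolding bcs_def by (metis mult_zero_left)
qed

lemma bcs_continuous:
  assumes "continuous_on UNIV f" "compact K" "\<And>x. x \<notin> K \<Longrightarrow> f x = 0"
  shows "bcs f"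
proof -
  have "bounded (f ` K)" using assms by (intro compact_imp_bounded compact_continuous_image) (auto intro: continuous_on_subset)
  then obtain M where M: "\<And>x. x \<in> K \<Longrightarrow> norm (f x) \<le> M" by (auto simp: bounded_iff)
  have "norm (f x) \<le> max M 0" for x using M[of x] assms(3)[of x] by (cases "x \<in> K") auto
  moreover obtain R where R: "\<And>x. x \<in> K \<Longrightarrow> norm x \<le> R"
    using compact_imp_bounded[OF assms(2)] by (auto simp: bounded_iff)
  ultimately show ?thesis unfolding bcs_def using assms(1,3)
    by (intro conjI exI[of _ "max M 0"] exI[of _ R] borel_measurable_continuous_onI) fastforce+
qed

lemma bcs_indicator:
  assumes "continuous_on K f" "compact K"
  shows "bcs (\<lambda>x. indicator K x *\<^sub>R f x)"
proof -
  have "bounded (f ` K)" using assms by (intro compact_imp_bounded compact_continuous_image)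
  then obtain M where M: "\<And>x. x \<in> K \<Longrightarrow> norm (f x) \<le> M" by (auto simp: bounded_iff)
  obtain R where R: "\<And>x. x \<in> K \<Longrightarrow> norm x \<le> R"
    using compact_imp_bounded[OF assms(2)] by (auto simp: bounded_iff)
  have "norm (indicator K x *\<^sub>R f x) \<le> max M 0" for x
    using M[of x] by (auto simp: indicator_def)
  moreover have "indicator K x *\<^sub>R f x = 0" if "norm x > R" for x
    using R[of x] that by (auto simp: indicator_def)
  moreover have "(\<lambda>x. indicator K x *\<^sub>R f x) \<in> borel_measurable borel"
    by (rule borel_measurable_continuous_on_indicator[OF borel_closed[OF compact_imp_closed[OF assms(2)]] assms(1)])
  ultimately show ?thesis unfolding bcs_def by blast
qed

lemma bcs_translate: assumes "bcs f" shows "bcs (\<lambda>x. f (x + a))"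
proof -
  obtain M R where *: "\<And>x. norm (f x) \<le> M" "\<And>x. norm x > R \<Longrightarrow> f x = 0" "f \<in> borel_measurable borel"
    using assms by (auto simp: bcs_def)
  have "f (x + a) = 0" if "norm x > R + norm a" for x
    using that norm_triangle_ineq4[of "x + a" a] by (intro *(2)) simp
  moreover have "(\<lambda>x. f (x + a)) \<in> borel_measurable borel" using *(3) by measurable
  ultimately show ?thesis using *(1) unfolding bcs_def by blast
qed

lemma integral_lborel_translate:
  fixes f :: "real^3 \<Rightarrow> complex"
  assumes "f \<in> borel_measurable borel"
  shows "(LINT x|lborel. f (x + a)) = (LINT x|lborel. f x)"
proof -
  have "(LINT x|lborel. f x) = (LINT x|distr lborel borel ((+) a). f x)"
    by (simp add: lborel_distr_plus)
  also have "\<dots> = (LINT x|lborel. f (a + x))" using assms by (subst integral_distr) auto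
  finally show ?thesis by (simp add: add.commute)
qed

lemma compact_dominated_convergence:
  fixes f :: "real^3 \<Rightarrow> complex"
  assumes "\<And>n. s n \<in> borel_measurable borel" "\<And>n x. norm (s n x) \<le> M"
    and "compact K" "\<And>n x. x \<notin> K \<Longrightarrow> s n x = 0" and lim: "\<And>x. (\<lambda>n. s n x) \<longlonglongrightarrow> f x"
  shows "(\<lambda>n. LINT x|lborel. s n x) \<longlonglongrightarrow> (LINT x|lborel. f x)"
proof (rule integral_dominated_convergence[where w="\<lambda>x. indicator K x *\<^sub>R M"])
  show "f \<in> borel_measurable lborel"
    using borel_measurable_LIMSEQ_metric[of s borel f] assms(1) lim by simp
  show "integrable lborel (\<lambda>x. indicator K x *\<^sub>R M)"
    by (rule borel_integrable_compact) (use assms in auto)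
  show "AE x in lborel. norm (s n x) \<le> indicator K x *\<^sub>R M" for n
    using assms(2,4) by (auto simp: indicator_def)
qed (use assms in auto)

text \<open>The seven-point difference Laplacian with step \<open>h\<close>.\<close>

definition lapl :: "real \<Rightarrow> (real^3 \<Rightarrow> complex) \<Rightarrow> real^3 \<Rightarrow> complex" where
  "lapl h f x = (\<Sum>i\<in>UNIV. f (x + h *\<^sub>R axis i 1) + f (x - h *\<^sub>R axis i 1) - 2 *\<^sub>R f x) /\<^sub>R h\<^sup>2"

lemma lapl_measurable:
  assumes [measurable]: "f \<in> borel_measurable borel"
  shows "lapl h f \<in> borel_measurable borel"
  unfolding lapl_def by measurable

text \<open>Summation by parts: translation invariance moves a shift from one factor to the opposite
  shift on the other, and the stencil is symmetric. This takes the place of Green's formula.\<close>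

lemma integral_lapl_parts:
  assumes "bcs v" "bcs f"
  shows "(LINT x|lborel. v x * lapl h f x) = (LINT x|lborel. lapl h v x * f x)"
proof -
  have tr: "(LINT x|lborel. v x * f (x + a)) = (LINT x|lborel. v (x - a) * f x)" for a
  proof -
    have "bcs (\<lambda>x. v (x + (-a)) * f x)" by (intro bcs_mult bcs_translate assms)
    then have "(\<lambda>x. v (x - a) * f x) \<in> borel_measurable borel" by (simp add: bcs_def)
    from integral_lborel_translate[OF this, of a] show ?thesis by simp
  qed
  have iv: "integrable lborel (\<lambda>x. v (x + a) * f (x + b))" for a b
    by (intro bcs_integrable bcs_mult bcs_translate assms)
  have i: "integrable lborel (\<lambda>x. v x * f (x + a))" "integrable lborel (\<lambda>x. v (x + a) * f x)"
    "integrable lborel (\<lambda>x. v x * f (x - a))" "integrable lborel (\<lambda>x. v (x - a) * f x)"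
    "integrable lborel (\<lambda>x. v x * f x)" for a
    using iv[of 0 a] iv[of a 0] iv[of 0 "-a"] iv[of "-a" 0] iv[of 0 0] by simp_all
  have "(LINT x|lborel. v x * lapl h f x) = (LINT x|lborel. (\<Sum>i\<in>UNIV.
     v x * f (x + h *\<^sub>R axis i 1) + v x * f (x - h *\<^sub>R axis i 1) - 2 * (v x * f x)) * of_real (inverse (h\<^sup>2)))"
    by (rule Bochner_Integration.integral_cong)
       (auto simp: lapl_def scaleR_conv_of_real sum_distrib_left sum_distrib_right algebra_simps intro!: sum.cong)
  also have "\<dots> = (\<Sum>i\<in>UNIV. (LINT x|lborel. v x * f (x + h *\<^sub>R axis i 1)) +
     (LINT x|lborel. v x * f (x - h *\<^sub>R axis i 1)) - 2 * (LINT x|lborel. v x * f x)) * of_real (inverse (h\<^sup>2))"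
    by (simp add: i Bochner_Integration.integral_sum Bochner_Integration.integral_add Bochner_Integration.integral_diff)
  also have "\<dots> = (\<Sum>i\<in>UNIV. (LINT x|lborel. v (x + h *\<^sub>R axis i 1) * f x) +
     (LINT x|lborel. v (x - h *\<^sub>R axis i 1) * f x) - 2 * (LINT x|lborel. v x * f x)) * of_real (inverse (h\<^sup>2))"
    using tr[of "h *\<^sub>R axis _ 1"] tr[of "- (h *\<^sub>R axis _ 1)"] by (simp add: add.commute)
  also have "\<dots> = (LINT x|lborel. (\<Sum>i\<in>UNIV.
     v (x + h *\<^sub>R axis i 1) * f x + v (x - h *\<^sub>R axis i 1) * f x - 2 * (v x * f x)) * of_real (inverse (h\<^sup>2)))"
    by (simp add: i Bochner_Integration.integral_sum Bochner_Integration.integral_add Bochner_Integration.integral_diff)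
  also have "\<dots> = (LINT x|lborel. lapl h v x * f x)"
    by (rule Bochner_Integration.integral_cong)
       (auto simp: lapl_def scaleR_conv_of_real sum_distrib_left sum_distrib_right algebra_simps intro!: sum.cong)
  finally show ?thesis .
qed

text \<open>Mixed second derivatives never occur. Compact support is demanded separately, through a
  set \<open>K\<close>, so that a cutoff and a kernel without compact support can be multiplied as
  test functions.\<close>

definition test_fn :: "(real^3 \<Rightarrow> complex) \<Rightarrow> (3 \<Rightarrow> real^3 \<Rightarrow> complex) \<Rightarrow> (3 \<Rightarrow> real^3 \<Rightarrow> complex) \<Rightarrow> bool" where
  "test_fn \<phi> G H \<longleftrightarrow> axis2 UNIV \<phi> G H \<and> continuous_on UNIV \<phi> \<and>
     (\<forall>i. continuous_on UNIV (G i)) \<and> (\<forall>i. continuous_on UNIV (H i))"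

lemma line_derivative_zero:
  fixes g :: "real^3 \<Rightarrow> complex"
  assumes "closed K" "\<And>x. x \<notin> K \<Longrightarrow> g x = 0" "x \<notin> K"
    and "((\<lambda>t. g (x + t *\<^sub>R axis i 1)) has_vector_derivative D) (at 0)"
  shows "D = 0"
proof -
  have "open (-K)" "x \<in> -K" using assms by auto
  then obtain e where e: "e > 0" "ball x e \<subseteq> -K" by (auto simp: open_contains_ball)
  have z: "g (x + t *\<^sub>R axis i 1) = 0" if "t \<in> {-e<..<e}" for t
  proof -
    have "x + t *\<^sub>R axis i 1 \<in> ball x e" using that by (auto simp: dist_norm norm_axis_1)
    then show ?thesis using e assms(2) by auto
  qed
  have "((\<lambda>t. g (x + t *\<^sub>R axis i 1)) has_vector_derivative 0) (at 0)"
    by (rule has_vector_derivative_transform_within_open[where f="\<lambda>_. 0" and S="{-e<..<e}", OF has_vector_derivative_const])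
       (use e z in auto)
  with assms(4) show ?thesis by (rule vector_derivative_unique_at)
qed

lemma axis2_zero_outside:
  fixes \<phi> :: "real^3 \<Rightarrow> complex"
  assumes "axis2 UNIV \<phi> G H" "closed K" "\<And>x. x \<notin> K \<Longrightarrow> \<phi> x = 0" "x \<notin> K"
  shows "G i x = 0" "H i x = 0"
proof -
  have G: "G i x = 0" if "x \<notin> K" for x
    by (rule line_derivative_zero[OF assms(2,3) that, where i=i]) (use assms(1) in \<open>auto simp: axis2_def\<close>)
  then show "G i x = 0" using assms(4) .
  show "H i x = 0"
    by (rule line_derivative_zero[OF assms(2) G assms(4), where i=i]) (use assms(1) in \<open>auto simp: axis2_def\<close>)
qed

lemma lapl_tendsto:
  fixes u :: "real^3 \<Rightarrow> complex"
  assumes "axis2 S u G H" "open S" "x \<in> S" "h \<longlonglongrightarrow> 0" "\<And>n. h n > (0::real)"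
  shows "(\<lambda>n. lapl (h n) u x) \<longlonglongrightarrow> (\<Sum>i\<in>UNIV. H i x)"
proof -
  obtain e where e: "e > 0" "ball x e \<subseteq> S" using assms by (auto simp: open_contains_ball)
  have inb: "x + t *\<^sub>R axis i 1 \<in> S" if "\<bar>t\<bar> < e" for t i
    using that by (intro subsetD[OF e(2)]) (simp add: dist_norm norm_axis_1)
  have "(\<lambda>n. (u (x + h n *\<^sub>R axis i 1) + u (x - h n *\<^sub>R axis i 1) - 2 *\<^sub>R u x) /\<^sub>R (h n)\<^sup>2) \<longlonglongrightarrow> H i x" for i
  proof -
    have "((\<lambda>t. (u (x + t *\<^sub>R axis i 1) + u (x + (-t) *\<^sub>R axis i 1) - 2 *\<^sub>R u (x + 0 *\<^sub>R axis i 1)) /\<^sub>R t\<^sup>2) \<longlongrightarrow> H i x) (at 0)"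
    proof (rule second_difference_tendsto[OF e(1)])
      show "((\<lambda>t. u (x + t *\<^sub>R axis i 1)) has_vector_derivative G i (x + t *\<^sub>R axis i 1)) (at t)"
        if "\<bar>t\<bar> < e" for t using axis2_D1[OF assms(1) inb[OF that]] .
      show "((\<lambda>t. G i (x + t *\<^sub>R axis i 1)) has_vector_derivative H i x) (at 0)"
        using assms by (auto simp: axis2_def)
    qed
    from this[unfolded tendsto_at_iff_sequentially, rule_format, of h] assms(4,5)
    show ?thesis by (simp add: o_def less_imp_neq[symmetric])
  qed
  then show ?thesis unfolding lapl_def scaleR_sum_right by (intro tendsto_sum)
qed

lemma test_fn_lapl_bound:
  assumes "test_fn \<phi> G H" "compact K" "\<And>x. x \<notin> K \<Longrightarrow> \<phi> x = 0"
  obtains C where "\<And>x h. h > 0 \<Longrightarrow> norm (lapl h \<phi> x) \<le> C"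
proof -
  have ax: "axis2 UNIV \<phi> G H" using assms by (simp add: test_fn_def)
  have "bcs (H i)" for i
    by (rule bcs_continuous[OF _ assms(2)])
       (use axis2_zero_outside[OF ax compact_imp_closed[OF assms(2)] assms(3)] assms(1) in \<open>auto simp: test_fn_def\<close>)
  then have "\<forall>i. \<exists>M. \<forall>x. norm (H i x) \<le> M" by (auto simp: bcs_def)
  then obtain M where M: "\<And>i x. norm (H i x) \<le> M i" by metis
  have "norm (lapl h \<phi> x) \<le> (\<Sum>i\<in>UNIV. 4 * M i)" if "h > 0" for h x
  proof -
    have *: "norm (\<phi> (x + h *\<^sub>R axis i 1) + \<phi> (x - h *\<^sub>R axis i 1) - 2 *\<^sub>R \<phi> x) \<le> 4 * M i * h\<^sup>2" for i
      using second_difference_bound[of "\<lambda>t. \<phi> (x + t *\<^sub>R axis i 1)" "\<lambda>t. G i (x + t *\<^sub>R axis i 1)" "\<lambda>t. H i (x + t *\<^sub>R axis i 1)" "M i" h,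
          OF axis2_D1[OF ax UNIV_I] axis2_D2[OF ax UNIV_I] M] by simp
    have "norm (\<Sum>i\<in>UNIV. \<phi> (x + h *\<^sub>R axis i 1) + \<phi> (x - h *\<^sub>R axis i 1) - 2 *\<^sub>R \<phi> x) \<le> (\<Sum>i\<in>UNIV. 4 * M i * h\<^sup>2)"
      by (rule order_trans[OF norm_sum sum_mono[OF *]])
    also have "\<dots> = (\<Sum>i\<in>UNIV. 4 * M i) * h\<^sup>2" by (simp add: sum_distrib_right)
    finally show ?thesis using that by (simp add: lapl_def field_simps)
  qed
  then show ?thesis using that by blast
qed

lemma integral_lapl_test_tendsto:
  assumes "test_fn \<phi> G H" "compact K" "\<And>x. x \<notin> K \<Longrightarrow> \<phi> x = 0" "bcs v"
    and h: "h \<longlonglongrightarrow> 0" "\<And>n. h n > (0::real)"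
  shows "(\<lambda>n. LINT x|lborel. v x * lapl (h n) \<phi> x) \<longlonglongrightarrow> (LINT x|lborel. v x * (\<Sum>i\<in>UNIV. H i x))"
proof -
  obtain C where C: "\<And>x h. h > 0 \<Longrightarrow> norm (lapl h \<phi> x) \<le> C"
    using test_fn_lapl_bound[OF assms(1-3)] by blast
  obtain M R where v: "\<And>x. norm (v x) \<le> M" "\<And>x. norm x > R \<Longrightarrow> v x = 0" "v \<in> borel_measurable borel"
    using assms(4) by (auto simp: bcs_def)
  have \<phi>: "\<phi> \<in> borel_measurable borel" "axis2 UNIV \<phi> G H"
    using assms(1) by (auto simp: test_fn_def intro: borel_measurable_continuous_onI)
  have M0: "0 \<le> M" using v(1) norm_ge_zero order_trans by blast
  show ?thesis
  proof (rule compact_dominated_convergence[where K="cball 0 R" and M="M * C"])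
    show "(\<lambda>x. v x * lapl (h n) \<phi> x) \<in> borel_measurable borel" for n
      using v(3) lapl_measurable[OF \<phi>(1), of "h n"] by measurable
    show "norm (v x * lapl (h n) \<phi> x) \<le> M * C" for n x
      unfolding norm_mult by (intro mult_mono v(1) C h(2) M0) auto
    show "(\<lambda>n. v x * lapl (h n) \<phi> x) \<longlonglongrightarrow> v x * (\<Sum>i\<in>UNIV. H i x)" for x
      by (intro tendsto_mult tendsto_const lapl_tendsto[OF \<phi>(2)] h) auto
  qed (use v(2) in auto)
qed

text \<open>The indicator of \<open>K\<close> keeps the values of \<open>u\<close> outside
  \<open>S\<close>, which are arbitrary, out of the integral.\<close>

definition weak_helm :: "real \<Rightarrow> (real^3) set \<Rightarrow> (real^3 \<Rightarrow> complex) \<Rightarrow> bool" where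
  "weak_helm k S u \<longleftrightarrow> continuous_on S u \<and>
     (\<forall>K \<phi> G H. compact K \<longrightarrow> K \<subseteq> S \<longrightarrow> test_fn \<phi> G H \<longrightarrow> (\<forall>x. x \<notin> K \<longrightarrow> \<phi> x = 0) \<longrightarrow>
        (LINT x|lborel. indicator K x *\<^sub>R (u x * ((\<Sum>i\<in>UNIV. H i x) + complex_of_real (k\<^sup>2) * \<phi> x))) = 0)"

text \<open>Provides the dominating constant for the difference Laplacians of a solution.
  \<open>K'\<close> is a compact enlargement of \<open>K\<close> that contains every stencil based
  in \<open>K\<close>, so the solution can be truncated outside \<open>K'\<close>.\<close>

lemma helm_lapl_bound:
  assumes "helm k S u" "open S" "compact K" "K \<subseteq> S"
  obtains d C K' where "d > 0" "C \<ge> 0" "compact K'" "K \<subseteq> K'" "K' \<subseteq> S"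
    "\<And>x h i. x \<in> K \<Longrightarrow> \<bar>h\<bar> \<le> d \<Longrightarrow> x + h *\<^sub>R axis i 1 \<in> K'"
    "\<And>x h. x \<in> K \<Longrightarrow> 0 < h \<Longrightarrow> h \<le> d \<Longrightarrow> norm (lapl h u x) \<le> C"
proof -
  obtain e where e: "e > 0" "(\<Union>x\<in>K. ball x e) \<subseteq> S"
    using compact_subset_open_imp_ball_epsilon_subset[OF assms(3,2,4)] by blast
  \<comment> \<open>The cube of half-side \<open>2 * d\<close> about a point lies in the ball of
    radius \<open>6 * d = e / 2\<close>.\<close>
  define d where "d = e / 12"
  define K' where "K' = {x + y | x y. x \<in> K \<and> y \<in> cball 0 (e/2)}"
  have "d > 0" using e by (simp add: d_def)
  have "compact K'" unfolding K'_def by (intro compact_sums assms compact_cball)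
  have cb: "cball x (e/2) \<subseteq> K'" if "x \<in> K" for x
  proof
    fix z assume "z \<in> cball x (e/2)"
    then have "z = x + (z - x)" "z - x \<in> cball 0 (e/2)" by (auto simp: dist_norm norm_minus_commute)
    then show "z \<in> K'" using that unfolding K'_def by blast
  qed
  have "K' \<subseteq> S"
  proof
    fix z assume "z \<in> K'"
    then obtain x y where "z = x + y" "x \<in> K" "norm y \<le> e/2" by (auto simp: K'_def)
    then have "z \<in> ball x e" using e by (simp add: dist_norm)
    then show "z \<in> S" using e \<open>x \<in> K\<close> by blast
  qed
  have "bounded (u ` K')" using assms(1) \<open>compact K'\<close> \<open>K' \<subseteq> S\<close>
    by (intro compact_imp_bounded compact_continuous_image) (auto simp: helm_def intro: continuous_on_subset)
  then obtain M where M: "M > 0" "\<And>x. x \<in> K' \<Longrightarrow> norm (u x) \<le> M" by (force simp: bounded_pos)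
  define C where "C = 3 * ((6 / d + (k\<^sup>2 + 1) * d)\<^sup>2 * M)"
  have cube: "cube x (2 * d) \<subseteq> K'" if "x \<in> K" for x
  proof -
    have "cube x (2 * d) \<subseteq> cball x (3 * (2 * d))" by (rule cube_subset_cball)
    also have "\<dots> = cball x (e/2)" by (simp add: d_def)
    finally show ?thesis using cb[OF that] by simp
  qed
  show ?thesis
  proof (rule that[OF \<open>d > 0\<close> _ \<open>compact K'\<close> _ \<open>K' \<subseteq> S\<close>, of C])
    show "C \<ge> 0" using M(1) by (simp add: C_def)
    show "K \<subseteq> K'" using cb \<open>e > 0\<close> by force
    show "x + h *\<^sub>R axis i 1 \<in> K'" if "x \<in> K" "\<bar>h\<bar> \<le> d" for x h i
      using cb[OF \<open>x \<in> K\<close>] that \<open>e > 0\<close> by (intro subsetD[OF cb]) (auto simp: dist_norm norm_axis_1 d_def)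
    show "norm (lapl h u x) \<le> C" if "x \<in> K" "0 < h" "h \<le> d" for x h
    proof -
      have *: "norm (u (x + h *\<^sub>R axis i 1) + u (x - h *\<^sub>R axis i 1) - 2 *\<^sub>R u x) \<le> C/3 * h\<^sup>2" for i
        using helm_second_difference_bound[OF \<open>d > 0\<close> helm_subset[OF assms(1)] M(1) M(2), of x h i]
          cube[OF \<open>x \<in> K\<close>] \<open>K' \<subseteq> S\<close> that(2,3) by (auto simp: C_def)
      have "norm (\<Sum>i\<in>UNIV. u (x + h *\<^sub>R axis i 1) + u (x - h *\<^sub>R axis i 1) - 2 *\<^sub>R u x) \<le> (\<Sum>i\<in>(UNIV::3 set). C/3 * h\<^sup>2)"
        by (rule order_trans[OF norm_sum sum_mono[OF *]])
      then show ?thesis using that by (simp add: lapl_def field_simps)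
    qed
  qed
qed

lemma lapl_cong: "(\<And>i. f (x + h *\<^sub>R axis i 1) = g (x + h *\<^sub>R axis i 1)) \<Longrightarrow>
  (\<And>i. f (x - h *\<^sub>R axis i 1) = g (x - h *\<^sub>R axis i 1)) \<Longrightarrow> f x = g x \<Longrightarrow> lapl h f x = lapl h g x"
  by (simp add: lapl_def)

text \<open>The difference Laplacian is moved from the test function to the solution, and the step
  tends to 0 on both sides. On one side the test function is smooth; on the other the quotients
  converge pointwise to what the equation prescribes and are dominated by the interior
  estimate.\<close>

theorem helm_imp_weak_helm:
  assumes "helm k S u" "open S"
  shows "weak_helm k S u"
  unfolding weak_helm_def
proof (intro conjI allI impI)
  show cont: "continuous_on S u" using assms by (simp add: helm_def)
  obtain Gu Hu where ax: "axis2 S u Gu Hu"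
    and eq: "\<And>x. x \<in> S \<Longrightarrow> (\<Sum>i\<in>UNIV. Hu i x) + complex_of_real (k\<^sup>2) * u x = 0"
    using assms by (auto simp: helm_def)
  fix K \<phi> G H assume K: "compact K" "K \<subseteq> S" and t: "test_fn \<phi> G H" and z: "\<forall>x. x \<notin> K \<longrightarrow> \<phi> x = 0"
  obtain d C K' where d: "d > 0" and C0: "C \<ge> 0" and K': "compact K'" "K \<subseteq> K'" "K' \<subseteq> S"
    "\<And>x h i. x \<in> K \<Longrightarrow> \<bar>h\<bar> \<le> d \<Longrightarrow> x + h *\<^sub>R axis i 1 \<in> K'"
    and C: "\<And>x h. x \<in> K \<Longrightarrow> 0 < h \<Longrightarrow> h \<le> d \<Longrightarrow> norm (lapl h u x) \<le> C"
    using helm_lapl_bound[OF assms K] by metis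
  \<comment> \<open>Truncation makes the solution integrable over the whole space and alters no
    short stencil based at a point of \<open>K\<close>.\<close>
  define v where "v x = indicator K' x *\<^sub>R u x" for x
  have v: "bcs v" unfolding v_def using K' cont by (intro bcs_indicator) (auto intro: continuous_on_subset)
  have tc: "continuous_on UNIV \<phi>" and \<phi>ax: "axis2 UNIV \<phi> G H" using t by (auto simp: test_fn_def)
  have \<phi>: "bcs \<phi>" by (rule bcs_continuous[OF tc K(1)]) (use z in auto)
  then obtain M where M: "\<And>x. norm (\<phi> x) \<le> M" by (auto simp: bcs_def)
  define h where "h n = d / real (Suc n)" for n
  have h: "h \<longlonglongrightarrow> 0" unfolding h_def divide_inverse
    by (rule tendsto_eq_rhs[OF tendsto_mult[OF tendsto_const LIMSEQ_inverse_real_of_nat]]) simp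
  have hp: "h n > 0" "h n \<le> d" for n using d by (auto simp: h_def field_simps)
  have lv: "lapl (h n) v x = lapl (h n) u x" if "x \<in> K" for x n
    using K'(4)[OF that, of "h n"] K'(4)[OF that, of "- h n"] K'(2) that hp[of n]
    by (intro lapl_cong) (auto simp: v_def indicator_def)
  have A: "(\<lambda>n. LINT x|lborel. v x * lapl (h n) \<phi> x) \<longlonglongrightarrow> (LINT x|lborel. v x * (\<Sum>i\<in>UNIV. H i x))"
    by (rule integral_lapl_test_tendsto[OF t K(1) _ v h hp(1)]) (use z in auto)
  have B: "(\<lambda>n. LINT x|lborel. lapl (h n) v x * \<phi> x) \<longlonglongrightarrow> (LINT x|lborel. - (complex_of_real (k\<^sup>2) * v x) * \<phi> x)"
  proof (rule compact_dominated_convergence[where K=K and M="C * M"])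
    show "(\<lambda>x. lapl (h n) v x * \<phi> x) \<in> borel_measurable borel" for n
    proof -
      have [measurable]: "v \<in> borel_measurable borel" "\<phi> \<in> borel_measurable borel"
        using v \<phi> by (auto simp: bcs_def)
      have [measurable]: "lapl (h n) v \<in> borel_measurable borel" by (rule lapl_measurable) simp
      show ?thesis by measurable
    qed
    show "norm (lapl (h n) v x * \<phi> x) \<le> C * M" for n x
    proof (cases "x \<in> K")
      case True
      then have "norm (lapl (h n) v x) \<le> C" using lv C hp by simp
      then show ?thesis unfolding norm_mult using M C0 by (intro mult_mono) auto
    next
      case False
      have "M \<ge> 0" using M norm_ge_zero order_trans by blast
      then show ?thesis using False z C0 by simp
    qed
    show "(\<lambda>n. lapl (h n) v x * \<phi> x) \<longlonglongrightarrow> - (complex_of_real (k\<^sup>2) * v x) * \<phi> x" for x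
    proof (cases "x \<in> K")
      case True
      then have x: "x \<in> S" "v x = u x" using K K' by (auto simp: v_def)
      have "(\<lambda>n. lapl (h n) u x * \<phi> x) \<longlonglongrightarrow> (\<Sum>i\<in>UNIV. Hu i x) * \<phi> x"
        by (intro tendsto_mult tendsto_const lapl_tendsto[OF ax \<open>open S\<close> x(1) h hp(1)])
      moreover have "(\<Sum>i\<in>UNIV. Hu i x) = - (complex_of_real (k\<^sup>2) * u x)"
        using eq[OF x(1)] by (simp add: eq_neg_iff_add_eq_0)
      ultimately show ?thesis using lv[OF True] x(2) by simp
    qed (use z in auto)
  qed (use z K in auto)
  have "(LINT x|lborel. v x * (\<Sum>i\<in>UNIV. H i x)) = (LINT x|lborel. - (complex_of_real (k\<^sup>2) * v x) * \<phi> x)"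
    using LIMSEQ_unique[OF A] B unfolding integral_lapl_parts[OF v \<phi>] by blast
  moreover have Hz: "H i x = 0" if "x \<notin> K" for i x
    using axis2_zero_outside(2)[OF \<phi>ax compact_imp_closed[OF K(1)] _ that] z by blast
  have "bcs (\<lambda>x. \<Sum>i\<in>UNIV. H i x)"
    by (rule bcs_continuous[OF _ K(1)]) (use t Hz in \<open>auto simp: test_fn_def intro!: continuous_intros\<close>)
  then have "integrable lborel (\<lambda>x. v x * (\<Sum>i\<in>UNIV. H i x))" "integrable lborel (\<lambda>x. v x * \<phi> x)"
    using v \<phi> by (auto intro!: bcs_integrable bcs_mult)
  moreover have "(LINT x|lborel. indicator K x *\<^sub>R (u x * ((\<Sum>i\<in>UNIV. H i x) + complex_of_real (k\<^sup>2) * \<phi> x)))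
     = (LINT x|lborel. v x * (\<Sum>i\<in>UNIV. H i x) + complex_of_real (k\<^sup>2) * (v x * \<phi> x))"
    by (rule Bochner_Integration.integral_cong)
       (use Hz z K' in \<open>auto simp: v_def indicator_def algebra_simps\<close>)
  ultimately show "(LINT x|lborel. indicator K x *\<^sub>R (u x * ((\<Sum>i\<in>UNIV. H i x) + complex_of_real (k\<^sup>2) * \<phi> x))) = 0"
    by (simp add: mult.assoc)
qed

section \<open>Calculus of test functions\<close>

lemma test_fn_mult:
  assumes "test_fn f G H" "test_fn g G' H'"
  shows "test_fn (\<lambda>x. f x * g x) (\<lambda>i x. f x * G' i x + G i x * g x)
     (\<lambda>i x. f x * H' i x + 2 * (G i x * G' i x) + H i x * g x)"
proof -
  have f: "axis2 UNIV f G H" and g: "axis2 UNIV g G' H'" using assms by (auto simp: test_fn_def)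
  have "axis2 UNIV (\<lambda>x. f x * g x) (\<lambda>i x. f x * G' i x + G i x * g x)
     (\<lambda>i x. f x * H' i x + 2 * (G i x * G' i x) + H i x * g x)"
    unfolding axis2_def
  proof (intro ballI allI conjI)
    fix x :: "real^3" and i :: 3
    let ?l = "\<lambda>t::real. x + t *\<^sub>R axis i 1"
    have *: "((\<lambda>t. f (?l t)) has_vector_derivative G i x) (at 0)" "((\<lambda>t. G i (?l t)) has_vector_derivative H i x) (at 0)"
      "((\<lambda>t. g (?l t)) has_vector_derivative G' i x) (at 0)" "((\<lambda>t. G' i (?l t)) has_vector_derivative H' i x) (at 0)"
      using f g by (auto simp: axis2_def)
    show "((\<lambda>t. f (?l t) * g (?l t)) has_vector_derivative f x * G' i x + G i x * g x) (at 0)"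
      using has_vector_derivative_mult[OF *(1,3)] by simp
    show "((\<lambda>t. f (?l t) * G' i (?l t) + G i (?l t) * g (?l t)) has_vector_derivative
       f x * H' i x + 2 * (G i x * G' i x) + H i x * g x) (at 0)"
      using has_vector_derivative_add[OF has_vector_derivative_mult[OF *(1,4)] has_vector_derivative_mult[OF *(2,3)]]
      by (simp add: algebra_simps)
  qed
  with assms show ?thesis unfolding test_fn_def by (auto intro!: continuous_intros)
qed

lemma test_fn_diff:
  assumes "test_fn f G H" "test_fn g G' H'"
  shows "test_fn (\<lambda>x. f x - g x) (\<lambda>i x. G i x - G' i x) (\<lambda>i x. H i x - H' i x)"
  using assms unfolding test_fn_def by (auto intro!: continuous_intros axis2_diff)

lemma test_fn_add:
  assumes "test_fn f G H" "test_fn g G' H'"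
  shows "test_fn (\<lambda>x. f x + g x) (\<lambda>i x. G i x + G' i x) (\<lambda>i x. H i x + H' i x)"
  using assms unfolding test_fn_def by (auto intro!: continuous_intros axis2_add)

lemma test_fn_mirror:
  assumes "test_fn f G H"
  shows "test_fn (\<lambda>x. f (mirror j y x)) (\<lambda>i x. (if i = j then -1 else 1) *\<^sub>R G i (mirror j y x))
           (\<lambda>i x. H i (mirror j y x))"
proof -
  have m: "continuous_on UNIV (mirror j y)" unfolding mirror_def by (intro continuous_intros)
  have c: "continuous_on UNIV (\<lambda>x. h (mirror j y x))" if "continuous_on UNIV h" for h :: "real^3 \<Rightarrow> complex"
    using continuous_on_compose2[OF that m] by auto
  show ?thesis using assms axis2_mirror[of UNIV f G H UNIV j y] unfolding test_fn_def
    by (auto intro!: continuous_intros c)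
qed

text \<open>Derivatives of \<open>f\<close> are asked for at nonnegative arguments, because
  functions of sqrt (q + d^2) will be composed with a squared distance.\<close>

lemma test_fn_comp:
  fixes Q :: "real^3 \<Rightarrow> real" and f :: "real \<Rightarrow> complex"
  assumes "axis2 UNIV Q GQ HQ" "continuous_on UNIV Q" "\<And>i. continuous_on UNIV (GQ i)" "\<And>i. continuous_on UNIV (HQ i)"
    and Q: "\<And>x. Q x \<ge> 0"
    and f: "\<And>q. q \<ge> 0 \<Longrightarrow> (f has_vector_derivative f' q) (at q)"
    and f': "\<And>q. q \<ge> 0 \<Longrightarrow> (f' has_vector_derivative f'' q) (at q)"
    and f'': "continuous_on {0..} f''"
  shows "test_fn (\<lambda>x. f (Q x)) (\<lambda>i x. GQ i x *\<^sub>R f' (Q x))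
    (\<lambda>i x. (GQ i x)\<^sup>2 *\<^sub>R f'' (Q x) + HQ i x *\<^sub>R f' (Q x))"
proof -
  have "axis2 UNIV (\<lambda>x. f (Q x)) (\<lambda>i x. GQ i x *\<^sub>R f' (Q x))
    (\<lambda>i x. (GQ i x)\<^sup>2 *\<^sub>R f'' (Q x) + HQ i x *\<^sub>R f' (Q x))"
    unfolding axis2_def
  proof (intro ballI allI conjI)
    fix x :: "real^3" and i :: 3
    let ?l = "\<lambda>t::real. x + t *\<^sub>R axis i 1"
    have *: "((\<lambda>t. Q (?l t)) has_vector_derivative GQ i x) (at 0)" "((\<lambda>t. GQ i (?l t)) has_vector_derivative HQ i x) (at 0)"
      using assms(1) by (auto simp: axis2_def)
    have q0: "(f has_vector_derivative f' (Q x)) (at (Q (?l 0)))" "(f' has_vector_derivative f'' (Q x)) (at (Q (?l 0)))"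
      using f[OF Q] f'[OF Q] by auto
    show "((\<lambda>t. f (Q (?l t))) has_vector_derivative GQ i x *\<^sub>R f' (Q x)) (at 0)"
      using vector_diff_chain_at[OF *(1) q0(1)] by (simp add: o_def)
    have d: "((\<lambda>t. f' (Q (?l t))) has_vector_derivative GQ i x *\<^sub>R f'' (Q x)) (at 0)"
      using vector_diff_chain_at[OF *(1) q0(2)] by (simp add: o_def)
    have "((\<lambda>t. GQ i (?l t)) has_field_derivative HQ i x) (at 0)"
      using *(2) by (simp add: has_real_derivative_iff_has_vector_derivative)
    from has_vector_derivative_scaleR[OF this d]
    show "((\<lambda>t. GQ i (?l t) *\<^sub>R f' (Q (?l t))) has_vector_derivative
      (GQ i x)\<^sup>2 *\<^sub>R f'' (Q x) + HQ i x *\<^sub>R f' (Q x)) (at 0)"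
      by (simp add: power2_eq_square)
  qed
  moreover have "continuous_on {0..} f" "continuous_on {0..} f'"
    using f f' by (auto intro!: continuous_at_imp_continuous_on has_vector_derivative_continuous)
  then have "continuous_on UNIV (\<lambda>x. f (Q x))" "continuous_on UNIV (\<lambda>x. f' (Q x))" "continuous_on UNIV (\<lambda>x. f'' (Q x))"
    using f'' by (auto intro!: continuous_on_compose2[OF _ assms(2)] simp: Q)
  ultimately show ?thesis unfolding test_fn_def using assms(3,4) by (auto intro!: continuous_intros)
qed

lemma axis2_dist_sq:
  "axis2 UNIV (\<lambda>x. (x - y) \<bullet> (x - y)) (\<lambda>i x. 2 * (x$i - y$i)) (\<lambda>i x. 2)"
  unfolding axis2_def
proof (intro ballI allI conjI)
  fix x i
  have q: "(x + s *\<^sub>R axis i 1 - y) \<bullet> (x + s *\<^sub>R axis i 1 - y)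
      = (x - y) \<bullet> (x - y) + 2 * s * (x$i - y$i) + s\<^sup>2" for s
  proof -
    have e: "x + s *\<^sub>R axis i 1 - y = (x - y) + s *\<^sub>R axis i 1" by simp
    have "axis i (1::real) \<bullet> axis i 1 = (1::real)" by (simp add: inner_axis_axis)
    then show ?thesis unfolding e
      by (simp add: inner_add_left inner_add_right inner_axis inner_axis' power2_eq_square algebra_simps)
  qed
  have "((\<lambda>s. (x - y) \<bullet> (x - y) + 2 * s * (x$i - y$i) + s\<^sup>2) has_real_derivative 2 * (x$i - y$i)) (at 0)"
    by (rule derivative_eq_intros refl | simp)+
  then show "((\<lambda>s. (x + s *\<^sub>R axis i 1 - y) \<bullet> (x + s *\<^sub>R axis i 1 - y)) has_vector_derivative 2 * (x$i - y$i)) (at 0)"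
    unfolding q has_real_derivative_iff_has_vector_derivative .
  have l: "(x + s *\<^sub>R axis i 1) $ i = x $ i + s" for s by simp
  have "((\<lambda>s. 2 * (x$i + s - y$i)) has_real_derivative 2) (at 0)"
    by (rule derivative_eq_intros refl | simp)+
  then show "((\<lambda>s. 2 * ((x + s *\<^sub>R axis i 1) $ i - y$i)) has_vector_derivative 2) (at 0)"
    unfolding l has_real_derivative_iff_has_vector_derivative .
qed

text \<open>Radial functions are written in the squared distance q, a polynomial, so that nothing
  singular happens at the centre. The Laplacian becomes 4 q f'' + 6 f', where 6 is twice the
  dimension.\<close>

lemma test_fn_radial:
  fixes f :: "real \<Rightarrow> complex"
  assumes "\<And>q. q \<ge> 0 \<Longrightarrow> (f has_vector_derivative f' q) (at q)"
    and "\<And>q. q \<ge> 0 \<Longrightarrow> (f' has_vector_derivative f'' q) (at q)" "continuous_on {0..} f''"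
  shows "test_fn (\<lambda>x. f ((x - y) \<bullet> (x - y))) (\<lambda>i x. (2 * (x$i - y$i)) *\<^sub>R f' ((x - y) \<bullet> (x - y)))
    (\<lambda>i x. (2 * (x$i - y$i))\<^sup>2 *\<^sub>R f'' ((x - y) \<bullet> (x - y)) + 2 *\<^sub>R f' ((x - y) \<bullet> (x - y)))"
  by (rule test_fn_comp[OF axis2_dist_sq]) (use assms in \<open>auto intro!: continuous_intros\<close>)

lemma inner_vec3: "(a::real^3) \<bullet> b = (\<Sum>i\<in>UNIV. a$i * b$i)"
  by (simp add: inner_vec_def)

lemma radial_laplacian:
  "(\<Sum>i\<in>UNIV. (2 * (x$i - y$i))\<^sup>2 *\<^sub>R c + 2 *\<^sub>R d) = of_real (4 * ((x - y) \<bullet> (x - y))) * (c::complex) + 6 * d"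
  for x y :: "real^3"
proof -
  have "(\<Sum>i\<in>UNIV. (2 * (x$i - y$i))\<^sup>2 *\<^sub>R c + 2 *\<^sub>R d) = (\<Sum>i\<in>UNIV. (2 * (x$i - y$i))\<^sup>2) *\<^sub>R c + 6 * d"
    by (simp only: sum.distrib scaleR_sum_left) (simp add: scaleR_conv_of_real)
  also have "(\<Sum>i\<in>UNIV. (2 * (x$i - y$i))\<^sup>2) = 4 * ((x - y) \<bullet> (x - y))"
    by (simp add: inner_vec3 power2_eq_square sum_distrib_left algebra_simps)
  finally show ?thesis by (simp add: scaleR_conv_of_real)
qed

lemma radial_gradient_product:
  "(\<Sum>i\<in>UNIV. ((2 * (x$i - y$i)) *\<^sub>R c) * ((2 * (x$i - z$i)) *\<^sub>R d)) = of_real (4 * ((x - y) \<bullet> (x - z))) * (c * d :: complex)"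
  for x y z :: "real^3"
proof -
  have "(\<Sum>i\<in>UNIV. ((2 * (x$i - y$i)) *\<^sub>R c) * ((2 * (x$i - z$i)) *\<^sub>R d))
      = (\<Sum>i\<in>UNIV. 4 * ((x$i - y$i) * (x$i - z$i))) *\<^sub>R (c * d)"
    by (simp add: scaleR_sum_left algebra_simps)
  also have "(\<Sum>i\<in>UNIV. 4 * ((x$i - y$i) * (x$i - z$i))) = 4 * ((x - y) \<bullet> (x - z))"
    by (simp add: inner_vec3 sum_distrib_left)
  finally show ?thesis by (simp add: scaleR_conv_of_real)
qed

section \<open>Cutoff functions\<close>

definition cutoff :: "(real \<Rightarrow> real) \<Rightarrow> (real \<Rightarrow> real) \<Rightarrow> (real \<Rightarrow> real) \<Rightarrow> bool" where
  "cutoff X X' X'' \<longleftrightarrow> (\<forall>q. (X has_real_derivative X' q) (at q)) \<and>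
     (\<forall>q. (X' has_real_derivative X'' q) (at q)) \<and> continuous_on UNIV X''"

lemma cutoff_cont:
  assumes "cutoff X X' X''"
  shows "continuous_on UNIV X" "continuous_on UNIV X'" "continuous_on UNIV X''"
  using assms unfolding cutoff_def by (auto intro!: continuous_at_imp_continuous_on DERIV_isCont)

lemma cutoff_radial:
  assumes "cutoff X X' X''"
  shows "test_fn (\<lambda>x. of_real (X ((x - y) \<bullet> (x - y)))) (\<lambda>i x. (2 * (x$i - y$i)) *\<^sub>R of_real (X' ((x - y) \<bullet> (x - y))))
    (\<lambda>i x. (2 * (x$i - y$i))\<^sup>2 *\<^sub>R of_real (X'' ((x - y) \<bullet> (x - y))) + 2 *\<^sub>R of_real (X' ((x - y) \<bullet> (x - y))))"
  by (rule test_fn_radial[of "\<lambda>q. of_real (X q)" "\<lambda>q. of_real (X' q)" "\<lambda>q. of_real (X'' q)"])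
     (use assms continuous_on_subset[OF cutoff_cont(3)[OF assms]] in \<open>auto simp: cutoff_def
       intro!: has_vector_derivative_of_real continuous_intros simp: has_real_derivative_iff_has_vector_derivative\<close>)

lemma has_real_derivative_max_power:
  assumes "n \<ge> 1"
  shows "((\<lambda>s. (max 0 s) ^ Suc n) has_real_derivative (real (Suc n) * (max 0 s) ^ n)) (at s)"
proof -
  consider "s > 0" | "s < 0" | "s = 0" by linarith
  then show ?thesis
  proof cases
    case 1
    have "((\<lambda>s. s ^ Suc n) has_real_derivative (real (Suc n) * (max 0 s) ^ n)) (at s)"
      using 1 DERIV_pow[of "Suc n" s] by simp
    then show ?thesis
      by (rule has_field_derivative_transform_within_open[where S="{0<..}"]) (use 1 in auto)
  next
    case 2
    have "((\<lambda>s::real. 0) has_real_derivative (real (Suc n) * (max 0 s) ^ n)) (at s)"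
      using 2 assms by (auto intro!: derivative_eq_intros)
    then show ?thesis
      by (rule has_field_derivative_transform_within_open[where S="{..<0}"]) (use 2 in auto)
  next
    case 3
    have "(\<lambda>h::real. (max 0 h) ^ Suc n / h) \<midarrow>0\<rightarrow> 0"
    proof (rule Lim_null_comparison)
      show "\<forall>\<^sub>F h in at 0. norm ((max 0 h) ^ Suc n / h) \<le> \<bar>h\<bar> ^ n"
        by (rule always_eventually) (auto simp: max_def)
      show "((\<lambda>h::real. \<bar>h\<bar> ^ n) \<longlongrightarrow> 0) (at 0)"
        using assms by (intro tendsto_eq_intros) auto
    qed
    then show ?thesis using 3 assms unfolding DERIV_def by (simp add: power_0_left)
  qed
qed

text \<open>\<open>c\<close> is a parameter because the derivative bounds must hold uniformly while
  the transition interval is stretched to infinity or shrunk to a point. In all uses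
  \<open>a\<close> and \<open>b\<close> are squares of radii or of heights.\<close>

definition plateau :: "real \<Rightarrow> real \<Rightarrow> real \<Rightarrow> (real \<Rightarrow> real) \<Rightarrow> (real \<Rightarrow> real) \<Rightarrow> (real \<Rightarrow> real) \<Rightarrow> bool" where
  "plateau c a b X X' X'' \<longleftrightarrow> cutoff X X' X'' \<and> (\<forall>q\<le>a. X q = 1) \<and> (\<forall>q\<ge>b. X q = 0)
    \<and> (\<forall>q. 0 \<le> X q \<and> X q \<le> 1) \<and> (\<forall>q. q \<le> a \<or> q \<ge> b \<longrightarrow> X' q = 0 \<and> X'' q = 0)
    \<and> (\<forall>q. \<bar>X' q\<bar> \<le> c / (b - a) \<and> \<bar>X'' q\<bar> \<le> c / (b - a)\<^sup>2)"

text \<open>With \<open>p\<close> the cube of the positive part, \<open>p (1 - p s)\<close> is 1 for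
  s <= 0 and 0 for s >= 1, and it inherits two continuous derivatives from \<open>p\<close>. Affine
  rescaling to the interval from \<open>a\<close> to \<open>b\<close> produces the powers of
  \<open>b - a\<close> with one constant.\<close>

lemma plateau_exists:
  obtains c where "c > 0" "\<And>a b. a < b \<Longrightarrow> \<exists>X X' X''. plateau c a b X X' X''"
proof -
  define p where "p s = (max 0 s) ^ 3" for s :: real
  define p' where "p' s = 3 * (max 0 s) ^ 2" for s :: real
  define p'' where "p'' s = 6 * max 0 s" for s :: real
  have dp: "(p has_real_derivative p' s) (at s)" for s
    using has_real_derivative_max_power[of 2 s] by (simp add: p_def[abs_def] p'_def numeral_3_eq_3 eval_nat_numeral)
  have dp': "(p' has_real_derivative p'' s) (at s)" for s
    unfolding p'_def p''_def using DERIV_cmult[OF has_real_derivative_max_power[of 1 s], of 3]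
    by (simp add: eval_nat_numeral)
  have cp: "continuous_on UNIV p" "continuous_on UNIV p'" "continuous_on UNIV p''"
    unfolding p_def p'_def p''_def by (intro continuous_intros)+
  define B where "B s = p (1 - p s)" for s
  define B' where "B' s = - (p' (1 - p s) * p' s)" for s
  define B'' where "B'' s = p'' (1 - p s) * (p' s)\<^sup>2 - p' (1 - p s) * p'' s" for s
  have dB: "(B has_real_derivative B' s) (at s)" for s
  proof -
    have "((\<lambda>s. 1 - p s) has_real_derivative - p' s) (at s)" using DERIV_diff[OF DERIV_const dp, of 1 s] by simp
    from DERIV_chain2[OF dp this] show ?thesis by (simp add: B_def[abs_def] B'_def)
  qed
  have dB': "(B' has_real_derivative B'' s) (at s)" for s
  proof -
    have "((\<lambda>s. 1 - p s) has_real_derivative - p' s) (at s)" using DERIV_diff[OF DERIV_const dp, of 1 s] by simp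
    from DERIV_minus[OF DERIV_mult[OF DERIV_chain2[OF dp' this] dp']]
    show ?thesis by (simp add: B'_def[abs_def] B''_def power2_eq_square algebra_simps)
  qed
  have cc: "continuous_on UNIV (\<lambda>s. g (1 - p s))" if "continuous_on UNIV g" for g :: "real \<Rightarrow> real"
  proof -
    have "continuous_on UNIV (\<lambda>s. 1 - p s)" by (intro continuous_intros cp)
    from continuous_on_compose2[OF that this] show ?thesis by simp
  qed
  have cB: "continuous_on UNIV B'" "continuous_on UNIV B''"
    unfolding B'_def B''_def using cp by (auto intro!: continuous_intros cc)
  have p1: "p s \<ge> 1" if "s \<ge> 1" for s using that by (simp add: p_def)
  have B1: "B s = 1" if "s \<le> 0" for s using that by (simp add: B_def p_def)
  have B0: "B s = 0" if "s \<ge> 1" for s using p1[OF that] by (simp add: B_def p_def[of "1 - p s"])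
  have B01: "0 \<le> B s \<and> B s \<le> 1" for s
  proof -
    have "0 \<le> p s" by (simp add: p_def)
    then show ?thesis by (auto simp: B_def p_def[of "1 - p s"] intro!: power_le_one)
  qed
  have Bz: "B' s = 0 \<and> B'' s = 0" if "s \<le> 0 \<or> s \<ge> 1" for s
    using that p1[of s] by (auto simp: B'_def B''_def p'_def p''_def)
  have "bounded (B' ` {0..1})" "bounded (B'' ` {0..1})"
    by (auto intro!: compact_imp_bounded compact_continuous_image continuous_on_subset[OF cB(1)] continuous_on_subset[OF cB(2)])
  then obtain c1 c2 where c: "c1 > 0" "c2 > 0" "\<And>s. s \<in> {0..1} \<Longrightarrow> \<bar>B' s\<bar> \<le> c1" "\<And>s. s \<in> {0..1} \<Longrightarrow> \<bar>B'' s\<bar> \<le> c2"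
    unfolding bounded_pos by auto
  define cm where "cm = c1 + c2"
  have cm: "cm > 0" "\<And>s. \<bar>B' s\<bar> \<le> cm" "\<And>s. \<bar>B'' s\<bar> \<le> cm"
  proof -
    show "cm > 0" using c by (simp add: cm_def)
    show "\<bar>B' s\<bar> \<le> cm" for s using c(1,2) c(3)[of s] Bz[of s] by (cases "s \<in> {0..1}") (auto simp: cm_def)
    show "\<bar>B'' s\<bar> \<le> cm" for s using c(1,2) c(4)[of s] Bz[of s] by (cases "s \<in> {0..1}") (auto simp: cm_def)
  qed
  show ?thesis
  proof (rule that[OF cm(1)])
    fix a b :: real assume "a < b"
    define l where "l q = (q - a) / (b - a)" for q
    have dl: "(l has_real_derivative 1 / (b - a)) (at q)" for q
      unfolding l_def using \<open>a < b\<close> by (auto intro!: derivative_eq_intros)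
    have cl: "continuous_on UNIV l" unfolding l_def using \<open>a < b\<close> by (intro continuous_intros) auto
    have "cutoff (\<lambda>q. B (l q)) (\<lambda>q. B' (l q) * (1 / (b - a))) (\<lambda>q. B'' (l q) * (1 / (b - a)) * (1 / (b - a)))"
      unfolding cutoff_def
    proof (intro conjI allI)
      show "((\<lambda>q. B (l q)) has_real_derivative B' (l q) * (1 / (b - a))) (at q)" for q
        by (rule DERIV_chain2[OF dB dl])
      show "((\<lambda>q. B' (l q) * (1 / (b - a))) has_real_derivative B'' (l q) * (1 / (b - a)) * (1 / (b - a))) (at q)" for q
        by (rule DERIV_cmult_right[OF DERIV_chain2[OF dB' dl]])
      have "continuous_on UNIV (\<lambda>q. B'' (l q))" using continuous_on_compose2[OF cB(2) cl] by auto
      then show "continuous_on UNIV (\<lambda>q. B'' (l q) * (1 / (b - a)) * (1 / (b - a)))" by (intro continuous_intros) (use \<open>a < b\<close> in auto)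
    qed
    moreover have "l q \<le> 0" if "q \<le> a" for q using that \<open>a < b\<close> by (simp add: l_def divide_le_0_iff)
    moreover have "l q \<ge> 1" if "q \<ge> b" for q using that \<open>a < b\<close> by (simp add: l_def)
    moreover have "\<bar>B' (l q) * (1 / (b - a))\<bar> \<le> cm / (b - a)" for q
      using cm(2)[of "l q"] \<open>a < b\<close> by (simp add: abs_mult divide_right_mono)
    moreover have "\<bar>B'' (l q) * (1 / (b - a)) * (1 / (b - a))\<bar> \<le> cm / (b - a)\<^sup>2" for q
      using cm(3)[of "l q"] \<open>a < b\<close> by (simp add: abs_mult divide_right_mono power2_eq_square)
    ultimately show "\<exists>X X' X''. plateau cm a b X X' X''"
      unfolding plateau_def
      using B1 B0 B01 Bz
      by (intro exI[of _ "\<lambda>q. B (l q)"] exI[of _ "\<lambda>q. B' (l q) * (1 / (b - a))"] exI[of _ "\<lambda>q. B'' (l q) * (1 / (b - a)) * (1 / (b - a))"]) auto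
  qed
qed

section \<open>The representation formula\<close>

text \<open>Up to a constant factor, the fundamental solution as a function of the distance s.
  \<open>K1\<close> and \<open>K2\<close> are its first and second derivatives in q = s^2, that is
  under (1 / (2 s)) d/ds. The sign of \<kappa> selects outgoing or incoming waves, and s is complex
  because distances will be continued to complex values.\<close>

definition K0 :: "real \<Rightarrow> complex \<Rightarrow> complex" where
  "K0 \<kappa> s = exp (\<i> * of_real \<kappa> * s) / s"

definition K1 :: "real \<Rightarrow> complex \<Rightarrow> complex" where
  "K1 \<kappa> s = exp (\<i> * of_real \<kappa> * s) * (\<i> * of_real \<kappa> / (2 * s^2) - 1 / (2 * s^3))"

definition K2 :: "real \<Rightarrow> complex \<Rightarrow> complex" where
  "K2 \<kappa> s = exp (\<i> * of_real \<kappa> * s) * (- ((of_real \<kappa>)^2) / (4 * s^3) - 3 * \<i> * of_real \<kappa> / (4 * s^4) + 3 / (4 * s^5))"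

text \<open>The defect of regularisation: the Helmholtz operator applied to the kernel at the
  softened distance s = sqrt (q + d^2) leaves d^2 / s^5 times this function. Its value at 0 is -3,
  the only value that survives in the limit.\<close>

definition KP :: "real \<Rightarrow> complex \<Rightarrow> complex" where
  "KP \<kappa> s = exp (\<i> * of_real \<kappa> * s) * (- 3 + 3 * \<i> * of_real \<kappa> * s + (of_real \<kappa> * s)^2)"

lemma K0_deriv: "s \<noteq> 0 \<Longrightarrow> (K0 \<kappa> has_field_derivative 2 * s * K1 \<kappa> s) (at s)"
  unfolding K0_def[abs_def] K1_def
  by (auto intro!: derivative_eq_intros simp: field_simps power2_eq_square power3_eq_cube)

lemma K1_deriv: "s \<noteq> 0 \<Longrightarrow> (K1 \<kappa> has_field_derivative 2 * s * K2 \<kappa> s) (at s)"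
  unfolding K1_def[abs_def] K2_def
  by (rule derivative_eq_intros refl | simp)+ (simp add: field_simps eval_nat_numeral)

text \<open>For \<open>d = 0\<close> the left side is the radial Helmholtz operator on the
  fundamental solution and vanishes. As q enters linearly, lowering it by d^2 leaves -4 d^2
  \<open>K2\<close>, which is the right side.\<close>

lemma K_helm:
  assumes "s \<noteq> 0" "q = s\<^sup>2 - d\<^sup>2"
  shows "4 * q * K2 \<kappa> s + 6 * K1 \<kappa> s + (of_real \<kappa>)^2 * K0 \<kappa> s = d^2 / s^5 * KP \<kappa> s"
  using assms(1) unfolding assms(2) K0_def K1_def K2_def KP_def
  by (simp add: field_simps eval_nat_numeral)

lemma K_cont: "continuous_on (-{0}) (K0 \<kappa>)" "continuous_on (-{0}) (K1 \<kappa>)" "continuous_on (-{0}) (K2 \<kappa>)" "continuous_on UNIV (KP \<kappa>)"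
  unfolding K0_def[abs_def] K1_def[abs_def] K2_def[abs_def] KP_def[abs_def] by (auto intro!: continuous_intros)

section \<open>The softened distance and the concentrating kernel\<close>

definition sd :: "real \<Rightarrow> real \<Rightarrow> real" where "sd d q = sqrt (q + d\<^sup>2)"

lemma sd_pos: "d > 0 \<Longrightarrow> q \<ge> 0 \<Longrightarrow> sd d q > 0"
  by (simp add: sd_def add_nonneg_pos)

lemma sd_sq: "q \<ge> 0 \<Longrightarrow> (sd d q)\<^sup>2 = q + d\<^sup>2"
  by (simp add: sd_def)

lemma sd_deriv:
  assumes "d > 0" "q \<ge> 0"
  shows "((\<lambda>q. complex_of_real (sd d q)) has_vector_derivative of_real (1 / (2 * sd d q))) (at q)"
proof -
  have "q + d\<^sup>2 > 0" using assms by (simp add: add_nonneg_pos)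
  then have "(sd d has_real_derivative 1 / (2 * sd d q)) (at q)"
    unfolding sd_def[abs_def] by (auto intro!: derivative_eq_intros simp: field_simps)
  then show ?thesis
    by (intro has_vector_derivative_of_real) (simp add: has_real_derivative_iff_has_vector_derivative)
qed

lemma kernel_test_fn:
  assumes "d > 0"
  shows "test_fn (\<lambda>x. K0 \<kappa> (of_real (sd d ((x - y) \<bullet> (x - y)))))
    (\<lambda>i x. (2 * (x$i - y$i)) *\<^sub>R K1 \<kappa> (of_real (sd d ((x - y) \<bullet> (x - y)))))
    (\<lambda>i x. (2 * (x$i - y$i))\<^sup>2 *\<^sub>R K2 \<kappa> (of_real (sd d ((x - y) \<bullet> (x - y)))) + 2 *\<^sub>R K1 \<kappa> (of_real (sd d ((x - y) \<bullet> (x - y)))))"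
proof (rule test_fn_radial[of "\<lambda>q. K0 \<kappa> (of_real (sd d q))" "\<lambda>q. K1 \<kappa> (of_real (sd d q))" "\<lambda>q. K2 \<kappa> (of_real (sd d q))"])
  fix q :: real assume "q \<ge> 0"
  then have s: "complex_of_real (sd d q) \<noteq> 0" using sd_pos[OF assms, of q] by simp
  show "((\<lambda>q. K0 \<kappa> (of_real (sd d q))) has_vector_derivative K1 \<kappa> (of_real (sd d q))) (at q)"
    using field_vector_diff_chain_at[OF sd_deriv[OF assms \<open>q \<ge> 0\<close>] K0_deriv[OF s]] s
    by (simp add: o_def field_simps)
  show "((\<lambda>q. K1 \<kappa> (of_real (sd d q))) has_vector_derivative K2 \<kappa> (of_real (sd d q))) (at q)"
    using field_vector_diff_chain_at[OF sd_deriv[OF assms \<open>q \<ge> 0\<close>] K1_deriv[OF s]] s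
    by (simp add: o_def field_simps)
next
  have "continuous_on {0..} (\<lambda>q. complex_of_real (sd d q))" unfolding sd_def by (intro continuous_intros)
  moreover have "complex_of_real (sd d q) \<noteq> 0" if "q \<ge> 0" for q using sd_pos[OF assms that] by simp
  ultimately show "continuous_on {0..} (\<lambda>q. K2 \<kappa> (of_real (sd d q)))"
    by (intro continuous_on_compose2[OF K_cont(3)]) auto
qed

text \<open>The function pk d is, up to a constant, the Laplacian of the regularised Newton kernel
  1 / sqrt (|x|^2 + d^2); it concentrates at the origin as d tends to 0.\<close>

definition pk :: "real \<Rightarrow> real^3 \<Rightarrow> real" where
  "pk d x = d\<^sup>2 / (sd d (x \<bullet> x))^5"

definition J :: "real \<Rightarrow> real" where
  "J d = (LINT x|lborel. indicator (ball 0 1) x *\<^sub>R pk d x)"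

lemma pk_nonneg: "pk d x \<ge> 0" by (simp add: pk_def sd_def)

lemma sd_ge: "sd d (x \<bullet> x) \<ge> norm x"
proof -
  have "sqrt (x \<bullet> x) \<le> sqrt (x \<bullet> x + d\<^sup>2)" by (rule real_sqrt_le_mono) simp
  then show ?thesis by (simp add: sd_def norm_eq_sqrt_inner)
qed

lemma sd_le: "d \<ge> 0 \<Longrightarrow> sd d (x \<bullet> x) \<le> norm x + d"
  using sqrt_add_le_add_sqrt[of "x \<bullet> x" "d\<^sup>2"] by (simp add: sd_def norm_eq_sqrt_inner)

lemma sd_ge_d: "d \<ge> 0 \<Longrightarrow> q \<ge> 0 \<Longrightarrow> sd d q \<ge> d"
proof -
  assume "d \<ge> 0" "q \<ge> 0"
  then have "sqrt (d\<^sup>2) \<le> sqrt (q + d\<^sup>2)" by (intro real_sqrt_le_mono) simp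
  then show ?thesis using \<open>d \<ge> 0\<close> by (simp add: sd_def)
qed

lemma pk_cont: "d > 0 \<Longrightarrow> continuous_on UNIV (pk d)"
  unfolding pk_def[abs_def] sd_def
  by (intro continuous_intros) (auto simp: add_nonneg_pos less_imp_neq[symmetric] add_nonneg_eq_0_iff)

lemma pk_measurable: "d > 0 \<Longrightarrow> pk d \<in> borel_measurable borel"
  by (rule borel_measurable_continuous_onI[OF pk_cont])

lemma pk_bound: "d > 0 \<Longrightarrow> pk d x \<le> d\<^sup>2 / d^5"
  unfolding pk_def by (intro divide_left_mono power_mono sd_ge_d) (auto simp: sd_pos)

lemma pk_bound_far: "\<eta> > 0 \<Longrightarrow> norm x \<ge> \<eta> \<Longrightarrow> pk d x \<le> d\<^sup>2 / \<eta>^5"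
proof -
  assume "\<eta> > 0" "norm x \<ge> \<eta>"
  then have "\<eta> \<le> sd d (x \<bullet> x)" using sd_ge[of x d] by linarith
  then show ?thesis unfolding pk_def using \<open>\<eta> > 0\<close> by (intro divide_left_mono power_mono mult_pos_pos zero_less_power) auto
qed

lemma pk_integrable:
  assumes "d > 0" "A \<in> sets borel" "bounded A"
  shows "integrable lborel (\<lambda>x. indicator A x *\<^sub>R pk d (x - y))"
proof (rule integrableI_bounded_set[where A=A and B="d\<^sup>2 / d^5"])
  show "emeasure lborel A < \<infinity>" by (rule emeasure_bounded_finite[OF assms(3)])
  have [measurable]: "pk d \<in> borel_measurable borel" by (rule pk_measurable[OF assms(1)])
  have [measurable]: "A \<in> sets borel" by fact
  show "(\<lambda>x. indicator A x *\<^sub>R pk d (x - y)) \<in> borel_measurable lborel" by measurable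
  show "AE x in lborel. x \<in> A \<longrightarrow> norm (indicator A x *\<^sub>R pk d (x - y)) \<le> d\<^sup>2 / d^5"
    using pk_bound[OF assms(1)] pk_nonneg by auto
qed (use assms in auto)

lemma J_translate:
  assumes "d > 0"
  shows "J d = (LINT x|lborel. indicator (ball y 1) x *\<^sub>R pk d (x - y))"
proof -
  have [measurable]: "pk d \<in> borel_measurable borel" by (rule pk_measurable[OF assms(1)])
  have [measurable]: "ball y 1 \<in> sets borel" by simp
  have mm: "(\<lambda>x. indicator (ball y 1) x *\<^sub>R pk d (x - y)) \<in> borel_measurable borel" by measurable
  have "(LINT x|lborel. indicator (ball y 1) x *\<^sub>R pk d (x - y))
      = (LINT x|distr lborel borel ((+) y). indicator (ball y 1) x *\<^sub>R pk d (x - y))"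
    by (simp add: lborel_distr_plus)
  also have "\<dots> = (LINT x|lborel. indicator (ball y 1) (y + x) *\<^sub>R pk d (y + x - y))"
    by (rule integral_distr[OF _ mm]) simp
  also have "\<dots> = J d" unfolding J_def
    by (rule Bochner_Integration.integral_cong) (auto simp: indicator_def dist_norm)
  finally show ?thesis by simp
qed

text \<open>On the ball of radius \<open>d\<close> the softened distance is at most 2 d, so
  \<open>pk d\<close> is at least d^2 / (2 d)^5 = 1 / (32 d^3), while the volume of that ball is
  \<open>unit_ball_vol 3\<close> times d^3.\<close>

definition Jmin :: real where "Jmin = unit_ball_vol 3 / 32"

lemma Jmin_pos: "Jmin > 0" by (simp add: Jmin_def)

lemma pk_ball_lower:
  assumes "0 < d" "A \<in> sets borel" "bounded A" "ball y d \<subseteq> A"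
  shows "(LINT x|lborel. indicator A x *\<^sub>R pk d (x - y)) \<ge> Jmin"
proof -
  have "Jmin = (LINT x|lborel. indicator (ball y d) x *\<^sub>R (1 / (32 * d^3)))"
    using assms by (simp add: Jmin_def content_ball)
  also have "\<dots> \<le> (LINT x|lborel. indicator A x *\<^sub>R pk d (x - y))"
  proof (rule integral_mono)
    show "integrable lborel (\<lambda>x. indicator (ball y d) x *\<^sub>R (1 / (32 * d^3)))"
      using emeasure_bounded_finite[of "ball y d"] by (intro integrable_scaleR_left integrable_real_indicator) auto
    show "integrable lborel (\<lambda>x. indicator A x *\<^sub>R pk d (x - y))" by (rule pk_integrable[OF assms(1-3)])
    fix x
    show "indicator (ball y d) x *\<^sub>R (1 / (32 * d^3)) \<le> indicator A x *\<^sub>R pk d (x - y)"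
    proof (cases "x \<in> ball y d")
      case True
      then have "x \<in> A" using assms by auto
      have "norm (x - y) \<le> d" using True by (simp add: dist_norm norm_minus_commute)
      then have s: "sd d ((x - y) \<bullet> (x - y)) \<le> 2 * d" using sd_le[of d "x - y"] assms by simp
      have p: "sd d ((x - y) \<bullet> (x - y)) > 0" using sd_pos[OF assms(1)] by simp
      have "1 / (32 * d^3) = d\<^sup>2 / (2 * d)^5" using assms(1) by (simp add: field_simps eval_nat_numeral)
      also have "\<dots> \<le> pk d (x - y)" unfolding pk_def using assms(1) s p
        by (intro divide_left_mono power_mono mult_pos_pos zero_less_power) auto
      finally show ?thesis using True \<open>x \<in> A\<close> by simp
    qed (simp add: indicator_def pk_nonneg)
  qed
  finally show ?thesis .
qed

lemma J_lower: "0 < d \<Longrightarrow> d \<le> 1 \<Longrightarrow> J d \<ge> Jmin"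
  using pk_ball_lower[of d "ball 0 1" 0] by (simp add: J_def subset_ball)

text \<open>The mass \<open>J\<close> stays above \<open>Jmin\<close>, whereas the kernel outside
  any fixed ball about \<open>y\<close> is O(\<delta>^2). The integrand may change with
  \<open>n\<close>, because in the application it contains the softened distance itself.\<close>

lemma approximate_identity:
  fixes g :: "nat \<Rightarrow> real^3 \<Rightarrow> complex"
  assumes \<delta>: "\<And>n. 0 < \<delta> n" "\<And>n. \<delta> n \<le> 1" "\<delta> \<longlonglongrightarrow> 0"
    and g: "\<And>n. g n \<in> borel_measurable borel" "\<And>n x. norm (g n x) \<le> M" "\<And>n x. x \<notin> cball y \<rho> \<Longrightarrow> g n x = 0"
    and L: "\<And>e. e > 0 \<Longrightarrow> \<exists>\<eta>>0. \<exists>n0. \<forall>n\<ge>n0. \<forall>x. dist x y < \<eta> \<longrightarrow> norm (g n x - L) \<le> e"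
  shows "(\<lambda>n. (LINT x|lborel. g n x * of_real (pk (\<delta> n) (x - y))) / of_real (J (\<delta> n))) \<longlonglongrightarrow> L"
proof (rule LIMSEQ_I)
  fix e :: real assume "e > 0"
  define \<rho>' where "\<rho>' = max \<rho> 1"
  have bcb: "ball y 1 \<subseteq> cball y \<rho>'" by (auto simp: \<rho>'_def)
  obtain \<eta>0 n0 where \<eta>0: "\<eta>0 > 0" and n0: "\<And>n x. n \<ge> n0 \<Longrightarrow> dist x y < \<eta>0 \<Longrightarrow> norm (g n x - L) \<le> e/4"
    using L[of "e/4"] \<open>e > 0\<close> by auto
  define \<eta> where "\<eta> = min \<eta>0 1"
  have \<eta>: "\<eta> > 0" "\<eta> \<le> 1" "\<eta> \<le> \<eta>0" using \<eta>0 by (auto simp: \<eta>_def)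
  define V where "V = measure lborel (cball y \<rho>')"
  have "M \<ge> 0" using g(2) norm_ge_zero order_trans by blast
  \<comment> \<open>Points at distance at least \<open>\<eta>\<close> from \<open>y\<close>
    contribute at most \<open>C\<close> times the square of \<open>\<delta> n\<close>.\<close>
  define C where "C = (M + norm L) * V / \<eta>^5 / Jmin"
  have "V \<ge> 0" by (simp add: V_def)
  then have "C \<ge> 0" using \<open>M \<ge> 0\<close> \<eta>(1) Jmin_pos by (auto simp: C_def)
  have "(\<lambda>n. C * (\<delta> n)\<^sup>2) \<longlonglongrightarrow> C * 0\<^sup>2" by (intro tendsto_intros \<delta>)
  then have "\<forall>\<^sub>F n in sequentially. C * (\<delta> n)\<^sup>2 < e/4"
    by (rule order_tendstoD) (use \<open>e > 0\<close> in auto)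
  then obtain n1 where n1: "\<And>n. n \<ge> n1 \<Longrightarrow> C * (\<delta> n)\<^sup>2 < e/4" by (auto simp: eventually_sequentially)
  show "\<exists>no. \<forall>n\<ge>no. norm ((LINT x|lborel. g n x * of_real (pk (\<delta> n) (x - y))) / of_real (J (\<delta> n)) - L) < e"
  proof (intro exI[of _ "max n0 n1"] allI impI)
    fix n assume "n \<ge> max n0 n1"
    then have n: "n \<ge> n0" "n \<ge> n1" by auto
    let ?d = "\<delta> n"
    have [measurable]: "pk ?d \<in> borel_measurable borel" by (rule pk_measurable[OF \<delta>(1)])
    have [measurable]: "g n \<in> borel_measurable borel" by (rule g)
    have i1: "integrable lborel (\<lambda>x. g n x * of_real (pk ?d (x - y)))"
    proof (rule Bochner_Integration.integrable_bound)
      show "integrable lborel (\<lambda>x. M *\<^sub>R (indicator (cball y \<rho>) x *\<^sub>R pk ?d (x - y)))"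
        by (intro integrable_scaleR_right pk_integrable \<delta>) auto
      show "AE x in lborel. norm (g n x * of_real (pk ?d (x - y))) \<le> norm (M *\<^sub>R (indicator (cball y \<rho>) x *\<^sub>R pk ?d (x - y)))"
      proof (rule AE_I2)
        fix x
        show "norm (g n x * of_real (pk ?d (x - y))) \<le> norm (M *\<^sub>R (indicator (cball y \<rho>) x *\<^sub>R pk ?d (x - y)))"
          using g(2)[of n x] g(3)[of x n] pk_nonneg[of ?d "x - y"] \<open>M \<ge> 0\<close>
          by (cases "x \<in> cball y \<rho>") (auto simp: norm_mult mult_right_mono)
      qed
    qed simp
    have ib: "integrable lborel (\<lambda>x. indicator (ball y 1) x *\<^sub>R pk ?d (x - y))" by (rule pk_integrable[OF \<delta>(1)]) auto
    have i2: "integrable lborel (\<lambda>x. L * of_real (indicator (ball y 1) x *\<^sub>R pk ?d (x - y)))"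
      by (intro integrable_mult_right integrable_of_real ib)
    have i3: "integrable lborel (\<lambda>x. (e/4) *\<^sub>R (indicator (ball y 1) x *\<^sub>R pk ?d (x - y)))"
      by (intro integrable_scaleR_right ib)
    have i4: "integrable lborel (\<lambda>x. indicator (cball y \<rho>') x *\<^sub>R ((M + norm L) * (?d\<^sup>2 / \<eta>^5)))"
      using emeasure_bounded_finite[of "cball y \<rho>'"] by (intro integrable_scaleR_left integrable_real_indicator) auto
    have "(LINT x|lborel. g n x * of_real (pk ?d (x - y))) - L * of_real (J ?d)
       = (LINT x|lborel. g n x * of_real (pk ?d (x - y)) - L * of_real (indicator (ball y 1) x *\<^sub>R pk ?d (x - y)))"
      unfolding J_translate[OF \<delta>(1), of n y] using i1 i2 
      by (simp only: Bochner_Integration.integral_diff integral_mult_right_zero integral_complex_of_real)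
    also have "norm \<dots> \<le> (LINT x|lborel. (e/4) *\<^sub>R (indicator (ball y 1) x *\<^sub>R pk ?d (x - y)) + indicator (cball y \<rho>') x *\<^sub>R ((M + norm L) * (?d\<^sup>2 / \<eta>^5)))"
    proof (rule Bochner_Integration.integral_norm_bound_integral)
      show "integrable lborel (\<lambda>x. g n x * of_real (pk ?d (x - y)) - L * of_real (indicator (ball y 1) x *\<^sub>R pk ?d (x - y)))"
        by (rule Bochner_Integration.integrable_diff[OF i1 i2])
      show "integrable lborel (\<lambda>x. (e/4) *\<^sub>R (indicator (ball y 1) x *\<^sub>R pk ?d (x - y)) + indicator (cball y \<rho>') x *\<^sub>R ((M + norm L) * (?d\<^sup>2 / \<eta>^5)))"
        by (rule Bochner_Integration.integrable_add[OF i3 i4])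
      fix x
      show "norm (g n x * of_real (pk ?d (x - y)) - L * of_real (indicator (ball y 1) x *\<^sub>R pk ?d (x - y)))
         \<le> (e/4) *\<^sub>R (indicator (ball y 1) x *\<^sub>R pk ?d (x - y)) + indicator (cball y \<rho>') x *\<^sub>R ((M + norm L) * (?d\<^sup>2 / \<eta>^5))"
      proof (cases "dist x y < \<eta>")
        case True
        then have "x \<in> ball y 1" using \<eta> by (simp add: dist_commute)
        then have xb: "indicator (ball y 1) x = (1::real)" "indicator (cball y \<rho>') x = (1::real)" using bcb by auto
        have "norm (g n x * of_real (pk ?d (x - y)) - L * of_real (pk ?d (x - y))) = norm (g n x - L) * pk ?d (x - y)"
          by (simp add: norm_mult pk_nonneg flip: left_diff_distrib)
        also have "\<dots> \<le> e/4 * pk ?d (x - y)" using n0[OF n(1)] True \<eta> pk_nonneg by (intro mult_right_mono) auto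
        finally have "norm (g n x * of_real (pk ?d (x - y)) - L * of_real (pk ?d (x - y))) \<le> e/4 * pk ?d (x - y)" .
        moreover have "0 \<le> (M + norm L) * (?d\<^sup>2 / \<eta>^5)" using \<open>M \<ge> 0\<close> \<eta> by simp
        ultimately show ?thesis unfolding xb by simp
      next
        case False
        then have far: "pk ?d (x - y) \<le> ?d\<^sup>2 / \<eta>^5" using \<eta> by (intro pk_bound_far) (auto simp: dist_norm)
        show ?thesis
        proof (cases "x \<in> cball y \<rho>'")
          case True
          have "norm (g n x * of_real (pk ?d (x - y)) - L * of_real (indicator (ball y 1) x *\<^sub>R pk ?d (x - y)))
             \<le> norm (g n x) * pk ?d (x - y) + norm L * (indicator (ball y 1) x * pk ?d (x - y))"
            by (rule order_trans[OF norm_triangle_ineq4]) (auto simp: norm_mult pk_nonneg)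
          also have "\<dots> \<le> M * (?d\<^sup>2 / \<eta>^5) + norm L * (?d\<^sup>2 / \<eta>^5)"
            using g(2)[of n x] far pk_nonneg[of ?d "x - y"] \<open>M \<ge> 0\<close>
            by (intro add_mono mult_mono) (auto simp: indicator_def intro: order_trans)
          also have "\<dots> = indicator (cball y \<rho>') x *\<^sub>R ((M + norm L) * (?d\<^sup>2 / \<eta>^5))"
            using True by (simp add: distrib_right add_divide_distrib)
          also have "\<dots> \<le> (e/4) *\<^sub>R (indicator (ball y 1) x *\<^sub>R pk ?d (x - y)) + \<dots>"
            using \<open>e > 0\<close> pk_nonneg by simp
          finally show ?thesis .
        next
          case F: False
          then have "g n x = 0" by (intro g) (auto simp: \<rho>'_def)
          moreover have "x \<notin> ball y 1" using F bcb by auto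
          ultimately show ?thesis using \<open>M \<ge> 0\<close> \<eta> by simp
        qed
      qed
    qed
    also have "\<dots> = e/4 * J ?d + (M + norm L) * (?d\<^sup>2 / \<eta>^5) * V"
      unfolding J_translate[OF \<delta>(1), of n y] V_def
      unfolding Bochner_Integration.integral_add[OF i3 i4] by simp
    finally have b: "norm ((LINT x|lborel. g n x * of_real (pk ?d (x - y))) - L * of_real (J ?d))
       \<le> e/4 * J ?d + (M + norm L) * (?d\<^sup>2 / \<eta>^5) * V" .
    have J: "J ?d \<ge> Jmin" "J ?d > 0" using J_lower[OF \<delta>(1,2)] Jmin_pos by (auto intro: less_le_trans)
    have "norm ((LINT x|lborel. g n x * of_real (pk ?d (x - y))) / of_real (J ?d) - L)
       = norm ((LINT x|lborel. g n x * of_real (pk ?d (x - y))) - L * of_real (J ?d)) / J ?d"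
    proof -
      have "norm (z / of_real j - L) = norm (z - L * of_real j) / j" if "j > 0" for z j
      proof -
        have "z / of_real j - L = (z - L * of_real j) / of_real j" using that by (simp add: diff_divide_distrib)
        then show ?thesis using that by (simp add: norm_divide)
      qed
      then show ?thesis using J(2) by blast
    qed
    also have "\<dots> \<le> (e/4 * J ?d + (M + norm L) * (?d\<^sup>2 / \<eta>^5) * V) / J ?d"
      using b J(2) by (simp add: divide_right_mono)
    also have "\<dots> = e/4 + (M + norm L) * V / \<eta>^5 * ?d\<^sup>2 / J ?d" using J(2) by (simp add: add_divide_distrib)
    also have "\<dots> \<le> e/4 + (M + norm L) * V / \<eta>^5 * ?d\<^sup>2 / Jmin"
      using J Jmin_pos \<open>M \<ge> 0\<close> \<open>V \<ge> 0\<close> \<eta> by (intro add_left_mono divide_left_mono mult_pos_pos) auto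
    also have "\<dots> = e/4 + C * ?d\<^sup>2" by (simp add: C_def)
    also have "\<dots> < e" using n1[OF n(2)] \<open>e > 0\<close> by simp
    finally show "norm ((LINT x|lborel. g n x * of_real (pk ?d (x - y))) / of_real (J ?d) - L) < e" .
  qed
qed

text \<open>Bolzano-Weierstrass on the interval from 0 to \<open>1 / Jmin\<close> replaces an
  evaluation of the integral \<open>J\<close>.\<close>

lemma J_subsequence:
  obtains \<delta> c where "\<And>n. 0 < \<delta> n" "\<And>n. \<delta> n \<le> 1" "\<delta> \<longlonglongrightarrow> 0" "(\<lambda>n. 1 / J (\<delta> n)) \<longlonglongrightarrow> c"
proof -
  define d where "d n = inverse (real (Suc n))" for n
  have d: "0 < d n" "d n \<le> 1" for n by (auto simp: d_def field_simps)
  have d0: "d \<longlonglongrightarrow> 0" unfolding d_def by (rule LIMSEQ_inverse_real_of_nat)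
  have "1 / J (d n) \<in> {0..1/Jmin}" for n
    using J_lower[OF d, of n] Jmin_pos by (auto intro!: divide_left_mono)
  then have "\<forall>n. 1 / J (d n) \<in> {0..1/Jmin}" by blast
  then obtain c r where "strict_mono r" "((\<lambda>n. 1 / J (d n)) \<circ> r) \<longlonglongrightarrow> c"
    using compact_Icc[of 0 "1/Jmin", unfolded compact_def, rule_format, of "\<lambda>n. 1 / J (d n)"] by blast
  then show ?thesis
    using that[of "d \<circ> r" c] d LIMSEQ_subseq_LIMSEQ[OF d0] by (auto simp: o_def)
qed

text \<open>The terms of the Helmholtz operator on cutoff times kernel in which the cutoff is
  differentiated: twice the product of the gradients, where two squared distances give 2 * 2 * 2 =
  8, and the Laplacian of the cutoff times the kernel. The distance \<open>s\<close> is a separate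
  argument so that the softened and the true distance can both be inserted.\<close>

definition rep_kernel :: "real \<Rightarrow> (real \<Rightarrow> real) \<Rightarrow> (real \<Rightarrow> real) \<Rightarrow> real^3 \<Rightarrow> real^3 \<Rightarrow> real^3 \<Rightarrow> complex \<Rightarrow> complex" where
  "rep_kernel \<kappa> X' X'' y0 y x s =
     of_real (8 * X' ((x - y0) \<bullet> (x - y0)) * ((x - y0) \<bullet> (x - y))) * K1 \<kappa> s +
     of_real (6 * X' ((x - y0) \<bullet> (x - y0)) + 4 * ((x - y0) \<bullet> (x - y0)) * X'' ((x - y0) \<bullet> (x - y0))) * K0 \<kappa> s"

lemma cutoff_times_kernel:
  assumes "cutoff X X' X''" "d > 0"
  obtains G H where
    "test_fn (\<lambda>x. of_real (X ((x - y0) \<bullet> (x - y0))) * K0 \<kappa> (of_real (sd d ((x - y) \<bullet> (x - y))))) G H"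
    "\<And>x. (\<Sum>i\<in>UNIV. H i x) + complex_of_real (\<kappa>\<^sup>2) * (of_real (X ((x - y0) \<bullet> (x - y0))) * K0 \<kappa> (of_real (sd d ((x - y) \<bullet> (x - y)))))
      = of_real (X ((x - y0) \<bullet> (x - y0))) * KP \<kappa> (of_real (sd d ((x - y) \<bullet> (x - y)))) * of_real (pk d (x - y))
        + rep_kernel \<kappa> X' X'' y0 y x (of_real (sd d ((x - y) \<bullet> (x - y))))"
proof (rule that[OF test_fn_mult[OF cutoff_radial[OF assms(1)] kernel_test_fn[OF assms(2)]]])
  fix x
  define q where "q = (x - y0) \<bullet> (x - y0)"
  define r where "r = (x - y) \<bullet> (x - y)"
  define s where "s = complex_of_real (sd d r)"
  have "r \<ge> 0" by (simp add: r_def)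
  have s0: "s \<noteq> 0" using sd_pos[OF assms(2) \<open>r \<ge> 0\<close>] by (simp add: s_def)
  have "s\<^sup>2 = of_real (r + d\<^sup>2)" unfolding s_def of_real_power[symmetric] sd_sq[OF \<open>r \<ge> 0\<close>] ..
  then have rs: "of_real r = s\<^sup>2 - (of_real d)\<^sup>2" by simp
  have pks: "complex_of_real (pk d (x - y)) = (of_real d)^2 / s^5"
    by (simp add: pk_def s_def r_def)
  have "(\<Sum>i\<in>UNIV. of_real (X q) * ((2 * (x $ i - y $ i))\<^sup>2 *\<^sub>R K2 \<kappa> s + 2 *\<^sub>R K1 \<kappa> s)
       + 2 * (((2 * (x $ i - y0 $ i)) *\<^sub>R of_real (X' q)) * ((2 * (x $ i - y $ i)) *\<^sub>R K1 \<kappa> s))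
       + ((2 * (x $ i - y0 $ i))\<^sup>2 *\<^sub>R of_real (X'' q) + 2 *\<^sub>R of_real (X' q)) * K0 \<kappa> s)
     = of_real (X q) * (of_real (4 * r) * K2 \<kappa> s + 6 * K1 \<kappa> s)
       + 2 * (of_real (4 * ((x - y0) \<bullet> (x - y))) * (of_real (X' q) * K1 \<kappa> s))
       + (of_real (4 * q) * of_real (X'' q) + 6 * of_real (X' q)) * K0 \<kappa> s" (is "?L = _")
    unfolding sum.distrib sum_distrib_left[symmetric] sum_distrib_right[symmetric] 
    unfolding radial_gradient_product sum.distrib[symmetric] radial_laplacian q_def r_def ..
  also have "\<dots> + complex_of_real (\<kappa>\<^sup>2) * (of_real (X q) * K0 \<kappa> s)
     = of_real (X q) * (4 * of_real r * K2 \<kappa> s + 6 * K1 \<kappa> s + (of_real \<kappa>)\<^sup>2 * K0 \<kappa> s)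
       + rep_kernel \<kappa> X' X'' y0 y x s"
    by (simp add: rep_kernel_def q_def algebra_simps)
  also have "\<dots> = of_real (X q) * KP \<kappa> s * of_real (pk d (x - y)) + rep_kernel \<kappa> X' X'' y0 y x s"
    unfolding K_helm[OF s0 rs] pks by simp
  finally have "?L + complex_of_real (\<kappa>\<^sup>2) * (of_real (X q) * K0 \<kappa> s)
     = of_real (X q) * KP \<kappa> s * of_real (pk d (x - y)) + rep_kernel \<kappa> X' X'' y0 y x s" .
  then show "(\<Sum>i\<in>UNIV. of_real (X ((x - y0) \<bullet> (x - y0))) * ((2 * (x $ i - y $ i))\<^sup>2 *\<^sub>R K2 \<kappa> (of_real (sd d ((x - y) \<bullet> (x - y)))) + 2 *\<^sub>R K1 \<kappa> (of_real (sd d ((x - y) \<bullet> (x - y)))))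
       + 2 * (((2 * (x $ i - y0 $ i)) *\<^sub>R of_real (X' ((x - y0) \<bullet> (x - y0)))) * ((2 * (x $ i - y $ i)) *\<^sub>R K1 \<kappa> (of_real (sd d ((x - y) \<bullet> (x - y))))))
       + ((2 * (x $ i - y0 $ i))\<^sup>2 *\<^sub>R of_real (X'' ((x - y0) \<bullet> (x - y0))) + 2 *\<^sub>R of_real (X' ((x - y0) \<bullet> (x - y0)))) * K0 \<kappa> (of_real (sd d ((x - y) \<bullet> (x - y)))))
    + complex_of_real (\<kappa>\<^sup>2) * (of_real (X ((x - y0) \<bullet> (x - y0))) * K0 \<kappa> (of_real (sd d ((x - y) \<bullet> (x - y)))))
      = of_real (X ((x - y0) \<bullet> (x - y0))) * KP \<kappa> (of_real (sd d ((x - y) \<bullet> (x - y)))) * of_real (pk d (x - y))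
        + rep_kernel \<kappa> X' X'' y0 y x (of_real (sd d ((x - y) \<bullet> (x - y))))"
    unfolding s_def q_def r_def .
qed

lemma K_bounds:
  assumes "\<eta> > 0" "\<eta> \<le> s"
  shows "norm (K0 \<kappa> (of_real s)) \<le> 1 / \<eta>" "norm (K1 \<kappa> (of_real s)) \<le> \<bar>\<kappa>\<bar> / (2 * \<eta>\<^sup>2) + 1 / (2 * \<eta>^3)"
proof -
  have s: "s > 0" using assms by linarith
  have e: "norm (exp (\<i> * of_real \<kappa> * complex_of_real s)) = 1"
    by (metis mult.assoc norm_exp_i_times of_real_mult)
  show "norm (K0 \<kappa> (of_real s)) \<le> 1 / \<eta>"
    unfolding K0_def norm_divide e using assms s by (simp add: divide_left_mono)
  have "norm (K1 \<kappa> (of_real s)) \<le> norm (\<i> * of_real \<kappa> / (2 * complex_of_real s ^ 2)) + norm (1 / (2 * complex_of_real s ^ 3))"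
    unfolding K1_def norm_mult[of "exp _"] e using norm_triangle_ineq4 by simp
  also have "\<dots> = \<bar>\<kappa>\<bar> / (2 * s\<^sup>2) + 1 / (2 * s^3)"
    using s by (simp add: norm_divide norm_mult norm_power)
  also have "\<dots> \<le> \<bar>\<kappa>\<bar> / (2 * \<eta>\<^sup>2) + 1 / (2 * \<eta>^3)"
    using assms s by (intro add_mono divide_left_mono mult_left_mono power_mono) auto
  finally show "norm (K1 \<kappa> (of_real s)) \<le> \<bar>\<kappa>\<bar> / (2 * \<eta>\<^sup>2) + 1 / (2 * \<eta>^3)" .
qed

lemma sd_tendsto: "\<delta> \<longlonglongrightarrow> 0 \<Longrightarrow> (\<lambda>n. complex_of_real (sd (\<delta> n) (x \<bullet> x))) \<longlonglongrightarrow> of_real (norm x)"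
proof -
  assume "\<delta> \<longlonglongrightarrow> 0"
  then have "(\<lambda>n. sqrt (x \<bullet> x + (\<delta> n)\<^sup>2)) \<longlonglongrightarrow> sqrt (x \<bullet> x + 0\<^sup>2)" by (intro tendsto_intros)
  then show ?thesis unfolding sd_def norm_eq_sqrt_inner by (intro tendsto_of_real) simp
qed

text \<open>The constant may be taken to be a limit point of 1 / (3 J d); its value is never needed.\<close>

definition rep_const :: "complex \<Rightarrow> bool" where
  "rep_const c \<longleftrightarrow> (\<forall>k \<kappa> S u y0 y X X' X'' K \<eta>. \<kappa>\<^sup>2 = k\<^sup>2 \<longrightarrow> open S \<longrightarrow> weak_helm k S u \<longrightarrow> cutoff X X' X'' \<longrightarrow>
      compact K \<longrightarrow> K \<subseteq> S \<longrightarrow> (\<forall>x. x \<notin> K \<longrightarrow> X ((x - y0) \<bullet> (x - y0)) = 0) \<longrightarrow> y \<in> S \<longrightarrow> \<eta> > 0 \<longrightarrow>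
      (\<forall>x\<in>ball y \<eta>. X' ((x - y0) \<bullet> (x - y0)) = 0 \<and> X'' ((x - y0) \<bullet> (x - y0)) = 0) \<longrightarrow>
    of_real (X ((y - y0) \<bullet> (y - y0))) * u y =
      c * (LINT x|lborel. indicator K x *\<^sub>R (u x * rep_kernel \<kappa> X' X'' y0 y x (of_real (norm (x - y))))))"

text \<open>The weak equation is tested with a cutoff times the softened kernel. One part
  concentrates at \<open>y\<close> and, divided by \<open>J\<close>, tends to -3 times cutoff times
  solution; the other contains derivatives of the cutoff, which vanish near \<open>y\<close>, and
  converges to the stated integral. The constant depends on the sequence \<open>\<delta>\<close>
  alone, so it is the same for all solutions, wave numbers and cutoffs.\<close>

theorem representation_formula: "\<exists>c. rep_const c"
proof -
  obtain \<delta> c where \<delta>: "\<And>n. 0 < \<delta> n" "\<And>n. \<delta> n \<le> 1" "\<delta> \<longlonglongrightarrow> 0" and c: "(\<lambda>n. 1 / J (\<delta> n)) \<longlonglongrightarrow> c"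
    using J_subsequence by blast
  have "rep_const (of_real c / 3)"
    unfolding rep_const_def
  proof (intro allI impI)
    fix k \<kappa> S u y0 y X X' X'' K \<eta>
    assume k: "\<kappa>\<^sup>2 = k\<^sup>2" and "open S" and u: "weak_helm k S u" and X: "cutoff X X' X''"
      and K: "compact K" "K \<subseteq> S" and XK': "\<forall>x. x \<notin> K \<longrightarrow> X ((x - y0) \<bullet> (x - y0)) = 0"
      and y: "y \<in> S" and \<eta>: "\<eta> > (0::real)"
      and X0': "\<forall>x\<in>ball y \<eta>. X' ((x - y0) \<bullet> (x - y0)) = 0 \<and> X'' ((x - y0) \<bullet> (x - y0)) = 0"
    have XK: "X ((x - y0) \<bullet> (x - y0)) = 0" if "x \<notin> K" for x using XK' that by blast
    have X0: "X' ((x - y0) \<bullet> (x - y0)) = 0 \<and> X'' ((x - y0) \<bullet> (x - y0)) = 0" if "x \<in> ball y \<eta>" for x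
      using X0' that by blast
    define q where "q x = (x - y0) \<bullet> (x - y0)" for x
    define s where "s n x = complex_of_real (sd (\<delta> n) ((x - y) \<bullet> (x - y)))" for n x
    have uc: "continuous_on S u" using u by (simp add: weak_helm_def)
    then have ucK: "continuous_on K u" using K continuous_on_subset by blast
    have qc: "continuous_on A q" for A unfolding q_def by (intro continuous_intros)
    have Xq: "continuous_on A (\<lambda>x. X (q x))" "continuous_on A (\<lambda>x. X' (q x))" "continuous_on A (\<lambda>x. X'' (q x))" for A
      using cutoff_cont[OF X] by (auto intro!: continuous_on_compose2[OF _ qc])
    have sc: "continuous_on A (s n)" for A n unfolding s_def sd_def by (intro continuous_intros)
    have s0: "s n x \<noteq> 0" for n x unfolding s_def using sd_pos[OF \<delta>(1)[of n], of "(x - y) \<bullet> (x - y)"] by simp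
    have K0c: "continuous_on A (\<lambda>x. K0 \<kappa> (s n x))" and K1c: "continuous_on A (\<lambda>x. K1 \<kappa> (s n x))"
      and KPc: "continuous_on A (\<lambda>x. KP \<kappa> (s n x))" for A n
      using s0 by (auto intro!: continuous_on_compose2[OF K_cont(1) sc] continuous_on_compose2[OF K_cont(2) sc]
          continuous_on_compose2[OF K_cont(4) sc])
    define g where "g n x = indicator K x *\<^sub>R (u x * (of_real (X (q x)) * KP \<kappa> (s n x)))" for n x
    define r where "r n x = indicator K x *\<^sub>R (u x * rep_kernel \<kappa> X' X'' y0 y x (s n x))" for n x
    have weak: "(LINT x|lborel. g n x * of_real (pk (\<delta> n) (x - y))) + (LINT x|lborel. r n x) = 0" for n
    proof -
      obtain G H where t: "test_fn (\<lambda>x. of_real (X (q x)) * K0 \<kappa> (s n x)) G H"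
        and eq: "\<And>x. (\<Sum>i\<in>UNIV. H i x) + complex_of_real (\<kappa>\<^sup>2) * (of_real (X (q x)) * K0 \<kappa> (s n x))
           = of_real (X (q x)) * KP \<kappa> (s n x) * of_real (pk (\<delta> n) (x - y)) + rep_kernel \<kappa> X' X'' y0 y x (s n x)"
        by (rule cutoff_times_kernel[OF X \<delta>(1)[of n], where \<kappa>=\<kappa> and y=y and ?y0.0=y0])
           (rule that[unfolded q_def s_def])
      have "(LINT x|lborel. indicator K x *\<^sub>R (u x * ((\<Sum>i\<in>UNIV. H i x) + complex_of_real (k\<^sup>2) * (of_real (X (q x)) * K0 \<kappa> (s n x))))) = 0"
        using u[unfolded weak_helm_def] K t XK by (auto simp: q_def)
      moreover have "indicator K x *\<^sub>R (u x * ((\<Sum>i\<in>UNIV. H i x) + complex_of_real (k\<^sup>2) * (of_real (X (q x)) * K0 \<kappa> (s n x))))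
         = g n x * of_real (pk (\<delta> n) (x - y)) + r n x" for x
        unfolding k[symmetric] eq g_def r_def by (simp add: indicator_def algebra_simps)
      moreover have "bcs (\<lambda>x. g n x * of_real (pk (\<delta> n) (x - y)))"
      proof -
        have "continuous_on UNIV (\<lambda>x. pk (\<delta> n) (x - y))"
          by (rule continuous_on_compose2[OF pk_cont[OF \<delta>(1)]]) (auto intro!: continuous_intros)
        then have pkc: "continuous_on K (\<lambda>x. pk (\<delta> n) (x - y))" by (rule continuous_on_subset) simp
        have "bcs (\<lambda>x. indicator K x *\<^sub>R ((u x * (of_real (X (q x)) * KP \<kappa> (s n x))) * of_real (pk (\<delta> n) (x - y))))"
          by (intro bcs_indicator continuous_intros ucK KPc K Xq pkc)
        then show ?thesis by (simp add: g_def)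
      qed
      moreover have "bcs (r n)"
        unfolding r_def rep_kernel_def q_def[symmetric] 
        by (intro bcs_indicator continuous_intros ucK K0c K1c K Xq qc)
      ultimately show ?thesis using bcs_integrable by (simp add: Bochner_Integration.integral_add)
    qed
    have bd: "\<exists>B>0. \<forall>x\<in>K. norm (f x) \<le> B" if "continuous_on K f" for f :: "real^3 \<Rightarrow> complex"
    proof -
      have "bounded (f ` K)" using that K by (intro compact_imp_bounded compact_continuous_image)
      then show ?thesis by (auto simp: bounded_pos)
    qed
    have lim1: "(\<lambda>n. (LINT x|lborel. g n x * of_real (pk (\<delta> n) (x - y))) / of_real (J (\<delta> n))) \<longlonglongrightarrow> - 3 * of_real (X (q y)) * u y"
    proof -
      obtain \<rho> where \<rho>: "K \<subseteq> cball y \<rho>" using bounded_subset_ballD[OF compact_imp_bounded[OF K(1)], of y] ball_subset_cball by blast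
      have "continuous_on K (\<lambda>x. u x * of_real (X (q x)))" by (intro continuous_intros ucK Xq)
      from bd[OF this] obtain B where B: "B > 0" "\<And>x. x \<in> K \<Longrightarrow> norm (u x * of_real (X (q x))) \<le> B"
        by blast
      have "bounded (KP \<kappa> ` cball 0 (\<rho> + 1))"
        by (rule compact_imp_bounded[OF compact_continuous_image[OF continuous_on_subset[OF K_cont(4)]]]) auto
      then obtain P where P: "P > 0" "\<And>z. norm z \<le> \<rho> + 1 \<Longrightarrow> norm (KP \<kappa> z) \<le> P" by (auto simp: bounded_pos)
      have sn: "norm (s n x) \<le> norm (x - y) + \<delta> n" for n x
        unfolding s_def using sd_le[of "\<delta> n" "x - y"] \<delta>(1)[of n] sd_pos[OF \<delta>(1)[of n], of "(x - y) \<bullet> (x - y)"] by simp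
      show ?thesis
      proof (rule approximate_identity[OF \<delta>, where M="B * P" and \<rho>=\<rho>])
        show "g n \<in> borel_measurable borel" for n
        proof -
          have "bcs (g n)" unfolding g_def by (intro bcs_indicator continuous_intros ucK KPc K Xq)
          then show ?thesis by (simp add: bcs_def)
        qed
        show "norm (g n x) \<le> B * P" for n x
        proof (cases "x \<in> K")
          case True
          then have "norm (x - y) \<le> \<rho>" using \<rho> by (auto simp: dist_norm norm_minus_commute)
          then have "norm (s n x) \<le> \<rho> + 1" using sn[of n x] \<delta>(2)[of n] by linarith
          then have "norm (KP \<kappa> (s n x)) \<le> P" by (rule P)
          moreover have "norm (g n x) = norm (u x * of_real (X (q x))) * norm (KP \<kappa> (s n x))"
            using True by (simp add: g_def norm_mult)
          ultimately show ?thesis using B(2)[OF True] B(1) by (simp add: mult_mono)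
        qed (use B P in \<open>simp add: g_def\<close>)
        show "g n x = 0" if "x \<notin> cball y \<rho>" for n x using that \<rho> by (auto simp: g_def indicator_def)
      next
        fix e :: real assume "e > 0"
        \<comment> \<open>Joint continuity in the point and the softened distance, at
          \<open>(y, 0)\<close>, handles the dependence of the integrand on \<open>n\<close>: that
          distance is small once \<open>x\<close> is near \<open>y\<close> and
          \<open>\<delta> n\<close> is small.\<close>
        define W where "W z = u (fst z) * (of_real (X (q (fst z))) * KP \<kappa> (snd z))" for z
        have Wc: "continuous_on (S \<times> UNIV) W" unfolding W_def
          by (intro continuous_intros continuous_on_compose2[OF uc] continuous_on_compose2[OF K_cont(4)]
              continuous_on_compose2[OF Xq(1)[of UNIV]]) auto
        have "open (S \<times> (UNIV::complex set))" by (intro open_Times \<open>open S\<close> open_UNIV)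
        then have "isCont W (y, 0)" using Wc continuous_on_eq_continuous_at y by blast
        then obtain m where m: "m > 0" "\<And>z. dist z (y, 0) < m \<Longrightarrow> dist (W z) (W (y, 0)) < e"
          using \<open>e > 0\<close> unfolding continuous_at_eps_delta by (metis dist_commute)
        obtain b where b: "b > 0" "ball y b \<subseteq> S" using y \<open>open S\<close> by (auto simp: open_contains_ball)
        have "\<forall>\<^sub>F n in sequentially. \<delta> n < m/4" using \<delta>(3) by (rule order_tendstoD) (use m in auto)
        then obtain n0 where n0: "\<And>n. n \<ge> n0 \<Longrightarrow> \<delta> n < m/4" by (auto simp: eventually_sequentially)
        have W0: "W (y, 0) = - 3 * of_real (X (q y)) * u y" by (simp add: W_def KP_def)
        show "\<exists>\<eta>>0. \<exists>n0. \<forall>n\<ge>n0. \<forall>x. dist x y < \<eta> \<longrightarrow> norm (g n x - - 3 * of_real (X (q y)) * u y) \<le> e"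
        proof (intro exI[of _ "min b (m/4)"] conjI exI[of _ n0] allI impI)
          fix n x assume n: "n0 \<le> n" and x: "dist x y < min b (m/4)"
          have "x \<in> S" using x b by (auto simp: dist_commute)
          have gW: "g n x = W (x, s n x)" using XK[of x] by (auto simp: g_def W_def q_def indicator_def)
          have "norm (s n x) < m/4 + m/4" using sn[of n x] n0[OF n] x by (simp add: dist_norm)
          then have "dist (x, s n x) (y, 0) < m"
            using x m(1) sqrt_sum_squares_le_sum_abs[of "dist x y" "norm (s n x)"] by (simp add: dist_prod_def)
          from m(2)[OF this] show "norm (g n x - - 3 * of_real (X (q y)) * u y) \<le> e"
            unfolding gW W0[symmetric] by (simp add: dist_norm)
        qed (use b m in auto)
      qed
    qed
    have lim2: "(\<lambda>n. LINT x|lborel. r n x) \<longlonglongrightarrow> (LINT x|lborel. indicator K x *\<^sub>R (u x * rep_kernel \<kappa> X' X'' y0 y x (of_real (norm (x - y)))))"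
    proof -
      define a where "a x = complex_of_real (8 * X' (q x) * ((x - y0) \<bullet> (x - y)))" for x
      define b where "b x = complex_of_real (6 * X' (q x) + 4 * q x * X'' (q x))" for x
      have rk: "rep_kernel \<kappa> X' X'' y0 y x z = a x * K1 \<kappa> z + b x * K0 \<kappa> z" for x z
        by (simp add: rep_kernel_def a_def b_def q_def)
      \<comment> \<open>The coefficients vanish within distance \<open>\<eta>\<close> of
        \<open>y\<close>, so the kernels are evaluated away from their singularity and are bounded
        uniformly in \<open>n\<close>.\<close>
      have ab0: "a x = 0 \<and> b x = 0" if "norm (x - y) < \<eta>" for x
        using X0[of x] that by (auto simp: a_def b_def q_def dist_norm norm_minus_commute)
      have ca: "continuous_on K a" "continuous_on K b" unfolding a_def b_def by (intro continuous_intros Xq qc)+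
      obtain A B where A: "A > 0" "\<And>x. x \<in> K \<Longrightarrow> norm (u x * a x) \<le> A" and B: "B > 0" "\<And>x. x \<in> K \<Longrightarrow> norm (u x * b x) \<le> B"
        using bd[OF continuous_on_mult[OF ucK ca(1)]] bd[OF continuous_on_mult[OF ucK ca(2)]] by blast
      define k1 where "k1 = \<bar>\<kappa>\<bar> / (2 * \<eta>\<^sup>2) + 1 / (2 * \<eta>^3)"
      have k1: "k1 > 0" unfolding k1_def using \<eta> by (simp add: add_nonneg_pos)
      show ?thesis
      proof (rule compact_dominated_convergence[where K=K and M="A * k1 + B * (1/\<eta>)"])
        show "r n \<in> borel_measurable borel" for n
        proof -
          have "bcs (r n)" unfolding r_def rk by (intro bcs_indicator continuous_intros ucK K0c K1c K ca)
          then show ?thesis by (simp add: bcs_def)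
        qed
        have pos: "0 \<le> A * k1 + B * (1/\<eta>)" using A B k1 \<eta> by simp
        show "norm (r n x) \<le> A * k1 + B * (1/\<eta>)" for n x
        proof (cases "x \<in> K \<and> \<eta> \<le> norm (x - y)")
          case True
          then have "\<eta> \<le> sd (\<delta> n) ((x - y) \<bullet> (x - y))" using sd_ge[of "x - y" "\<delta> n"] by linarith
          from K_bounds[OF \<eta> this, of \<kappa>]
          have kb: "norm (K0 \<kappa> (s n x)) \<le> 1 / \<eta>" "norm (K1 \<kappa> (s n x)) \<le> k1" by (auto simp: s_def k1_def)
          have "r n x = (u x * a x) * K1 \<kappa> (s n x) + (u x * b x) * K0 \<kappa> (s n x)"
            using True by (simp add: r_def rk algebra_simps)
          then have "norm (r n x) \<le> norm (u x * a x) * norm (K1 \<kappa> (s n x)) + norm (u x * b x) * norm (K0 \<kappa> (s n x))"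
            by (metis norm_mult norm_triangle_ineq)
          also have "\<dots> \<le> A * k1 + B * (1/\<eta>)"
            using kb A B True k1 \<eta> by (intro add_mono mult_mono) (auto simp del: norm_mult)
          finally show ?thesis .
        next
          case False
          then have "r n x = 0" using ab0[of x] by (auto simp: r_def rk indicator_def)
          then show ?thesis using pos by simp
        qed
        show "(\<lambda>n. r n x) \<longlonglongrightarrow> indicator K x *\<^sub>R (u x * rep_kernel \<kappa> X' X'' y0 y x (of_real (norm (x - y))))" for x
        proof (cases "norm (x - y) < \<eta>")
          case True then show ?thesis using ab0[of x] by (simp add: r_def rk)
        next
          case False
          then have z: "complex_of_real (norm (x - y)) \<noteq> 0" using \<eta> by auto
          have "isCont (K0 \<kappa>) (of_real (norm (x - y)))" "isCont (K1 \<kappa>) (of_real (norm (x - y)))"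
            using K0_deriv[OF z] K1_deriv[OF z] DERIV_isCont by blast+
          from isCont_tendsto_compose[OF this(1) sd_tendsto[OF \<delta>(3)]] isCont_tendsto_compose[OF this(2) sd_tendsto[OF \<delta>(3)]]
          show ?thesis unfolding r_def rk s_def by (intro tendsto_intros) auto
        qed
      qed (use K in \<open>auto simp: r_def\<close>)
    qed
    have eqn: "(\<lambda>n. (LINT x|lborel. g n x * of_real (pk (\<delta> n) (x - y))) / of_real (J (\<delta> n)))
       = (\<lambda>n. - (of_real (1 / J (\<delta> n)) * (LINT x|lborel. r n x)))"
      using weak by (auto simp: fun_eq_iff add_eq_0_iff2 field_simps)
    have "(\<lambda>n. - (of_real (1 / J (\<delta> n)) * (LINT x|lborel. r n x))) \<longlonglongrightarrow>
       - (of_real c * (LINT x|lborel. indicator K x *\<^sub>R (u x * rep_kernel \<kappa> X' X'' y0 y x (of_real (norm (x - y))))))"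
      by (intro tendsto_intros c lim2)
    from LIMSEQ_unique[OF lim1[unfolded eqn] this]
    show "of_real (X ((y - y0) \<bullet> (y - y0))) * u y =
      of_real c / 3 * (LINT x|lborel. indicator K x *\<^sub>R (u x * rep_kernel \<kappa> X' X'' y0 y x (of_real (norm (x - y)))))"
      by (simp add: q_def field_simps)
  qed
  then show ?thesis ..
qed

section \<open>Analyticity on lines\<close>

text \<open>Differentiation under the integral sign: Cauchy's inequality bounds the difference
  quotients in the parameter uniformly in \<open>x\<close>, which gives the dominating
  constant.\<close>

lemma holomorphic_integral:
  fixes N :: "real^3 \<Rightarrow> complex \<Rightarrow> complex"
  assumes A: "compact A" and cont: "continuous_on (A \<times> cball z0 r) (\<lambda>p. N (fst p) (snd p))"
    and hol: "\<And>x. x \<in> A \<Longrightarrow> N x holomorphic_on ball z0 r"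
  shows "(\<lambda>z. LINT x|lborel. indicator A x *\<^sub>R N x z) holomorphic_on ball z0 r"
proof -
  have "bounded ((\<lambda>p. N (fst p) (snd p)) ` (A \<times> cball z0 r))"
    by (rule compact_imp_bounded[OF compact_continuous_image[OF cont]]) (intro compact_Times A compact_cball)
  then obtain M where "M > 0" and M0: "\<forall>p\<in>A \<times> cball z0 r. norm (N (fst p) (snd p)) \<le> M"
    unfolding bounded_pos by auto
  have M: "norm (N x z) \<le> M" if "x \<in> A" "z \<in> cball z0 r" for x z
    using M0[rule_format, of "(x, z)"] that by simp
  have bcsN: "bcs (\<lambda>x. indicator A x *\<^sub>R N x z)" if "z \<in> cball z0 r" for z
  proof (rule bcs_indicator[OF _ A])
    have "continuous_on A (\<lambda>x. (x, z))" by (intro continuous_intros)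
    moreover have "(\<lambda>x. (x, z)) ` A \<subseteq> A \<times> cball z0 r" using that by auto
    ultimately show "continuous_on A (\<lambda>x. N x z)" using continuous_on_compose2[OF cont] by fastforce
  qed
  define F where "F z = (LINT x|lborel. indicator A x *\<^sub>R N x z)" for z
  have "(F has_field_derivative (LINT x|lborel. indicator A x *\<^sub>R deriv (N x) z)) (at z)" if z: "z \<in> ball z0 r" for z
  proof -
    define \<rho> where "\<rho> = (r - dist z0 z) / 4"
    have \<rho>: "\<rho> > 0" using z by (simp add: \<rho>_def)
    have sub: "cball w \<rho> \<subseteq> ball z0 r" if "w \<in> ball z \<rho>" for w
    proof
      fix v assume "v \<in> cball w \<rho>"
      have "dist z0 v \<le> dist z0 z + dist z w + dist w v"
        using dist_triangle[of z0 v z] dist_triangle[of z v w] by linarith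
      then show "v \<in> ball z0 r" using that \<open>v \<in> cball w \<rho>\<close> z by (simp add: \<rho>_def)
    qed
    have zz: "z \<in> ball z \<rho>" using \<rho> by simp
    have lip: "norm (N x w - N x z) \<le> M / \<rho> * norm (w - z)" if "x \<in> A" "w \<in> ball z \<rho>" for x w
    proof (rule field_differentiable_bound[where S="ball z \<rho>" and f'="deriv (N x)"])
      fix v assume v: "v \<in> ball z \<rho>"
      have cb: "cball v \<rho> \<subseteq> ball z0 r" by (rule sub[OF v])
      have vb: "v \<in> ball z0 r" by (rule subsetD[OF cb]) (use \<rho> in simp)
      show "(N x has_field_derivative deriv (N x) v) (at v within ball z \<rho>)"
        by (rule has_field_derivative_at_within[OF holomorphic_derivI[OF hol[OF \<open>x \<in> A\<close>] open_ball vb]])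
      have h2: "N x holomorphic_on cball v \<rho>" by (rule holomorphic_on_subset[OF hol[OF \<open>x \<in> A\<close>] cb])
      have "norm ((deriv ^^ 1) (N x) v) \<le> fact 1 * M / \<rho> ^ 1"
      proof (rule Cauchy_inequality)
        show "N x holomorphic_on ball v \<rho>" by (rule holomorphic_on_subset[OF h2 ball_subset_cball])
        show "continuous_on (cball v \<rho>) (N x)" by (rule holomorphic_on_imp_continuous_on[OF h2])
        show "norm (N x w) \<le> M" if "norm (v - w) = \<rho>" for w
        proof -
          have "w \<in> ball z0 r" by (rule subsetD[OF cb]) (use that in \<open>simp add: dist_norm\<close>)
          then show ?thesis by (intro M \<open>x \<in> A\<close>) simp
        qed
      qed (use \<rho> in auto)
      then show "norm (deriv (N x) v) \<le> M / \<rho>" by simp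
    qed (use that zz in auto)
    show ?thesis
      unfolding has_field_derivative_iff tendsto_at_iff_sequentially
    proof (intro allI impI)
      fix X :: "nat \<Rightarrow> complex" assume X: "\<forall>i. X i \<in> UNIV - {z}" "X \<longlonglongrightarrow> z"
      from X(2)[unfolded lim_sequentially, rule_format, OF \<rho>]
      obtain n0 where n0: "\<And>n. n \<ge> n0 \<Longrightarrow> X n \<in> ball z \<rho>" by (auto simp: dist_commute)
      define Y where "Y n = X (n + n0)" for n
      have Y: "Y n \<in> ball z \<rho>" "Y n \<noteq> z" for n using n0 X by (auto simp: Y_def)
      have Yl: "Y \<longlonglongrightarrow> z" unfolding Y_def using X(2) by (rule LIMSEQ_ignore_initial_segment)
      have Yc: "Y n \<in> cball z0 r" "z \<in> cball z0 r" for n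
        using subsetD[OF sub[OF Y(1)[of n]], of "Y n"] \<rho> z by auto
      have quo: "(F (Y n) - F z) / (Y n - z) = (LINT x|lborel. indicator A x *\<^sub>R ((N x (Y n) - N x z) / (Y n - z)))" for n
      proof -
        have "(LINT x|lborel. indicator A x *\<^sub>R ((N x (Y n) - N x z) / (Y n - z)))
          = (LINT x|lborel. (indicator A x *\<^sub>R N x (Y n) - indicator A x *\<^sub>R N x z) / (Y n - z))"
          by (rule Bochner_Integration.integral_cong) (auto simp: indicator_def)
        then show ?thesis unfolding F_def
          using bcs_integrable[OF bcsN[OF Yc(1)]] bcs_integrable[OF bcsN[OF Yc(2)]]
          by (simp add: Bochner_Integration.integral_diff)
      qed
      have "(\<lambda>n. LINT x|lborel. indicator A x *\<^sub>R ((N x (Y n) - N x z) / (Y n - z))) \<longlonglongrightarrow>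
         (LINT x|lborel. indicator A x *\<^sub>R deriv (N x) z)"
      proof (rule compact_dominated_convergence[where K=A and M="M / \<rho>"])
        show "(\<lambda>x. indicator A x *\<^sub>R ((N x (Y n) - N x z) / (Y n - z))) \<in> borel_measurable borel" for n
        proof -
          have [measurable]: "(\<lambda>x. indicator A x *\<^sub>R N x (Y n)) \<in> borel_measurable borel"
            "(\<lambda>x. indicator A x *\<^sub>R N x z) \<in> borel_measurable borel"
            using bcsN[OF Yc(1)] bcsN[OF Yc(2)] by (auto simp: bcs_def)
          have "(\<lambda>x. indicator A x *\<^sub>R ((N x (Y n) - N x z) / (Y n - z)))
             = (\<lambda>x. (indicator A x *\<^sub>R N x (Y n) - indicator A x *\<^sub>R N x z) / (Y n - z))"
            by (auto simp: indicator_def fun_eq_iff)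
          then show ?thesis by simp
        qed
        show "norm (indicator A x *\<^sub>R ((N x (Y n) - N x z) / (Y n - z))) \<le> M / \<rho>" for n x
          using lip[of x "Y n"] Y[of n] \<open>M > 0\<close> \<rho> by (auto simp: indicator_def norm_divide pos_divide_le_eq)
        show "(\<lambda>n. indicator A x *\<^sub>R ((N x (Y n) - N x z) / (Y n - z))) \<longlonglongrightarrow> indicator A x *\<^sub>R deriv (N x) z" for x
        proof (cases "x \<in> A")
          case True
          have "(N x has_field_derivative deriv (N x) z) (at z)"
            by (rule holomorphic_derivI[OF hol[OF True] open_ball z])
          then have "(\<lambda>n. (N x (Y n) - N x z) / (Y n - z)) \<longlonglongrightarrow> deriv (N x) z"
            unfolding has_field_derivative_iff tendsto_at_iff_sequentially using Y Yl by (auto simp: o_def)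
          then show ?thesis using True by simp
        qed simp
      qed (use A in auto)
      then have "(\<lambda>n. (F (Y n) - F z) / (Y n - z)) \<longlonglongrightarrow> (LINT x|lborel. indicator A x *\<^sub>R deriv (N x) z)"
        unfolding quo .
      then show "((\<lambda>y. (F y - F z) / (y - z)) \<circ> X) \<longlonglongrightarrow> (LINT x|lborel. indicator A x *\<^sub>R deriv (N x) z)"
        unfolding Y_def by (simp add: o_def LIMSEQ_offset[of _ n0])
    qed
  qed
  then show ?thesis unfolding F_def[symmetric]
    by (intro holomorphic_onI) (auto simp: field_differentiable_def intro: has_field_derivative_at_within)
qed

text \<open>In the representation formula the point y0 + t e enters through its squared distance q -
  2 t p + t^2 from \<open>x\<close> and through the inner product q - t p, both polynomial in t. For
  \<open>x\<close> in the zone where the cutoff varies and complex t with |t| <=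
  \<open>\<rho> / 8\<close>, the squared distance keeps positive real part, so its principal square
  root is holomorphic in t.\<close>

lemma helm_line_holomorphic:
  assumes "open S" "weak_helm k S u" "cball y0 \<rho> \<subseteq> S" "\<rho> > 0" "norm e = 1"
  obtains h where "h holomorphic_on ball 0 (\<rho>/8)" "\<And>t. \<bar>t\<bar> < \<rho>/8 \<Longrightarrow> h (of_real t) = u (y0 + t *\<^sub>R e)"
proof -
  have "\<rho>\<^sup>2/4 < \<rho>\<^sup>2" using assms by simp
  then obtain X X' X'' C where "plateau C (\<rho>\<^sup>2/4) (\<rho>\<^sup>2) X X' X''"
    using plateau_exists by metis
  then have X: "cutoff X X' X''" and X1: "\<forall>q\<le>\<rho>\<^sup>2/4. X q = 1" and X0: "\<forall>q\<ge>\<rho>\<^sup>2. X q = 0"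
    and Xz: "\<forall>q. q \<le> \<rho>\<^sup>2/4 \<or> q \<ge> \<rho>\<^sup>2 \<longrightarrow> X' q = 0 \<and> X'' q = 0"
    by (simp_all add: plateau_def)
  obtain c where c: "rep_const c" using representation_formula ..
  \<comment> \<open>Outside this shell the derivatives of the cutoff vanish, so the integral over
    the ball reduces to it.\<close>
  define A where "A = cball y0 \<rho> - ball y0 (\<rho>/2)"
  have A: "compact A" unfolding A_def by (intro compact_diff) auto
  have AS: "A \<subseteq> S" using assms by (auto simp: A_def)
  define q where "q x = (x - y0) \<bullet> (x - y0)" for x
  define p where "p x = (x - y0) \<bullet> e" for x
  define Q where "Q x z = of_real (q x) - 2 * z * of_real (p x) + z\<^sup>2" for x and z :: complex
  define N where "N x z = u x * (of_real (8 * X' (q x)) * (of_real (q x) - z * of_real (p x)) * K1 k (csqrt (Q x z))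
     + of_real (6 * X' (q x) + 4 * q x * X'' (q x)) * K0 k (csqrt (Q x z)))" for x z
  have qn: "q x = (norm (x - y0))\<^sup>2" for x by (simp add: q_def power2_norm_eq_inner)
  have pn: "\<bar>p x\<bar> \<le> norm (x - y0)" for x
    using Cauchy_Schwarz_ineq2[of "x - y0" e] assms(5) by (simp add: p_def)
  have ReQ: "Re (Q x z) > 0" if "x \<in> A" "norm z \<le> \<rho>/8" for x z
  proof -
    define m where "m = norm (x - y0)"
    have m: "m \<ge> \<rho>/2" "m > 0" using that(1) assms(4) by (auto simp: A_def m_def dist_norm norm_minus_commute)
    have z: "norm z \<le> m/4" using that(2) m by simp
    have "\<bar>Re (2 * z * of_real (p x))\<bar> \<le> norm (2 * z * of_real (p x))" by (rule abs_Re_le_cmod)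
    also have "\<dots> \<le> 2 * (m/4) * m" unfolding norm_mult using z pn[of x] by (intro mult_mono) (auto simp: m_def)
    finally have 1: "\<bar>Re (2 * z * of_real (p x))\<bar> \<le> m\<^sup>2/2" by (simp add: power2_eq_square)
    have "\<bar>Re (z\<^sup>2)\<bar> \<le> (norm z)\<^sup>2" using abs_Re_le_cmod[of "z\<^sup>2"] by (simp add: norm_power)
    also have "\<dots> \<le> (m/4)\<^sup>2" using z by (intro power_mono) auto
    finally have 2: "\<bar>Re (z\<^sup>2)\<bar> \<le> m\<^sup>2/16" by (simp add: power2_eq_square)
    have "m\<^sup>2 > 0" using m by simp
    moreover have "Re (Q x z) = m\<^sup>2 - Re (2 * z * of_real (p x)) + Re (z\<^sup>2)"
      by (simp add: Q_def qn m_def)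
    ultimately show ?thesis using 1 2 by linarith
  qed
  have Qnp: "Q x z \<notin> \<real>\<^sub>\<le>\<^sub>0" "csqrt (Q x z) \<noteq> 0" if "x \<in> A" "norm z \<le> \<rho>/8" for x z
    using ReQ[OF that] by (auto simp: complex_nonpos_Reals_iff)
  have hol: "N x holomorphic_on ball 0 (\<rho>/8)" if "x \<in> A" for x
  proof -
    have 1: "(\<lambda>z. csqrt (Q x z)) holomorphic_on ball 0 (\<rho>/8)"
      unfolding Q_def using Qnp(1)[OF that, unfolded Q_def] by (intro holomorphic_intros) auto
    have "csqrt (Q x z) \<noteq> 0" if "z \<in> ball 0 (\<rho>/8)" for z using Qnp(2)[OF \<open>x \<in> A\<close>, of z] that by auto
    then show ?thesis unfolding N_def K0_def K1_def by (intro holomorphic_intros 1) auto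
  qed
  have cont: "continuous_on (A \<times> cball 0 (\<rho>/8)) (\<lambda>p. N (fst p) (snd p))"
  proof -
    let ?D = "A \<times> cball (0::complex) (\<rho>/8)"
    have uA: "continuous_on ?D (\<lambda>p. u (fst p))"
      by (rule continuous_on_compose2[of S u]) (use assms(2) AS in \<open>auto simp: weak_helm_def intro!: continuous_intros\<close>)
    have qc: "continuous_on ?D (\<lambda>p. q (fst p))" unfolding q_def by (intro continuous_intros)
    have pc: "continuous_on ?D (\<lambda>r. p (fst r))" unfolding p_def by (intro continuous_intros)
    have X1c: "continuous_on ?D (\<lambda>p. X' (q (fst p)))" by (rule continuous_on_compose2[OF cutoff_cont(2)[OF X] qc]) simp
    have X2c: "continuous_on ?D (\<lambda>p. X'' (q (fst p)))" by (rule continuous_on_compose2[OF cutoff_cont(3)[OF X] qc]) simp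
    have Qc: "continuous_on ?D (\<lambda>p. Q (fst p) (snd p))" unfolding Q_def by (intro continuous_intros qc pc)
    have sc: "continuous_on ?D (\<lambda>p. csqrt (Q (fst p) (snd p)))"
      using Qnp(1) by (intro continuous_on_compose2[OF continuous_on_csqrt Qc]) auto
    have s0: "csqrt (Q (fst p) (snd p)) \<in> -{0}" if "p \<in> ?D" for p using Qnp(2)[of "fst p" "snd p"] that by auto
    have "continuous_on ?D (\<lambda>p. K0 k (csqrt (Q (fst p) (snd p))))" "continuous_on ?D (\<lambda>p. K1 k (csqrt (Q (fst p) (snd p))))"
      using s0 by (auto intro!: continuous_on_compose2[OF K_cont(1) sc] continuous_on_compose2[OF K_cont(2) sc])
    then show ?thesis unfolding N_def by (intro continuous_intros uA qc pc X1c X2c)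
  qed
  define h where "h z = c * (LINT x|lborel. indicator A x *\<^sub>R N x z)" for z
  show ?thesis
  proof (rule that)
    show "h holomorphic_on ball 0 (\<rho>/8)" unfolding h_def
      by (intro holomorphic_intros holomorphic_integral A cont hol)
    fix t :: real assume t: "\<bar>t\<bar> < \<rho>/8"
    define y where "y = y0 + t *\<^sub>R e"
    have yd: "norm (y - y0) < \<rho>/8" using t assms(5) by (simp add: y_def)
    have small: "(x - y0) \<bullet> (x - y0) \<le> \<rho>\<^sup>2/4" if "norm (x - y0) \<le> \<rho>/2" for x
    proof -
      have "(norm (x - y0))\<^sup>2 \<le> (\<rho>/2)\<^sup>2" by (rule power_mono[OF that]) simp
      then show ?thesis unfolding power2_norm_eq_inner by (simp add: power_divide)
    qed
    have large: "(x - y0) \<bullet> (x - y0) \<ge> \<rho>\<^sup>2" if "x \<notin> cball y0 \<rho>" for x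
    proof -
      have "\<rho>\<^sup>2 \<le> (norm (x - y0))\<^sup>2" using that assms(4) by (intro power_mono) (auto simp: dist_norm norm_minus_commute)
      then show ?thesis by (simp add: power2_norm_eq_inner)
    qed
    have "of_real (X ((y - y0) \<bullet> (y - y0))) * u y =
      c * (LINT x|lborel. indicator (cball y0 \<rho>) x *\<^sub>R (u x * rep_kernel k X' X'' y0 y x (of_real (norm (x - y)))))"
    proof (rule c[unfolded rep_const_def, rule_format, OF refl assms(1,2) X compact_cball assms(3), where \<eta>="\<rho>/4"])
      show "X ((x - y0) \<bullet> (x - y0)) = 0" if "x \<notin> cball y0 \<rho>" for x using X0 large[OF that] by simp
      show "y \<in> S" using yd assms(3,4) by (intro subsetD[OF assms(3)]) (auto simp: dist_norm norm_minus_commute)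
      fix x assume "x \<in> ball y (\<rho>/4)"
      then have "norm (x - y) < \<rho>/4" by (simp add: dist_norm norm_minus_commute)
      then have "norm (x - y0) \<le> \<rho>/2" using yd norm_triangle_ineq[of "x - y" "y - y0"] assms(4) by simp
      then show "X' ((x - y0) \<bullet> (x - y0)) = 0 \<and> X'' ((x - y0) \<bullet> (x - y0)) = 0" using Xz small by blast
    qed (use assms in auto)
    moreover have "X ((y - y0) \<bullet> (y - y0)) = 1" using X1 small[of y] yd assms(4) by auto
    moreover have "indicator (cball y0 \<rho>) x *\<^sub>R (u x * rep_kernel k X' X'' y0 y x (of_real (norm (x - y)))) = indicator A x *\<^sub>R N x (of_real t)" for x
    proof (cases "x \<in> A")
      case True
      have xy: "x - y = (x - y0) - t *\<^sub>R e" by (simp add: y_def)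
      have ee: "e \<bullet> e = 1" using assms(5) by (simp add: norm_eq_1)
      have i1: "(x - y0) \<bullet> (x - y) = q x - t * p x"
        unfolding xy by (simp add: inner_diff_right q_def p_def)
      have i2: "(x - y) \<bullet> (x - y) = q x - 2 * t * p x + t\<^sup>2"
        unfolding xy using ee by (simp add: inner_diff_right inner_diff_left q_def p_def inner_commute power2_eq_square algebra_simps)
      have "Q x (of_real t) = of_real ((x - y) \<bullet> (x - y))" unfolding i2 by (simp add: Q_def)
      then have "csqrt (Q x (of_real t)) = of_real (norm (x - y))"
        by (simp add: csqrt_of_real_nonneg norm_eq_sqrt_inner)
      then show ?thesis using True unfolding N_def rep_kernel_def i1 q_def[symmetric]
        by (auto simp: A_def algebra_simps)
    next
      case False
      show ?thesis
      proof (cases "x \<in> cball y0 \<rho>")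
        case True
        then have "norm (x - y0) \<le> \<rho>/2" using False by (simp add: A_def dist_norm norm_minus_commute)
        then show ?thesis using False Xz small[of x] by (simp add: rep_kernel_def)
      qed (use False in simp)
    qed
    ultimately show "h (of_real t) = u (y0 + t *\<^sub>R e)" by (simp add: h_def y_def)
  qed
qed

text \<open>By the identity theorem, vanishing near one parameter value spreads to all values within
  a uniform radius of any given one; connectedness of the parameter set carries it along the
  line.\<close>

lemma helm_line_unique_continuation:
  assumes "open S" "weak_helm k S u" "norm e = 1" "connected I" "\<And>t. t \<in> I \<Longrightarrow> x + t *\<^sub>R e \<in> S"
    and "t0 \<in> I" "\<epsilon> > 0" "\<And>t. \<bar>t - t0\<bar> < \<epsilon> \<Longrightarrow> u (x + t *\<^sub>R e) = 0" and "t1 \<in> I"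
  shows "u (x + t1 *\<^sub>R e) = 0"
proof -
  define P where "P t \<longleftrightarrow> (\<exists>\<epsilon>>0. \<forall>s. \<bar>s - t\<bar> < \<epsilon> \<longrightarrow> u (x + s *\<^sub>R e) = 0)" for t
  have "P t1"
  proof (rule connected_induction_simple[OF \<open>connected I\<close> \<open>t0 \<in> I\<close> \<open>t1 \<in> I\<close>])
    show "P t0" using assms(7,8) unfolding P_def by blast
    fix t assume "t \<in> I"
    then obtain \<rho>' where "\<rho>' > 0" "ball (x + t *\<^sub>R e) \<rho>' \<subseteq> S" using assms(1,5) by (meson open_contains_ball)
    then have \<rho>: "\<rho>'/2 > 0" "cball (x + t *\<^sub>R e) (\<rho>'/2) \<subseteq> S" by (auto simp: subset_iff)
    from helm_line_holomorphic[OF assms(1,2) \<rho>(2,1) assms(3)] obtain h where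
      h: "h holomorphic_on ball 0 (\<rho>'/2/8)" "\<And>s. \<bar>s\<bar> < \<rho>'/2/8 \<Longrightarrow> h (of_real s) = u ((x + t *\<^sub>R e) + s *\<^sub>R e)" by metis
    define r where "r = \<rho>'/2/8"
    have r: "r > 0" using \<rho> by (simp add: r_def)
    have hs: "h (of_real (s - t)) = u (x + s *\<^sub>R e)" if "\<bar>s - t\<bar> < r" for s
      using h(2)[of "s - t"] that by (simp add: r_def algebra_simps)
    have "P b" if a: "\<bar>a - t\<bar> < r" "P a" and b: "\<bar>b - t\<bar> < r" for a b
    proof -
      obtain \<epsilon> where \<epsilon>: "\<epsilon> > 0" "\<And>s. \<bar>s - a\<bar> < \<epsilon> \<Longrightarrow> u (x + s *\<^sub>R e) = 0" using a(2) by (auto simp: P_def)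
      define U where "U = complex_of_real ` {s - t | s. \<bar>s - a\<bar> < \<epsilon> \<and> \<bar>s - t\<bar> < r}"
      have "h w = 0" if "w \<in> ball 0 r" for w
      proof (rule analytic_continuation[of h "ball 0 r" U "of_real (a - t)"])
        show "U \<subseteq> ball 0 r" by (auto simp: U_def simp del: of_real_diff)
        show "complex_of_real (a - t) islimpt U"
          unfolding islimpt_approachable
        proof (intro allI impI)
          fix \<mu> :: real assume "\<mu> > 0"
          define m where "m = min (min \<mu> \<epsilon>) (r - \<bar>a - t\<bar>) / 2"
          have m: "m > 0" "m < \<mu>" "m < \<epsilon>" "m < r - \<bar>a - t\<bar>" using \<open>\<mu> > 0\<close> \<epsilon> a(1) by (auto simp: m_def min_def)
          have "complex_of_real ((a + m) - t) \<in> U" unfolding U_def using m by (intro imageI CollectI exI[of _ "a + m"]) auto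
          moreover have "complex_of_real ((a + m) - t) \<noteq> of_real (a - t)" using m by (simp del: of_real_diff of_real_add)
          moreover have "dist (complex_of_real ((a + m) - t)) (of_real (a - t)) < \<mu>"
            using m by (simp add: dist_norm)
          ultimately show "\<exists>x'\<in>U. x' \<noteq> complex_of_real (a - t) \<and> dist x' (complex_of_real (a - t)) < \<mu>" by blast
        qed
        show "h z = 0" if "z \<in> U" for z using that hs \<epsilon>(2) by (auto simp: U_def simp del: of_real_diff)
      qed (use h(1) that a in \<open>auto simp: r_def simp del: of_real_diff\<close>)
      then have "u (x + s *\<^sub>R e) = 0" if "\<bar>s - t\<bar> < r" for s
        using hs[OF that] that by (simp del: of_real_diff)
      then show "P b" unfolding P_def using b by (intro exI[of _ "r - \<bar>b - t\<bar>"]) auto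
    qed
    then show "\<exists>T. openin (top_of_set I) T \<and> t \<in> T \<and> (\<forall>a\<in>T. \<forall>b\<in>T. P a \<longrightarrow> P b)"
      using r \<open>t \<in> I\<close> by (intro exI[of _ "I \<inter> ball t r"]) (auto simp: openin_open dist_real_def abs_minus_commute)
  qed
  then show ?thesis unfolding P_def by (metis abs_zero cancel_comm_monoid_add_class.diff_cancel)
qed

section \<open>Decaying exterior solutions vanish\<close>

text \<open>An essential singularity cannot be compensated: below the real axis the exponential is
  smaller than every power of z.\<close>

lemma essential_singularity_quotient:
  assumes "r > 0" "k > (0::real)" and f: "f holomorphic_on ball 0 r" and g: "g holomorphic_on ball 0 r"
    and fg: "\<And>x. 0 < x \<Longrightarrow> x < r \<Longrightarrow> g (of_real x) = exp (2 * \<i> * of_real k / of_real x) * f (of_real x)"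
    and x: "0 < x" "x < r"
  shows "f (of_real x) = 0"
proof -
  define U where "U = ball (0::complex) r \<inter> {z. Re z > 0}"
  have U: "open U" "connected U" unfolding U_def
    by (auto intro!: open_Int open_halfspace_Re_gt convex_connected convex_Int convex_halfspace_Re_gt)
  \<comment> \<open>The relation on the real interval extends to the right half of the disc by the
    identity theorem.\<close>
  have ext: "g z = exp (2 * \<i> * of_real k / z) * f z" if "z \<in> U" for z
  proof -
    have "g z - exp (2 * \<i> * of_real k / z) * f z = 0"
    proof (rule analytic_continuation[of "\<lambda>z. g z - exp (2 * \<i> * of_real k / z) * f z" U "of_real ` {0<..<r}" "of_real (r/2)"])
      show "(\<lambda>z. g z - exp (2 * \<i> * of_real k / z) * f z) holomorphic_on U"
        using f g by (intro holomorphic_intros) (auto simp: U_def elim: holomorphic_on_subset)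
      show "of_real ` {0<..<r} \<subseteq> U" by (auto simp: U_def)
      show "complex_of_real (r/2) islimpt of_real ` {0<..<r}"
        unfolding islimpt_approachable
      proof (intro allI impI)
        fix e :: real assume "e > 0"
        define m where "m = min e (r/2) / 2"
        have m: "m > 0" "m < e" "m < r/2" using \<open>e > 0\<close> \<open>r > 0\<close> by (auto simp: m_def min_def)
        have "complex_of_real (r/2 + m) \<in> of_real ` {0<..<r}" using m by (intro imageI) auto
        moreover have "complex_of_real (r/2 + m) \<noteq> of_real (r/2)" using m by (simp only: of_real_eq_iff)
        moreover have "dist (complex_of_real (r/2 + m)) (of_real (r/2)) < e" using m by (simp add: dist_norm)
        ultimately show "\<exists>x'\<in>complex_of_real ` {0<..<r}. x' \<noteq> complex_of_real (r/2) \<and> dist x' (complex_of_real (r/2)) < e"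
          by blast
      qed
      show "g w - exp (2 * \<i> * of_real k / w) * f w = 0" if "w \<in> of_real ` {0<..<r}" for w
        using that fg by auto
    qed (use U that assms(1) in \<open>auto simp: U_def simp del: of_real_divide\<close>)
    then show ?thesis by simp
  qed
  have "g w = 0" if "w \<in> ball 0 r" for w
  proof (rule ccontr)
    assume "g w \<noteq> 0"
    \<comment> \<open>If \<open>g\<close> is not identically zero, it has a zero of finite order
      \<open>n\<close> at 0, so its modulus is at least a constant times |z|^n near 0.\<close>
    define n where "n = nat (zorder g 0)"
    define p where "p = zor_poly g 0"
    have ex: "\<exists>w\<in>ball 0 r. g w \<noteq> 0" using that \<open>g w \<noteq> 0\<close> by blast
    have "0 \<in> ball (0::complex) r" using \<open>r > 0\<close> by simp
    have "\<exists>\<rho>>0. cball (0::complex) \<rho> \<subseteq> ball 0 r \<and> p holomorphic_on cball 0 \<rho> \<and>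
      (\<forall>w\<in>cball 0 \<rho>. g w = p w * (w - 0) ^ n \<and> p w \<noteq> 0)"
      unfolding n_def p_def
      by (rule conjunct2[OF zorder_exist_zero[OF g open_ball convex_connected[OF convex_ball] \<open>0 \<in> ball 0 r\<close> ex]])
    then obtain \<rho> where *: "0 < \<rho> \<and> cball (0::complex) \<rho> \<subseteq> ball 0 r \<and> p holomorphic_on cball 0 \<rho> \<and>
      (\<forall>w\<in>cball 0 \<rho>. g w = p w * (w - 0) ^ n \<and> p w \<noteq> 0)" ..
    then have \<rho>: "\<rho> > 0" "cball (0::complex) \<rho> \<subseteq> ball 0 r" "p holomorphic_on cball 0 \<rho>" by blast+
    have g_eq: "g z = p z * z ^ n \<and> p z \<noteq> 0" if "z \<in> cball 0 \<rho>" for z using * that by simp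
    have "continuous_on (cball 0 \<rho>) (\<lambda>z. norm (p z))"
      by (intro continuous_intros holomorphic_on_imp_continuous_on \<rho>)
    then obtain z1 where z1: "z1 \<in> cball 0 \<rho>" "\<And>z. z \<in> cball 0 \<rho> \<Longrightarrow> norm (p z1) \<le> norm (p z)"
      using continuous_attains_inf[of "cball 0 \<rho>" "\<lambda>z. norm (p z)"] \<rho>(1) by auto
    define c where "c = norm (p z1)"
    have "c > 0" using g_eq[OF z1(1)] by (simp add: c_def)
    have "bounded (f ` cball 0 \<rho>)" using f \<rho>(2)
      by (intro compact_imp_bounded compact_continuous_image holomorphic_on_imp_continuous_on) (auto elim: holomorphic_on_subset)
    then obtain M where M: "\<And>z. z \<in> cball 0 \<rho> \<Longrightarrow> norm (f z) \<le> M" unfolding bounded_iff by blast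
    have key: "c * k ^ n \<le> M * (y ^ n / exp y)" if y: "y > 0" "2 * k / \<rho> \<le> y" for y
    proof -
      define s where "s = k / y"
      have s: "s > 0" "2 * s \<le> \<rho>" using y \<open>k > 0\<close> \<rho>(1) by (auto simp: s_def field_simps)
      \<comment> \<open>On this ray, with \<open>s = k / y\<close>, the exponent 2 i k / z equals -y
        + i y. The exponential thus decays like exp (-y), while |z|^n decays only like
        y^(-n).\<close>
      define z where "z = Complex s (- s)"
      have nz: "norm z \<le> 2 * s" "norm z \<ge> s"
        using cmod_le[of z] abs_Re_le_cmod[of z] s by (auto simp: z_def)
      have zc: "z \<in> cball 0 \<rho>" using nz s by simp
      then have zU: "z \<in> U" using \<rho>(2) s by (auto simp: U_def z_def)
      have "2 * \<i> * of_real k / z = Complex (- y) y"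
      proof -
        have "z \<noteq> 0" using s by (auto simp: z_def complex_eq_iff)
        moreover have "2 * \<i> * of_real k = Complex (- y) y * z"
          using y by (simp add: z_def s_def complex_eq_iff)
        ultimately show ?thesis by (simp add: divide_eq_eq)
      qed
      then have "norm (exp (2 * \<i> * of_real k / z)) = exp (- y)" by (simp add: norm_exp_eq_Re)
      then have "norm (g z) = exp (- y) * norm (f z)" using ext[OF zU] by (simp add: norm_mult)
      also have "\<dots> \<le> exp (- y) * M" using M[OF zc] by (intro mult_left_mono) auto
      finally have up: "norm (g z) \<le> exp (- y) * M" .
      have "c * s ^ n \<le> norm (p z) * norm z ^ n"
        using z1(2)[OF zc] nz s by (intro mult_mono power_mono) (auto simp: c_def)
      also have "\<dots> = norm (g z)" using g_eq[OF zc] by (simp add: norm_mult norm_power)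
      finally have "c * s ^ n \<le> exp (- y) * M" using up by simp
      then have "c * s ^ n * y ^ n \<le> exp (- y) * M * y ^ n" using y by (intro mult_right_mono) auto
      moreover have "s ^ n * y ^ n = k ^ n" using y by (simp add: s_def flip: power_mult_distrib)
      ultimately show ?thesis by (simp add: exp_minus field_simps)
    qed
    have "((\<lambda>y::real. M * (y ^ n / exp y)) \<longlongrightarrow> M * 0) at_top"
      by (intro tendsto_intros tendsto_power_div_exp_0)
    moreover have "\<forall>\<^sub>F y in at_top. c * k ^ n \<le> M * (y ^ n / exp y)"
      using eventually_gt_at_top[of "max 0 (2 * k / \<rho>)"] by eventually_elim (rule key, auto)
    ultimately have "c * k ^ n \<le> M * 0" by (intro tendsto_lowerbound) auto
    moreover have "0 < c * k ^ n" using \<open>c > 0\<close> \<open>k > 0\<close> by simp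
    ultimately show False by simp
  qed
  then have "g (of_real x) = 0" using x by auto
  then show ?thesis using fg[OF x] by auto
qed

section \<open>Representation outside a ball\<close>

lemma rep_kernel_diff:
  "rep_kernel \<kappa> (\<lambda>q. X' q - Y' q) (\<lambda>q. X'' q - Y'' q) y0 y x s
    = rep_kernel \<kappa> X' X'' y0 y x s - rep_kernel \<kappa> Y' Y'' y0 y x s"
  by (simp add: rep_kernel_def algebra_simps)

lemma cutoff_diff: "cutoff X X' X'' \<Longrightarrow> cutoff Y Y' Y'' \<Longrightarrow>
   cutoff (\<lambda>q. X q - Y q) (\<lambda>q. X' q - Y' q) (\<lambda>q. X'' q - Y'' q)"
  unfolding cutoff_def by (auto intro!: DERIV_diff continuous_on_diff)

lemma rep_kernel_cont:
  assumes "cutoff X X' X''" and A: "\<And>x. x \<in> A \<Longrightarrow> x \<noteq> y"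
  shows "continuous_on A (\<lambda>x. rep_kernel \<kappa> X' X'' y0 y x (of_real (norm (x - y))))"
proof -
  have q: "continuous_on A (\<lambda>x. (x - y0) \<bullet> (x - y0))" by (intro continuous_intros)
  have X': "continuous_on A (\<lambda>x. X' ((x - y0) \<bullet> (x - y0)))" by (rule continuous_on_compose2[OF cutoff_cont(2)[OF assms(1)] q]) simp
  have X'': "continuous_on A (\<lambda>x. X'' ((x - y0) \<bullet> (x - y0)))" by (rule continuous_on_compose2[OF cutoff_cont(3)[OF assms(1)] q]) simp
  have n: "continuous_on A (\<lambda>x. complex_of_real (norm (x - y)))" by (intro continuous_intros)
  have "continuous_on A (\<lambda>x. K0 \<kappa> (of_real (norm (x - y))))" by (rule continuous_on_compose2[OF K_cont(1) n]) (use A in auto)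
  moreover have "continuous_on A (\<lambda>x. K1 \<kappa> (of_real (norm (x - y))))" by (rule continuous_on_compose2[OF K_cont(2) n]) (use A in auto)
  ultimately show ?thesis unfolding rep_kernel_def by (intro continuous_intros X' X'')
qed

text \<open>In the shell from \<open>\<rho>\<close> to 2 \<open>\<rho>\<close> the cutoff
  derivatives have orders \<rho>^(-2) and \<rho>^(-4), the squared radius has order \<rho>^2, and
  \<open>K0\<close> and \<open>K1\<close> have orders \<rho>^(-1) and \<rho>^(-2). So both summands
  are O(\<rho>^(-2)).\<close>

lemma far_kernel_bound:
  assumes pl: "plateau cp (\<rho>\<^sup>2) (4 * \<rho>\<^sup>2) X X' X''" and "cp > 0" and \<rho>: "\<rho> \<ge> 1" "2 * norm y \<le> \<rho>" and x: "norm x \<le> 2 * \<rho>"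
  shows "norm (rep_kernel \<kappa> X' X'' 0 y x (of_real (norm (x - y)))) \<le> cp * (28 * \<bar>\<kappa>\<bar> + 64) / \<rho>\<^sup>2"
    and "norm x \<le> \<rho> \<Longrightarrow> rep_kernel \<kappa> X' X'' 0 y x (of_real (norm (x - y))) = 0"
proof -
  define q where "q = x \<bullet> x"
  have q: "q = (norm x)\<^sup>2" by (simp add: q_def power2_norm_eq_inner)
  have rk: "rep_kernel \<kappa> X' X'' 0 y x s = of_real (8 * X' q * (x \<bullet> (x - y))) * K1 \<kappa> s + of_real (6 * X' q + 4 * q * X'' q) * K0 \<kappa> s" for s
    by (simp add: rep_kernel_def q_def)
  have z: "X' q = 0 \<and> X'' q = 0" if "norm x \<le> \<rho>"
  proof -
    have "q \<le> \<rho>\<^sup>2" unfolding q using that by (intro power_mono) auto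
    then show ?thesis using pl by (simp add: plateau_def)
  qed
  then show zero: "norm x \<le> \<rho> \<Longrightarrow> rep_kernel \<kappa> X' X'' 0 y x (of_real (norm (x - y))) = 0" by (simp add: rk)
  show "norm (rep_kernel \<kappa> X' X'' 0 y x (of_real (norm (x - y)))) \<le> cp * (28 * \<bar>\<kappa>\<bar> + 64) / \<rho>\<^sup>2"
  proof (cases "norm x \<le> \<rho>")
    case True
    then show ?thesis using zero \<open>cp > 0\<close> by simp
  next
    case False
    have r: "\<rho> > 0" using \<rho> by simp
    have "norm x \<le> norm (x - y) + norm y" using norm_triangle_ineq[of "x - y" y] by simp
    then have far: "\<rho>/2 \<le> norm (x - y)" using False \<rho> by linarith
    have ub: "norm (x - y) \<le> 5/2 * \<rho>" using norm_triangle_ineq4[of x y] x \<rho> by linarith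
    have q4: "q \<le> 4 * \<rho>\<^sup>2" unfolding q using power_mono[OF x, of 2] by (simp add: power_mult_distrib)
    have q0: "q \<ge> 0" by (simp add: q)
    have "\<bar>X' q\<bar> \<le> cp / (4 * \<rho>\<^sup>2 - \<rho>\<^sup>2)" "\<bar>X'' q\<bar> \<le> cp / (4 * \<rho>\<^sup>2 - \<rho>\<^sup>2)\<^sup>2"
      using pl by (auto simp: plateau_def)
    then have X': "\<bar>X' q\<bar> \<le> cp / (3 * \<rho>\<^sup>2)" and X'': "\<bar>X'' q\<bar> \<le> cp / (9 * \<rho>^4)"
      by (auto simp: power2_eq_square eval_nat_numeral algebra_simps)
    have "\<bar>x \<bullet> (x - y)\<bar> \<le> norm x * norm (x - y)" by (rule Cauchy_Schwarz_ineq2)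
    also have "\<dots> \<le> (2 * \<rho>) * (5/2 * \<rho>)" using x ub r by (intro mult_mono) auto
    finally have ip: "\<bar>x \<bullet> (x - y)\<bar> \<le> 5 * \<rho>\<^sup>2" by (simp add: power2_eq_square)
    have a: "norm (complex_of_real (8 * X' q * (x \<bullet> (x - y)))) \<le> 14 * cp"
    proof -
      have "norm (complex_of_real (8 * X' q * (x \<bullet> (x - y)))) = 8 * (\<bar>X' q\<bar> * \<bar>x \<bullet> (x - y)\<bar>)"
        by (simp only: norm_of_real abs_mult)
      also have "\<dots> \<le> 8 * (cp / (3 * \<rho>\<^sup>2) * (5 * \<rho>\<^sup>2))" using X' ip \<open>cp > 0\<close> by (intro mult_left_mono mult_mono) auto
      also have "\<dots> \<le> 14 * cp" using r \<open>cp > 0\<close> by simp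
      finally show ?thesis .
    qed
    have b: "norm (complex_of_real (6 * X' q + 4 * q * X'' q)) \<le> 4 * cp / \<rho>\<^sup>2"
    proof -
      have "norm (complex_of_real (6 * X' q + 4 * q * X'' q)) \<le> 6 * \<bar>X' q\<bar> + 4 * (q * \<bar>X'' q\<bar>)"
        unfolding norm_of_real using q0 by (intro order_trans[OF abs_triangle_ineq]) (simp add: abs_mult)
      also have "\<dots> \<le> 6 * (cp / (3 * \<rho>\<^sup>2)) + 4 * ((4 * \<rho>\<^sup>2) * (cp / (9 * \<rho>^4)))"
        using X' X'' q4 q0 by (intro add_mono mult_left_mono mult_mono) auto
      also have "\<dots> = 34/9 * (cp / \<rho>\<^sup>2)" using r by (simp add: field_simps eval_nat_numeral)
      also have "\<dots> \<le> 4 * (cp / \<rho>\<^sup>2)" using \<open>cp > 0\<close> by (intro mult_right_mono) auto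
      also have "\<dots> = 4 * cp / \<rho>\<^sup>2" by simp
      finally show ?thesis .
    qed
    from K_bounds[OF _ far, of \<kappa>] r
    have k0: "norm (K0 \<kappa> (of_real (norm (x - y)))) \<le> 2 / \<rho>"
      and "norm (K1 \<kappa> (of_real (norm (x - y)))) \<le> \<bar>\<kappa>\<bar> / (2 * (\<rho>/2)\<^sup>2) + 1 / (2 * (\<rho>/2)^3)" by auto
    moreover have "\<bar>\<kappa>\<bar> / (2 * (\<rho>/2)\<^sup>2) + 1 / (2 * (\<rho>/2)^3) \<le> (2 * \<bar>\<kappa>\<bar> + 4) / \<rho>\<^sup>2"
    proof -
      have "1 / (2 * (\<rho>/2)^3) = 4 / \<rho>\<^sup>2 * (1 / \<rho>)" using r by (simp add: field_simps eval_nat_numeral)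
      also have "\<dots> \<le> 4 / \<rho>\<^sup>2 * 1" using \<rho> by (intro mult_left_mono) auto
      finally show ?thesis using r by (simp add: field_simps eval_nat_numeral)
    qed
    ultimately have k1: "norm (K1 \<kappa> (of_real (norm (x - y)))) \<le> (2 * \<bar>\<kappa>\<bar> + 4) / \<rho>\<^sup>2" by linarith
    have "norm (rep_kernel \<kappa> X' X'' 0 y x (of_real (norm (x - y)))) \<le>
       norm (complex_of_real (8 * X' q * (x \<bullet> (x - y)))) * norm (K1 \<kappa> (of_real (norm (x - y)))) +
       norm (complex_of_real (6 * X' q + 4 * q * X'' q)) * norm (K0 \<kappa> (of_real (norm (x - y))))"
      unfolding rk by (rule order_trans[OF norm_triangle_ineq]) (simp only: norm_mult order_refl)
    also have "\<dots> \<le> (14 * cp) * ((2 * \<bar>\<kappa>\<bar> + 4) / \<rho>\<^sup>2) + (4 * cp / \<rho>\<^sup>2) * (2 / \<rho>)"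
      by (intro add_mono mult_mono a b k0 k1) (use \<open>cp > 0\<close> r in auto)
    also have "\<dots> \<le> (14 * cp) * ((2 * \<bar>\<kappa>\<bar> + 4) / \<rho>\<^sup>2) + (4 * cp / \<rho>\<^sup>2) * 2"
      using \<rho> \<open>cp > 0\<close> by (intro add_left_mono mult_left_mono) (auto simp: field_simps)
    also have "\<dots> = cp * (28 * \<bar>\<kappa>\<bar> + 64) / \<rho>\<^sup>2" using r by (simp add: field_simps)
    finally show ?thesis .
  qed
qed

lemma exterior_representation:
  assumes "R > 0" and V: "weak_helm k {x. R < norm x} V" and dec: "\<And>x. R < norm x \<Longrightarrow> norm (V x) \<le> C / (norm x)\<^sup>2"
    and \<kappa>: "\<kappa>\<^sup>2 = k\<^sup>2" and pl: "plateau cp (4 * R\<^sup>2) (9 * R\<^sup>2) X X' X''" and c: "rep_const c" and y: "norm y > 3 * R"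
  shows "V y = - c * (LINT x|lborel. indicator (cball 0 (3*R) - ball 0 (2*R)) x *\<^sub>R (V x * rep_kernel \<kappa> X' X'' 0 y x (of_real (norm (x - y)))))"
proof -
  define I2 where "I2 = (LINT x|lborel. indicator (cball 0 (3*R) - ball 0 (2*R)) x *\<^sub>R (V x * rep_kernel \<kappa> X' X'' 0 y x (of_real (norm (x - y)))))"
  obtain cq where cq: "cq > 0" "\<And>a b. a < b \<Longrightarrow> \<exists>X X' X''. plateau cq a b X X' X''" using plateau_exists by blast
  have oS: "open {x::real^3. R < norm x}" by (intro open_Collect_less continuous_intros)
  have C0: "C \<ge> 0"
  proof -
    have "0 \<le> C / (norm y)\<^sup>2" by (rule order_trans[OF norm_ge_zero dec]) (use y assms(1) in auto)
    moreover have "0 < (norm y)\<^sup>2" using y assms(1) by (intro zero_less_power) linarith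
    ultimately show ?thesis by (simp add: zero_le_divide_iff)
  qed
  have nq: "x \<bullet> x = (norm x)\<^sup>2" for x :: "real^3" by (simp add: power2_norm_eq_inner)
  have X: "cutoff X X' X''" "\<And>q. q \<le> 4 * R\<^sup>2 \<Longrightarrow> X q = 1 \<and> X' q = 0 \<and> X'' q = 0" "\<And>q. q \<ge> 9 * R\<^sup>2 \<Longrightarrow> X q = 0 \<and> X' q = 0 \<and> X'' q = 0"
    using pl by (auto simp: plateau_def)
  define D where "D = norm c * (8 * unit_ball_vol 3 * C * (cq * (28 * \<bar>\<kappa>\<bar> + 64)))"
  have bound: "norm (V y + c * I2) \<le> D / \<rho>" if \<rho>: "\<rho> \<ge> 1" "2 * norm y \<le> \<rho>" for \<rho>
  proof -
    have r3: "\<rho> > 3 * R" "\<rho> > norm y" "\<rho> > 0" using \<rho> y assms(1) by auto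
    have "\<rho>\<^sup>2 < 4 * \<rho>\<^sup>2" using r3 by simp
    then obtain Y Y' Y'' where Y: "plateau cq (\<rho>\<^sup>2) (4 * \<rho>\<^sup>2) Y Y' Y''" using cq(2) by blast
    have Yc: "cutoff Y Y' Y''" "\<And>q. q \<le> \<rho>\<^sup>2 \<Longrightarrow> Y q = 1 \<and> Y' q = 0 \<and> Y'' q = 0" "\<And>q. q \<ge> 4 * \<rho>\<^sup>2 \<Longrightarrow> Y q = 0"
      using Y by (auto simp: plateau_def)
    define K :: "(real^3) set" where "K = cball 0 (2 * \<rho>) - ball 0 (2 * R)"
    have K: "compact K" unfolding K_def by (intro compact_diff) auto
    have KS: "K \<subseteq> {x. R < norm x}" using assms(1) by (auto simp: K_def)
    define \<eta> where "\<eta> = min (norm y - 3 * R) (\<rho> - norm y)"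
    have \<eta>: "\<eta> > 0" using y r3 by (simp add: \<eta>_def)
    have near: "3 * R < norm x \<and> norm x < \<rho>" if "x \<in> ball y \<eta>" for x
    proof -
      have "norm (y - x) < \<eta>" using that by (simp add: dist_norm)
      then show ?thesis using norm_triangle_ineq3[of y x] by (auto simp: \<eta>_def)
    qed
    have sq: "9 * R\<^sup>2 \<le> (norm x)\<^sup>2" if "3 * R \<le> norm x" for x :: "real^3"
      using power_mono[OF that, of 2] assms(1) by (simp add: power_mult_distrib)
    have sq2: "(norm x)\<^sup>2 \<le> \<rho>\<^sup>2" if "norm x \<le> \<rho>" for x :: "real^3" by (rule power_mono[OF that]) simp
    have rep: "of_real (Y ((y - 0) \<bullet> (y - 0)) - X ((y - 0) \<bullet> (y - 0))) * V y = c * (LINT x|lborel. indicator K x *\<^sub>R (V x *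
      rep_kernel \<kappa> (\<lambda>q. Y' q - X' q) (\<lambda>q. Y'' q - X'' q) 0 y x (of_real (norm (x - y)))))"
    proof (rule c[unfolded rep_const_def, rule_format, OF \<kappa> oS V cutoff_diff[OF Yc(1) X(1)] K KS, where \<eta>=\<eta>])
      fix x :: "real^3" assume "x \<notin> K"
      then consider "norm x > 2 * \<rho>" | "norm x < 2 * R" by (auto simp: K_def)
      then show "Y ((x - 0) \<bullet> (x - 0)) - X ((x - 0) \<bullet> (x - 0)) = 0"
      proof cases
        case 1
        then have "4 * \<rho>\<^sup>2 \<le> (norm x)\<^sup>2" using power_mono[of "2 * \<rho>" "norm x" 2] r3 by (simp add: power_mult_distrib)
        then show ?thesis using Yc(3) X(3) sq[of x] 1 r3 by (simp add: nq)
      next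
        case 2
        then have "(norm x)\<^sup>2 \<le> 4 * R\<^sup>2" using power_mono[of "norm x" "2 * R" 2] by (simp add: power_mult_distrib)
        then show ?thesis using X(2) Yc(2) sq2[of x] 2 r3 assms(1) by (simp add: nq)
      qed
    next
      fix x assume "x \<in> ball y \<eta>"
      from near[OF this] show "Y' ((x - 0) \<bullet> (x - 0)) - X' ((x - 0) \<bullet> (x - 0)) = 0 \<and> Y'' ((x - 0) \<bullet> (x - 0)) - X'' ((x - 0) \<bullet> (x - 0)) = 0"
        using X(3) Yc(2) sq[of x] sq2[of x] by (simp add: nq)
    qed (use y assms(1) \<eta> in auto)
    have XY: "Y (y \<bullet> y) - X (y \<bullet> y) = 1" using Yc(2) X(3) sq[of y] sq2[of y] y r3 by (simp add: nq)
    let ?f = "\<lambda>x. indicator K x *\<^sub>R (V x * rep_kernel \<kappa> Y' Y'' 0 y x (of_real (norm (x - y))))"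
    let ?g = "\<lambda>x. indicator K x *\<^sub>R (V x * rep_kernel \<kappa> X' X'' 0 y x (of_real (norm (x - y))))"
    let ?A = "cball 0 (3*R) - ball 0 (2*R) :: (real^3) set"
    have Vc: "continuous_on T V" if "T \<subseteq> {x. R < norm x}" for T
      using V that continuous_on_subset by (auto simp: weak_helm_def)
    have geq: "?g x = indicator ?A x *\<^sub>R (V x * rep_kernel \<kappa> X' X'' 0 y x (of_real (norm (x - y))))" for x
    proof (cases "x \<in> ?A")
      case True then have "x \<in> K" using r3 by (auto simp: K_def)
      then show ?thesis using True by simp
    next
      case False
      show ?thesis
      proof (cases "x \<in> K")
        case True
        then have "3 * R \<le> norm x" using False by (auto simp: K_def)
        then show ?thesis using False X(3) sq[of x] by (simp add: rep_kernel_def nq)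
      qed (use False in simp)
    qed
    have ig: "integrable lborel ?g"
      unfolding geq
      by (intro bcs_integrable bcs_indicator continuous_on_mult Vc rep_kernel_cont[OF X(1)] compact_diff)
         (use assms(1) y in auto)
    have fz: "?f x = 0" if "norm x \<le> \<rho>" for x
      using far_kernel_bound(2)[OF Y cq(1) \<rho> _ that] that r3 by simp
    have feq: "?f x = indicator (cball 0 (2 * \<rho>) - ball 0 \<rho>) x *\<^sub>R (V x * rep_kernel \<kappa> Y' Y'' 0 y x (of_real (norm (x - y))))" for x
      using fz[of x] r3 assms(1) by (cases "norm x < \<rho>") (auto simp: K_def indicator_def)
    have if': "integrable lborel ?f"
      unfolding feq
      by (intro bcs_integrable bcs_indicator continuous_on_mult Vc rep_kernel_cont[OF Yc(1)] compact_diff)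
         (use r3 assms(1) in auto)
    have "V y = c * ((LINT x|lborel. ?f x) - I2)"
    proof -
      have "(LINT x|lborel. indicator K x *\<^sub>R (V x * rep_kernel \<kappa> (\<lambda>q. Y' q - X' q) (\<lambda>q. Y'' q - X'' q) 0 y x (of_real (norm (x - y)))))
         = (LINT x|lborel. ?f x - ?g x)"
        by (rule Bochner_Integration.integral_cong) (auto simp: rep_kernel_diff indicator_def algebra_simps)
      also have "\<dots> = (LINT x|lborel. ?f x) - (LINT x|lborel. ?g x)" by (rule Bochner_Integration.integral_diff[OF if' ig])
      also have "(LINT x|lborel. ?g x) = I2" unfolding I2_def geq ..
      finally show ?thesis using rep XY by simp
    qed
    then have eq: "V y + c * I2 = c * (LINT x|lborel. ?f x)" by (simp add: algebra_simps)
    have "norm (LINT x|lborel. ?f x) \<le> (LINT x|lborel. indicator (cball (0::real^3) (2 * \<rho>)) x *\<^sub>R (C / \<rho>\<^sup>2 * (cq * (28 * \<bar>\<kappa>\<bar> + 64) / \<rho>\<^sup>2)))"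
    proof (rule Bochner_Integration.integral_norm_bound_integral[OF if'])
      show "integrable lborel (\<lambda>x. indicator (cball (0::real^3) (2 * \<rho>)) x *\<^sub>R (C / \<rho>\<^sup>2 * (cq * (28 * \<bar>\<kappa>\<bar> + 64) / \<rho>\<^sup>2)))"
        using emeasure_bounded_finite[of "cball (0::real^3) (2 * \<rho>)"] by (intro integrable_scaleR_left integrable_real_indicator) auto
      fix x :: "real^3"
      show "norm (?f x) \<le> indicator (cball 0 (2 * \<rho>)) x *\<^sub>R (C / \<rho>\<^sup>2 * (cq * (28 * \<bar>\<kappa>\<bar> + 64) / \<rho>\<^sup>2))"
      proof (cases "norm x \<le> \<rho> \<or> x \<notin> K")
        case True
        then have "?f x = 0" using fz[of x] by auto
        then have "norm (?f x) = 0" by (simp only: norm_zero)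
        then show ?thesis using C0 cq(1) by (simp only:) (simp add: indicator_def)
      next
        case False
        then have x: "\<rho> < norm x" "norm x \<le> 2 * \<rho>" "x \<in> K" by (auto simp: K_def)
        have "norm (V x) \<le> C / (norm x)\<^sup>2" by (rule dec) (use x r3 assms(1) in auto)
        also have "\<dots> \<le> C / \<rho>\<^sup>2" using x r3 C0 by (intro divide_left_mono power_mono mult_pos_pos) auto
        finally have "norm (V x * rep_kernel \<kappa> Y' Y'' 0 y x (of_real (norm (x - y)))) \<le> C / \<rho>\<^sup>2 * (cq * (28 * \<bar>\<kappa>\<bar> + 64) / \<rho>\<^sup>2)"
          unfolding norm_mult using far_kernel_bound(1)[OF Y cq(1) \<rho> x(2), of \<kappa>] C0 by (intro mult_mono) auto
        then show ?thesis using x by simp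
      qed
    qed
    also have "\<dots> = 8 * unit_ball_vol 3 * C * (cq * (28 * \<bar>\<kappa>\<bar> + 64)) / \<rho>"
      using r3 by (simp add: content_cball power_mult_distrib) (simp add: field_simps eval_nat_numeral)
    finally have "norm (LINT x|lborel. ?f x) \<le> 8 * unit_ball_vol 3 * C * (cq * (28 * \<bar>\<kappa>\<bar> + 64)) / \<rho>" .
    then have "norm c * norm (LINT x|lborel. ?f x) \<le> norm c * (8 * unit_ball_vol 3 * C * (cq * (28 * \<bar>\<kappa>\<bar> + 64)) / \<rho>)"
      by (rule mult_left_mono) simp
    then show ?thesis unfolding eq by (simp add: norm_mult D_def)
  qed
  have "V y + c * I2 = 0"
  proof (rule ccontr)
    assume "V y + c * I2 \<noteq> 0"
    then have pos: "norm (V y + c * I2) > 0" by simp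
    define \<rho> where "\<rho> = max (max 1 (2 * norm y)) (D / norm (V y + c * I2) + 1)"
    have "\<rho> > 0" "D / norm (V y + c * I2) < \<rho>" unfolding \<rho>_def by linarith+
    then have "D / \<rho> < norm (V y + c * I2)" using pos by (simp add: field_simps)
    moreover have "norm (V y + c * I2) \<le> D / \<rho>" by (rule bound) (auto simp: \<rho>_def)
    ultimately show False by simp
  qed
  then show ?thesis unfolding I2_def by (simp add: add_eq_0_iff2)
qed

text \<open>\<open>rep_kernel\<close> at y = t e, multiplied by t exp (-i \<kappa> t) and rewritten
  in z = 1 / t, with s = |x - y| / t. The exponent comes from the phase |x - y| - t = t (s - 1),
  rationalised to (z q - 2 p) / (s + 1), which is regular at z = 0.\<close>

definition far_kernel :: "real \<Rightarrow> complex \<Rightarrow> complex \<Rightarrow> complex \<Rightarrow> complex \<Rightarrow> complex \<Rightarrow> complex \<Rightarrow> complex" where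
  "far_kernel \<kappa> a b q p s z = exp (\<i> * of_real \<kappa> * ((z * q - 2 * p) / (s + 1))) *
     (a * ((z * q - p) * (\<i> * of_real \<kappa> / (2 * s\<^sup>2) - z / (2 * s^3))) + b * (1 / s))"

lemma far_kernel_holomorphic:
  assumes "s holomorphic_on B" "\<And>z. z \<in> B \<Longrightarrow> s z \<noteq> 0" "\<And>z. z \<in> B \<Longrightarrow> s z + 1 \<noteq> 0"
  shows "(\<lambda>z. v * far_kernel \<kappa> a b q p (s z) z) holomorphic_on B"
  unfolding far_kernel_def using assms by (intro holomorphic_intros) auto

lemma far_kernel_continuous:
  assumes "continuous_on B s" "\<And>z. z \<in> B \<Longrightarrow> s z \<noteq> 0" "\<And>z. z \<in> B \<Longrightarrow> s z + 1 \<noteq> 0"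
    "continuous_on B a" "continuous_on B b" "continuous_on B q" "continuous_on B p" "continuous_on B w"
  shows "continuous_on B (\<lambda>z. far_kernel \<kappa> (a z) (b z) (q z) (p z) (s z) (w z))"
  unfolding far_kernel_def using assms by (intro continuous_intros) auto

text \<open>A form of the Atkinson-Wilcox expansion: along a ray, the field freed of its spherical
  wave factor is a convergent power series in 1 / t. With \<open>\<kappa> = - k\<close> the same
  holds relative to incoming waves.\<close>

lemma radiation_pattern_holomorphic:
  assumes "R > 0" and V: "weak_helm k {x. R < norm x} V" and dec: "\<And>x. R < norm x \<Longrightarrow> norm (V x) \<le> C / (norm x)\<^sup>2"
    and \<kappa>: "\<kappa>\<^sup>2 = k\<^sup>2" and e: "norm e = 1"
  obtains h where "h holomorphic_on ball 0 (1 / (12 * R))"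
    "\<And>t. t > 12 * R \<Longrightarrow> of_real t * exp (- (\<i> * of_real \<kappa> * of_real t)) * V (t *\<^sub>R e) = h (of_real (1 / t))"
proof -
  obtain cp where cp: "cp > 0" "\<And>a b. a < b \<Longrightarrow> \<exists>X X' X''. plateau cp a b X X' X''" using plateau_exists by blast
  have "4 * R\<^sup>2 < 9 * R\<^sup>2" using assms(1) by simp
  then obtain X X' X'' where pl: "plateau cp (4 * R\<^sup>2) (9 * R\<^sup>2) X X' X''" using cp(2) by blast
  then have X: "cutoff X X' X''" by (simp add: plateau_def)
  obtain c where c: "rep_const c" using representation_formula ..
  define A :: "(real^3) set" where "A = cball 0 (3*R) - ball 0 (2*R)"
  have A: "compact A" unfolding A_def by (intro compact_diff) auto
  have AS: "A \<subseteq> {x. R < norm x}" using assms(1) by (auto simp: A_def)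
  define q where "q x = x \<bullet> x" for x :: "real^3"
  define p where "p x = x \<bullet> e" for x :: "real^3"
  define Q where "Q x z = 1 - 2 * z * of_real (p x) + z\<^sup>2 * of_real (q x)" for x and z :: complex
  define N where "N x z = V x * far_kernel \<kappa> (of_real (8 * X' (q x))) (of_real (6 * X' (q x) + 4 * q x * X'' (q x)))
     (of_real (q x)) (of_real (p x)) (csqrt (Q x z)) z" for x z
  have qn: "q x = (norm x)\<^sup>2" for x by (simp add: q_def power2_norm_eq_inner)
  have pn: "\<bar>p x\<bar> \<le> norm x" for x using Cauchy_Schwarz_ineq2[of x e] e by (simp add: p_def)
  \<comment> \<open>This fixes the number 12: for |x| <= 3 R and |z| <= 1 / (12 R) the two terms
    added to 1 in \<open>Q\<close> have real parts at most 1/2 and 1/16 in modulus.\<close>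
  have ReQ: "Re (Q x z) > 0" if "x \<in> A" "norm z \<le> 1 / (12 * R)" for x z
  proof -
    have x: "norm x \<le> 3 * R" using that by (simp add: A_def)
    have "\<bar>Re (2 * z * of_real (p x))\<bar> \<le> norm (2 * z * of_real (p x))" by (rule abs_Re_le_cmod)
    also have "\<dots> \<le> 2 * (1 / (12 * R)) * (3 * R)" unfolding norm_mult using that(2) pn[of x] x
      by (intro mult_mono) auto
    also have "\<dots> = 1/2" using assms(1) by simp
    finally have 1: "\<bar>Re (2 * z * of_real (p x))\<bar> \<le> 1/2" .
    have "\<bar>Re (z\<^sup>2 * of_real (q x))\<bar> \<le> (norm z)\<^sup>2 * (norm x)\<^sup>2"
      using abs_Re_le_cmod[of "z\<^sup>2 * of_real (q x)"] by (simp add: norm_mult norm_power qn)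
    also have "\<dots> \<le> (1 / (12 * R))\<^sup>2 * (3 * R)\<^sup>2" using that(2) x by (intro mult_mono power_mono) auto
    also have "\<dots> = 1/16" using assms(1) by (simp add: field_simps power2_eq_square)
    finally have 2: "\<bar>Re (z\<^sup>2 * of_real (q x))\<bar> \<le> 1/16" .
    have "Re (Q x z) = 1 - Re (2 * z * of_real (p x)) + Re (z\<^sup>2 * of_real (q x))" by (simp add: Q_def)
    then show ?thesis using 1 2 by linarith
  qed
  have Qnp: "Q x z \<notin> \<real>\<^sub>\<le>\<^sub>0" "csqrt (Q x z) \<noteq> 0" if "x \<in> A" "norm z \<le> 1 / (12 * R)" for x z
    using ReQ[OF that] by (auto simp: complex_nonpos_Reals_iff)
  have S1: "csqrt w + 1 \<noteq> 0" for w
  proof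
    assume "csqrt w + 1 = 0"
    then have "Re (csqrt w) = -1" by (simp add: complex_eq_iff)
    then show False using csqrt_principal[of w] by linarith
  qed
  have hol: "N x holomorphic_on ball 0 (1 / (12 * R))" if "x \<in> A" for x
  proof -
    have 1: "(\<lambda>z. csqrt (Q x z)) holomorphic_on ball 0 (1 / (12 * R))"
      unfolding Q_def using Qnp(1)[OF that, unfolded Q_def] by (intro holomorphic_intros) auto
    have "csqrt (Q x z) \<noteq> 0" if "z \<in> ball 0 (1 / (12 * R))" for z using Qnp(2)[OF \<open>x \<in> A\<close>, of z] that by auto
    then show ?thesis unfolding N_def by (rule far_kernel_holomorphic[OF 1 _ S1])
  qed
  have cont: "continuous_on (A \<times> cball 0 (1 / (12 * R))) (\<lambda>p. N (fst p) (snd p))"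
  proof -
    let ?D = "A \<times> cball (0::complex) (1 / (12 * R))"
    have uA: "continuous_on ?D (\<lambda>p. V (fst p))"
      by (rule continuous_on_compose2[of "{x. R < norm x}" V]) (use V AS in \<open>auto simp: weak_helm_def intro!: continuous_intros\<close>)
    have qc: "continuous_on ?D (\<lambda>p. q (fst p))" unfolding q_def by (intro continuous_intros)
    have pc: "continuous_on ?D (\<lambda>r. p (fst r))" unfolding p_def by (intro continuous_intros)
    have X1c: "continuous_on ?D (\<lambda>p. X' (q (fst p)))" by (rule continuous_on_compose2[OF cutoff_cont(2)[OF X] qc]) simp
    have X2c: "continuous_on ?D (\<lambda>p. X'' (q (fst p)))" by (rule continuous_on_compose2[OF cutoff_cont(3)[OF X] qc]) simp
    have Qc: "continuous_on ?D (\<lambda>p. Q (fst p) (snd p))" unfolding Q_def by (intro continuous_intros qc pc)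
    have sc: "continuous_on ?D (\<lambda>p. csqrt (Q (fst p) (snd p)))"
      using Qnp(1) by (intro continuous_on_compose2[OF continuous_on_csqrt Qc]) auto
    have s0: "csqrt (Q (fst p) (snd p)) \<noteq> 0" if "p \<in> ?D" for p using Qnp(2)[of "fst p" "snd p"] that by auto
    show ?thesis unfolding N_def
      by (rule continuous_on_mult[OF uA far_kernel_continuous[OF sc s0 S1]]) (assumption | intro continuous_intros qc pc X1c X2c)+
  qed
  define h where "h z = - c * (LINT x|lborel. indicator A x *\<^sub>R N x z)" for z
  show ?thesis
  proof (rule that)
    show "h holomorphic_on ball 0 (1 / (12 * R))" unfolding h_def
      by (intro holomorphic_intros holomorphic_integral A cont hol)
    fix t :: real assume t: "t > 12 * R"
    have t0: "t > 0" using t assms(1) by linarith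
    define y where "y = t *\<^sub>R e"
    have ny: "norm y > 3 * R" using t t0 e assms(1) by (simp add: y_def)
    define a where "a = complex_of_real t * exp (- (\<i> * of_real \<kappa> * of_real t))"
    have Vy: "V y = - c * (LINT x|lborel. indicator A x *\<^sub>R (V x * rep_kernel \<kappa> X' X'' 0 y x (of_real (norm (x - y)))))"
      unfolding A_def by (rule exterior_representation[OF assms(1) V dec \<kappa> pl c ny])
    have Neq: "indicator A x *\<^sub>R N x (of_real (1/t)) = a * (indicator A x *\<^sub>R (V x * rep_kernel \<kappa> X' X'' 0 y x (of_real (norm (x - y)))))" for x
    proof (cases "x \<in> A")
      case True
      have ee: "e \<bullet> e = 1" using e by (simp add: norm_eq_1)
      define s where "s = norm (x - y)"
      have "s > 0" using True ny by (auto simp: s_def A_def)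
      have i1: "x \<bullet> (x - y) = q x - t * p x" by (simp add: y_def inner_diff_right q_def p_def)
      have i2: "s\<^sup>2 = q x - 2 * t * p x + t\<^sup>2"
        unfolding s_def power2_norm_eq_inner y_def using ee
        by (simp add: inner_diff_right inner_diff_left q_def p_def inner_commute power2_eq_square algebra_simps)
      have "Q x (of_real (1/t)) = of_real (1 - 2 * (1/t) * p x + (1/t)\<^sup>2 * q x)" by (simp add: Q_def)
      also have "1 - 2 * (1/t) * p x + (1/t)\<^sup>2 * q x = (s / t)\<^sup>2"
        using t0 unfolding power_divide i2 by (simp add: field_simps power2_eq_square)
      finally have S: "csqrt (Q x (of_real (1/t))) = of_real (s / t)"
        using \<open>s > 0\<close> t0 by (simp add: csqrt_of_real_nonneg)
      have "(1/t * q x - 2 * p x) = (s - t) * (s / t + 1)"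
        using i2 t0 by (simp add: field_simps power2_eq_square)
      moreover have "s / t + 1 \<noteq> 0" using \<open>s > 0\<close> t0 by (simp add: add_nonneg_eq_0_iff)
      ultimately have arg: "(1/t * q x - 2 * p x) / (s / t + 1) = s - t" by simp
      have arg': "(of_real (1/t) * of_real (q x) - 2 * of_real (p x)) / (csqrt (Q x (of_real (1/t))) + 1) = complex_of_real (s - t)"
        unfolding S arg[symmetric] by simp
      have E: "exp (\<i> * of_real \<kappa> * ((of_real (1/t) * of_real (q x) - 2 * of_real (p x)) / (csqrt (Q x (of_real (1/t))) + 1)))
         = exp (- (\<i> * of_real \<kappa> * of_real t)) * exp (\<i> * of_real \<kappa> * of_real s)"
        unfolding arg' exp_add[symmetric] by (simp add: algebra_simps)
      define E0 where "E0 = exp (\<i> * complex_of_real \<kappa> * of_real s)"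
      define xq where "xq = complex_of_real (X' (q x))"
      define bb where "bb = complex_of_real (6 * X' (q x) + 4 * q x * X'' (q x))"
      have nz: "complex_of_real s \<noteq> 0" "complex_of_real t \<noteq> 0" using \<open>s > 0\<close> t0 by auto
      have "rep_kernel \<kappa> X' X'' 0 y x (of_real s) = 8 * xq * (of_real (q x) - of_real t * of_real (p x)) * (E0 * (\<i> * of_real \<kappa> / (2 * (of_real s)^2) - 1 / (2 * (of_real s)^3)))
        + bb * (E0 / of_real s)"
        unfolding rep_kernel_def K0_def K1_def diff_zero i1 q_def[symmetric] E0_def xq_def bb_def by simp
      moreover define N1 where "N1 = 8 * xq * ((of_real (q x) / of_real t - of_real (p x)) * (\<i> * of_real \<kappa> / (2 * (of_real s / of_real t)\<^sup>2) - (1 / of_real t) / (2 * (of_real s / of_real t)^3)))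
         + bb * (1 / (of_real s / of_real t))"
      moreover have "of_real t * (8 * xq * (of_real (q x) - of_real t * of_real (p x)) * (E0 * (\<i> * of_real \<kappa> / (2 * (of_real s)^2) - 1 / (2 * (of_real s)^3))) + bb * (E0 / of_real s))
        = E0 * (8 * xq * ((of_real (q x) / of_real t - of_real (p x)) * (\<i> * of_real \<kappa> / (2 * (of_real s / of_real t)\<^sup>2) - (1 / of_real t) / (2 * (of_real s / of_real t)^3)))
         + bb * (1 / (of_real s / of_real t)))"
      proof -
        have "of_real (q x) / complex_of_real t - of_real (p x) = (of_real (q x) - of_real t * of_real (p x)) / of_real t" using nz by (simp add: field_simps)
        moreover have "\<i> * of_real \<kappa> / (2 * (of_real s / of_real t)\<^sup>2) - (1 / of_real t) / (2 * (of_real s / complex_of_real t)^3)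
          = (of_real t)\<^sup>2 * (\<i> * of_real \<kappa> / (2 * (of_real s)^2) - 1 / (2 * (of_real s)^3))"
          using nz by (simp add: field_simps power2_eq_square power3_eq_cube)
        moreover have "\<tau> * (8 * xq * w * (E0 * A0) + bb * (E0 / \<sigma>)) = E0 * (8 * xq * ((w / \<tau>) * (\<tau>\<^sup>2 * A0)) + bb * (1 / (\<sigma> / \<tau>)))"
          if "\<sigma> \<noteq> 0" "\<tau> \<noteq> 0" for \<tau> \<sigma> w A0 :: complex
          using that by (simp add: field_simps power2_eq_square)
        ultimately show ?thesis using nz by (simp only: )
      qed
      ultimately have "of_real t * rep_kernel \<kappa> X' X'' 0 y x (of_real s) = E0 * N1" unfolding N1_def by simp
      then have "a * rep_kernel \<kappa> X' X'' 0 y x (of_real s) = exp (- (\<i> * of_real \<kappa> * of_real t)) * (E0 * N1)"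
        unfolding a_def by (simp add: mult.assoc mult.left_commute)
      moreover have "far_kernel \<kappa> (of_real (8 * X' (q x))) bb (of_real (q x)) (of_real (p x)) (csqrt (Q x (of_real (1/t)))) (of_real (1/t))
        = exp (- (\<i> * of_real \<kappa> * of_real t)) * (E0 * N1)"
        unfolding far_kernel_def E unfolding S E0_def N1_def xq_def by simp
      ultimately show ?thesis using True unfolding N_def s_def[symmetric] bb_def[symmetric] by (simp add: mult.left_commute)
    qed simp
    have "h (of_real (1/t)) = - c * (a * (LINT x|lborel. indicator A x *\<^sub>R (V x * rep_kernel \<kappa> X' X'' 0 y x (of_real (norm (x - y))))))"
      unfolding h_def Neq integral_mult_right_zero ..
    then show "of_real t * exp (- (\<i> * of_real \<kappa> * of_real t)) * V (t *\<^sub>R e) = h (of_real (1/t))"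
      unfolding y_def[symmetric] a_def[symmetric] Vy by simp
  qed
qed

text \<open>The outgoing and the incoming expansion describe the same values of \<open>V\<close>
  with opposite phases, so with s = 1 / t their sums are related by the factor exp (2 i k / s). Two
  functions holomorphic at 0 admit such a relation only if both vanish.\<close>

theorem rellich:
  assumes "R > 0" "k > 0" and V: "weak_helm k {x. R < norm x} V" and dec: "\<And>x. R < norm x \<Longrightarrow> norm (V x) \<le> C / (norm x)\<^sup>2"
    and x: "norm x > 12 * R"
  shows "V x = 0"
proof -
  define e where "e = x /\<^sub>R norm x"
  define t where "t = norm x"
  have t: "t > 0" "t > 12 * R" using x assms(1) by (auto simp: t_def)
  have "norm e = 1" using t by (simp add: e_def t_def)
  obtain f where f: "f holomorphic_on ball 0 (1 / (12 * R))"
    "\<And>t. t > 12 * R \<Longrightarrow> of_real t * exp (- (\<i> * of_real k * of_real t)) * V (t *\<^sub>R e) = f (of_real (1 / t))"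
    using radiation_pattern_holomorphic[OF assms(1) V dec refl \<open>norm e = 1\<close>] by blast
  have "(- k)\<^sup>2 = k\<^sup>2" by simp
  from radiation_pattern_holomorphic[OF assms(1) V dec this \<open>norm e = 1\<close>]
  obtain g where g: "g holomorphic_on ball 0 (1 / (12 * R))"
    "\<And>t. t > 12 * R \<Longrightarrow> of_real t * exp (- (\<i> * of_real (- k) * of_real t)) * V (t *\<^sub>R e) = g (of_real (1 / t))"
    by blast
  have "f (of_real (1 / t)) = 0"
  proof (rule essential_singularity_quotient[OF _ assms(2) f(1) g(1)])
    fix s :: real assume s: "0 < s" "s < 1 / (12 * R)"
    define \<tau> where "\<tau> = 1 / s"
    have \<tau>: "\<tau> > 12 * R" "s = 1 / \<tau>" using s assms(1) by (auto simp: \<tau>_def field_simps)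
    have "exp (2 * \<i> * of_real k / of_real s) = exp (\<i> * of_real k * of_real \<tau>) * exp (\<i> * of_real k * of_real \<tau>)"
      by (simp add: \<tau>_def field_simps flip: exp_add)
    moreover have "exp (- (\<i> * of_real k * of_real \<tau>)) * exp (\<i> * of_real k * of_real \<tau>) = (1::complex)"
      by (simp flip: exp_add)
    ultimately show "g (of_real s) = exp (2 * \<i> * of_real k / of_real s) * f (of_real s)"
      unfolding \<tau>(2) f(2)[OF \<tau>(1), symmetric] g(2)[OF \<tau>(1), symmetric]
      by (simp add: algebra_simps flip: \<tau>(2))
  qed (use t assms(1) in \<open>auto simp: field_simps\<close>)
  then have "V (t *\<^sub>R e) = 0" using f(2)[OF t(2)] t(1) by simp
  then show ?thesis using t by (simp add: e_def t_def)
qed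

section \<open>Odd reflection\<close>

lemma mirror0: "mirror 3 0 x = x - (2 * x$3) *\<^sub>R axis 3 1"
  by (simp add: mirror_def)

lemma mirror_mirror: "mirror j y (mirror j y x) = x"
  by (simp add: mirror_def algebra_simps flip: scaleR_left_distrib)

lemma mirror0_component: "mirror 3 0 x $ i = (if i = 3 then - x$3 else x$i)"
  by (simp add: mirror0 axis_def)

lemma norm_mirror0: "norm (mirror 3 0 x) = norm x"
proof -
  have "(\<Sum>i\<in>UNIV. (mirror 3 0 x $ i)\<^sup>2) = (\<Sum>i\<in>UNIV. (x $ i)\<^sup>2)"
    by (rule sum.cong) (auto simp: mirror0_component)
  then show ?thesis by (simp add: norm_vec_def L2_set_def)
qed

lemma mirror_continuous: "continuous_on A (mirror j y)"
  unfolding mirror_def by (intro continuous_intros)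

lemma lborel_mirror0: "distr lborel borel (mirror 3 0) = lborel"
proof -
  let ?c = "\<lambda>b::real^3. if b = axis 3 1 then -1 else 1 :: real"
  have T: "mirror 3 0 = (\<lambda>x. 0 + (\<Sum>j\<in>Basis. (?c j * (x \<bullet> j)) *\<^sub>R j))"
  proof
    fix x :: "real^3"
    have b: "axis 3 1 \<in> (Basis :: (real^3) set)" by (rule axis_in_Basis_iff[THEN iffD2]) simp
    have "(\<Sum>j\<in>Basis. (?c j * (x \<bullet> j)) *\<^sub>R j) = (\<Sum>j\<in>Basis. (x \<bullet> j) *\<^sub>R j - (if j = axis 3 1 then (2 * (x \<bullet> j)) *\<^sub>R j else 0))"
      by (rule sum.cong) (auto simp: algebra_simps simp flip: scaleR_left_distrib)
    also have "\<dots> = x - (2 * (x \<bullet> axis 3 1)) *\<^sub>R axis 3 1"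
      using b by (simp add: sum_subtractf euclidean_representation)
    finally show "mirror 3 0 x = 0 + (\<Sum>j\<in>Basis. (?c j * (x \<bullet> j)) *\<^sub>R j)"
      by (simp add: mirror0 inner_axis)
  qed
  have "lborel = density (distr lborel borel (mirror 3 0)) (\<lambda>_. \<Prod>j\<in>Basis. \<bar>?c j\<bar>)"
    unfolding T by (rule lborel_affine_euclidean) auto
  also have "(\<Prod>j\<in>Basis. \<bar>?c j\<bar>) = 1" by (rule prod.neutral) auto
  finally show ?thesis by (simp add: density_1)
qed

lemma integral_mirror0:
  fixes f :: "real^3 \<Rightarrow> complex"
  assumes "f \<in> borel_measurable borel"
  shows "(LINT x|lborel. f (mirror 3 0 x)) = (LINT x|lborel. f x)"
proof -
  have m: "mirror 3 0 \<in> borel_measurable borel"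
    by (rule borel_measurable_continuous_onI) (rule mirror_continuous)
  have "(LINT x|lborel. f x) = (LINT x|distr lborel borel (mirror 3 0). f x)" by (simp add: lborel_mirror0)
  also have "\<dots> = (LINT x|lborel. f (mirror 3 0 x))" by (rule integral_distr) (use m assms in auto)
  finally show ?thesis by simp
qed

lemma axis2_coord_sq:
  "axis2 UNIV (\<lambda>x. (x$3)\<^sup>2) (\<lambda>i x. if i = 3 then 2 * x$3 else 0) (\<lambda>i x. if i = 3 then 2 else 0)"
  unfolding axis2_def
proof (intro ballI allI conjI)
  fix x :: "real^3" and i :: 3
  show "((\<lambda>t. ((x + t *\<^sub>R axis i 1)$3)\<^sup>2) has_vector_derivative (if i = 3 then 2 * x$3 else 0)) (at 0)"
  proof (cases "i = 3")
    case True
    have "((\<lambda>t. (x$3 + t)\<^sup>2) has_real_derivative 2 * x$3) (at 0)" by (rule derivative_eq_intros refl | simp)+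
    then show ?thesis using True by (simp add: has_real_derivative_iff_has_vector_derivative)
  qed (simp add: axis_def)
  show "((\<lambda>t. if i = 3 then 2 * (x + t *\<^sub>R axis i 1)$3 else 0) has_vector_derivative (if i = 3 then 2 else 0)) (at 0)"
  proof (cases "i = 3")
    case True
    have "((\<lambda>t. 2 * (x$3 + t)) has_real_derivative 2) (at 0)" by (rule derivative_eq_intros refl | simp)+
    then show ?thesis using True by (simp add: has_real_derivative_iff_has_vector_derivative)
  qed simp
qed

lemma slab_cutoff_test_fn:
  assumes "cutoff Y Y' Y''"
  shows "test_fn (\<lambda>x. complex_of_real (1 - Y ((x$3)\<^sup>2)))
    (\<lambda>i x. (if i = 3 then 2 * x$3 else 0) *\<^sub>R complex_of_real (- Y' ((x$3)\<^sup>2)))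
    (\<lambda>i x. (if i = 3 then 2 * x$3 else 0)\<^sup>2 *\<^sub>R complex_of_real (- Y'' ((x$3)\<^sup>2)) + (if i = 3 then 2 else 0) *\<^sub>R complex_of_real (- Y' ((x$3)\<^sup>2)))"
proof (rule test_fn_comp[OF axis2_coord_sq, of "\<lambda>q. complex_of_real (1 - Y q)" "\<lambda>q. complex_of_real (- Y' q)" "\<lambda>q. complex_of_real (- Y'' q)"])
  show "((\<lambda>q. complex_of_real (1 - Y q)) has_vector_derivative complex_of_real (- Y' q)) (at q)" for q
    using assms by (intro has_vector_derivative_of_real) (auto simp: cutoff_def has_real_derivative_iff_has_vector_derivative[symmetric] intro!: derivative_eq_intros)
  show "((\<lambda>q. complex_of_real (- Y' q)) has_vector_derivative complex_of_real (- Y'' q)) (at q)" for q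
    using assms by (intro has_vector_derivative_of_real) (auto simp: cutoff_def has_real_derivative_iff_has_vector_derivative[symmetric] intro!: derivative_eq_intros)
  show "continuous_on {0..} (\<lambda>q. complex_of_real (- Y'' q))"
    by (intro continuous_intros continuous_on_subset[OF cutoff_cont(3)[OF assms]]) auto
  show "continuous_on UNIV (\<lambda>x::real^3. if i = 3 then 2 * x$3 else 0)" for i :: 3
    by (cases "i = 3") (auto intro!: continuous_intros)
qed (auto intro!: continuous_intros)

lemma sum_only_3:
  fixes f g :: "3 \<Rightarrow> complex"
  assumes "\<And>i. i \<noteq> 3 \<Longrightarrow> f i = 0"
  shows "(\<Sum>i\<in>UNIV. f i) = f 3"
  using sum.mono_neutral_right[of UNIV "{3::3}" f] assms by auto

lemma slab_measure:
  assumes "\<rho> > 0" "\<epsilon> > 0"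
  shows "emeasure lborel {x::real^3. norm x \<le> \<rho> \<and> \<bar>x$3\<bar> \<le> 2 * \<epsilon>} < \<infinity>"
    "measure lborel {x::real^3. norm x \<le> \<rho> \<and> \<bar>x$3\<bar> \<le> 2 * \<epsilon>} \<le> 16 * \<rho>\<^sup>2 * \<epsilon>"
proof -
  let ?S = "{x::real^3. norm x \<le> \<rho> \<and> \<bar>x$3\<bar> \<le> 2 * \<epsilon>}"
  have "bounded ?S" by (rule bounded_subset[of "cball 0 \<rho>"]) auto
  then show "emeasure lborel ?S < \<infinity>" by (rule emeasure_bounded_finite)
  define b :: "real^3" where "b = (\<chi> i. if i = 3 then 2 * \<epsilon> else \<rho>)"
  have bp: "0 < b$i" for i using assms by (simp add: b_def)
  have "?S \<subseteq> cbox (-b) b"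
  proof
    fix x assume "x \<in> ?S"
    then have "\<bar>x$i\<bar> \<le> b$i" for i using component_le_norm_cart[of x i] by (auto simp: b_def)
    then show "x \<in> cbox (-b) b" by (auto simp: mem_box_cart abs_le_iff minus_le_iff)
  qed
  then have "measure lborel ?S \<le> measure lborel (cbox (-b) b)"
    by (intro measure_mono_fmeasurable) (auto intro!: closed_Collect_conj closed_Collect_le continuous_intros borel_closed)
  also have "\<dots> = (\<Prod>i\<in>UNIV. b$i - (-b)$i)"
    using bp by (intro content_cbox_cart) (auto simp: interval_ne_empty_cart intro: order_trans[OF _ less_imp_le] less_imp_le)
  also have "\<dots> = (\<Prod>i\<in>UNIV. 2 * b$i)" by simp
  also have "\<dots> = 16 * \<rho>\<^sup>2 * \<epsilon>"
    unfolding UNIV_3 by (simp add: b_def power2_eq_square)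
  finally show "measure lborel ?S \<le> 16 * \<rho>\<^sup>2 * \<epsilon>" .
qed

text \<open>The odd part of a test function vanishes on the plane, and at a linear rate. This
  compensates one of the two powers of 1 / \<epsilon> produced by second derivatives of a cutoff in
  a slab of thickness \<epsilon>.\<close>

lemma odd_difference_bound:
  fixes \<phi> :: "real^3 \<Rightarrow> complex"
  assumes "axis2 UNIV \<phi> G H" "\<And>x. norm (G 3 x) \<le> M"
  shows "norm (\<phi> x - \<phi> (mirror 3 0 x)) \<le> 2 * M * \<bar>x$3\<bar>"
proof -
  have "norm (\<phi> (x + 0 *\<^sub>R axis 3 1) - \<phi> (x + (- 2 * x$3) *\<^sub>R axis 3 1)) \<le> M * norm (0 - (- 2 * x$3))"
  proof (rule differentiable_bound[where S=UNIV and f'="\<lambda>s t. t *\<^sub>R G 3 (x + s *\<^sub>R axis 3 1)" and f="\<lambda>t. \<phi> (x + t *\<^sub>R axis 3 1)"])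
    show "((\<lambda>t. \<phi> (x + t *\<^sub>R axis 3 1)) has_derivative (\<lambda>t. t *\<^sub>R G 3 (x + s *\<^sub>R axis 3 1))) (at s within UNIV)" for s
      using axis2_D1[OF assms(1) UNIV_I, where x=x and t=s and i=3] by (simp add: has_vector_derivative_def)
    show "onorm (\<lambda>t. t *\<^sub>R G 3 (x + s *\<^sub>R axis 3 1)) \<le> M" for s
      using assms(2) by (simp add: onorm_scaleR_left onorm_id)
  qed auto
  then show ?thesis by (simp add: mirror0 abs_mult mult.commute mult.left_commute)
qed

text \<open>Since \<open>V\<close> is odd, only the odd part of a test function matters. Multiplied
  by a cutoff that vanishes near the plane it becomes admissible off the plane. The error terms are
  O(1 / \<epsilon>) on a slab of volume O(\<epsilon>), and \<open>V\<close> tends to 0 uniformly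
  there, so they disappear in the limit; no normal derivative of \<open>V\<close> at the plane is
  involved.\<close>

theorem odd_reflection_weak_helm:
  assumes V: "continuous_on {x. R < norm x} V" and odd: "\<And>x. R < norm x \<Longrightarrow> V (mirror 3 0 x) = - V x"
    and helm: "helm k {x. R < norm x \<and> x$3 \<noteq> 0} V"
  shows "weak_helm k {x. R < norm x} V"
  unfolding weak_helm_def
proof (intro conjI allI impI)
  show "continuous_on {x. R < norm x} V" by fact
  let ?m = "mirror 3 0"
  let ?S = "{x::real^3. R < norm x \<and> x$3 \<noteq> 0}"
  have oS: "open ?S" by (intro open_Collect_conj open_Collect_less open_Collect_neq continuous_intros)
  have weak: "weak_helm k ?S V" by (rule helm_imp_weak_helm[OF helm oS])
  fix K \<phi> G H assume K: "compact K" "K \<subseteq> {x. R < norm x}" and t: "test_fn \<phi> G H" and z: "\<forall>x. x \<notin> K \<longrightarrow> \<phi> x = 0"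
  have ax: "axis2 UNIV \<phi> G H" using t by (simp add: test_fn_def)
  \<comment> \<open>The support is made symmetric, so that the truncation of \<open>V\<close> to it
    is still odd.\<close>
  define K2 where "K2 = K \<union> ?m ` K"
  have K2: "compact K2" unfolding K2_def by (intro compact_Un K compact_continuous_image mirror_continuous)
  have K2E: "K2 \<subseteq> {x. R < norm x}" using K(2) by (auto simp: K2_def norm_mirror0)
  have mK2: "?m x \<in> K2 \<longleftrightarrow> x \<in> K2" for x
    by (auto simp: K2_def mirror_mirror image_iff) (metis mirror_mirror)+
  define L where "L x = (\<Sum>i\<in>UNIV. H i x) + complex_of_real (k\<^sup>2) * \<phi> x" for x
  have Gz: "G i x = 0" and Hz: "H i x = 0" if "x \<notin> K" for i x
    using axis2_zero_outside[OF ax compact_imp_closed[OF K(1)] _ that] z by blast+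
  have Lz: "L x = 0" if "x \<notin> K" for x using Hz[OF that] z that by (simp add: L_def)
  have Lc: "continuous_on UNIV L" unfolding L_def using t by (intro continuous_intros) (auto simp: test_fn_def)
  define \<psi> where "\<psi> x = \<phi> x - \<phi> (?m x)" for x
  define G\<psi> where "G\<psi> i x = G i x - (if i = 3 then -1 else 1) *\<^sub>R G i (?m x)" for i x
  define H\<psi> where "H\<psi> i x = H i x - H i (?m x)" for i x
  define L\<psi> where "L\<psi> x = L x - L (?m x)" for x
  have t\<psi>: "test_fn \<psi> G\<psi> H\<psi>" unfolding \<psi>_def G\<psi>_def H\<psi>_def by (rule test_fn_diff[OF t test_fn_mirror[OF t]])
  have L\<psi>: "L\<psi> x = (\<Sum>i\<in>UNIV. H\<psi> i x) + complex_of_real (k\<^sup>2) * \<psi> x" for x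
    by (simp add: L\<psi>_def L_def H\<psi>_def \<psi>_def sum_subtractf algebra_simps)
  have mz: "x \<notin> K2 \<Longrightarrow> x \<notin> K \<and> ?m x \<notin> K" for x using mK2[of x] by (auto simp: K2_def)
  have Lmc: "continuous_on UNIV (\<lambda>x. L (?m x))" by (rule continuous_on_compose2[OF Lc mirror_continuous]) simp
  define W where "W x = indicator K2 x *\<^sub>R V x" for x
  have Vc2: "continuous_on K2 V" using V K2E continuous_on_subset by blast
  have W: "bcs W" unfolding W_def by (intro bcs_indicator Vc2 K2)
  then obtain MW where MW: "\<And>x. norm (W x) \<le> MW" by (auto simp: bcs_def)
  have Wodd: "W (?m x) = - W x" for x
    using mK2[of x] odd[of x] K2E by (cases "x \<in> K2") (auto simp: W_def)
  have bL: "bcs L" by (rule bcs_continuous[OF Lc K(1) Lz])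
  have bLm: "bcs (\<lambda>x. L (?m x))" by (rule bcs_continuous[OF Lmc K2]) (use Lz mz in auto)
  define I where "I = (LINT x|lborel. W x * L x)"
  have I1: "(LINT x|lborel. indicator K x *\<^sub>R (V x * ((\<Sum>i\<in>UNIV. H i x) + complex_of_real (k\<^sup>2) * \<phi> x))) = I"
    unfolding I_def L_def[symmetric]
    by (rule Bochner_Integration.integral_cong) (use Lz in \<open>auto simp: W_def indicator_def K2_def\<close>)
  \<comment> \<open>The reflected half of the test function contributes the same integral a second
    time, by oddness of \<open>W\<close> and invariance of the measure.\<close>
  have I2: "(LINT x|lborel. W x * L\<psi> x) = 2 * I"
  proof -
    have "(LINT x|lborel. W (?m x) * L (?m (?m x))) = (LINT x|lborel. W x * L (?m x))"
      using integral_mirror0[of "\<lambda>x. W x * L (?m x)"] bcs_mult[OF W bLm] by (simp add: bcs_def)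
    then have "(LINT x|lborel. W x * L (?m x)) = - I" by (simp add: Wodd mirror_mirror I_def)
    moreover have "(LINT x|lborel. W x * L\<psi> x) = (LINT x|lborel. W x * L x) - (LINT x|lborel. W x * L (?m x))"
      unfolding L\<psi>_def right_diff_distrib
      by (intro Bochner_Integration.integral_diff bcs_integrable bcs_mult W bL bLm)
    ultimately show ?thesis by (simp add: I_def)
  qed
  obtain cp where cp: "cp > 0" "\<And>a b. a < b \<Longrightarrow> \<exists>X X' X''. plateau cp a b X X' X''" using plateau_exists by blast
  define \<epsilon> where "\<epsilon> n = inverse (real (Suc n))" for n
  have \<epsilon>: "\<epsilon> n > 0" for n by (simp add: \<epsilon>_def)
  have \<epsilon>0: "\<epsilon> \<longlonglongrightarrow> 0" unfolding \<epsilon>_def by (rule LIMSEQ_inverse_real_of_nat)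
  have "\<forall>n. \<exists>X X' X''. plateau cp ((\<epsilon> n)\<^sup>2) (4 * (\<epsilon> n)\<^sup>2) X X' X''"
  proof
    fix n
    have "(\<epsilon> n)\<^sup>2 < 4 * (\<epsilon> n)\<^sup>2" using \<epsilon>[of n] by simp
    then show "\<exists>X X' X''. plateau cp ((\<epsilon> n)\<^sup>2) (4 * (\<epsilon> n)\<^sup>2) X X' X''" by (rule cp(2))
  qed
  then obtain Y Y' Y'' where pl: "\<And>n. plateau cp ((\<epsilon> n)\<^sup>2) (4 * (\<epsilon> n)\<^sup>2) (Y n) (Y' n) (Y'' n)" by metis
  have Yc: "cutoff (Y n) (Y' n) (Y'' n)" for n using pl[of n] by (simp add: plateau_def)
  define \<theta> where "\<theta> n x = complex_of_real (1 - Y n ((x$3)\<^sup>2))" for n and x :: "real^3"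
  define \<theta>1 where "\<theta>1 n x = (2 * x$3) *\<^sub>R complex_of_real (- Y' n ((x$3)\<^sup>2))" for n and x :: "real^3"
  define \<theta>2 where "\<theta>2 n x = (2 * x$3)\<^sup>2 *\<^sub>R complex_of_real (- Y'' n ((x$3)\<^sup>2)) + 2 *\<^sub>R complex_of_real (- Y' n ((x$3)\<^sup>2))" for n and x :: "real^3"
  \<comment> \<open>The terms in which the slab cutoff is differentiated; only derivatives along the
    third axis occur.\<close>
  define r where "r n x = 2 * (\<theta>1 n x * G\<psi> 3 x) + \<theta>2 n x * \<psi> x" for n x
  have small: "\<theta> n x = 0 \<and> \<theta>1 n x = 0 \<and> \<theta>2 n x = 0" if "\<bar>x$3\<bar> \<le> \<epsilon> n" for n and x :: "real^3"
  proof -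
    have "(x$3)\<^sup>2 \<le> (\<epsilon> n)\<^sup>2" using power_mono[OF that, of 2] by simp
    then show ?thesis using pl[of n] by (simp add: plateau_def \<theta>_def \<theta>1_def \<theta>2_def)
  qed
  have big: "\<theta> n x = 1 \<and> \<theta>1 n x = 0 \<and> \<theta>2 n x = 0" if "2 * \<epsilon> n \<le> \<bar>x$3\<bar>" for n and x :: "real^3"
  proof -
    have "4 * (\<epsilon> n)\<^sup>2 \<le> (x$3)\<^sup>2" using power_mono[OF that, of 2] \<epsilon>[of n] by (simp add: power_mult_distrib)
    then show ?thesis using pl[of n] by (simp add: plateau_def \<theta>_def \<theta>1_def \<theta>2_def)
  qed
  have \<theta>c: "continuous_on UNIV (\<theta> n)" "continuous_on UNIV (\<theta>1 n)" "continuous_on UNIV (\<theta>2 n)" for n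
  proof -
    have q: "continuous_on UNIV (\<lambda>x::real^3. (x$3)\<^sup>2)" by (intro continuous_intros)
    note c = continuous_on_compose2[OF cutoff_cont(1)[OF Yc] q] continuous_on_compose2[OF cutoff_cont(2)[OF Yc] q] continuous_on_compose2[OF cutoff_cont(3)[OF Yc] q]
    show "continuous_on UNIV (\<theta> n)" "continuous_on UNIV (\<theta>1 n)" "continuous_on UNIV (\<theta>2 n)"
      unfolding \<theta>_def \<theta>1_def \<theta>2_def by (intro continuous_intros c subset_UNIV)+
  qed
  have \<psi>c: "continuous_on UNIV \<psi>" "continuous_on UNIV (G\<psi> 3)" "continuous_on UNIV L\<psi>"
    using t\<psi> Lc Lmc by (auto simp: test_fn_def L\<psi>_def intro!: continuous_intros)
  have \<psi>z: "\<psi> x = 0" "G\<psi> i x = 0" "L\<psi> x = 0" if "x \<notin> K2" for x i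
    using mz[OF that] z Gz Lz by (auto simp: \<psi>_def G\<psi>_def L\<psi>_def)
  \<comment> \<open>The product of slab cutoff and odd test function is supported off the plane,
    where the equation is already known in weak form.\<close>
  have AB: "(LINT x|lborel. W x * (\<theta> n x * L\<psi> x)) + (LINT x|lborel. W x * r n x) = 0" for n
  proof -
    define Ke where "Ke = K2 \<inter> {x::real^3. \<epsilon> n \<le> \<bar>x$3\<bar>}"
    have Ke: "compact Ke" unfolding Ke_def by (intro compact_Int_closed K2 closed_Collect_le continuous_intros)
    have KeS: "Ke \<subseteq> ?S" using K2E \<epsilon>[of n] by (auto simp: Ke_def)
    note tt = test_fn_mult[OF slab_cutoff_test_fn[OF Yc[of n]] t\<psi>]
    have "(LINT x|lborel. indicator Ke x *\<^sub>R (V x * ((\<Sum>i\<in>UNIV.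
       complex_of_real (1 - Y n ((x$3)\<^sup>2)) * H\<psi> i x + 2 * ((if i = 3 then 2 * x$3 else 0) *\<^sub>R complex_of_real (- Y' n ((x$3)\<^sup>2)) * G\<psi> i x) +
       ((if i = 3 then 2 * x$3 else 0)\<^sup>2 *\<^sub>R complex_of_real (- Y'' n ((x$3)\<^sup>2)) + (if i = 3 then 2 else 0) *\<^sub>R complex_of_real (- Y' n ((x$3)\<^sup>2))) * \<psi> x)
       + complex_of_real (k\<^sup>2) * (complex_of_real (1 - Y n ((x$3)\<^sup>2)) * \<psi> x)))) = 0"
    proof (rule weak[unfolded weak_helm_def, THEN conjunct2, rule_format, OF Ke KeS tt])
      fix x assume "x \<notin> Ke"
      then show "complex_of_real (1 - Y n ((x$3)\<^sup>2)) * \<psi> x = 0"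
        using \<psi>z(1)[of x] small[of x n] by (auto simp: Ke_def \<theta>_def)
    qed
    moreover have "(\<Sum>i\<in>UNIV.
       complex_of_real (1 - Y n ((x$3)\<^sup>2)) * H\<psi> i x + 2 * ((if i = 3 then 2 * x$3 else 0) *\<^sub>R complex_of_real (- Y' n ((x$3)\<^sup>2)) * G\<psi> i x) +
       ((if i = 3 then 2 * x$3 else 0)\<^sup>2 *\<^sub>R complex_of_real (- Y'' n ((x$3)\<^sup>2)) + (if i = 3 then 2 else 0) *\<^sub>R complex_of_real (- Y' n ((x$3)\<^sup>2))) * \<psi> x)
       + complex_of_real (k\<^sup>2) * (complex_of_real (1 - Y n ((x$3)\<^sup>2)) * \<psi> x) = \<theta> n x * L\<psi> x + r n x" for x :: "real^3"
    proof -
      have s1: "(\<Sum>i\<in>UNIV. 2 * ((if i = 3 then 2 * x$3 else 0) *\<^sub>R complex_of_real (- Y' n ((x$3)\<^sup>2)) * G\<psi> i x)) = 2 * (\<theta>1 n x * G\<psi> 3 x)"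
        by (subst sum_only_3) (auto simp: \<theta>1_def)
      have s2: "(\<Sum>i\<in>UNIV. ((if i = (3::3) then 2 * x$3 else 0)\<^sup>2 *\<^sub>R complex_of_real (- Y'' n ((x$3)\<^sup>2)) + (if i = 3 then 2 else 0) *\<^sub>R complex_of_real (- Y' n ((x$3)\<^sup>2))) * \<psi> x) = \<theta>2 n x * \<psi> x"
        by (subst sum_only_3) (auto simp: \<theta>2_def)
      have s3: "(\<Sum>i\<in>UNIV. complex_of_real (1 - Y n ((x$3)\<^sup>2)) * H\<psi> i x) = \<theta> n x * (\<Sum>i\<in>UNIV. H\<psi> i x)"
        by (simp add: \<theta>_def sum_distrib_left)
      show ?thesis unfolding sum.distrib s1 s2 s3 L\<psi> r_def \<theta>_def by (simp add: algebra_simps)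
    qed
    moreover have "indicator Ke x *\<^sub>R (V x * (\<theta> n x * L\<psi> x + r n x)) = W x * (\<theta> n x * L\<psi> x) + W x * r n x" for x
    proof (cases "x \<in> Ke")
      case True then show ?thesis by (simp add: W_def Ke_def algebra_simps)
    next
      case False
      then show ?thesis using small[of x n] by (auto simp: W_def Ke_def r_def)
    qed
    ultimately have "(LINT x|lborel. W x * (\<theta> n x * L\<psi> x) + W x * r n x) = 0" by simp
    moreover have "bcs (\<lambda>x. \<theta> n x * L\<psi> x)"
      by (rule bcs_continuous[OF _ K2]) (use \<psi>z \<theta>c \<psi>c in \<open>auto intro!: continuous_intros\<close>)
    moreover have "bcs (r n)" unfolding r_def
      by (rule bcs_continuous[OF _ K2]) (use \<psi>z \<theta>c \<psi>c in \<open>auto intro!: continuous_intros\<close>)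
    ultimately show ?thesis using W by (simp add: Bochner_Integration.integral_add bcs_integrable bcs_mult)
  qed
  have "bcs L\<psi>" by (rule bcs_continuous[OF \<psi>c(3) K2 \<psi>z(3)])
  then obtain BL where BL: "\<And>x. norm (L\<psi> x) \<le> BL" by (auto simp: bcs_def)
  have MW0: "MW \<ge> 0" using MW norm_ge_zero order_trans by blast
  have A: "(\<lambda>n. LINT x|lborel. W x * (\<theta> n x * L\<psi> x)) \<longlonglongrightarrow> (LINT x|lborel. W x * L\<psi> x)"
  proof (rule compact_dominated_convergence[where K=K2 and M="MW * BL"])
    show "(\<lambda>x. W x * (\<theta> n x * L\<psi> x)) \<in> borel_measurable borel" for n
    proof -
      have "bcs (\<lambda>x. \<theta> n x * L\<psi> x)"
        by (rule bcs_continuous[OF _ K2]) (use \<psi>z \<theta>c \<psi>c in \<open>auto intro!: continuous_intros\<close>)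
      from bcs_mult[OF W this] show ?thesis by (simp add: bcs_def)
    qed
    show "norm (W x * (\<theta> n x * L\<psi> x)) \<le> MW * BL" for n x
    proof -
      have "norm (\<theta> n x) \<le> 1" using pl[of n] by (auto simp: plateau_def \<theta>_def simp del: of_real_diff)
      then have "norm (\<theta> n x) * norm (L\<psi> x) \<le> 1 * BL" using BL[of x] by (intro mult_mono) auto
      then show ?thesis unfolding norm_mult using MW[of x] MW0 by (intro mult_mono) auto
    qed
    show "(\<lambda>n. W x * (\<theta> n x * L\<psi> x)) \<longlonglongrightarrow> W x * L\<psi> x" for x
    proof (cases "x$3 = 0")
      case True
      then have "W x = 0" using Wodd[of x] by (simp add: mirror0)
      then show ?thesis by simp
    next
      case False
      have "\<forall>\<^sub>F n in sequentially. \<epsilon> n < \<bar>x$3\<bar> / 2" using \<epsilon>0 by (rule order_tendstoD) (use False in auto)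
      then have "\<forall>\<^sub>F n in sequentially. W x * (\<theta> n x * L\<psi> x) = W x * L\<psi> x"
        by eventually_elim (use big in auto)
      then show ?thesis by (rule tendsto_eventually)
    qed
  qed (use K2 in \<open>auto simp: W_def\<close>)
  have "bcs (G 3)" by (rule bcs_continuous[OF _ K(1)]) (use t Gz in \<open>auto simp: test_fn_def\<close>)
  then obtain M1 where M1: "\<And>x. norm (G 3 x) \<le> M1" by (auto simp: bcs_def)
  have M10: "M1 \<ge> 0" using M1 norm_ge_zero order_trans by blast
  obtain \<rho>0 where "\<And>x. x \<in> K2 \<Longrightarrow> norm x \<le> \<rho>0" using compact_imp_bounded[OF K2] by (auto simp: bounded_iff)
  then obtain \<rho> where \<rho>: "\<rho> > 0" "\<And>x. x \<in> K2 \<Longrightarrow> norm x \<le> \<rho>" by (metis le_max_iff_disj max.strict_coboundedI2 zero_less_one)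
  \<comment> \<open>The orders are 1 / \<epsilon> times a bounded gradient, and \<epsilon>^(-2)
    times an odd function of size \<epsilon>.\<close>
  have rb: "norm (r n x) \<le> 20 * cp * M1 / \<epsilon> n" if "\<bar>x$3\<bar> \<le> 2 * \<epsilon> n" for n and x :: "real^3"
  proof -
    have e: "\<epsilon> n > 0" by (rule \<epsilon>)
    have e3: "4 * (\<epsilon> n)\<^sup>2 - (\<epsilon> n)\<^sup>2 = 3 * (\<epsilon> n)\<^sup>2" by simp
    have Y1: "\<bar>Y' n q\<bar> \<le> cp / (3 * (\<epsilon> n)\<^sup>2)" and Y2: "\<bar>Y'' n q\<bar> \<le> cp / (3 * (\<epsilon> n)\<^sup>2)\<^sup>2" for q
      using pl[of n] unfolding plateau_def e3 by auto
    have "norm (\<theta>1 n x) = (2 * \<bar>x$3\<bar>) * \<bar>Y' n ((x$3)\<^sup>2)\<bar>" by (simp add: \<theta>1_def abs_mult)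
    also have "\<dots> \<le> (2 * (2 * \<epsilon> n)) * (cp / (3 * (\<epsilon> n)\<^sup>2))" using that Y1 e by (intro mult_mono) auto
    also have "\<dots> \<le> 2 * cp / \<epsilon> n" using e cp(1) by (simp add: field_simps power2_eq_square)
    finally have t1: "norm (\<theta>1 n x) \<le> 2 * cp / \<epsilon> n" .
    have "norm (\<theta>2 n x) \<le> norm ((2 * x$3)\<^sup>2 *\<^sub>R complex_of_real (- Y'' n ((x$3)\<^sup>2))) + norm (2 *\<^sub>R complex_of_real (- Y' n ((x$3)\<^sup>2)))"
      unfolding \<theta>2_def by (rule norm_triangle_ineq)
    also have "\<dots> = (2 * \<bar>x$3\<bar>)\<^sup>2 * \<bar>Y'' n ((x$3)\<^sup>2)\<bar> + 2 * \<bar>Y' n ((x$3)\<^sup>2)\<bar>"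
      by (simp add: power_mult_distrib)
    also have "\<dots> \<le> (2 * (2 * \<epsilon> n))\<^sup>2 * (cp / (3 * (\<epsilon> n)\<^sup>2)\<^sup>2) + 2 * (cp / (3 * (\<epsilon> n)\<^sup>2))"
      using that Y1 Y2 by (intro add_mono mult_mono power_mono) auto
    also have "\<dots> = 22/9 * (cp / (\<epsilon> n)\<^sup>2)" using e by (simp add: field_simps power2_eq_square)
    also have "\<dots> \<le> 3 * (cp / (\<epsilon> n)\<^sup>2)" using cp(1) by (intro mult_right_mono) auto
    finally have t2: "norm (\<theta>2 n x) \<le> 3 * (cp / (\<epsilon> n)\<^sup>2)" .
    have g: "norm (G\<psi> 3 x) \<le> 2 * M1"
      using norm_triangle_ineq[of "G 3 x" "G 3 (?m x)"] M1[of x] M1[of "?m x"] by (simp add: G\<psi>_def)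
    have "norm (\<psi> x) \<le> 2 * M1 * \<bar>x$3\<bar>" unfolding \<psi>_def by (rule odd_difference_bound[OF ax M1])
    also have "\<dots> \<le> 2 * M1 * (2 * \<epsilon> n)" using that M10 by (intro mult_left_mono) auto
    finally have p: "norm (\<psi> x) \<le> 2 * M1 * (2 * \<epsilon> n)" .
    have "norm (r n x) \<le> 2 * (norm (\<theta>1 n x) * norm (G\<psi> 3 x)) + norm (\<theta>2 n x) * norm (\<psi> x)"
      unfolding r_def by (rule order_trans[OF norm_triangle_ineq]) (simp add: norm_mult)
    also have "\<dots> \<le> 2 * ((2 * cp / \<epsilon> n) * (2 * M1)) + (3 * (cp / (\<epsilon> n)\<^sup>2)) * (2 * M1 * (2 * \<epsilon> n))"
      using t1 t2 g p cp(1) e M10 by (intro add_mono mult_left_mono mult_mono) auto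
    also have "\<dots> = 20 * cp * M1 / \<epsilon> n" using e by (simp add: field_simps power2_eq_square)
    finally show ?thesis .
  qed
  have B: "(\<lambda>n. LINT x|lborel. W x * r n x) \<longlonglongrightarrow> 0"
  proof (rule LIMSEQ_I)
    fix e :: real assume "e > 0"
    \<comment> \<open>320 = 16 * 20 is the constant of the slab volume times that of the bound on
      \<open>r n\<close>.\<close>
    define D where "D = 320 * cp * M1 * \<rho>\<^sup>2"
    have D0: "D \<ge> 0" using cp(1) M10 by (simp add: D_def)
    define e' where "e' = e / (D + 1)"
    have e': "e' > 0" "e' * D < e" using \<open>e > 0\<close> D0 by (auto simp: e'_def field_simps)
    have "uniformly_continuous_on K2 V" by (rule compact_uniformly_continuous[OF Vc2 K2])
    then obtain d where d: "d > 0" "\<And>x y. x \<in> K2 \<Longrightarrow> y \<in> K2 \<Longrightarrow> dist y x < d \<Longrightarrow> dist (V y) (V x) < e'"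
      unfolding uniformly_continuous_on_def using e'(1) by metis
    have "\<forall>\<^sub>F n in sequentially. \<epsilon> n < d / 5" using \<epsilon>0 by (rule order_tendstoD) (use d in auto)
    then obtain n0 where n0: "\<And>n. n \<ge> n0 \<Longrightarrow> \<epsilon> n < d / 5" by (auto simp: eventually_sequentially)
    show "\<exists>no. \<forall>n\<ge>no. norm ((LINT x|lborel. W x * r n x) - 0) < e"
    proof (intro exI[of _ n0] allI impI)
      fix n assume n: "n0 \<le> n"
      let ?T = "{x::real^3. norm x \<le> \<rho> \<and> \<bar>x$3\<bar> \<le> 2 * \<epsilon> n}"
      have bT: "closed ?T" by (intro closed_Collect_conj closed_Collect_le continuous_intros)
      \<comment> \<open>A point of the slab and its mirror image are at most 4 \<epsilon> apart and
        carry opposite values of \<open>V\<close>, so uniform continuity makes the value itself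
        small.\<close>
      have Wb: "norm (W x) \<le> e'" if "\<bar>x$3\<bar> \<le> 2 * \<epsilon> n" for x :: "real^3"
      proof (cases "x \<in> K2")
        case True
        have "dist (?m x) x = 2 * \<bar>x$3\<bar>" by (simp add: mirror0 dist_norm norm_axis_1 abs_mult)
        also have "\<dots> < d" using that n0[OF n] d(1) by linarith
        finally have "dist (V (?m x)) (V x) < e'" using True mK2 d(2) by blast
        moreover have "V (?m x) = - V x" using True K2E odd by auto
        moreover have "norm (- V x - V x) = 2 * norm (V x)"
        proof -
          have "- V x - V x = - (2 * V x)" by simp
          then show ?thesis by (simp only: norm_minus_cancel norm_mult norm_numeral)
        qed
        ultimately have "2 * norm (V x) < e'" by (simp add: dist_norm)
        moreover have "norm (W x) = norm (V x)" using True by (simp add: W_def)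
        ultimately show ?thesis using norm_ge_zero[of "V x"] by linarith
      qed (use e' in \<open>simp add: W_def\<close>)
      have br: "bcs (r n)" unfolding r_def
        by (rule bcs_continuous[OF _ K2]) (use \<psi>z \<theta>c \<psi>c in \<open>auto intro!: continuous_intros\<close>)
      have "norm (LINT x|lborel. W x * r n x) \<le> (LINT x|lborel. indicator ?T x *\<^sub>R (e' * (20 * cp * M1 / \<epsilon> n)))"
      proof (rule Bochner_Integration.integral_norm_bound_integral)
        show "integrable lborel (\<lambda>x. W x * r n x)" by (intro bcs_integrable bcs_mult W br)
        show "integrable lborel (\<lambda>x. indicator ?T x *\<^sub>R (e' * (20 * cp * M1 / \<epsilon> n)))"
          using slab_measure(1)[OF \<rho>(1) \<epsilon>[of n]] bT by (intro integrable_scaleR_left integrable_real_indicator) auto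
        fix x
        show "norm (W x * r n x) \<le> indicator ?T x *\<^sub>R (e' * (20 * cp * M1 / \<epsilon> n))"
        proof (cases "x \<in> ?T")
          case True
          then have "norm (W x * r n x) \<le> e' * (20 * cp * M1 / \<epsilon> n)"
            unfolding norm_mult using Wb[of x] rb[of x n] e'(1) by (intro mult_mono) auto
          then show ?thesis using True by simp
        next
          case False
          then have "W x * r n x = 0" using \<rho>(2)[of x] big[of n x] by (auto simp: W_def r_def indicator_def)
          then show ?thesis using False by simp
        qed
      qed
      also have "\<dots> = measure lborel ?T * (e' * (20 * cp * M1 / \<epsilon> n))" using bT by simp
      also have "\<dots> \<le> (16 * \<rho>\<^sup>2 * \<epsilon> n) * (e' * (20 * cp * M1 / \<epsilon> n))"
        using slab_measure(2)[OF \<rho>(1) \<epsilon>[of n]] e'(1) cp(1) M10 \<epsilon>[of n] by (intro mult_right_mono) auto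
      also have "\<dots> = e' * D" using \<epsilon>[of n] by (simp add: D_def field_simps)
      also have "\<dots> < e" by (rule e')
      finally show "norm ((LINT x|lborel. W x * r n x) - 0) < e" by simp
    qed
  qed
  have "(LINT x|lborel. W x * L\<psi> x) + 0 = 0"
    using LIMSEQ_unique[OF tendsto_add[OF A B], of 0] AB by simp
  then have "I = 0" using I2 by simp
  then show "(LINT x|lborel. indicator K x *\<^sub>R (V x * ((\<Sum>i\<in>UNIV. H i x) + complex_of_real (k\<^sup>2) * \<phi> x))) = 0"
    using I1 by simp
qed

section \<open>Finite dimension of the Dirichlet solutions on a bounded set\<close>

text \<open>Kato's inequality: the modulus of a solution vanishing on the boundary, extended by zero, is a
  subsolution on the whole space.  The truncation by e keeps the argument away from the boundary.\<close>

lemma modulus_subsolution: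
  fixes W :: "real^3 \<Rightarrow> complex"
  assumes W: "continuous_on UNIV W" "helm k D W" and D: "open D" "bounded D" and zero: "\<And>x. x \<notin> D \<Longrightarrow> W x = 0"
    and t: "test_fn \<phi> G H" and K: "compact K" and z: "\<And>x. x \<notin> K \<Longrightarrow> \<phi> x = 0"
    and f: "\<And>x. \<phi> x = of_real (f x)" "\<And>x. f x \<ge> 0"
  shows "0 \<le> Re (LINT x|lborel. of_real (norm (W x)) * ((\<Sum>i\<in>UNIV. H i x) + complex_of_real (k\<^sup>2) * \<phi> x))"
proof -
  obtain Gu Hu where ax: "axis2 D W Gu Hu"
    and eq: "\<And>x. x \<in> D \<Longrightarrow> (\<Sum>i\<in>UNIV. Hu i x) + complex_of_real (k\<^sup>2) * W x = 0"
    using W(2) by (auto simp: helm_def)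
  have tc: "continuous_on UNIV \<phi>" and \<phi>ax: "axis2 UNIV \<phi> G H" using t by (auto simp: test_fn_def)
  have \<phi>: "bcs \<phi>" by (rule bcs_continuous[OF tc K z])
  then obtain M where M: "\<And>x. norm (\<phi> x) \<le> M" by (auto simp: bcs_def)
  have fM: "f x \<le> M" for x using M[of x] f(2)[of x] unfolding f(1) by simp
  have M0: "M \<ge> 0" using fM[of 0] f(2)[of 0] by linarith
  have cD: "compact (closure D)" using D by simp
  have clz: "W x = 0" if "x \<notin> closure D" for x using that zero closure_subset by blast
  have HS: "bcs (\<lambda>x. \<Sum>i\<in>UNIV. H i x)"
  proof (rule bcs_continuous[OF _ K])
    show "continuous_on UNIV (\<lambda>x. \<Sum>i\<in>UNIV. H i x)" using t by (auto simp: test_fn_def intro!: continuous_intros)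
    show "(\<Sum>i\<in>UNIV. H i x) = 0" if "x \<notin> K" for x
      using axis2_zero_outside(2)[OF \<phi>ax compact_imp_closed[OF K] z that] by simp
  qed
  define aw where "aw x = complex_of_real (norm (W x))" for x
  have aw: "bcs aw" by (rule bcs_continuous[OF _ cD]) (auto simp: aw_def clz intro!: continuous_intros W(1))
  define w where "w e x = complex_of_real (max 0 (norm (W x) - e))" for e x
  have w: "bcs (w e)" if "e > 0" for e
    by (rule bcs_continuous[OF _ cD]) (use that in \<open>auto simp: w_def clz intro!: continuous_intros W(1)\<close>)
  have rint: "integrable lborel (\<lambda>x. norm (W x) * f x)"
  proof -
    have "integrable lborel (\<lambda>x. Re (aw x * \<phi> x))" by (intro integrable_Re bcs_integrable bcs_mult aw \<phi>)
    then show ?thesis by (simp add: aw_def f(1))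
  qed
  have main: "- (k\<^sup>2) * (LINT x|lborel. norm (W x) * f x) \<le> Re (LINT x|lborel. w e x * (\<Sum>i\<in>UNIV. H i x))" if "e > 0" for e
  proof -
    \<comment> \<open>This level set is a compact subset of \<open>D\<close>, since \<open>W\<close>
      vanishes outside \<open>D\<close>; on it the interior estimate bounds the difference
      Laplacians of \<open>W\<close> uniformly.\<close>
    define A where "A = {x. e \<le> norm (W x)}"
    have AD: "A \<subseteq> D" using zero \<open>e > 0\<close> by (force simp: A_def)
    have "closed A" unfolding A_def by (intro closed_Collect_le continuous_intros W(1))
    moreover have "bounded A" using AD D(2) bounded_subset by blast
    ultimately have cA: "compact A" by (simp add: compact_eq_bounded_closed)
    obtain d C K' where d: "d > 0" and C0: "C \<ge> 0" 
      and C: "\<And>x h. x \<in> A \<Longrightarrow> 0 < h \<Longrightarrow> h \<le> d \<Longrightarrow> norm (lapl h W x) \<le> C"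
      using helm_lapl_bound[OF W(2) D(1) cA AD] by metis
    define h where "h n = d / real (Suc n)" for n
    have h: "h \<longlonglongrightarrow> 0" unfolding h_def divide_inverse
      by (rule tendsto_eq_rhs[OF tendsto_mult[OF tendsto_const LIMSEQ_inverse_real_of_nat]]) simp
    have hp: "h n > 0" "h n \<le> d" for n using d by (auto simp: h_def field_simps)
    define s where "s n x = indicator A x *\<^sub>R ((cnj (sgn (W x)) * lapl (h n) W x) * \<phi> x)" for n x
    have WM: "W \<in> borel_measurable borel" by (rule borel_measurable_continuous_onI[OF W(1)])
    have sm: "s n \<in> borel_measurable borel" for n
    proof -
      have [measurable]: "W \<in> borel_measurable borel" "lapl (h n) W \<in> borel_measurable borel" "\<phi> \<in> borel_measurable borel" "A \<in> sets borel"
        using WM lapl_measurable[OF WM] tc \<open>closed A\<close> by (auto intro: borel_measurable_continuous_onI)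
      have [measurable]: "cnj \<in> borel_measurable borel"
        by (intro borel_measurable_continuous_onI continuous_intros)
      have [measurable]: "(\<lambda>x. cnj (sgn (W x))) \<in> borel_measurable borel"
        unfolding sgn_div_norm by measurable
      show ?thesis unfolding s_def by measurable
    qed
    have sb: "norm (s n x) \<le> C * M" for n x
    proof (cases "x \<in> A")
      case True
      have "norm (cnj (sgn (W x))) \<le> 1" by (simp add: norm_sgn)
      then have "norm (cnj (sgn (W x))) * norm (lapl (h n) W x) \<le> 1 * C" using C[OF True hp] by (intro mult_mono) auto
      then show ?thesis using True M[of x] C0 unfolding s_def by (simp add: norm_mult mult_mono)
    qed (use C0 M0 in \<open>simp add: s_def\<close>)
    have sgn: "cnj (sgn z) * z = of_real (norm z)" for z :: complex
    proof (cases "z = 0")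
      case False
      have "cnj z * z = of_real (norm z) * of_real (norm z)"
        by (metis complex_norm_square mult.commute of_real_mult power2_eq_square)
      then show ?thesis using False by (simp add: sgn_eq)
    qed simp
    have lim: "(\<lambda>n. LINT x|lborel. s n x) \<longlonglongrightarrow> (LINT x|lborel. indicator A x *\<^sub>R (- (complex_of_real (k\<^sup>2) * aw x) * \<phi> x))"
    proof (rule compact_dominated_convergence[OF sm sb cA])
      show "(\<lambda>n. s n x) \<longlonglongrightarrow> indicator A x *\<^sub>R (- (complex_of_real (k\<^sup>2) * aw x) * \<phi> x)" for x
      proof (cases "x \<in> A")
        case True
        then have "x \<in> D" using AD by blast
        have l1: "(\<lambda>n. cnj (sgn (W x)) * lapl (h n) W x * \<phi> x) \<longlonglongrightarrow> cnj (sgn (W x)) * (\<Sum>i\<in>UNIV. Hu i x) * \<phi> x"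
          by (intro tendsto_mult tendsto_const lapl_tendsto[OF ax D(1) \<open>x \<in> D\<close> h hp(1)])
        have e1: "(\<Sum>i\<in>UNIV. Hu i x) = - (complex_of_real (k\<^sup>2) * W x)"
          using eq[OF \<open>x \<in> D\<close>] by (simp add: eq_neg_iff_add_eq_0)
        have e2: "cnj (sgn (W x)) * - (complex_of_real (k\<^sup>2) * W x) = - (complex_of_real (k\<^sup>2) * aw x)"
          using sgn[of "W x"] by (simp add: aw_def mult.left_commute)
        show ?thesis using l1[unfolded e1 e2] True by (simp add: s_def)
      qed (simp add: s_def)
    qed (simp add: s_def)
    \<comment> \<open>The truncated modulus is a convex function on the complex plane, and at a
      point \<open>a\<close> with modulus at least \<open>e\<close> the functional z -> Re (cnj (sgn
      a) z) is a subgradient of it.\<close>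
    have conv: "F a + Re (cnj (sgn a) * (b - a)) \<le> F b" if "e \<le> norm a" "F = (\<lambda>z. max 0 (norm z - e))" for a b :: complex and F
    proof -
      have "Re (cnj (sgn a) * b) \<le> norm (cnj (sgn a) * b)" by (rule complex_Re_le_cmod)
      also have "\<dots> \<le> 1 * norm b" unfolding norm_mult by (intro mult_right_mono) (auto simp: norm_sgn)
      finally have "Re (cnj (sgn a) * b) \<le> norm b" by simp
      moreover have "Re (cnj (sgn a) * a) = norm a" by (simp add: sgn)
      ultimately show ?thesis using that by (simp add: right_diff_distrib)
    qed
    have ge: "Re (s n x) \<le> Re (lapl (h n) (w e) x * \<phi> x)" for n x
    proof -
      have L: "Re (lapl (h n) (w e) x * \<phi> x) = Re (lapl (h n) (w e) x) * f x" by (simp add: f(1))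
      define F where "F = (\<lambda>z::complex. max 0 (norm z - e))"
      have wF: "Re (w e y) = F (W y)" for y by (simp add: w_def F_def)
      have Rl: "Re (lapl (h n) (w e) x) = (\<Sum>i\<in>UNIV. F (W (x + h n *\<^sub>R axis i 1)) + F (W (x - h n *\<^sub>R axis i 1)) - 2 * F (W x)) / (h n)\<^sup>2"
        by (simp add: lapl_def wF divide_inverse mult.commute)
      show ?thesis
      proof (cases "x \<in> A")
        case True
        then have a: "e \<le> norm (W x)" by (simp add: A_def)
        have Rw: "Re (cnj (sgn (W x)) * lapl (h n) W x) = (\<Sum>i\<in>UNIV. Re (cnj (sgn (W x)) * (W (x + h n *\<^sub>R axis i 1) - W x)) + Re (cnj (sgn (W x)) * (W (x - h n *\<^sub>R axis i 1) - W x))) / (h n)\<^sup>2"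
        proof -
          define l where "l z = Re (cnj (sgn (W x)) * z)" for z
          have lin: "linear l"
          proof
            show "l (a + b) = l a + l b" for a b unfolding l_def by (simp only: distrib_left plus_complex.sel)
            show "l (c *\<^sub>R a) = c *\<^sub>R l a" for c a unfolding l_def by (simp only: mult_scaleR_right scaleR_complex.sel real_scaleR_def)
          qed
          have "l (lapl (h n) W x) = (\<Sum>i\<in>UNIV. l (W (x + h n *\<^sub>R axis i 1) - W x) + l (W (x - h n *\<^sub>R axis i 1) - W x)) / (h n)\<^sup>2"
            by (simp add: lapl_def linear_cmul[OF lin] linear_sum[OF lin] linear_diff[OF lin] linear_add[OF lin] divide_inverse algebra_simps)
          then show ?thesis by (simp add: l_def)
        qed
        have "Re (cnj (sgn (W x)) * lapl (h n) W x) \<le> Re (lapl (h n) (w e) x)"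
          unfolding Rw Rl
        proof (intro divide_right_mono sum_mono)
          fix i :: 3
          show "Re (cnj (sgn (W x)) * (W (x + h n *\<^sub>R axis i 1) - W x)) + Re (cnj (sgn (W x)) * (W (x - h n *\<^sub>R axis i 1) - W x))
            \<le> F (W (x + h n *\<^sub>R axis i 1)) + F (W (x - h n *\<^sub>R axis i 1)) - 2 * F (W x)"
            using conv[OF a F_def, of "W (x + h n *\<^sub>R axis i 1)"] conv[OF a F_def, of "W (x - h n *\<^sub>R axis i 1)"] by linarith
        qed simp
        then have "Re (cnj (sgn (W x)) * lapl (h n) W x) * f x \<le> Re (lapl (h n) (w e) x) * f x" using f(2) by (rule mult_right_mono)
        moreover have "Re (s n x) = Re (cnj (sgn (W x)) * lapl (h n) W x) * f x" using True by (simp add: s_def f(1))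
        ultimately show ?thesis unfolding L by simp
      next
        \<comment> \<open>Off the level set the truncated modulus takes its minimum 0, so its
          difference Laplacian is nonnegative there.\<close>
        case False
        then have "F (W x) = 0" by (simp add: A_def F_def)
        moreover have "F y \<ge> 0" for y by (simp add: F_def)
        ultimately have "Re (lapl (h n) (w e) x) \<ge> 0" unfolding Rl by (intro divide_nonneg_nonneg sum_nonneg) auto
        then show ?thesis unfolding L using False f(2) by (simp add: s_def)
      qed
    qed
    have sz: "s n x = 0" if "x \<notin> A" for n x using that by (simp add: s_def)
    have bs: "integrable lborel (s n)" for n
      by (rule integrableI_bounded_set[where A=A and B="C * M"])
         (use sm sb sz \<open>closed A\<close> emeasure_compact_finite[OF cA] in auto)
    have bl: "bcs (\<lambda>x. lapl (h n) (w e) x * \<phi> x)" for n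
    proof -
      obtain Mw where Mw: "\<And>x. norm (w e x) \<le> Mw" and wm: "w e \<in> borel_measurable borel" using w[OF \<open>e > 0\<close>] by (auto simp: bcs_def)
      have "norm (lapl (h n) (w e) x * \<phi> x) \<le> (3 * (4 * Mw) / (h n)\<^sup>2) * M" for x
      proof -
        have "norm (\<Sum>i\<in>UNIV. w e (x + h n *\<^sub>R axis i 1) + w e (x - h n *\<^sub>R axis i 1) - 2 *\<^sub>R w e x) \<le> (\<Sum>i\<in>(UNIV::3 set). 4 * Mw)"
        proof (rule order_trans[OF norm_sum sum_mono])
          fix i :: 3
          have "norm (w e (x + h n *\<^sub>R axis i 1) + w e (x - h n *\<^sub>R axis i 1) - 2 *\<^sub>R w e x)
            \<le> norm (w e (x + h n *\<^sub>R axis i 1)) + norm (w e (x - h n *\<^sub>R axis i 1)) + norm (2 *\<^sub>R w e x)"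
            by (meson add_right_mono norm_triangle_ineq norm_triangle_ineq4 order_trans)
          also have "\<dots> \<le> Mw + Mw + 2 * Mw" using Mw by (intro add_mono) (auto intro: mult_left_mono)
          finally show "norm (w e (x + h n *\<^sub>R axis i 1) + w e (x - h n *\<^sub>R axis i 1) - 2 *\<^sub>R w e x) \<le> 4 * Mw" by simp
        qed
        then have "norm (lapl (h n) (w e) x) \<le> 3 * (4 * Mw) / (h n)\<^sup>2"
          by (simp add: lapl_def divide_inverse mult.commute mult_left_mono)
        moreover have "0 \<le> 3 * (4 * Mw) / (h n)\<^sup>2" using order_trans[OF norm_ge_zero Mw[of 0]] by simp
        ultimately show ?thesis unfolding norm_mult using M[of x] by (intro mult_mono) auto
      qed
      moreover have "(\<lambda>x. lapl (h n) (w e) x * \<phi> x) \<in> borel_measurable borel"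
      proof -
        have [measurable]: "lapl (h n) (w e) \<in> borel_measurable borel" "\<phi> \<in> borel_measurable borel"
          using lapl_measurable[OF wm] \<phi> by (auto simp: bcs_def)
        show ?thesis by measurable
      qed
      moreover obtain R where "\<And>x. norm x > R \<Longrightarrow> \<phi> x = 0" using \<phi> by (auto simp: bcs_def)
      ultimately show ?thesis unfolding bcs_def by (metis mult_zero_right)
    qed
    have step: "Re (LINT x|lborel. s n x) \<le> Re (LINT x|lborel. w e x * lapl (h n) \<phi> x)" for n
    proof -
      have "(LINT x|lborel. Re (s n x)) \<le> (LINT x|lborel. Re (lapl (h n) (w e) x * \<phi> x))"
        by (intro integral_mono integrable_Re bs bcs_integrable bl ge)
      then show ?thesis unfolding integral_lapl_parts[OF w[OF \<open>e > 0\<close>] \<phi>]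
        using integral_Re[OF bs[of n]] integral_Re[OF bcs_integrable[OF bl[of n]]] by simp
    qed
    have limR: "(\<lambda>n. LINT x|lborel. w e x * lapl (h n) \<phi> x) \<longlonglongrightarrow> (LINT x|lborel. w e x * (\<Sum>i\<in>UNIV. H i x))"
      by (rule integral_lapl_test_tendsto[OF t K z w[OF \<open>e > 0\<close>] h hp(1)])
    have "Re (LINT x|lborel. indicator A x *\<^sub>R (- (complex_of_real (k\<^sup>2) * aw x) * \<phi> x)) \<le> Re (LINT x|lborel. w e x * (\<Sum>i\<in>UNIV. H i x))"
      by (rule LIMSEQ_le[OF tendsto_Re[OF lim] tendsto_Re[OF limR]]) (use step in auto)
    moreover have "- (k\<^sup>2) * (LINT x|lborel. norm (W x) * f x) \<le> Re (LINT x|lborel. indicator A x *\<^sub>R (- (complex_of_real (k\<^sup>2) * aw x) * \<phi> x))"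
    proof -
      have c: "continuous_on A (\<lambda>x. - (complex_of_real (k\<^sup>2) * aw x) * \<phi> x)"
        unfolding aw_def by (intro continuous_intros continuous_on_subset[OF W(1)] continuous_on_subset[OF tc]) auto
      have i: "integrable lborel (\<lambda>x. indicator A x *\<^sub>R (- (complex_of_real (k\<^sup>2) * aw x) * \<phi> x))"
        by (intro bcs_integrable bcs_indicator c cA)
      have "(LINT x|lborel. - (k\<^sup>2) * (norm (W x) * f x)) \<le> (LINT x|lborel. Re (indicator A x *\<^sub>R (- (complex_of_real (k\<^sup>2) * aw x) * \<phi> x)))"
      proof (rule integral_mono)
        show "integrable lborel (\<lambda>x. - (k\<^sup>2) * (norm (W x) * f x))" by (intro integrable_mult_right rint)
        show "integrable lborel (\<lambda>x. Re (indicator A x *\<^sub>R (- (complex_of_real (k\<^sup>2) * aw x) * \<phi> x)))" by (rule integrable_Re[OF i])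
        show "- (k\<^sup>2) * (norm (W x) * f x) \<le> Re (indicator A x *\<^sub>R (- (complex_of_real (k\<^sup>2) * aw x) * \<phi> x))" for x
          using f(2)[of x] by (auto simp: aw_def f(1) indicator_def simp flip: of_real_power of_real_mult)
      qed
      then show ?thesis using integral_Re[OF i] by simp
    qed
    ultimately show ?thesis by simp
  qed
  have lim: "(\<lambda>n. LINT x|lborel. w (inverse (real (Suc n))) x * (\<Sum>i\<in>UNIV. H i x)) \<longlonglongrightarrow> (LINT x|lborel. aw x * (\<Sum>i\<in>UNIV. H i x))"
  proof -
    obtain Ma where Ma: "\<And>x. norm (aw x) \<le> Ma" using aw by (auto simp: bcs_def)
    obtain MH where MH: "\<And>x. norm (\<Sum>i\<in>UNIV. H i x) \<le> MH" using HS by (auto simp: bcs_def)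
    show ?thesis
    proof (rule compact_dominated_convergence[where K="closure D" and M="Ma * MH"])
      show "(\<lambda>x. w (inverse (real (Suc n))) x * (\<Sum>i\<in>UNIV. H i x)) \<in> borel_measurable borel" for n
        using bcs_mult[OF w HS, of "inverse (real (Suc n))"] by (simp add: bcs_def)
      show "norm (w (inverse (real (Suc n))) x * (\<Sum>i\<in>UNIV. H i x)) \<le> Ma * MH" for n x
      proof -
        have "norm (w (inverse (real (Suc n))) x) \<le> norm (aw x)" by (auto simp: w_def aw_def max_def)
        then have "norm (w (inverse (real (Suc n))) x) \<le> Ma" using Ma[of x] by linarith
        moreover have "0 \<le> Ma" using order_trans[OF norm_ge_zero Ma[of x]] .
        ultimately show ?thesis unfolding norm_mult using MH[of x] by (intro mult_mono) auto
      qed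
      show "(\<lambda>n. w (inverse (real (Suc n))) x * (\<Sum>i\<in>UNIV. H i x)) \<longlonglongrightarrow> aw x * (\<Sum>i\<in>UNIV. H i x)" for x
      proof -
        have "(\<lambda>n. complex_of_real (max 0 (norm (W x) - inverse (real (Suc n))))) \<longlonglongrightarrow> complex_of_real (max 0 (norm (W x) - 0))"
          by (intro tendsto_intros LIMSEQ_inverse_real_of_nat)
        then have "(\<lambda>n. w (inverse (real (Suc n))) x) \<longlonglongrightarrow> aw x" by (simp add: w_def aw_def)
        then show ?thesis by (intro tendsto_intros)
      qed
    qed (use cD clz in \<open>auto simp: w_def\<close>)
  qed
  have "- (k\<^sup>2) * (LINT x|lborel. norm (W x) * f x) \<le> Re (LINT x|lborel. aw x * (\<Sum>i\<in>UNIV. H i x))"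
    by (rule LIMSEQ_le_const[OF tendsto_Re[OF lim]]) (use main in auto)
  moreover have "(LINT x|lborel. aw x * ((\<Sum>i\<in>UNIV. H i x) + complex_of_real (k\<^sup>2) * \<phi> x))
     = (LINT x|lborel. aw x * (\<Sum>i\<in>UNIV. H i x)) + complex_of_real (k\<^sup>2) * (LINT x|lborel. aw x * \<phi> x)"
  proof -
    have "(LINT x|lborel. aw x * ((\<Sum>i\<in>UNIV. H i x) + complex_of_real (k\<^sup>2) * \<phi> x))
      = (LINT x|lborel. aw x * (\<Sum>i\<in>UNIV. H i x) + complex_of_real (k\<^sup>2) * (aw x * \<phi> x))"
      by (rule Bochner_Integration.integral_cong) (auto simp: algebra_simps)
    also have "\<dots> = (LINT x|lborel. aw x * (\<Sum>i\<in>UNIV. H i x)) + (LINT x|lborel. complex_of_real (k\<^sup>2) * (aw x * \<phi> x))"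
      by (intro Bochner_Integration.integral_add integrable_mult_right bcs_integrable bcs_mult aw HS \<phi>)
    finally show ?thesis by simp
  qed
  moreover have "(LINT x|lborel. aw x * \<phi> x) = of_real (LINT x|lborel. norm (W x) * f x)"
    unfolding aw_def f(1) of_real_mult[symmetric] by (rule integral_complex_of_real)
  ultimately show ?thesis unfolding aw_def[symmetric] by simp
qed

section \<open>Pointwise bounds by the L2 norm\<close>

definition zero_ext :: "real \<Rightarrow> (real^3) set \<Rightarrow> (real^3 \<Rightarrow> complex) \<Rightarrow> bool" where
  "zero_ext k D W \<longleftrightarrow> continuous_on UNIV W \<and> helm k D W \<and> (\<forall>x. x \<notin> D \<longrightarrow> W x = 0)"

text \<open>The subsolution inequality demands a real nonnegative test function. Adding the outgoing
  and the incoming kernel makes it real, and it is nonnegative as long as k s is at most pi /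
  2.\<close>

lemma K0_sum_real: "K0 k (of_real s) + K0 (- k) (of_real s) = of_real (2 * cos (k * s) / s)"
proof -
  have "exp (\<i> * of_real k * complex_of_real s) = cis (k * s)" "exp (\<i> * of_real (- k) * complex_of_real s) = cis (- (k * s))"
    by (simp_all add: cis_conv_exp mult.assoc)
  then have "K0 k (of_real s) + K0 (- k) (of_real s) = (cis (k * s) + cis (- (k * s))) / of_real s"
    by (simp add: K0_def add_divide_distrib)
  also have "cis (k * s) + cis (- (k * s)) = of_real (2 * cos (k * s))" by (simp add: complex_eq_iff)
  finally show ?thesis by simp
qed

text \<open>The concentrating term must keep a definite sign. For k s <= 1 the cosine is at least
  cos (pi / 3) = 1/2, the factor 3 - (k s)^2 is at least 2, and the sine term has the same sign as
  the main one.\<close>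

lemma KP_sum_Re:
  assumes "k > 0" "0 \<le> s" "k * s \<le> 1"
  shows "Re (KP k (of_real s) + KP (- k) (of_real s)) \<le> -2"
proof -
  define t where "t = k * s"
  have t: "0 \<le> t" "t \<le> 1" using assms by (auto simp: t_def)
  have "KP k (of_real s) = cis t * Complex (t\<^sup>2 - 3) (3 * t)" "KP (- k) (of_real s) = cis (- t) * Complex (t\<^sup>2 - 3) (- 3 * t)"
    by (simp_all add: KP_def t_def cis_conv_exp mult.assoc complex_eq_iff power2_eq_square)
  then have eq: "Re (KP k (of_real s) + KP (- k) (of_real s)) = 2 * (cos t * (t\<^sup>2 - 3)) - 6 * (t * sin t)"
    by (simp add: algebra_simps)
  have "cos 1 \<ge> cos (pi / 3)" using pi_gt3 by (intro cos_monotone_0_pi_le) auto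
  moreover have "cos t \<ge> cos 1" using t pi_gt3 by (intro cos_monotone_0_pi_le) auto
  ultimately have c: "cos t \<ge> 1/2" by (simp add: cos_60)
  have "t\<^sup>2 \<le> 1" using t by (simp add: power_le_one)
  then have "cos t * (3 - t\<^sup>2) \<ge> 1/2 * 2" using c by (intro mult_mono) auto
  moreover have "t * sin t \<ge> 0" using t pi_gt3 by (intro mult_nonneg_nonneg sin_ge_zero) auto
  ultimately show ?thesis unfolding eq by (simp add: algebra_simps)
qed

lemma rep_kernel_near_bound:
  assumes "\<eta> > 0" "\<eta> \<le> s" and X: "\<bar>X' ((x - y) \<bullet> (x - y))\<bar> \<le> c1" "\<bar>X'' ((x - y) \<bullet> (x - y))\<bar> \<le> c2" and q: "(x - y) \<bullet> (x - y) \<le> r2"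
  shows "norm (rep_kernel \<kappa> X' X'' y y x (of_real s)) \<le> 8 * c1 * r2 * (\<bar>\<kappa>\<bar> / (2 * \<eta>\<^sup>2) + 1 / (2 * \<eta>^3)) + (6 * c1 + 4 * r2 * c2) * (1 / \<eta>)"
proof -
  define q where "q = (x - y) \<bullet> (x - y)"
  have q0: "0 \<le> q" "q \<le> r2" using assms(5) by (auto simp: q_def)
  have X': "\<bar>X' q\<bar> \<le> c1" "\<bar>X'' q\<bar> \<le> c2" using X by (auto simp: q_def)
  have c0: "0 \<le> c1" "0 \<le> c2" using X' abs_ge_zero order_trans by blast+
  have a: "norm (complex_of_real (8 * X' q * q)) \<le> 8 * c1 * r2"
    unfolding norm_of_real abs_mult using X' q0 c0 by (intro mult_mono) auto
  have b: "norm (complex_of_real (6 * X' q + 4 * q * X'' q)) \<le> 6 * c1 + 4 * r2 * c2"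
  proof -
    have "\<bar>6 * X' q + 4 * q * X'' q\<bar> \<le> 6 * \<bar>X' q\<bar> + 4 * q * \<bar>X'' q\<bar>"
      using q0 by (intro order_trans[OF abs_triangle_ineq]) (simp add: abs_mult)
    also have "\<dots> \<le> 6 * c1 + 4 * r2 * c2" using X' q0 c0 by (intro add_mono mult_mono) auto
    finally show ?thesis unfolding norm_of_real .
  qed
  have "norm (rep_kernel \<kappa> X' X'' y y x (of_real s)) \<le> norm (complex_of_real (8 * X' q * q)) * norm (K1 \<kappa> (of_real s))
     + norm (complex_of_real (6 * X' q + 4 * q * X'' q)) * norm (K0 \<kappa> (of_real s))"
    unfolding rep_kernel_def q_def[symmetric] by (rule order_trans[OF norm_triangle_ineq]) (simp only: norm_mult order_refl)
  also have "\<dots> \<le> 8 * c1 * r2 * (\<bar>\<kappa>\<bar> / (2 * \<eta>\<^sup>2) + 1 / (2 * \<eta>^3)) + (6 * c1 + 4 * r2 * c2) * (1 / \<eta>)"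
    using a b K_bounds[OF assms(1,2), of \<kappa>] c0 q0 by (intro add_mono mult_mono) auto
  finally show ?thesis .
qed

text \<open>A mean value inequality for the subsolution |W|, with a constant depending on
  \<open>k\<close> alone: testing with the cutoff kernel bounds the value at \<open>y\<close> by a
  multiple of the integral over a ball. Young's inequality then gives half of the squared L2 norm
  plus a constant; the factor 1/2 is what permits absorption when this bound is applied to an
  orthonormal system.\<close>

theorem zero_ext_sup_bound:
  assumes "k > 0"
  shows "\<exists>C. \<forall>D W y. open D \<longrightarrow> bounded D \<longrightarrow> zero_ext k D W \<longrightarrow> norm (W y) \<le> (LINT x|lborel. (norm (W x))\<^sup>2) / 2 + C"
proof -
  \<comment> \<open>Within distance \<open>r\<close> of \<open>y\<close>, and for a regularisation
    of at most \<open>r\<close>, the softened distance s satisfies s <= 2 r and hence k s <=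
    1.\<close>
  define r where "r = min 1 (1 / (2 * k))"
  have r: "r > 0" using assms by (simp add: r_def)
  have kr: "k * (2 * r) \<le> 1"
  proof -
    have "k * (2 * r) \<le> k * (2 * (1 / (2 * k)))" using assms by (intro mult_left_mono) (auto simp: r_def)
    then show ?thesis using assms by simp
  qed
  obtain cp where cp: "cp > 0" "\<And>a b. a < b \<Longrightarrow> \<exists>X X' X''. plateau cp a b X X' X''" using plateau_exists by blast
  have "r\<^sup>2/4 < r\<^sup>2" using r by simp
  then obtain X X' X'' where pl: "plateau cp (r\<^sup>2/4) (r\<^sup>2) X X' X''" using cp(2) by blast
  have X: "cutoff X X' X''" using pl by (simp add: plateau_def)
  define c1 where "c1 = cp / (r\<^sup>2 - r\<^sup>2/4)"
  define c2 where "c2 = cp / (r\<^sup>2 - r\<^sup>2/4)\<^sup>2"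
  have Xb: "\<bar>X' q\<bar> \<le> c1" "\<bar>X'' q\<bar> \<le> c2" for q using pl by (auto simp: plateau_def c1_def c2_def)
  define \<eta> where "\<eta> = r / 2"
  have \<eta>: "\<eta> > 0" using r by (simp add: \<eta>_def)
  define b where "b = 8 * c1 * r\<^sup>2 * (\<bar>k\<bar> / (2 * \<eta>\<^sup>2) + 1 / (2 * \<eta>^3)) + (6 * c1 + 4 * r\<^sup>2 * c2) * (1 / \<eta>)"
  have b0: "b \<ge> 0"
  proof -
    have "c1 \<ge> 0" "c2 \<ge> 0" using Xb abs_ge_zero order_trans by blast+
    then show ?thesis unfolding b_def using \<eta> by (intro add_nonneg_nonneg mult_nonneg_nonneg divide_nonneg_nonneg) auto
  qed
  \<comment> \<open>Division by \<open>Jmin\<close> turns a lower bound on the concentrated integral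
    into a bound on the value at \<open>y\<close>; the added 1 makes \<open>C1\<close>
    positive.\<close>
  define C1 where "C1 = b / Jmin + 1"
  have C1: "C1 > 0" using b0 Jmin_pos by (simp add: C1_def add_nonneg_pos)
  define Vl where "Vl = measure lborel (cball (0::real^3) r)"
  have Vl: "measure lborel (cball y r) = Vl" for y :: "real^3" unfolding Vl_def using r by (simp add: content_cball)
  have goal: "norm (W y) \<le> (LINT x|lborel. (norm (W x))\<^sup>2) / 2 + C1\<^sup>2 * Vl / 2"
    if D: "open D" "bounded D" and zW: "zero_ext k D W" for D W y
  proof -
    have W: "continuous_on UNIV W" "helm k D W" "\<And>x. x \<notin> D \<Longrightarrow> W x = 0" using zW by (auto simp: zero_ext_def)
    have Wz: "W x = 0" if "x \<notin> closure D" for x using that W(3) closure_subset by blast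
    have cD: "compact (closure D)" using D by simp
    define v where "v x = norm (W x)" for x
    have vc: "continuous_on A v" for A unfolding v_def using W(1) by (intro continuous_intros) (rule continuous_on_subset, auto)
    have v0: "v x \<ge> 0" for x by (simp add: v_def)
    define q where "q x = (x - y) \<bullet> (x - y)" for x
    have qn: "q x = (norm (x - y))\<^sup>2" for x by (simp add: q_def power2_norm_eq_inner)
    have Xz: "X (q x) = 0 \<and> X' (q x) = 0 \<and> X'' (q x) = 0" if "norm (x - y) \<ge> r" for x
    proof -
      have "r\<^sup>2 \<le> q x" unfolding qn using that r by (intro power_mono) auto
      then show ?thesis using pl by (simp add: plateau_def)
    qed
    have X1: "X (q x) = 1 \<and> X' (q x) = 0 \<and> X'' (q x) = 0" if "norm (x - y) \<le> \<eta>" for x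
    proof -
      have "q x \<le> \<eta>\<^sup>2" unfolding qn using that by (intro power_mono) auto
      then have "q x \<le> r\<^sup>2/4" by (simp add: \<eta>_def power_divide)
      then show ?thesis using pl by (simp add: plateau_def)
    qed
    have X01: "0 \<le> X (q x)" for x using pl by (simp add: plateau_def)
    have Xqc: "continuous_on A (\<lambda>x. X (q x))" for A
      by (rule continuous_on_compose2[OF cutoff_cont(1)[OF X]]) (auto simp: q_def intro!: continuous_intros)
    have iB: "integrable lborel (\<lambda>x. indicator (cball y r) x *\<^sub>R v x)"
      by (rule borel_integrable_compact[OF compact_cball vc])
    have ipk: "integrable lborel (\<lambda>x. indicator (cball y r) x *\<^sub>R (v x * X (q x) * pk d (x - y)))" if "d > 0" for d
    proof (rule borel_integrable_compact[OF compact_cball])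
      have "continuous_on (cball y r) (\<lambda>x. pk d (x - y))"
        by (rule continuous_on_compose2[OF pk_cont[OF that]]) (auto intro!: continuous_intros)
      then show "continuous_on (cball y r) (\<lambda>x. v x * X (q x) * pk d (x - y))" by (intro continuous_intros vc Xqc)
    qed
    have ineq: "2 * (LINT x|lborel. indicator (cball y r) x *\<^sub>R (v x * X (q x) * pk d (x - y))) \<le> 2 * b * (LINT x|lborel. indicator (cball y r) x *\<^sub>R v x)"
      if d: "0 < d" "d \<le> r" for d
    proof -
      define s where "s x = sd d (q x)" for x
      have s0: "s x > 0" for x unfolding s_def using sd_pos[OF d(1)] by (simp add: q_def)
      obtain G1 H1 where t1: "test_fn (\<lambda>x. of_real (X (q x)) * K0 k (of_real (s x))) G1 H1"
        and e1: "\<And>x. (\<Sum>i\<in>UNIV. H1 i x) + complex_of_real (k\<^sup>2) * (of_real (X (q x)) * K0 k (of_real (s x)))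
           = of_real (X (q x)) * KP k (of_real (s x)) * of_real (pk d (x - y)) + rep_kernel k X' X'' y y x (of_real (s x))"
        by (rule cutoff_times_kernel[OF X d(1), where \<kappa>=k and y=y and ?y0.0=y]) (rule that[unfolded q_def s_def])
      obtain G2 H2 where t2: "test_fn (\<lambda>x. of_real (X (q x)) * K0 (- k) (of_real (s x))) G2 H2"
        and e2: "\<And>x. (\<Sum>i\<in>UNIV. H2 i x) + complex_of_real ((- k)\<^sup>2) * (of_real (X (q x)) * K0 (- k) (of_real (s x)))
           = of_real (X (q x)) * KP (- k) (of_real (s x)) * of_real (pk d (x - y)) + rep_kernel (- k) X' X'' y y x (of_real (s x))"
        by (rule cutoff_times_kernel[OF X d(1), where \<kappa>="- k" and y=y and ?y0.0=y]) (rule that[unfolded q_def s_def])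
      define \<phi> where "\<phi> x = of_real (X (q x)) * K0 k (of_real (s x)) + of_real (X (q x)) * K0 (- k) (of_real (s x))" for x
      define f where "f x = X (q x) * (2 * cos (k * s x) / s x)" for x
      have \<phi>f: "\<phi> x = of_real (f x)" for x
        unfolding \<phi>_def f_def distrib_left[symmetric] K0_sum_real by simp
      have ks: "k * s x \<le> 1" if "norm (x - y) \<le> r" for x
      proof -
        have "s x \<le> norm (x - y) + d" unfolding s_def q_def using d by (intro sd_le) auto
        then have "s x \<le> 2 * r" using that d by linarith
        then have "k * s x \<le> k * (2 * r)" using assms by (intro mult_left_mono) auto
        then show ?thesis using kr by linarith
      qed
      have f0: "f x \<ge> 0" for x
      proof (cases "norm (x - y) \<le> r")
        case True
        have "0 \<le> k * s x" using s0[of x] assms by simp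
        then have "cos (k * s x) \<ge> 0" using ks[OF True] pi_gt3 by (intro cos_ge_zero) auto
        then show ?thesis unfolding f_def using X01[of x] s0[of x] by (intro mult_nonneg_nonneg divide_nonneg_nonneg) auto
      next
        case False then show ?thesis using Xz[of x] by (simp add: f_def)
      qed
      define R where "R x = rep_kernel k X' X'' y y x (of_real (s x)) + rep_kernel (- k) X' X'' y y x (of_real (s x))" for x
      define P where "P x = KP k (of_real (s x)) + KP (- k) (of_real (s x))" for x
      have sum: "(\<Sum>i\<in>UNIV. H1 i x + H2 i x) + complex_of_real (k\<^sup>2) * \<phi> x = of_real (X (q x) * pk d (x - y)) * P x + R x" for x
      proof -
        have "(\<Sum>i\<in>UNIV. H1 i x + H2 i x) + complex_of_real (k\<^sup>2) * \<phi> x =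
          ((\<Sum>i\<in>UNIV. H1 i x) + complex_of_real (k\<^sup>2) * (of_real (X (q x)) * K0 k (of_real (s x)))) +
          ((\<Sum>i\<in>UNIV. H2 i x) + complex_of_real ((- k)\<^sup>2) * (of_real (X (q x)) * K0 (- k) (of_real (s x))))"
          by (simp add: \<phi>_def sum.distrib algebra_simps)
        then show ?thesis unfolding e1 e2 by (simp add: P_def R_def algebra_simps)
      qed
      have Rz: "R x = 0" if "norm (x - y) \<le> \<eta> \<or> norm (x - y) \<ge> r" for x
        using that X1[of x] Xz[of x] by (auto simp: R_def rep_kernel_def q_def)
      have Rb: "norm (R x) \<le> 2 * b" for x
      proof (cases "norm (x - y) \<le> \<eta> \<or> norm (x - y) \<ge> r")
        case True then show ?thesis using Rz b0 by simp
      next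
        case False
        have "\<eta> \<le> s x" unfolding s_def q_def using sd_ge[of "x - y" d] False by linarith
        moreover have "q x \<le> r\<^sup>2" unfolding qn using False by (intro power_mono) auto
        ultimately have "norm (rep_kernel k X' X'' y y x (of_real (s x))) \<le> b" "norm (rep_kernel (- k) X' X'' y y x (of_real (s x))) \<le> b"
          using rep_kernel_near_bound[OF \<eta>, of "s x" X' x y c1 X'' c2 "r\<^sup>2" k] rep_kernel_near_bound[OF \<eta>, of "s x" X' x y c1 X'' c2 "r\<^sup>2" "- k"] Xb
          by (auto simp: b_def q_def)
        then show ?thesis unfolding R_def using norm_triangle_ineq order_trans by (smt (verit, best))
      qed
      have tf: "test_fn \<phi> (\<lambda>i x. G1 i x + G2 i x) (\<lambda>i x. H1 i x + H2 i x)" unfolding \<phi>_def by (rule test_fn_add[OF t1 t2])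
      have \<phi>z: "\<phi> x = 0" if "x \<notin> cball y r" for x
        using Xz[of x] that by (simp add: \<phi>_def dist_norm norm_minus_commute)
      have iL: "integrable lborel (\<lambda>x. of_real (v x) * (of_real (X (q x) * pk d (x - y)) * P x + R x))"
      proof (rule bcs_integrable, rule bcs_continuous[OF _ cD])
        have "continuous_on UNIV (\<lambda>x. (\<Sum>i\<in>UNIV. H1 i x + H2 i x) + complex_of_real (k\<^sup>2) * \<phi> x)"
          using t1 t2 tf by (auto simp: test_fn_def intro!: continuous_intros)
        then have "continuous_on UNIV (\<lambda>x. of_real (X (q x) * pk d (x - y)) * P x + R x)" unfolding sum .
        then show "continuous_on UNIV (\<lambda>x. of_real (v x) * (of_real (X (q x) * pk d (x - y)) * P x + R x))"
          by (intro continuous_on_mult continuous_on_of_real vc)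
        show "of_real (v x) * (of_real (X (q x) * pk d (x - y)) * P x + R x) = 0" if "x \<notin> closure D" for x
          using Wz[OF that] by (simp add: v_def)
      qed
      have "0 \<le> Re (LINT x|lborel. of_real (norm (W x)) * ((\<Sum>i\<in>UNIV. H1 i x + H2 i x) + complex_of_real (k\<^sup>2) * \<phi> x))"
        by (rule modulus_subsolution[OF W(1,2) D W(3) tf compact_cball \<phi>z \<phi>f f0])
      also have "\<dots> = Re (LINT x|lborel. of_real (v x) * (of_real (X (q x) * pk d (x - y)) * P x + R x))"
        unfolding sum v_def ..
      also have "\<dots> = (LINT x|lborel. Re (of_real (v x) * (of_real (X (q x) * pk d (x - y)) * P x + R x)))"
        by (rule integral_Re[OF iL, symmetric])
      also have "\<dots> \<le> (LINT x|lborel. (2 * b) * (indicator (cball y r) x *\<^sub>R v x) - 2 * (indicator (cball y r) x *\<^sub>R (v x * X (q x) * pk d (x - y))))"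
      proof (rule integral_mono[OF integrable_Re[OF iL]])
        show "integrable lborel (\<lambda>x. (2 * b) * (indicator (cball y r) x *\<^sub>R v x) - 2 * (indicator (cball y r) x *\<^sub>R (v x * X (q x) * pk d (x - y))))"
          by (intro Bochner_Integration.integrable_diff integrable_mult_right iB ipk d)
        fix x
        show "Re (of_real (v x) * (of_real (X (q x) * pk d (x - y)) * P x + R x)) \<le> (2 * b) * (indicator (cball y r) x *\<^sub>R v x) - 2 * (indicator (cball y r) x *\<^sub>R (v x * X (q x) * pk d (x - y)))"
        proof (cases "x \<in> cball y r")
          case True
          then have n: "norm (x - y) \<le> r" by (simp add: dist_norm norm_minus_commute)
          have "Re (P x) \<le> -2" unfolding P_def using KP_sum_Re[OF assms less_imp_le[OF s0] ks[OF n]] .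
          define A where "A = v x * X (q x) * pk d (x - y)"
          have "A \<ge> 0" unfolding A_def by (intro mult_nonneg_nonneg v0 X01 pk_nonneg)
          then have "A * Re (P x) \<le> A * (-2)" using \<open>Re (P x) \<le> -2\<close> by (intro mult_left_mono)
          moreover have "v x * Re (R x) \<le> v x * (2 * b)"
            using complex_Re_le_cmod[of "R x"] Rb[of x] v0 by (intro mult_left_mono) linarith+
          ultimately have l: "A * Re (P x) + v x * Re (R x) \<le> (2 * b) * v x - 2 * A" by (simp add: algebra_simps)
          have eq: "Re (of_real (v x) * (of_real (X (q x) * pk d (x - y)) * P x + R x)) = A * Re (P x) + v x * Re (R x)"
            by (simp add: A_def algebra_simps)
          show ?thesis unfolding eq using l True by (simp add: A_def)
        next
          case False
          then have "norm (x - y) \<ge> r" by (simp add: dist_norm norm_minus_commute)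
          then show ?thesis using False Rz[of x] Xz[of x] by simp
        qed
      qed
      also have "\<dots> = 2 * b * (LINT x|lborel. indicator (cball y r) x *\<^sub>R v x) - 2 * (LINT x|lborel. indicator (cball y r) x *\<^sub>R (v x * X (q x) * pk d (x - y)))"
        unfolding Bochner_Integration.integral_diff[OF integrable_mult_right[OF iB, of "2 * b"] integrable_mult_right[OF ipk[OF d(1)], of 2]]
          integral_mult_right_zero ..
      finally show ?thesis by simp
    qed
    have vy: "v y \<le> C1 * (LINT x|lborel. indicator (cball y r) x *\<^sub>R v x)"
    proof (rule field_le_epsilon)
      fix e :: real assume "e > 0"
      define I where "I = (LINT x|lborel. indicator (cball y r) x *\<^sub>R v x)"
      have I0: "I \<ge> 0" unfolding I_def by (rule Bochner_Integration.integral_nonneg) (simp add: v0)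
      have bI: "b / Jmin * I \<le> C1 * I" using I0 by (intro mult_right_mono) (auto simp: C1_def)
      show "v y \<le> C1 * I + e"
      proof (cases "v y \<le> e")
        case True then show ?thesis using I0 C1 by (simp add: add_increasing)
      next
        case False
        have "isCont v y" using vc[of UNIV] by (simp add: continuous_on_eq_continuous_at)
        then obtain d0 where d0: "d0 > 0" "\<And>x. dist x y < d0 \<Longrightarrow> dist (v x) (v y) < e"
          using \<open>e > 0\<close> unfolding continuous_at_eps_delta by blast
        \<comment> \<open>One regularisation is enough, without a limit: if \<open>v\<close> is at
          least \<open>v y - e\<close> on the ball of radius \<open>d\<close>, that ball alone
          carries kernel mass at least \<open>Jmin\<close>.\<close>
        define d where "d = min d0 \<eta>"
        have d: "d > 0" "d \<le> r" "d \<le> \<eta>" "d \<le> d0" using d0 \<eta> r by (auto simp: d_def \<eta>_def)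
        have bc: "ball y d \<subseteq> cball y r" using d by auto
        have "(v y - e) * Jmin \<le> (v y - e) * (LINT x|lborel. indicator (ball y d) x *\<^sub>R pk d (x - y))"
          using False d by (intro mult_left_mono pk_ball_lower) auto
        also have "\<dots> = (LINT x|lborel. (v y - e) * (indicator (ball y d) x *\<^sub>R pk d (x - y)))" by simp
        also have "\<dots> \<le> (LINT x|lborel. indicator (cball y r) x *\<^sub>R (v x * X (q x) * pk d (x - y)))"
        proof (rule integral_mono)
          show "integrable lborel (\<lambda>x. (v y - e) * (indicator (ball y d) x *\<^sub>R pk d (x - y)))"
            by (intro integrable_mult_right pk_integrable d) auto
          show "integrable lborel (\<lambda>x. indicator (cball y r) x *\<^sub>R (v x * X (q x) * pk d (x - y)))" by (rule ipk[OF d(1)])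
          fix x
          show "(v y - e) * (indicator (ball y d) x *\<^sub>R pk d (x - y)) \<le> indicator (cball y r) x *\<^sub>R (v x * X (q x) * pk d (x - y))"
          proof (cases "x \<in> ball y d")
            case True
            then have x: "x \<in> cball y r" "dist x y < d0" "norm (x - y) \<le> \<eta>" using bc d by (auto simp: dist_commute dist_norm norm_minus_commute)
            have "v y - e \<le> v x" using d0(2)[OF x(2)] by (simp add: dist_real_def)
            then have "(v y - e) * pk d (x - y) \<le> v x * pk d (x - y)" by (intro mult_right_mono pk_nonneg)
            then show ?thesis using True x X1[OF x(3)] by simp
          next
            case False
            have "0 \<le> v x * X (q x) * pk d (x - y)" by (intro mult_nonneg_nonneg v0 X01 pk_nonneg)
            then show ?thesis using False by (simp add: indicator_def)
          qed
        qed
        also have "\<dots> \<le> b * I" using ineq[OF d(1,2)] by (simp add: I_def)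
        finally have "v y - e \<le> b / Jmin * I" using Jmin_pos by (simp add: field_simps)
        then show ?thesis using bI by linarith
      qed
    qed
    have i2: "integrable lborel (\<lambda>x. (v x)\<^sup>2)"
    proof -
      have "integrable lborel (\<lambda>x. indicator (closure D) x *\<^sub>R (v x)\<^sup>2)"
        by (rule borel_integrable_compact[OF cD]) (intro continuous_intros vc)
      moreover have "(\<lambda>x. indicator (closure D) x *\<^sub>R (v x)\<^sup>2) = (\<lambda>x. (v x)\<^sup>2)"
        using Wz by (auto simp: fun_eq_iff v_def indicator_def)
      ultimately show ?thesis by simp
    qed
    have "(LINT x|lborel. indicator (cball y r) x *\<^sub>R v x) \<le> (LINT x|lborel. (v x)\<^sup>2 / (2 * C1) + indicator (cball y r) x *\<^sub>R (C1 / 2))"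
    proof (rule integral_mono[OF iB])
      show "integrable lborel (\<lambda>x. (v x)\<^sup>2 / (2 * C1) + indicator (cball y r) x *\<^sub>R (C1 / 2))"
        by (intro Bochner_Integration.integrable_add integrable_divide i2 borel_integrable_compact continuous_intros compact_cball)
      fix x
      \<comment> \<open>Young's inequality, weighted so that multiplication by \<open>C1\<close>
        leaves the coefficient 1/2 in front of the squared norm.\<close>
      have "v x \<le> (v x)\<^sup>2 / (2 * C1) + C1 / 2"
      proof -
        have "0 \<le> (v x - C1)\<^sup>2" by simp
        then have "2 * C1 * v x \<le> (v x)\<^sup>2 + C1\<^sup>2" by (simp add: power2_diff algebra_simps)
        then show ?thesis using C1 by (simp add: field_simps power2_eq_square)
      qed
      moreover have "0 \<le> (v x)\<^sup>2 / (2 * C1)" using C1 by simp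
      ultimately show "indicator (cball y r) x *\<^sub>R v x \<le> (v x)\<^sup>2 / (2 * C1) + indicator (cball y r) x *\<^sub>R (C1 / 2)"
        by (auto simp: indicator_def)
    qed
    also have "\<dots> = (LINT x|lborel. (v x)\<^sup>2) / (2 * C1) + Vl * (C1 / 2)"
    proof -
      have i3: "integrable lborel (\<lambda>x. indicator (cball y r) x *\<^sub>R (C1 / 2))"
        by (intro borel_integrable_compact continuous_intros compact_cball)
      show ?thesis unfolding Bochner_Integration.integral_add[OF integrable_divide[OF i2] i3] by (simp add: Vl)
    qed
    finally have "C1 * (LINT x|lborel. indicator (cball y r) x *\<^sub>R v x) \<le> C1 * ((LINT x|lborel. (v x)\<^sup>2) / (2 * C1) + Vl * (C1 / 2))"
      using C1 by (intro mult_left_mono) auto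
    also have "C1 * ((LINT x|lborel. (v x)\<^sup>2) / (2 * C1) + Vl * (C1 / 2)) = (LINT x|lborel. (v x)\<^sup>2) / 2 + C1\<^sup>2 * Vl / 2"
    proof -
      have "C1 * (i / (2 * C1) + Vl * (C1 / 2)) = i / 2 + C1\<^sup>2 * Vl / 2" for i
        using C1 by (simp add: field_simps power2_eq_square)
      then show ?thesis .
    qed
    finally have "v y \<le> (LINT x|lborel. (v x)\<^sup>2) / 2 + C1\<^sup>2 * Vl / 2" using vy by simp
    then show ?thesis by (simp add: v_def)
  qed
  then show ?thesis by blast
qed

section \<open>Linear combinations and orthonormal systems\<close>

lemma helm_add:
  assumes "helm k S u" "helm k S v"
  shows "helm k S (\<lambda>x. u x + v x)"
proof -
  obtain G H G' H' where *: "axis2 S u G H" "axis2 S v G' H'"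
    "\<forall>x\<in>S. (\<Sum>i\<in>UNIV. H i x) + complex_of_real (k\<^sup>2) * u x = 0"
    "\<forall>x\<in>S. (\<Sum>i\<in>UNIV. H' i x) + complex_of_real (k\<^sup>2) * v x = 0"
    using assms by (auto simp: helm_def)
  have "\<forall>x\<in>S. (\<Sum>i\<in>UNIV. H i x + H' i x) + complex_of_real (k\<^sup>2) * (u x + v x) = 0"
  proof
    fix x assume "x \<in> S"
    with *(3,4) have "((\<Sum>i\<in>UNIV. H i x) + complex_of_real (k\<^sup>2) * u x) +
      ((\<Sum>i\<in>UNIV. H' i x) + complex_of_real (k\<^sup>2) * v x) = 0" by simp
    then show "(\<Sum>i\<in>UNIV. H i x + H' i x) + complex_of_real (k\<^sup>2) * (u x + v x) = 0"
      by (simp add: sum.distrib algebra_simps)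
  qed
  with axis2_add[OF *(1,2)] assms show ?thesis
    unfolding helm_def by (blast intro: continuous_on_add)
qed

lemma helm_cmult:
  assumes "helm k S u"
  shows "helm k S (\<lambda>x. c * u x)"
proof -
  obtain G H where *: "axis2 S u G H" "\<forall>x\<in>S. (\<Sum>i\<in>UNIV. H i x) + complex_of_real (k\<^sup>2) * u x = 0"
    using assms by (auto simp: helm_def)
  have "\<forall>x\<in>S. (\<Sum>i\<in>UNIV. c * H i x) + complex_of_real (k\<^sup>2) * (c * u x) = 0"
  proof
    fix x assume "x \<in> S"
    with *(2) have "c * ((\<Sum>i\<in>UNIV. H i x) + complex_of_real (k\<^sup>2) * u x) = 0" by simp
    then show "(\<Sum>i\<in>UNIV. c * H i x) + complex_of_real (k\<^sup>2) * (c * u x) = 0"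
      by (simp add: sum_distrib_left algebra_simps)
  qed
  moreover have "axis2 S (\<lambda>x. c * u x) (\<lambda>i x. c * G i x) (\<lambda>i x. c * H i x)"
    by (rule axis2_linear[OF bounded_linear_mult_right *(1)])
  moreover have "continuous_on S (\<lambda>x. c * u x)" using assms by (auto simp: helm_def intro!: continuous_intros)
  ultimately show ?thesis unfolding helm_def by blast
qed

lemma helm_zero: "helm k S (\<lambda>x. 0)"
  unfolding helm_def axis2_def by (intro conjI exI[of _ "\<lambda>i x. 0"]) auto

lemma helm_sum: "(\<And>i. helm k S (u i)) \<Longrightarrow> helm k S (\<lambda>x. \<Sum>i<(N::nat). c i * u i x)"
  by (induction N) (simp_all add: helm_zero helm_add helm_cmult)

lemma zero_ext_sum: "(\<And>i. zero_ext k D (U i)) \<Longrightarrow> zero_ext k D (\<lambda>x. \<Sum>i<(N::nat). c i * U i x)"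
  unfolding zero_ext_def by (auto intro!: helm_sum continuous_intros)

lemma zero_ext_bcs:
  assumes "bounded D" "zero_ext k D U"
  shows "bcs U"
proof (rule bcs_continuous[of U "closure D"])
  show "U x = 0" if "x \<notin> closure D" for x using that assms(2) closure_subset by (auto simp: zero_ext_def)
qed (use assms in \<open>auto simp: zero_ext_def\<close>)

lemma bcs_cnj: "bcs f \<Longrightarrow> bcs (\<lambda>x. cnj (f x))"
proof -
  assume "bcs f"
  moreover have "cnj \<in> borel_measurable borel" by (intro borel_measurable_continuous_onI continuous_intros)
  ultimately show ?thesis unfolding bcs_def using measurable_compose[of f borel borel cnj] by auto
qed

lemma L2_positive:
  assumes "bcs f" "continuous_on UNIV f" "f x0 \<noteq> 0"
  shows "(LINT x|lborel. (norm (f x))\<^sup>2) > 0"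
proof -
  have "isCont f x0" using assms(2) by (simp add: continuous_on_eq_continuous_at)
  then obtain d where d: "d > 0" "\<And>x. dist x x0 < d \<Longrightarrow> dist (f x) (f x0) < norm (f x0) / 2"
    using assms(3) unfolding continuous_at_eps_delta by (metis half_gt_zero zero_less_norm_iff)
  define m where "m = (norm (f x0) / 2)\<^sup>2"
  have m: "m > 0" using assms(3) by (simp add: m_def)
  have i: "integrable lborel (\<lambda>x. (norm (f x))\<^sup>2)"
  proof -
    have "integrable lborel (\<lambda>x. Re (f x * cnj (f x)))" by (intro integrable_Re bcs_integrable bcs_mult bcs_cnj assms(1))
    then show ?thesis by (simp add: complex_mult_cnj cmod_power2)
  qed
  have "0 < measure lborel (ball x0 d) * m" using d m by (simp add: content_ball)
  also have "\<dots> = (LINT x|lborel. indicator (ball x0 d) x *\<^sub>R m)" by simp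
  also have "\<dots> \<le> (LINT x|lborel. (norm (f x))\<^sup>2)"
  proof (rule integral_mono[OF _ i])
    show "integrable lborel (\<lambda>x. indicator (ball x0 d) x *\<^sub>R m)"
      using emeasure_bounded_finite[of "ball x0 d"] by (intro integrable_scaleR_left integrable_real_indicator) auto
    fix x
    show "indicator (ball x0 d) x *\<^sub>R m \<le> (norm (f x))\<^sup>2"
    proof (cases "x \<in> ball x0 d")
      case True
      then have "norm (f x - f x0) < norm (f x0) / 2" using d(2)[of x] by (simp add: dist_commute dist_norm norm_minus_commute)
      then have "norm (f x0) / 2 \<le> norm (f x)" using norm_triangle_ineq3[of "f x" "f x0"] by linarith
      then have "m \<le> (norm (f x))\<^sup>2" unfolding m_def by (intro power_mono) auto
      then show ?thesis using True by simp
    qed simp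
  qed
  finally show ?thesis .
qed

definition ip :: "(real^3 \<Rightarrow> complex) \<Rightarrow> (real^3 \<Rightarrow> complex) \<Rightarrow> complex" where
  "ip f g = (LINT x|lborel. f x * cnj (g x))"

lemma ip_self: "bcs f \<Longrightarrow> ip f f = of_real (LINT x|lborel. (norm (f x))\<^sup>2)"
proof -
  have "ip f f = (LINT x|lborel. complex_of_real ((norm (f x))\<^sup>2))"
    unfolding ip_def by (rule Bochner_Integration.integral_cong) (simp_all only: complex_norm_square)
  then show ?thesis by (simp only: integral_complex_of_real)
qed

lemma ip_integrable: "bcs f \<Longrightarrow> bcs g \<Longrightarrow> integrable lborel (\<lambda>x. f x * cnj (g x))"
  by (intro bcs_integrable bcs_mult bcs_cnj)

lemma bcs_add:
  assumes "bcs f" "bcs g"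
  shows "bcs (\<lambda>x. f x + g x)"
proof -
  obtain M1 R1 where 1: "f \<in> borel_measurable borel" "\<And>x. norm (f x) \<le> M1" "\<And>x. norm x > R1 \<Longrightarrow> f x = 0"
    using assms(1) by (auto simp: bcs_def)
  obtain M2 R2 where 2: "g \<in> borel_measurable borel" "\<And>x. norm (g x) \<le> M2" "\<And>x. norm x > R2 \<Longrightarrow> g x = 0"
    using assms(2) by (auto simp: bcs_def)
  have "norm (f x + g x) \<le> M1 + M2" for x by (rule order_trans[OF norm_triangle_ineq add_mono[OF 1(2) 2(2)]])
  moreover have "f x + g x = 0" if "norm x > max R1 R2" for x using 1(3) 2(3) that by simp
  ultimately show ?thesis unfolding bcs_def using 1(1) 2(1)
    by (intro conjI exI[of _ "M1 + M2"] exI[of _ "max R1 R2"]) auto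
qed

lemma bcs_cmult:
  assumes "bcs f"
  shows "bcs (\<lambda>x. a * f x)"
proof -
  obtain M R where 1: "f \<in> borel_measurable borel" "\<And>x. norm (f x) \<le> M" "\<And>x. norm x > R \<Longrightarrow> f x = 0"
    using assms(1) by (auto simp: bcs_def)
  have "norm (a * f x) \<le> norm a * M" for x unfolding norm_mult using 1(2) by (intro mult_left_mono) auto
  then show ?thesis unfolding bcs_def using 1(1,3)
    by (intro conjI exI[of _ "norm a * M"] exI[of _ R]) auto
qed

lemma bcs_sum: "(\<And>j. j < N \<Longrightarrow> bcs (\<Phi> j)) \<Longrightarrow> bcs (\<lambda>x. \<Sum>j<(N::nat). a j * \<Phi> j x)"
proof (induction N)
  case 0
  show ?case by (auto simp: bcs_def)
next
  case (Suc N)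
  then show ?case by (simp add: bcs_add bcs_cmult)
qed

lemma ip_sum_left:
  assumes "\<And>j. j < N \<Longrightarrow> bcs (\<Phi> j)" "bcs g"
  shows "ip (\<lambda>x. \<Sum>j<(N::nat). a j * \<Phi> j x) g = (\<Sum>j<N. a j * ip (\<Phi> j) g)"
proof -
  have "ip (\<lambda>x. \<Sum>j<N. a j * \<Phi> j x) g = (LINT x|lborel. (\<Sum>j<N. a j * (\<Phi> j x * cnj (g x))))"
    unfolding ip_def by (simp add: sum_distrib_right mult.assoc)
  also have "\<dots> = (\<Sum>j<N. (LINT x|lborel. a j * (\<Phi> j x * cnj (g x))))"
    by (rule Bochner_Integration.integral_sum) (use assms in \<open>auto intro!: integrable_mult_right ip_integrable\<close>)
  finally show ?thesis by (simp add: ip_def)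
qed

lemma ip_cnj: "ip g f = cnj (ip f g)"
proof -
  have "cnj (ip f g) = (LINT x|lborel. cnj (f x * cnj (g x)))" unfolding ip_def by (rule Bochner_Integration.integral_cnj[symmetric])
  then show ?thesis by (simp add: ip_def mult.commute)
qed

definition comb :: "(nat \<Rightarrow> real^3 \<Rightarrow> complex) \<Rightarrow> nat \<Rightarrow> (real^3 \<Rightarrow> complex) \<Rightarrow> bool" where
  "comb U N f \<longleftrightarrow> (\<exists>c. \<forall>x. f x = (\<Sum>i<N. c i * U i x))"

lemma comb_cmult: "comb U N f \<Longrightarrow> comb U N (\<lambda>x. a * f x)"
proof -
  assume "comb U N f"
  then obtain c where "\<forall>x. f x = (\<Sum>i<N. c i * U i x)" by (auto simp: comb_def)
  then show ?thesis unfolding comb_def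
    by (intro exI[of _ "\<lambda>i. a * c i"]) (simp add: sum_distrib_left mult.assoc)
qed

lemma comb_add: "comb U N f \<Longrightarrow> comb U N g \<Longrightarrow> comb U N (\<lambda>x. f x + g x)"
proof -
  assume "comb U N f" "comb U N g"
  then obtain c d where "\<forall>x. f x = (\<Sum>i<N. c i * U i x)" "\<forall>x. g x = (\<Sum>i<N. d i * U i x)" by (auto simp: comb_def)
  then show ?thesis unfolding comb_def
    by (intro exI[of _ "\<lambda>i. c i + d i"]) (simp add: sum.distrib distrib_right)
qed

lemma comb_sum: "(\<And>j. j < M \<Longrightarrow> comb U N (\<Phi> j)) \<Longrightarrow> comb U N (\<lambda>x. \<Sum>j<(M::nat). a j * \<Phi> j x)"
proof (induction M)
  case 0
  then show ?case unfolding comb_def by (intro exI[of _ "\<lambda>_. 0"]) simp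
next
  case (Suc M)
  then show ?case by (simp add: comb_add comb_cmult)
qed

lemma comb_Suc: "comb U N f \<Longrightarrow> comb U (Suc N) f"
proof -
  assume "comb U N f"
  then obtain c where c: "\<forall>x. f x = (\<Sum>i<N. c i * U i x)" by (auto simp: comb_def)
  then have "\<forall>x. f x = (\<Sum>i<Suc N. (c(N := 0)) i * U i x)" by simp
  then show ?thesis unfolding comb_def by (rule exI[of _ "c(N := 0)"])
qed

lemma gram_schmidt:
  assumes D: "bounded D" and U: "\<And>i. zero_ext k D (U i)"
    and ind: "\<And>N c. (\<forall>x. (\<Sum>i<N. c i * U i x) = 0) \<Longrightarrow> (\<forall>i<N. c i = 0)"
  shows "\<exists>\<Phi>. (\<forall>j<N. comb U N (\<Phi> j)) \<and> (\<forall>j<N. \<forall>l<N. ip (\<Phi> j) (\<Phi> l) = (if j = l then 1 else 0))"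
proof (induction N)
  case 0
  show ?case by simp
next
  case (Suc N)
  then obtain \<Phi> where \<Phi>: "\<And>j. j < N \<Longrightarrow> comb U N (\<Phi> j)"
    "\<And>j l. j < N \<Longrightarrow> l < N \<Longrightarrow> ip (\<Phi> j) (\<Phi> l) = (if j = l then 1 else 0)" by blast
  have ze: "zero_ext k D f" if "comb U M f" for f M
  proof -
    obtain c where "\<forall>x. f x = (\<Sum>i<M. c i * U i x)" using \<open>comb U M f\<close> by (auto simp: comb_def)
    then have f: "f = (\<lambda>x. \<Sum>i<M. c i * U i x)" by blast
    show ?thesis unfolding f by (rule zero_ext_sum[OF U])
  qed
  have b\<Phi>: "bcs (\<Phi> j)" if "j < N" for j by (rule zero_ext_bcs[OF D ze[OF \<Phi>(1)[OF that]]])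
  have bU: "bcs (U N)" by (rule zero_ext_bcs[OF D U])
  define a where "a j = - ip (U N) (\<Phi> j)" for j
  define \<Psi> where "\<Psi> x = (\<Sum>j<N. a j * \<Phi> j x) + U N x" for x
  obtain d where d: "\<And>x. (\<Sum>j<N. a j * \<Phi> j x) = (\<Sum>i<N. d i * U i x)"
    using comb_sum[where M=N and \<Phi>=\<Phi> and a=a, OF \<Phi>(1)] by (auto simp: comb_def)
  have \<Psi>c: "\<Psi> x = (\<Sum>i<Suc N. (d(N := 1)) i * U i x)" for x by (simp add: \<Psi>_def d)
  then have comb\<Psi>: "comb U (Suc N) \<Psi>" unfolding comb_def by (intro exI[of _ "d(N := 1)"]) blast
  have z\<Psi>: "zero_ext k D \<Psi>" by (rule ze[OF comb\<Psi>])
  have b\<Psi>: "bcs \<Psi>" by (rule zero_ext_bcs[OF D z\<Psi>])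
  \<comment> \<open>In terms of the original functions, \<open>U N\<close> enters
    \<open>\<Psi>\<close> with coefficient 1, so independence prevents \<open>\<Psi>\<close> from
    vanishing identically.\<close>
  have "\<exists>x. \<Psi> x \<noteq> 0"
  proof (rule ccontr)
    assume "\<not> ?thesis"
    then have "\<forall>x. (\<Sum>i<Suc N. (d(N := 1)) i * U i x) = 0" using \<Psi>c by simp
    from ind[OF this] show False by auto
  qed
  then obtain x0 where "\<Psi> x0 \<noteq> 0" ..
  define m where "m = (LINT x|lborel. (norm (\<Psi> x))\<^sup>2)"
  have m: "m > 0" unfolding m_def by (rule L2_positive[OF b\<Psi> _ \<open>\<Psi> x0 \<noteq> 0\<close>]) (use z\<Psi> in \<open>simp add: zero_ext_def\<close>)
  have orth: "ip \<Psi> (\<Phi> l) = 0" if "l < N" for l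
  proof -
    have "ip \<Psi> (\<Phi> l) = ip (\<lambda>x. \<Sum>j<N. a j * \<Phi> j x) (\<Phi> l) + ip (U N) (\<Phi> l)"
      unfolding ip_def \<Psi>_def distrib_right
      by (intro Bochner_Integration.integral_add ip_integrable bcs_sum b\<Phi> bU that)
    also have "ip (\<lambda>x. \<Sum>j<N. a j * \<Phi> j x) (\<Phi> l) = (\<Sum>j<N. a j * ip (\<Phi> j) (\<Phi> l))"
      by (rule ip_sum_left) (use b\<Phi> that in auto)
    also have "\<dots> = (\<Sum>j<N. if j = l then a j else 0)" using \<Phi>(2) that by (intro sum.cong) auto
    also have "\<dots> = a l" using that by simp
    finally show ?thesis by (simp add: a_def)
  qed
  define \<psi> where "\<psi> x = of_real (1 / sqrt m) * \<Psi> x" for x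
  have ip1: "ip \<psi> g = of_real (1 / sqrt m) * ip \<Psi> g" for g
    unfolding ip_def \<psi>_def mult.assoc by (rule integral_mult_right_zero)
  have ip2: "ip g \<psi> = of_real (1 / sqrt m) * ip g \<Psi>" for g
    using ip1[of g] by (simp add: ip_cnj[of g])
  have self: "ip \<psi> \<psi> = 1"
  proof -
    have "ip \<psi> \<psi> = of_real (1 / sqrt m * (1 / sqrt m) * m)"
      unfolding ip1 ip2 ip_self[OF b\<Psi>] m_def[symmetric] by (simp only: of_real_mult mult.assoc)
    also have "1 / sqrt m * (1 / sqrt m) * m = 1" using m by (simp add: field_simps)
    finally show ?thesis by simp
  qed
  define \<Phi>' where "\<Phi>' = \<Phi>(N := \<psi>)"
  have "comb U (Suc N) (\<Phi>' j)" if "j < Suc N" for j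
    using that \<Phi>(1)[of j] comb_cmult[OF comb\<Psi>, of "of_real (1 / sqrt m)"]
    by (cases "j = N") (auto simp: \<Phi>'_def \<psi>_def[abs_def] intro: comb_Suc)
  moreover have "ip (\<Phi>' j) (\<Phi>' l) = (if j = l then 1 else 0)" if "j < Suc N" "l < Suc N" for j l
  proof -
    have o1: "ip \<psi> (\<Phi> i) = 0" if "i < N" for i using orth[OF that] by (simp add: ip1)
    then have o2: "ip (\<Phi> i) \<psi> = 0" if "i < N" for i using that ip_cnj[of "\<Phi> i" \<psi>] by simp
    show ?thesis using that \<Phi>(2)[of j l] self o1 o2 by (cases "j = N"; cases "l = N") (auto simp: \<Phi>'_def)
  qed
  ultimately show ?case by blast
qed

text \<open>If the first N functions are orthonormal, then at each point y the function
  sum_j cnj (phi_j y) phi_j has value S(y) = sum_j |phi_j y|^2 and squared norm S(y), so the sup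
  bound gives S(y) <= 2 C, and integration gives N <= 2 C vol D.\<close>

theorem zero_ext_dependent:
  fixes U :: "nat \<Rightarrow> real^3 \<Rightarrow> complex"
  assumes "k > 0" "open D" "bounded D" and U: "\<And>i. zero_ext k D (U i)"
  shows "\<exists>N c. (\<forall>x. (\<Sum>i<N. c i * U i x) = 0) \<and> (\<exists>i<N. c i \<noteq> 0)"
proof (rule ccontr)
  assume "\<not> ?thesis"
  then have ind: "\<And>N c. (\<forall>x. (\<Sum>i<N. c i * U i x) = 0) \<Longrightarrow> (\<forall>i<N. c i = 0)" by blast
  obtain C where C: "\<And>W y. zero_ext k D W \<Longrightarrow> norm (W y) \<le> (LINT x|lborel. (norm (W x))\<^sup>2) / 2 + C"
    using zero_ext_sup_bound[OF assms(1)] assms(2,3) by blast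
  define vol where "vol = measure lborel (closure D)"
  have cD: "compact (closure D)" using assms(3) by simp
  have "real N \<le> 2 * C * vol" for N
  proof -
    obtain \<Phi> where \<Phi>: "\<And>j. j < N \<Longrightarrow> comb U N (\<Phi> j)"
      "\<And>j l. j < N \<Longrightarrow> l < N \<Longrightarrow> ip (\<Phi> j) (\<Phi> l) = (if j = l then 1 else 0)"
      using gram_schmidt[where U=U and N=N, OF assms(3) U ind] by blast
    have ze: "zero_ext k D f" if "comb U N f" for f
    proof -
      obtain c where "\<forall>x. f x = (\<Sum>i<N. c i * U i x)" using \<open>comb U N f\<close> by (auto simp: comb_def)
      then have f: "f = (\<lambda>x. \<Sum>i<N. c i * U i x)" by blast
      show ?thesis unfolding f by (rule zero_ext_sum[OF U])
    qed
    have b\<Phi>: "bcs (\<Phi> j)" if "j < N" for j by (rule zero_ext_bcs[OF assms(3) ze[OF \<Phi>(1)[OF that]]])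
    define S where "S y = (\<Sum>j<N. (norm (\<Phi> j y))\<^sup>2)" for y
    have Sb: "S y \<le> 2 * C" for y
    proof -
      \<comment> \<open>The reproducing kernel of the span with one argument fixed at
        \<open>y\<close>: its inner product with each basis function is the value of that function
        at \<open>y\<close>.\<close>
      define W where "W x = (\<Sum>j<N. cnj (\<Phi> j y) * \<Phi> j x)" for x
      have cW: "comb U N W" unfolding W_def by (rule comb_sum[OF \<Phi>(1)])
      have bW: "bcs W" by (rule zero_ext_bcs[OF assms(3) ze[OF cW]])
      have Sc: "complex_of_real (S y) = (\<Sum>j<N. cnj (\<Phi> j y) * \<Phi> j y)"
        unfolding S_def of_real_sum complex_norm_square by (simp add: mult.commute)
      have "W y = of_real (S y)" unfolding Sc W_def ..
      moreover have "S y \<ge> 0" by (simp add: S_def sum_nonneg)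
      ultimately have Wy: "norm (W y) = S y" by simp
      have ipl: "ip (\<Phi> l) W = \<Phi> l y" if "l < N" for l
      proof -
        have "ip W (\<Phi> l) = (\<Sum>j<N. cnj (\<Phi> j y) * ip (\<Phi> j) (\<Phi> l))"
          unfolding W_def by (rule ip_sum_left) (use b\<Phi> that in auto)
        also have "\<dots> = (\<Sum>j<N. if j = l then cnj (\<Phi> j y) else 0)" using \<Phi>(2) that by (intro sum.cong) auto
        also have "\<dots> = cnj (\<Phi> l y)" using that by simp
        finally show ?thesis using ip_cnj[of "\<Phi> l" W] by simp
      qed
      have "ip W W = (\<Sum>j<N. cnj (\<Phi> j y) * ip (\<Phi> j) W)"
        using ip_sum_left[of N \<Phi> W "\<lambda>j. cnj (\<Phi> j y)"] b\<Phi> bW unfolding W_def by blast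
      also have "\<dots> = of_real (S y)" unfolding Sc using ipl by simp
      finally have "(LINT x|lborel. (norm (W x))\<^sup>2) = S y" unfolding ip_self[OF bW] by (simp only: of_real_eq_iff)
      then have "S y \<le> S y / 2 + C" using C[OF ze[OF cW], of y] Wy by simp
      then show ?thesis by simp
    qed
    have Sz: "S x = 0" if "x \<notin> closure D" for x
    proof -
      have "\<Phi> j x = 0" if "j < N" for j using ze[OF \<Phi>(1)[OF that]] \<open>x \<notin> closure D\<close> closure_subset by (auto simp: zero_ext_def)
      then show ?thesis by (simp add: S_def)
    qed
    have ij: "integrable lborel (\<lambda>x. (norm (\<Phi> j x))\<^sup>2)" if "j < N" for j
    proof -
      have "integrable lborel (\<lambda>x. Re (\<Phi> j x * cnj (\<Phi> j x)))" by (intro integrable_Re ip_integrable b\<Phi> that)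
      then show ?thesis by (simp add: complex_mult_cnj cmod_power2)
    qed
    have "(LINT x|lborel. S x) = (\<Sum>j<N. LINT x|lborel. (norm (\<Phi> j x))\<^sup>2)"
      unfolding S_def by (rule Bochner_Integration.integral_sum) (use ij in auto)
    also have "\<dots> = (\<Sum>j<N. 1)"
    proof (rule sum.cong[OF refl])
      fix j assume "j \<in> {..<N}"
      then have "complex_of_real (LINT x|lborel. (norm (\<Phi> j x))\<^sup>2) = 1" using ip_self[OF b\<Phi>, of j] \<Phi>(2)[of j j] by simp
      then show "(LINT x|lborel. (norm (\<Phi> j x))\<^sup>2) = 1" by (simp only: of_real_eq_1_iff)
    qed
    finally have "real N = (LINT x|lborel. S x)" by simp
    also have "\<dots> \<le> (LINT x|lborel. indicator (closure D) x *\<^sub>R (2 * C))"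
    proof (rule integral_mono)
      show "integrable lborel S" unfolding S_def by (rule Bochner_Integration.integrable_sum) (use ij in auto)
      show "integrable lborel (\<lambda>x. indicator (closure D) x *\<^sub>R (2 * C))"
        by (rule borel_integrable_compact[OF cD]) auto
      show "S x \<le> indicator (closure D) x *\<^sub>R (2 * C)" for x using Sb[of x] Sz[of x] by (auto simp: indicator_def)
    qed
    also have "\<dots> = 2 * C * vol" by (simp add: vol_def)
    finally show ?thesis .
  qed
  then show False using reals_Archimedean2[of "2 * C * vol"] by (meson not_le)
qed

text \<open>The combination g (t + h) + g (t - h) - 2 cos (l_N h) g t annihilates the last sine and
  multiplies the i-th one by 2 (cos (l_i h) - cos (l_N h)). Since it still tends to 0, induction
  removes all the other coefficients, and the remaining single sine does not tend to 0.\<close>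

lemma sin_independent:
  fixes l :: "nat \<Rightarrow> real" and c :: "nat \<Rightarrow> complex"
  assumes "\<And>i. l i > 0" "inj l"
    and "((\<lambda>t. \<Sum>i<N. c i * of_real (sin (l i * t))) \<longlongrightarrow> 0) at_top" "i < N"
  shows "c i = 0"
  using assms(3,4)
proof (induction N arbitrary: c i)
  case 0
  then show ?case by simp
next
  case (Suc N)
  define g where "g t = (\<Sum>i<Suc N. c i * of_real (sin (l i * t)))" for t
  have g: "(g \<longlongrightarrow> 0) at_top" using Suc.prems(1) by (simp add: g_def[abs_def])
  \<comment> \<open>This puts every \<open>l i * h\<close> strictly between 0 and pi, where the
    cosine is injective, so the new factors do not vanish.\<close>
  define h where "h = pi / (1 + (\<Sum>i<Suc N. l i))"
  have s0: "(\<Sum>i<Suc N. l i) \<ge> 0" using assms(1) by (intro sum_nonneg) (auto intro: less_imp_le)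
  have h0: "h > 0" using s0 by (simp add: h_def add_pos_nonneg)
  have lh: "0 < l i * h" "l i * h < pi" if "i < Suc N" for i
  proof -
    show "0 < l i * h" using assms(1) h0 by simp
    have "l i \<le> (\<Sum>i<Suc N. l i)" using that assms(1) by (intro member_le_sum) (auto intro: less_imp_le)
    then have "l i / (1 + (\<Sum>i<Suc N. l i)) < 1" using s0 by (subst divide_less_eq_1_pos) linarith+
    then have "pi * (l i / (1 + (\<Sum>i<Suc N. l i))) < pi * 1" by (intro mult_strict_left_mono) auto
    then show "l i * h < pi" by (simp add: h_def mult.commute)
  qed
  have sh: "filterlim (\<lambda>t. t + a) at_top at_top" for a :: real
    unfolding filterlim_at_top
  proof
    fix Z :: real
    show "\<forall>\<^sub>F t in at_top. Z \<le> t + a" using eventually_ge_at_top[of "Z - a"] by eventually_elim simp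
  qed
  have "((\<lambda>t. g (t + h) + g (t + (- h)) - of_real (2 * cos (l N * h)) * g t) \<longlongrightarrow> 0 + 0 - of_real (2 * cos (l N * h)) * 0) at_top"
    by (intro tendsto_intros g filterlim_compose[OF g sh])
  moreover have "g (t + h) + g (t + (- h)) - of_real (2 * cos (l N * h)) * g t
    = (\<Sum>i<N. (c i * of_real (2 * (cos (l i * h) - cos (l N * h)))) * of_real (sin (l i * t)))" for t
  proof -
    have ss: "sin (l i * (t + h)) + sin (l i * (t + (- h))) = 2 * cos (l i * h) * sin (l i * t)" for i
      by (simp add: distrib_left sin_add algebra_simps) (simp add: sin_diff algebra_simps)
    have "g (t + h) + g (t + (- h)) - of_real (2 * cos (l N * h)) * g t =
      (\<Sum>i<Suc N. c i * of_real (sin (l i * (t + h)) + sin (l i * (t + (- h))) - 2 * cos (l N * h) * sin (l i * t)))"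
      unfolding g_def sum_distrib_left sum.distrib[symmetric] sum_subtractf[symmetric]
      by (rule sum.cong) (auto simp: algebra_simps)
    also have "\<dots> = (\<Sum>i<Suc N. (c i * of_real (2 * (cos (l i * h) - cos (l N * h)))) * of_real (sin (l i * t)))"
      unfolding ss by (rule sum.cong) (auto simp: algebra_simps)
    finally show ?thesis by simp
  qed
  ultimately have lim: "((\<lambda>t. \<Sum>i<N. (c i * of_real (2 * (cos (l i * h) - cos (l N * h)))) * of_real (sin (l i * t))) \<longlongrightarrow> 0) at_top"
    by simp
  have small: "c i = 0" if "i < N" for i
  proof -
    have "c i * of_real (2 * (cos (l i * h) - cos (l N * h))) = 0" by (rule Suc.IH[OF lim that])
    moreover have "cos (l i * h) \<noteq> cos (l N * h)"
    proof
      assume "cos (l i * h) = cos (l N * h)"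
      then have "l i * h = l N * h" using cos_inj_pi[of "l i * h" "l N * h"] lh[of i] lh[of N] that by auto
      then have "l i = l N" using h0 by simp
      then show False using assms(2) that by (auto dest: injD)
    qed
    ultimately show ?thesis by auto
  qed
  have gN: "g t = c N * of_real (sin (l N * t))" for t using small by (simp add: g_def)
  have "c N = 0"
  proof -
    \<comment> \<open>Arguments tending to infinity at which the last sine equals 1.\<close>
    define \<tau> where "\<tau> n = (pi / 2 + real n * (2 * pi)) / l N" for n :: nat
    have "filterlim \<tau> at_top sequentially"
    proof -
      have "filterlim (\<lambda>n. (pi / 2 + real n * (2 * pi)) * (1 / l N)) at_top sequentially"
        using assms(1)[of N]
        by (intro filterlim_at_top_mult_tendsto_pos[OF tendsto_const] filterlim_tendsto_add_at_top[OF tendsto_const]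
             filterlim_real_sequentially) auto
      then show ?thesis by (simp add: \<tau>_def[abs_def])
    qed
    from filterlim_compose[OF g this] have "(\<lambda>n. g (\<tau> n)) \<longlonglongrightarrow> 0" .
    moreover have "g (\<tau> n) = c N" for n
    proof -
      have "l N * \<tau> n = pi / 2 + real n * (2 * pi)" using assms(1)[of N] by (simp add: \<tau>_def)
      moreover have "sin (pi / 2 + real n * (2 * pi)) = 1"
        using cos_2npi[of n] by (simp add: sin_add mult.commute mult.left_commute)
      ultimately show ?thesis unfolding gN by simp
    qed
    ultimately show ?thesis by (simp add: LIMSEQ_const_iff)
  qed
  then show ?case using small Suc.prems(2) by (cases "i = N") auto
qed

section \<open>Total fields over perturbed surfaces\<close>

lemma linear_tild: "linear tild"
  by (rule linearI) (simp_all add: tild_def vec_eq_iff forall_2)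

lemma continuous_tild: "continuous_on A tild"
  by (rule linear_continuous_on) (use linear_tild in \<open>simp add: linear_conv_bounded_linear\<close>)

lemma tild_component: "tild x $ 1 = x$1" "tild x $ 2 = x$2"
  by (simp_all add: tild_def)

lemma axis3_components: "(x + t *\<^sub>R axis 3 1 :: real^3) $ 1 = x$1" "(x + t *\<^sub>R axis 3 1 :: real^3) $ 2 = x$2"
  "(x + t *\<^sub>R axis 3 1 :: real^3) $ 3 = x$3 + t"
  by (simp_all add: axis_def)

lemma tild_up: "tild (x + t *\<^sub>R axis 3 1) = tild x"
  unfolding vec_eq_iff forall_2 tild_component axis3_components by simp

lemma norm_tild: "(norm x)\<^sup>2 = (norm (tild x))\<^sup>2 + (x$3)\<^sup>2"
  unfolding power2_norm_eq_inner inner_vec_def sum_3 sum_2 tild_component by (simp add: power2_eq_square)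

lemma lp_continuous:
  assumes "locally_perturbed f"
  shows "continuous_on A (\<lambda>x. f (tild x))"
proof -
  obtain L where "L-lipschitz_on UNIV f" using assms by (auto simp: locally_perturbed_def)
  then have "continuous_on UNIV f" by (rule lipschitz_on_continuous_on)
  then show ?thesis using continuous_on_compose2[OF _ continuous_tild] by blast
qed

lemma lp_radius:
  assumes "locally_perturbed f"
  obtains R where "R > 0" "\<And>y. norm y > R \<Longrightarrow> f y = 0" "\<And>y. \<bar>f y\<bar> < R"
proof -
  obtain R where *: "\<forall>y. norm y > R \<longrightarrow> f y = 0" "\<forall>y. \<bar>f y\<bar> < R" using assms by (auto simp: locally_perturbed_def)
  then have "R > 0" using abs_ge_zero[of "f 0"] by (meson le_less_trans)
  with * that show ?thesis by blast
qed

lemma open_Omega: "locally_perturbed f \<Longrightarrow> open (Omega f)"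
  unfolding Omega_def by (intro open_Collect_less lp_continuous continuous_intros)

lemma up_in_Omega: "x \<in> Omega f \<or> x \<in> Gamma f \<Longrightarrow> t > 0 \<Longrightarrow> x + t *\<^sub>R axis 3 1 \<in> Omega f"
  by (auto simp: Omega_def Gamma_def tild_up axis3_components)

lemma up_sequence: "(\<lambda>n. x + inverse (real (Suc n)) *\<^sub>R axis 3 1) \<longlonglongrightarrow> (x :: real^3)"
proof -
  have "(\<lambda>n. x + inverse (real (Suc n)) *\<^sub>R axis 3 1) \<longlonglongrightarrow> x + 0 *\<^sub>R axis 3 1"
    by (intro tendsto_intros LIMSEQ_inverse_real_of_nat)
  then show ?thesis by simp
qed

lemma Gamma_closure: "x \<in> Gamma f \<Longrightarrow> x \<in> closure (Omega f)"
  unfolding closure_sequential using up_sequence[of x] up_in_Omega[of x f]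
  by (intro exI[of _ "\<lambda>n. x + inverse (real (Suc n)) *\<^sub>R axis 3 1"]) auto

lemma helmholtz_imp_helm:
  assumes "helmholtz_on S k u"
  shows "helm k S u"
proof -
  have d: "((\<lambda>t. v (x + t *\<^sub>R axis i 1)) has_vector_derivative pdiff i v x) (at 0)" if "v differentiable (at x)" for v i x
  proof -
    have "(\<lambda>t. x + t *\<^sub>R axis i 1) differentiable (at (0::real))" by (intro derivative_intros differentiableI) (auto intro!: derivative_eq_intros) 
    moreover have "v differentiable (at (x + 0 *\<^sub>R axis i 1))" using that by simp
    ultimately have "(v \<circ> (\<lambda>t. x + t *\<^sub>R axis i 1)) differentiable (at 0)"
      by (intro differentiable_chain_at) auto
    then show ?thesis unfolding pdiff_def vector_derivative_works by (simp add: o_def)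
  qed
  have "continuous_on S u" using assms
    by (auto simp: helmholtz_on_def intro!: continuous_at_imp_continuous_on differentiable_imp_continuous_within)
  moreover have "axis2 S u (\<lambda>i. pdiff i u) (\<lambda>i. pdiff i (pdiff i u))"
    unfolding axis2_def using assms d by (auto simp: helmholtz_on_def)
  ultimately show ?thesis unfolding helm_def using assms
    by (intro conjI exI[of _ "\<lambda>i. pdiff i u"] exI[of _ "\<lambda>i. pdiff i (pdiff i u)"]) (auto simp: helmholtz_on_def)
qed

text \<open>On an open set the existential derivatives of \<open>helm\<close> are determined by
  \<open>u\<close>. Passing to \<open>pdiff\<close> gives a choice independent of the set, so that
  solutions on two open sets can be glued.\<close>

lemma helm_pdiff:
  assumes "open S" "helm k S u"
  shows "axis2 S u (\<lambda>i. pdiff i u) (\<lambda>i. pdiff i (pdiff i u))"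
    "\<And>x. x \<in> S \<Longrightarrow> (\<Sum>i\<in>UNIV. pdiff i (pdiff i u) x) + complex_of_real (k\<^sup>2) * u x = 0"
proof -
  obtain G H where ax: "axis2 S u G H" and eq: "\<And>x. x \<in> S \<Longrightarrow> (\<Sum>i\<in>UNIV. H i x) + complex_of_real (k\<^sup>2) * u x = 0"
    using assms by (auto simp: helm_def)
  have G: "pdiff i u x = G i x" if "x \<in> S" for i x
    unfolding pdiff_def by (rule vector_derivative_at) (use ax that in \<open>auto simp: axis2_def\<close>)
  have d2: "((\<lambda>t. pdiff i u (x + t *\<^sub>R axis i 1)) has_vector_derivative H i x) (at 0)" if "x \<in> S" for i x
  proof -
    obtain e where e: "e > 0" "ball x e \<subseteq> S" using openE[OF assms(1) \<open>x \<in> S\<close>] by blast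
    have inS: "x + t *\<^sub>R axis i 1 \<in> S" if "t \<in> {-e<..<e}" for t
      using that by (intro subsetD[OF e(2)]) (auto simp: dist_norm norm_axis_1)
    have "((\<lambda>t. G i (x + t *\<^sub>R axis i 1)) has_vector_derivative H i x) (at 0)" using ax that by (auto simp: axis2_def)
    then show ?thesis
      by (rule has_vector_derivative_transform_within_open[where S="{-e<..<e}"]) (use e G inS in auto)
  qed
  have H: "pdiff i (pdiff i u) x = H i x" if "x \<in> S" for i x
    unfolding pdiff_def[of i "pdiff i u"] by (rule vector_derivative_at[OF d2[OF that]])
  show "axis2 S u (\<lambda>i. pdiff i u) (\<lambda>i. pdiff i (pdiff i u))"
    unfolding axis2_def using d2 G H ax by (auto simp: axis2_def)
  show "(\<Sum>i\<in>UNIV. pdiff i (pdiff i u) x) + complex_of_real (k\<^sup>2) * u x = 0" if "x \<in> S" for x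
    using eq[OF that] H[OF that] by simp
qed

lemma helm_Un:
  assumes "open S" "open T" "helm k S u" "helm k T u"
  shows "helm k (S \<union> T) u"
proof -
  have "axis2 (S \<union> T) u (\<lambda>i. pdiff i u) (\<lambda>i. pdiff i (pdiff i u))"
    using helm_pdiff(1)[OF assms(1,3)] helm_pdiff(1)[OF assms(2,4)] by (auto simp: axis2_def)
  moreover have "continuous_on (S \<union> T) u" using assms by (intro continuous_on_open_Un) (auto simp: helm_def)
  ultimately show ?thesis unfolding helm_def
    using helm_pdiff(2)[OF assms(1,3)] helm_pdiff(2)[OF assms(2,4)] by blast
qed

lemma helm_cong:
  assumes "open S" "helm k S u" "\<And>x. x \<in> S \<Longrightarrow> u x = v x"
  shows "helm k S v"
proof -
  obtain G H where ax: "axis2 S u G H" and eq: "\<And>x. x \<in> S \<Longrightarrow> (\<Sum>i\<in>UNIV. H i x) + complex_of_real (k\<^sup>2) * u x = 0"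
    using assms by (auto simp: helm_def)
  have "((\<lambda>t. v (x + t *\<^sub>R axis i 1)) has_vector_derivative G i x) (at 0)" if "x \<in> S" for i x
  proof -
    obtain e where e: "e > 0" "ball x e \<subseteq> S" using openE[OF assms(1) \<open>x \<in> S\<close>] by blast
    have inS: "x + t *\<^sub>R axis i 1 \<in> S" if "t \<in> {-e<..<e}" for t
      using that by (intro subsetD[OF e(2)]) (auto simp: dist_norm norm_axis_1)
    have "((\<lambda>t. u (x + t *\<^sub>R axis i 1)) has_vector_derivative G i x) (at 0)" using ax that by (auto simp: axis2_def)
    then show ?thesis
      by (rule has_vector_derivative_transform_within_open[where S="{-e<..<e}"]) (use e assms(3) inS in auto)
  qed
  then have "axis2 S v G H" using ax by (auto simp: axis2_def)
  moreover have "continuous_on S v" using assms continuous_on_cong[of S S u v] by (auto simp: helm_def)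
  moreover have "\<forall>x\<in>S. (\<Sum>i\<in>UNIV. H i x) + complex_of_real (k\<^sup>2) * v x = 0" using eq assms(3) by simp
  ultimately show ?thesis unfolding helm_def by blast
qed

lemma helm_mirror:
  assumes "helm k S u" "\<And>x. x \<in> T \<Longrightarrow> mirror j y x \<in> S"
  shows "helm k T (\<lambda>x. u (mirror j y x))"
proof -
  obtain G H where ax: "axis2 S u G H" and eq: "\<And>x. x \<in> S \<Longrightarrow> (\<Sum>i\<in>UNIV. H i x) + complex_of_real (k\<^sup>2) * u x = 0"
    and c: "continuous_on S u" using assms by (auto simp: helm_def)
  have "continuous_on T (\<lambda>x. u (mirror j y x))"
    by (rule continuous_on_compose2[OF c mirror_continuous]) (use assms(2) in auto)
  moreover have "\<forall>x\<in>T. (\<Sum>i\<in>UNIV. H i (mirror j y x)) + complex_of_real (k\<^sup>2) * u (mirror j y x) = 0"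
    using eq assms(2) by blast
  ultimately show ?thesis unfolding helm_def using axis2_mirror[OF ax assms(2)]
    by (intro conjI exI[of _ "\<lambda>i x. (if i = j then -1 else 1) *\<^sub>R G i (mirror j y x)"] exI[of _ "\<lambda>i x. H i (mirror j y x)"]) auto
qed

text \<open>Incident and reflected waves are common to both surfaces and drop out of the difference,
  as do the leading terms of the two expansions. Far out both surfaces coincide with the plane, so
  the difference vanishes on it there, which makes the odd extension continuous.\<close>

lemma total_fields_agree:
  assumes "k > 0" and lp: "locally_perturbed f1" "locally_perturbed f2"
    and tf: "dirichlet_total_field k f1 d u1" "dirichlet_total_field k f2 d u2"
    and ff: "far_field k (Omega f1) (\<lambda>x. u1 x - u_in k d x - u_re_D k d x) F1"
      "far_field k (Omega f2) (\<lambda>x. u2 x - u_in k d x - u_re_D k d x) F2"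
    and F: "\<forall>xh\<in>S2plus. F1 xh = F2 xh" and x: "x \<in> Omega f1 \<inter> Omega f2"
  shows "u1 x = u2 x"
proof -
  obtain R1 where R1: "R1 > 0" "\<And>y. norm y > R1 \<Longrightarrow> f1 y = 0" "\<And>y. \<bar>f1 y\<bar> < R1" by (rule lp_radius[OF lp(1)]) (rule that)
  obtain R2 where R2: "R2 > 0" "\<And>y. norm y > R2 \<Longrightarrow> f2 y = 0" "\<And>y. \<bar>f2 y\<bar> < R2" by (rule lp_radius[OF lp(2)]) (rule that)
  obtain C1 T1 where C1: "\<And>x. x \<in> Omega f1 \<Longrightarrow> norm x \<ge> T1 \<Longrightarrow> cmod (u1 x - u_in k d x - u_re_D k d x - exp (\<i> * complex_of_real (k * norm x)) / complex_of_real (norm x) * F1 (x /\<^sub>R norm x)) \<le> C1 / (norm x)^2"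
    using ff(1) unfolding far_field_def by blast
  obtain C2 T2 where C2: "\<And>x. x \<in> Omega f2 \<Longrightarrow> norm x \<ge> T2 \<Longrightarrow> cmod (u2 x - u_in k d x - u_re_D k d x - exp (\<i> * complex_of_real (k * norm x)) / complex_of_real (norm x) * F2 (x /\<^sub>R norm x)) \<le> C2 / (norm x)^2"
    using ff(2) unfolding far_field_def by blast
  define R where "R = R1 + R2"
  \<comment> \<open>Norm above 2 R forces horizontal part or height above R in modulus. In the first
    case both profiles vanish at that point; in the second a positive height exceeds both of
    them.\<close>
  define \<rho> where "\<rho> = 2 * R + \<bar>T1\<bar> + \<bar>T2\<bar>"
  have R: "R > 0" "R1 \<le> R" "R2 \<le> R" "2 * R \<le> \<rho>" "T1 \<le> \<rho>" "T2 \<le> \<rho>" "\<rho> > 0" using R1(1) R2(1) by (auto simp: R_def \<rho>_def)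
  have far: "norm (tild x) > R \<or> \<bar>x$3\<bar> > R" if "norm x > \<rho>" for x :: "real^3"
  proof (rule ccontr)
    assume "\<not> ?thesis"
    then have "(norm (tild x))\<^sup>2 \<le> R\<^sup>2" "\<bar>x$3\<bar>\<^sup>2 \<le> R\<^sup>2"
      using power_mono[of "norm (tild x)" R 2] power_mono[of "\<bar>x$3\<bar>" R 2] by auto
    then have "(norm x)\<^sup>2 \<le> 2 * R\<^sup>2" unfolding norm_tild by simp
    also have "\<dots> \<le> (2 * R)\<^sup>2" by (simp add: power_mult_distrib)
    finally have "norm x \<le> 2 * R" by (rule power2_le_imp_le) (use R(1) in simp)
    then show False using that R by linarith
  qed
  have upper: "x \<in> Omega f1 \<inter> Omega f2" if "norm x > \<rho>" "x$3 > 0" for x :: "real^3"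
    using far[OF that(1)] that(2) R1(2,3)[of "tild x"] R2(2,3)[of "tild x"] R(2,3) by (auto simp: Omega_def)
  have plane: "x \<in> Gamma f1 \<inter> Gamma f2" if "norm x > \<rho>" "x$3 = 0" for x :: "real^3"
    using far[OF that(1)] that(2) R1(2)[of "tild x"] R2(2)[of "tild x"] R by (auto simp: Gamma_def)
  define w where "w x = u1 x - u2 x" for x :: "real^3"
  have O: "open (Omega f1 \<inter> Omega f2)" using open_Omega[OF lp(1)] open_Omega[OF lp(2)] by (rule open_Int)
  have hw: "helm k (Omega f1 \<inter> Omega f2) w" unfolding w_def
    using tf by (intro helm_diff) (auto simp: dirichlet_total_field_def intro: helm_subset[OF helmholtz_imp_helm])
  have wplane: "w x = 0" if "norm x > \<rho>" "x$3 = 0" for x :: "real^3"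
    using plane[OF that] tf by (auto simp: w_def dirichlet_total_field_def)
  have wcont: "continuous_on {x::real^3. norm x > \<rho> \<and> x$3 \<ge> 0} w"
  proof -
    have "{x::real^3. norm x > \<rho> \<and> x$3 \<ge> 0} \<subseteq> closure (Omega f1) \<inter> closure (Omega f2)"
    proof
      fix x :: "real^3" assume "x \<in> {x. norm x > \<rho> \<and> x$3 \<ge> 0}"
      then consider "norm x > \<rho>" "x$3 > 0" | "norm x > \<rho>" "x$3 = 0" by fastforce
      then show "x \<in> closure (Omega f1) \<inter> closure (Omega f2)"
        by cases (use upper plane Gamma_closure closure_subset in blast)+
    qed
    then show ?thesis unfolding w_def using tf
      by (intro continuous_on_diff) (auto simp: dirichlet_total_field_def elim!: continuous_on_subset)
  qed
  let ?m = "mirror 3 0"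
  have m3: "?m x $ 3 = - x$3" for x :: "real^3" by (simp add: mirror0_component)
  define V where "V x = (if x$3 \<le> 0 then - w (?m x) else w x)" for x :: "real^3"
  have Vcont: "continuous_on {x. \<rho> < norm x} V" unfolding V_def
  proof (rule continuous_on_cases_le)
    show "continuous_on {t \<in> {x::real^3. \<rho> < norm x}. t $ 3 \<le> 0} (\<lambda>x. - w (?m x))"
      by (intro continuous_intros continuous_on_compose2[OF wcont mirror_continuous]) (auto simp: norm_mirror0 m3)
    show "continuous_on {t \<in> {x::real^3. \<rho> < norm x}. 0 \<le> t $ 3} w" using wcont by (rule continuous_on_subset) auto
    show "- w (?m t) = w t" if "t \<in> {x. \<rho> < norm x}" "t $ 3 = 0" for t :: "real^3"
      using that wplane[of t] by (simp add: mirror0)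
  qed (intro continuous_intros)
  have Vodd: "V (?m x) = - V x" if "\<rho> < norm x" for x :: "real^3"
    using wplane[OF that] wplane[of "?m x"] that by (auto simp: V_def m3 mirror_mirror norm_mirror0)
  have Vhelm: "helm k {x::real^3. \<rho> < norm x \<and> x$3 \<noteq> 0} V"
  proof -
    let ?P = "{x::real^3. \<rho> < norm x \<and> x$3 > 0}"
    let ?M = "{x::real^3. \<rho> < norm x \<and> x$3 < 0}"
    have oP: "open ?P" and oM: "open ?M" by (intro open_Collect_conj open_Collect_less continuous_intros)+
    have hP: "helm k ?P w" by (rule helm_subset[OF hw]) (use upper in auto)
    have "helm k ?P V" by (rule helm_cong[OF oP hP]) (auto simp: V_def)
    moreover have "helm k ?M V"
    proof (rule helm_cong[OF oM])
      show "helm k ?M (\<lambda>x. (-1) * w (?m x))"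
        by (intro helm_cmult helm_mirror[OF hP]) (auto simp: norm_mirror0 m3)
    qed (auto simp: V_def)
    moreover have "{x::real^3. \<rho> < norm x \<and> x$3 \<noteq> 0} = ?P \<union> ?M" by auto
    ultimately show ?thesis using helm_Un[OF oP oM] by simp
  qed
  have Vweak: "weak_helm k {x. \<rho> < norm x} V" by (rule odd_reflection_weak_helm[OF Vcont Vodd Vhelm])
  have wdec: "norm (w x) \<le> (\<bar>C1\<bar> + \<bar>C2\<bar>) / (norm x)\<^sup>2" if "norm x > \<rho>" "x$3 > 0" for x :: "real^3"
  proof -
    define E where "E = exp (\<i> * complex_of_real (k * norm x)) / complex_of_real (norm x) * F1 (x /\<^sub>R norm x)"
    have "norm x > 0" using that R by linarith
    then have "x /\<^sub>R norm x \<in> S2plus" using that by (simp add: S2plus_def)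
    then have "F2 (x /\<^sub>R norm x) = F1 (x /\<^sub>R norm x)" using F by simp
    then have a: "cmod (u1 x - u_in k d x - u_re_D k d x - E) \<le> C1 / (norm x)^2" "cmod (u2 x - u_in k d x - u_re_D k d x - E) \<le> C2 / (norm x)^2"
      using C1[of x] C2[of x] upper[OF that] that R by (auto simp: E_def)
    have weq: "w x = (u1 x - u_in k d x - u_re_D k d x - E) - (u2 x - u_in k d x - u_re_D k d x - E)" by (simp add: w_def)
    have "norm (w x) \<le> C1 / (norm x)^2 + C2 / (norm x)^2"
      unfolding weq by (rule order_trans[OF norm_triangle_ineq4 add_mono[OF a]])
    also have "\<dots> \<le> (\<bar>C1\<bar> + \<bar>C2\<bar>) / (norm x)\<^sup>2"
      unfolding add_divide_distrib[symmetric] by (intro divide_right_mono) auto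
    finally show ?thesis .
  qed
  have Vdec: "norm (V x) \<le> (\<bar>C1\<bar> + \<bar>C2\<bar>) / (norm x)\<^sup>2" if "\<rho> < norm x" for x :: "real^3"
  proof -
    consider "x$3 > 0" | "x$3 < 0" | "x$3 = 0" by linarith
    then show ?thesis
    proof cases
      case 1 then show ?thesis using wdec[OF that] by (simp add: V_def)
    next
      case 2 then show ?thesis using wdec[of "?m x"] that by (simp add: V_def norm_mirror0 m3)
    next
      case 3 then show ?thesis using wplane[OF that] by (simp add: V_def mirror0)
    qed
  qed
  have wz: "w x = 0" if "norm x > 12 * \<rho>" "x$3 > 0" for x :: "real^3"
    using rellich[OF R(7) assms(1) Vweak Vdec that(1)] that(2) by (simp add: V_def)
  have "w (x + 0 *\<^sub>R axis 3 1) = 0"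
  \<comment> \<open>The starting parameter is high enough that all points within parameter distance
    1 have positive height and norm above 12 \<rho>, since the norm at parameter t is at least t
    minus the norm of \<open>x\<close>.\<close>
  proof (rule helm_line_unique_continuation[OF O helm_imp_weak_helm[OF hw O], where I="{0..}" and ?t0.0="12 * \<rho> + 2 * norm x + 2" and \<epsilon>=1])
    show "x + t *\<^sub>R axis 3 1 \<in> Omega f1 \<inter> Omega f2" if "t \<in> {0..}" for t
      using that x by (auto simp: Omega_def tild_up axis3_components)
    show "w (x + t *\<^sub>R axis 3 1) = 0" if "\<bar>t - (12 * \<rho> + 2 * norm x + 2)\<bar> < 1" for t
    proof (rule wz)
      have t: "t > 12 * \<rho> + 2 * norm x + 1" using that by linarith
      then have "t > 0" using R(7) norm_ge_zero[of x] by linarith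
      have "norm (t *\<^sub>R axis 3 (1::real) :: real^3) = t" using \<open>t > 0\<close> by (simp add: norm_axis_1)
      then have "t \<le> norm (x + t *\<^sub>R axis 3 1) + norm x"
        using norm_triangle_ineq4[of "x + t *\<^sub>R axis 3 1" x] by simp
      then show "12 * \<rho> < norm (x + t *\<^sub>R axis 3 1)" using t norm_ge_zero[of x] by linarith
      show "0 < (x + t *\<^sub>R axis 3 1) $ 3" unfolding axis3_components
        using t component_le_norm_cart[of x 3] R norm_ge_zero[of x] by linarith
    qed
  qed (use R in \<open>auto simp: norm_axis_1\<close>)
  then show ?thesis by (simp add: w_def)
qed

lemma zero_extension_continuous:
  fixes u :: "real^3 \<Rightarrow> complex"
  assumes "open D" "continuous_on (closure D) u" "\<And>x. x \<in> closure D - D \<Longrightarrow> u x = 0"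
  shows "continuous_on UNIV (\<lambda>x. if x \<in> D then u x else 0)"
proof -
  have "continuous_on (closure D \<union> - D) (\<lambda>x. if x \<in> D then u x else 0)"
    by (rule continuous_on_If) (use assms in auto)
  moreover have "closure D \<union> - D = UNIV" using closure_subset[of D] by auto
  ultimately show ?thesis by simp
qed

lemma sgn_up_tendsto:
  fixes x :: "real^3"
  shows "((\<lambda>t. sgn (x + t *\<^sub>R axis 3 1)) \<longlongrightarrow> axis 3 1) at_top"
proof -
  have "((\<lambda>t. inverse t *\<^sub>R x + axis 3 1) \<longlongrightarrow> 0 *\<^sub>R x + axis 3 1) at_top"
    by (intro tendsto_add tendsto_scaleR tendsto_const tendsto_inverse_0_at_top filterlim_ident)
  then have "((\<lambda>t. inverse t *\<^sub>R x + axis 3 1) \<longlongrightarrow> axis 3 (1::real)) at_top" by simp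
  then have "((\<lambda>t. sgn (inverse t *\<^sub>R x + axis 3 1)) \<longlongrightarrow> sgn (axis 3 (1::real))) at_top"
    by (rule tendsto_sgn) (simp add: axis_eq_0_iff)
  moreover have "sgn (axis 3 (1::real)) = (axis 3 1 :: real^3)" by (simp add: sgn_div_norm norm_axis_1)
  moreover have "eventually (\<lambda>t. sgn (inverse t *\<^sub>R x + axis 3 1) = sgn (x + t *\<^sub>R axis 3 1)) at_top"
    using eventually_gt_at_top[of 0]
  proof (rule eventually_mono)
    fix t :: real assume "0 < t"
    then have "x + t *\<^sub>R axis 3 1 = t *\<^sub>R (inverse t *\<^sub>R x + axis 3 1)" by (simp add: scaleR_add_right)
    then show "sgn (inverse t *\<^sub>R x + axis 3 1) = sgn (x + t *\<^sub>R axis 3 1)"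
      using \<open>0 < t\<close> by (simp add: sgn_scaleR)
  qed
  ultimately show ?thesis using Lim_transform_eventually by fastforce
qed

lemma norm_up_at_top:
  fixes x :: "real^3"
  shows "filterlim (\<lambda>t. norm (x + t *\<^sub>R axis 3 1)) at_top at_top"
proof (rule filterlim_at_top_mono)
  show "filterlim (\<lambda>t::real. - norm x + t) at_top at_top"
    by (rule filterlim_tendsto_add_at_top[OF tendsto_const filterlim_ident])
  show "\<forall>\<^sub>F t in at_top. - norm x + t \<le> norm (x + t *\<^sub>R axis 3 1)"
    using eventually_gt_at_top[of 0]
  proof (rule eventually_mono)
    fix t :: real assume "0 < t"
    then have "norm (t *\<^sub>R axis 3 (1::real) :: real^3) = t" by (simp add: norm_axis_1)
    then show "- norm x + t \<le> norm (x + t *\<^sub>R axis 3 1)"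
      using norm_triangle_ineq4[of "x + t *\<^sub>R axis 3 1" x] by simp
  qed
qed

text \<open>The far field itself is bounded near the vertical direction: compare it with the field on a
  fixed large sphere.\<close>

lemma far_field_vertical_decay:
  assumes lp: "locally_perturbed f" and ff: "far_field k (Omega f) v F"
    and cont: "continuous_on (Omega f) v"
  shows "((\<lambda>t. v (x + t *\<^sub>R axis 3 1)) \<longlongrightarrow> 0) at_top"
proof -
  obtain R where R: "R > 0" "\<And>y. norm y > R \<Longrightarrow> f y = 0" "\<And>y. \<bar>f y\<bar> < R"
    by (rule lp_radius[OF lp]) (rule that)
  obtain C T where CT: "\<And>x. x \<in> Omega f \<Longrightarrow> norm x \<ge> T \<Longrightarrow>
      cmod (v x - exp (\<i> * complex_of_real (k * norm x)) / complex_of_real (norm x) * F (x /\<^sub>R norm x)) \<le> C / (norm x)^2"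
    using ff unfolding far_field_def by blast
  define r where "r = \<bar>T\<bar> + R + 1"
  have r: "r > 0" "r > R" "r \<ge> T" using R(1) by (auto simp: r_def)
  define p :: "real^3" where "p = r *\<^sub>R axis 3 1"
  have p: "p \<in> Omega f" using R(3)[of "tild p"] r by (auto simp: Omega_def p_def axis_def)
  define y where "y t = x + t *\<^sub>R axis 3 1" for t
  \<comment> \<open>The point of the fixed sphere in the same direction as \<open>y t\<close>: the
    expansions at both points contain the same value of \<open>F\<close>, about which nothing else
    is known.\<close>
  define h where "h t = r *\<^sub>R sgn (y t)" for t
  have hp: "(h \<longlongrightarrow> p) at_top" unfolding h_def p_def y_def
    by (intro tendsto_scaleR tendsto_const sgn_up_tendsto)
  have "isCont v p" using cont p open_Omega[OF lp] by (simp add: continuous_on_eq_continuous_at)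
  then have "((\<lambda>t. v (h t)) \<longlongrightarrow> v p) at_top" using hp by (rule isCont_tendsto_compose)
  then have vh: "\<forall>\<^sub>F t in at_top. cmod (v (h t)) < cmod (v p) + 1"
    by (intro order_tendstoD(2)[OF tendsto_norm]) auto
  have hO: "\<forall>\<^sub>F t in at_top. h t \<in> Omega f" using topological_tendstoD[OF hp open_Omega[OF lp] p] .
  have ny: "filterlim (\<lambda>t. norm (y t)) at_top at_top" unfolding y_def by (rule norm_up_at_top)
  have nT: "\<forall>\<^sub>F t in at_top. norm (y t) \<ge> max T 1" using ny unfolding filterlim_at_top by blast
  define B where "B = r * (cmod (v p) + 1 + C / r\<^sup>2)"
  have bound: "\<forall>\<^sub>F t in at_top. cmod (v (y t)) \<le> C * (inverse (norm (y t)))\<^sup>2 + B * inverse (norm (y t))"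
    using vh hO nT eventually_gt_at_top[of "f (tild x) - x$3"]
  proof eventually_elim
    case (elim t)
    have yO: "y t \<in> Omega f" using elim(4) by (auto simp: y_def Omega_def tild_up axis3_components)
    have y0: "norm (y t) > 0" "norm (y t) \<ge> T" using elim(3) by auto
    then have nh: "norm (h t) = r" using r by (simp add: h_def norm_sgn)
    have sh: "h t /\<^sub>R norm (h t) = y t /\<^sub>R norm (y t)" unfolding nh using r by (simp add: h_def sgn_div_norm)
    define E where "E = F (y t /\<^sub>R norm (y t))"
    have "cmod (v (h t) - exp (\<i> * complex_of_real (k * r)) / complex_of_real r * E) \<le> C / r\<^sup>2"
      using CT[OF elim(2)] r nh sh by (simp add: E_def)
    moreover have "cmod (exp (\<i> * complex_of_real (k * r)) / complex_of_real r * E) = cmod E / r"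
      using r by (simp add: norm_mult norm_divide norm_exp_i_times del: of_real_mult)
    ultimately have "cmod E / r \<le> cmod (v (h t)) + C / r\<^sup>2"
      using norm_triangle_ineq2[of "exp (\<i> * complex_of_real (k * r)) / complex_of_real r * E" "v (h t)"]
      by (simp add: norm_minus_commute)
    also have "\<dots> \<le> cmod (v p) + 1 + C / r\<^sup>2" using elim(1) by simp
    finally have "cmod E \<le> B" using r by (simp add: B_def pos_divide_le_eq mult.commute)
    have "cmod (v (y t) - exp (\<i> * complex_of_real (k * norm (y t))) / complex_of_real (norm (y t)) * E) \<le> C / (norm (y t))\<^sup>2"
      using CT[OF yO y0(2)] by (simp add: E_def)
    moreover have "cmod (exp (\<i> * complex_of_real (k * norm (y t))) / complex_of_real (norm (y t)) * E) = cmod E / norm (y t)"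
      using y0 by (simp add: norm_mult norm_divide norm_exp_i_times del: of_real_mult)
    ultimately have "cmod (v (y t)) \<le> C / (norm (y t))\<^sup>2 + cmod E / norm (y t)"
      using norm_triangle_ineq2[of "v (y t)" "exp (\<i> * complex_of_real (k * norm (y t))) / complex_of_real (norm (y t)) * E"]
      by simp
    also have "\<dots> \<le> C / (norm (y t))\<^sup>2 + B / norm (y t)"
      using \<open>cmod E \<le> B\<close> y0 by (intro add_left_mono divide_right_mono) auto
    finally show ?case by (simp add: divide_inverse power_inverse)
  qed
  have inv: "((\<lambda>t. inverse (norm (y t))) \<longlongrightarrow> 0) at_top"
    by (rule tendsto_inverse_0_at_top[OF ny])
  have "((\<lambda>t. C * (inverse (norm (y t)))\<^sup>2 + B * inverse (norm (y t))) \<longlongrightarrow> C * 0\<^sup>2 + B * 0) at_top"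
    by (intro tendsto_intros inv)
  then have "((\<lambda>t. C * (inverse (norm (y t)))\<^sup>2 + B * inverse (norm (y t))) \<longlongrightarrow> 0) at_top" by simp
  then show ?thesis using Lim_null_comparison[OF bound] by (simp add: y_def)
qed

section \<open>Comparison of two surfaces\<close>

lemma incident_plus_reflected:
  "u_in k d x + u_re_D k d x =
     cis (k * (d$1 * x$1 + d$2 * x$2)) * (- 2 * \<i>) * of_real (sin (k * (- d$3) * x$3))"
proof -
  define A where "A = k * (d$1 * x$1 + d$2 * x$2)"
  define \<theta> where "\<theta> = k * (- d$3) * x$3"
  have "u_in k d x = cis (A - \<theta>)"
    unfolding u_in_def cis_conv_exp A_def \<theta>_def inner_vec_def sum_3 by (simp add: algebra_simps)
  moreover have "u_re_D k d x = - cis (A + \<theta>)"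
    unfolding u_re_D_def cis_conv_exp A_def \<theta>_def by (simp add: algebra_simps)
  moreover have "cis (A - \<theta>) - cis (A + \<theta>) = cis A * (- 2 * \<i>) * of_real (sin \<theta>)"
    by (simp add: complex_eq_iff cos_add cos_diff sin_add sin_diff)
  ultimately show ?thesis by (simp add: A_def \<theta>_def)
qed

lemma plane_wave_continuous: "continuous_on A (u_in k d)" "continuous_on A (u_re_D k d)"
  unfolding u_in_def u_re_D_def by (intro continuous_intros)+

lemma continuous_on_ray_tendsto:
  assumes "continuous_on A u" "x \<in> A" "\<And>t. t > 0 \<Longrightarrow> x + t *\<^sub>R axis 3 1 \<in> A"
  shows "(\<lambda>n. u (x + inverse (real (Suc n)) *\<^sub>R axis 3 1)) \<longlonglongrightarrow> u (x :: real^3)"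
  by (rule continuous_on_tendsto_compose[OF assms(1) up_sequence assms(2)]) (use assms(3) in auto)

text \<open>The statement is one-sided because on the region above the first and below the second
  surface only the fields of the first are defined. Exchanging the roles gives the opposite
  inequality.\<close>

lemma surface_le:
  assumes k: "k > 0" and lp: "locally_perturbed f1" "locally_perturbed f2"
    and hyp: "\<forall>d\<in>S2minus. \<exists>u1 u2 F1 F2.
           dirichlet_total_field k f1 d u1 \<and> dirichlet_total_field k f2 d u2 \<and>
           far_field k (Omega f1) (\<lambda>x. u1 x - u_in k d x - u_re_D k d x) F1 \<and>
           far_field k (Omega f2) (\<lambda>x. u2 x - u_in k d x - u_re_D k d x) F2 \<and>
           (\<forall>xh\<in>S2plus. F1 xh = F2 xh)"
  shows "f2 y \<le> f1 y"
proof (rule ccontr)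
  assume "\<not> f2 y \<le> f1 y"
  then have y: "f1 y < f2 y" by simp
  obtain R1 where R1: "R1 > 0" "\<And>y. norm y > R1 \<Longrightarrow> f1 y = 0" "\<And>y. \<bar>f1 y\<bar> < R1" by (rule lp_radius[OF lp(1)]) (rule that)
  obtain R2 where R2: "R2 > 0" "\<And>y. norm y > R2 \<Longrightarrow> f2 y = 0" "\<And>y. \<bar>f2 y\<bar> < R2" by (rule lp_radius[OF lp(2)]) (rule that)
  define D where "D = {x::real^3. f1 (tild x) < x$3 \<and> x$3 < f2 (tild x)}"
  have oD: "open D" unfolding D_def
    by (intro open_Collect_conj open_Collect_less lp_continuous[OF lp(1)] lp_continuous[OF lp(2)] continuous_intros)
  have bD: "bounded D"
  proof (rule boundedI)
    fix x assume x: "x \<in> D"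
    have "norm (tild x) \<le> R1 + R2"
    proof (rule ccontr)
      assume "\<not> ?thesis"
      then have "f1 (tild x) = 0" "f2 (tild x) = 0" using R1(1) R2(1) R1(2)[of "tild x"] R2(2)[of "tild x"] by auto
      then show False using x by (auto simp: D_def)
    qed
    moreover have "\<bar>x$3\<bar> \<le> R1 + R2" using x R1(3)[of "tild x"] R2(3)[of "tild x"] by (auto simp: D_def)
    ultimately have "(norm (tild x))\<^sup>2 \<le> (R1 + R2)\<^sup>2" "(x$3)\<^sup>2 \<le> (R1 + R2)\<^sup>2"
      using power_mono[of "norm (tild x)" "R1 + R2" 2] power_mono[of "\<bar>x$3\<bar>" "R1 + R2" 2] by auto
    then have "(norm x)\<^sup>2 \<le> 2 * (R1 + R2)\<^sup>2" unfolding norm_tild by simp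
    also have "\<dots> \<le> (2 * (R1 + R2))\<^sup>2" unfolding power_mult_distrib by simp
    finally show "norm x \<le> 2 * (R1 + R2)" by (rule power2_le_imp_le) (use R1(1) R2(1) in simp)
  qed
  have DO: "D \<subseteq> Omega f1" by (auto simp: D_def Omega_def)
  have clD: "closure D \<subseteq> {x. f1 (tild x) \<le> x$3 \<and> x$3 \<le> f2 (tild x)}"
    by (rule closure_minimal) (auto simp: D_def intro!: closed_Collect_conj closed_Collect_le lp_continuous[OF lp(1)] lp_continuous[OF lp(2)] continuous_intros)
  define x0 :: "real^3" where "x0 = vector [y$1, y$2, (f1 y + f2 y) / 2]"
  have "tild x0 = y" by (simp add: x0_def tild_def vec_eq_iff forall_2)
  then have x0: "x0 \<in> D" using y by (simp add: D_def) (simp add: x0_def)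
  \<comment> \<open>Distinct vertical components, all below 1, so that the sines on a vertical line
    have pairwise different frequencies \<open>k * g i\<close>.\<close>
  define g where "g i = 1 / (real i + 2)" for i
  have g: "g i > 0" "g i \<le> 1" for i by (auto simp: g_def)
  define d :: "nat \<Rightarrow> real^3" where "d i = vector [sqrt (1 - (g i)\<^sup>2), 0, - g i]" for i
  have d: "d i \<in> S2minus" "d i $ 3 = - g i" for i
  proof -
    have "(g i)\<^sup>2 \<le> 1" using g[of i] by (simp add: power_le_one)
    then have "norm (d i) = 1" by (simp add: norm_vec_def L2_set_def sum_3 d_def)
    then show "d i \<in> S2minus" using g(1)[of i] by (simp add: S2minus_def d_def)
  qed (simp add: d_def)
  \<comment> \<open>Everything needed about a field once it is separated from its companion over the
    second surface; this allows one field to be chosen for each direction.\<close>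
  define P where "P i u \<longleftrightarrow> continuous_on (closure D) u \<and> helm k (Omega f1) u \<and> (\<forall>x\<in>closure D - D. u x = 0) \<and>
      ((\<lambda>t. u (x0 + t *\<^sub>R axis 3 1) - u_in k (d i) (x0 + t *\<^sub>R axis 3 1) - u_re_D k (d i) (x0 + t *\<^sub>R axis 3 1)) \<longlongrightarrow> 0) at_top" for i u
  have "\<exists>u. P i u" for i
  proof -
    obtain u1 u2 F1 F2 where tf: "dirichlet_total_field k f1 (d i) u1" "dirichlet_total_field k f2 (d i) u2"
      and ff: "far_field k (Omega f1) (\<lambda>x. u1 x - u_in k (d i) x - u_re_D k (d i) x) F1"
        "far_field k (Omega f2) (\<lambda>x. u2 x - u_in k (d i) x - u_re_D k (d i) x) F2"
      and F: "\<forall>xh\<in>S2plus. F1 xh = F2 xh"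
      using hyp d(1)[of i] by blast
    have c1: "continuous_on (closure (Omega f1)) u1" and c2: "continuous_on (closure (Omega f2)) u2"
      and z1: "\<And>x. x \<in> Gamma f1 \<Longrightarrow> u1 x = 0" and z2: "\<And>x. x \<in> Gamma f2 \<Longrightarrow> u2 x = 0"
      and h1: "helm k (Omega f1) u1"
      using tf by (auto simp: dirichlet_total_field_def intro: helmholtz_imp_helm)
    have c1': "continuous_on (Omega f1) u1" using c1 closure_subset by (rule continuous_on_subset)
    have "u1 x = 0" if xD: "x \<in> closure D - D" for x
    proof -
      have "f1 (tild x) \<le> x$3" "x$3 \<le> f2 (tild x)" using that clD by auto
      then consider "x \<in> Gamma f1" | "x \<in> Omega f1" "x \<in> Gamma f2" using xD
        by (force simp: D_def Gamma_def Omega_def)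
      then show ?thesis
      proof cases
        case 1 then show ?thesis by (rule z1)
      next
        \<comment> \<open>Here the first field is continuous but has no boundary condition of its
          own. Just above the point both fields are defined and agree, so the boundary value of the
          second is inherited in the limit.\<close>
        case 2
        have "(\<lambda>n. u1 (x + inverse (real (Suc n)) *\<^sub>R axis 3 1)) \<longlonglongrightarrow> u1 x"
          by (rule continuous_on_ray_tendsto[OF c1' 2(1)]) (use up_in_Omega[of x f1] 2 in auto)
        moreover have "(\<lambda>n. u2 (x + inverse (real (Suc n)) *\<^sub>R axis 3 1)) \<longlonglongrightarrow> u2 x"
          by (rule continuous_on_ray_tendsto[OF c2 Gamma_closure[OF 2(2)]])
            (use up_in_Omega[of x f2] 2 closure_subset[of "Omega f2"] in blast)
        moreover have "u1 (x + inverse (real (Suc n)) *\<^sub>R axis 3 1) = u2 (x + inverse (real (Suc n)) *\<^sub>R axis 3 1)" for n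
          by (rule total_fields_agree[OF k lp tf ff F]) (use up_in_Omega[of x] 2 in auto)
        ultimately have "u1 x = u2 x" using LIMSEQ_unique by simp
        then show ?thesis using z2[OF 2(2)] by simp
      qed
    qed
    moreover have "((\<lambda>t. u1 (x0 + t *\<^sub>R axis 3 1) - u_in k (d i) (x0 + t *\<^sub>R axis 3 1) - u_re_D k (d i) (x0 + t *\<^sub>R axis 3 1)) \<longlongrightarrow> 0) at_top"
      by (rule far_field_vertical_decay[OF lp(1) ff(1)]) (intro continuous_on_diff c1' plane_wave_continuous)
    moreover have "continuous_on (closure D) u1" using c1 closure_mono[OF DO] by (rule continuous_on_subset)
    ultimately have "P i u1" unfolding P_def using h1 by blast
    then show ?thesis by (rule exI[of "P i" u1])
  qed
  then have "\<forall>i. \<exists>u. P i u" by blast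
  then obtain u where u: "\<And>i. P i (u i)" using choice[of P] by blast
  have "zero_ext k D (\<lambda>x. if x \<in> D then u i x else 0)" for i
    unfolding zero_ext_def
  proof (intro conjI)
    show "continuous_on UNIV (\<lambda>x. if x \<in> D then u i x else 0)"
      by (rule zero_extension_continuous[OF oD]) (use u[of i] in \<open>auto simp: P_def\<close>)
    show "helm k D (\<lambda>x. if x \<in> D then u i x else 0)"
      by (rule helm_cong[OF oD helm_subset[OF _ DO, where u="u i"]]) (use u[of i] in \<open>auto simp: P_def\<close>)
  qed auto
  from zero_ext_dependent[OF k oD bD, where U="\<lambda>i x. if x \<in> D then u i x else 0", OF this] obtain N c i0
    where dep: "\<And>x. (\<Sum>i<N. c i * (if x \<in> D then u i x else 0)) = 0" and i0: "i0 < N" "c i0 \<noteq> 0"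
    by blast
  define z where "z x = (\<Sum>i<N. c i * u i x)" for x
  have hz: "helm k (Omega f1) z" unfolding z_def by (rule helm_sum) (use u in \<open>simp add: P_def\<close>)
  have zD: "z x = 0" if "x \<in> D" for x using dep[of x] that by (simp add: z_def)
  obtain e where e: "e > 0" "ball x0 e \<subseteq> D" using openE[OF oD x0] by blast
  \<comment> \<open>The vertical ray starts in \<open>D\<close>, where the combination vanishes, and
    never leaves \<open>Omega f1\<close>.\<close>
  have zray: "z (x0 + t *\<^sub>R axis 3 1) = 0" if "t \<ge> 0" for t
  proof (rule helm_line_unique_continuation[OF open_Omega[OF lp(1)] helm_imp_weak_helm[OF hz open_Omega[OF lp(1)]],
        where I="{0..}" and ?t0.0=0 and \<epsilon>=e])
    show "x0 + s *\<^sub>R axis 3 1 \<in> Omega f1" if "s \<in> {0..}" for s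
      using that x0 by (auto simp: D_def Omega_def tild_up axis3_components)
    show "z (x0 + s *\<^sub>R axis 3 1) = 0" if "\<bar>s - 0\<bar> < e" for s
      by (intro zD subsetD[OF e(2)]) (use that in \<open>auto simp: dist_norm norm_axis_1\<close>)
  qed (use e(1) that in \<open>auto simp: norm_axis_1\<close>)
  define a where "a i = cis (k * (d i$1 * x0$1 + d i$2 * x0$2)) * (- 2 * \<i>)" for i
  have inc: "u_in k (d i) (x0 + t *\<^sub>R axis 3 1) + u_re_D k (d i) (x0 + t *\<^sub>R axis 3 1) = a i * of_real (sin (k * g i * (x0$3 + t)))" for i t
    unfolding incident_plus_reflected a_def axis3_components d(2) by simp
  \<comment> \<open>With this sign, minus the combined scattered fields is the combined incident and
    reflected waves minus \<open>z\<close>, and \<open>z\<close> vanishes on the ray. So the sines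
    must tend to 0.\<close>
  have "((\<lambda>t. \<Sum>i<N. - c i * (u i (x0 + t *\<^sub>R axis 3 1) - u_in k (d i) (x0 + t *\<^sub>R axis 3 1) - u_re_D k (d i) (x0 + t *\<^sub>R axis 3 1)))
      \<longlongrightarrow> (\<Sum>i<N. - c i * 0)) at_top"
    by (intro tendsto_sum tendsto_mult tendsto_const) (use u in \<open>simp add: P_def\<close>)
  then have "((\<lambda>t. \<Sum>i<N. - c i * (u i (x0 + t *\<^sub>R axis 3 1) - u_in k (d i) (x0 + t *\<^sub>R axis 3 1) - u_re_D k (d i) (x0 + t *\<^sub>R axis 3 1)))
      \<longlongrightarrow> 0) at_top" by simp
  moreover have "\<forall>\<^sub>F t in at_top. (\<Sum>i<N. - c i * (u i (x0 + t *\<^sub>R axis 3 1) - u_in k (d i) (x0 + t *\<^sub>R axis 3 1) - u_re_D k (d i) (x0 + t *\<^sub>R axis 3 1)))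
      = (\<Sum>i<N. (c i * a i) * of_real (sin (k * g i * (x0$3 + t))))"
    using eventually_ge_at_top[of 0]
  proof (rule eventually_mono)
    fix t :: real assume "0 \<le> t"
    have "(\<Sum>i<N. - c i * (u i (x0 + t *\<^sub>R axis 3 1) - u_in k (d i) (x0 + t *\<^sub>R axis 3 1) - u_re_D k (d i) (x0 + t *\<^sub>R axis 3 1)))
      = (\<Sum>i<N. (c i * a i) * of_real (sin (k * g i * (x0$3 + t))) - c i * u i (x0 + t *\<^sub>R axis 3 1))"
    proof (rule sum.cong)
      show "- c i * (u i (x0 + t *\<^sub>R axis 3 1) - u_in k (d i) (x0 + t *\<^sub>R axis 3 1) - u_re_D k (d i) (x0 + t *\<^sub>R axis 3 1))
        = c i * a i * of_real (sin (k * g i * (x0$3 + t))) - c i * u i (x0 + t *\<^sub>R axis 3 1)" for i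
        unfolding mult.assoc[of "c i" "a i"] inc[symmetric] by (simp add: algebra_simps)
    qed simp
    also have "\<dots> = (\<Sum>i<N. (c i * a i) * of_real (sin (k * g i * (x0$3 + t)))) - z (x0 + t *\<^sub>R axis 3 1)"
      by (simp add: sum_subtractf z_def)
    finally show "(\<Sum>i<N. - c i * (u i (x0 + t *\<^sub>R axis 3 1) - u_in k (d i) (x0 + t *\<^sub>R axis 3 1) - u_re_D k (d i) (x0 + t *\<^sub>R axis 3 1)))
      = (\<Sum>i<N. (c i * a i) * of_real (sin (k * g i * (x0$3 + t))))" using zray[OF \<open>0 \<le> t\<close>] by simp
  qed
  ultimately have lim: "((\<lambda>t. \<Sum>i<N. (c i * a i) * of_real (sin (k * g i * (x0$3 + t)))) \<longlongrightarrow> 0) at_top"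
    by (rule Lim_transform_eventually)
  have "filterlim (\<lambda>s::real. - (x0$3) + s) at_top at_top"
    by (rule filterlim_tendsto_add_at_top[OF tendsto_const filterlim_ident])
  from filterlim_compose[OF lim this]
  have "((\<lambda>s. \<Sum>i<N. (c i * a i) * of_real (sin (k * g i * s))) \<longlongrightarrow> 0) at_top" by simp
  then have "c i0 * a i0 = 0"
  proof (rule sin_independent[rotated 2])
    show "k * g i > 0" for i using k g by simp
    show "inj (\<lambda>i. k * g i)" using k by (auto simp: inj_on_def g_def)
  qed (rule i0(1))
  then show False using i0(2) by (simp add: a_def)
qed

theorem mainTheorem4:
  fixes k :: real and f1 f2 :: "real^2 \<Rightarrow> real"
  assumes "k > 0"
    and "locally_perturbed f1" and "locally_perturbed f2"
    and "\<forall>d\<in>S2minus. \<exists>u1 u2 F1 F2.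
           dirichlet_total_field k f1 d u1 \<and> dirichlet_total_field k f2 d u2 \<and>
           far_field k (Omega f1) (\<lambda>x. u1 x - u_in k d x - u_re_D k d x) F1 \<and>
           far_field k (Omega f2) (\<lambda>x. u2 x - u_in k d x - u_re_D k d x) F2 \<and>
           (\<forall>xh\<in>S2plus. F1 xh = F2 xh)"
  shows "Gamma f1 = Gamma f2"
proof -
  have swap: "\<forall>d\<in>S2minus. \<exists>u1 u2 F1 F2.
           dirichlet_total_field k f2 d u1 \<and> dirichlet_total_field k f1 d u2 \<and>
           far_field k (Omega f2) (\<lambda>x. u1 x - u_in k d x - u_re_D k d x) F1 \<and>
           far_field k (Omega f1) (\<lambda>x. u2 x - u_in k d x - u_re_D k d x) F2 \<and>
           (\<forall>xh\<in>S2plus. F1 xh = F2 xh)"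
  proof
    fix d :: "real^3" assume "d \<in> S2minus"
    then obtain u1 u2 F1 F2 where
      "dirichlet_total_field k f1 d u1" "dirichlet_total_field k f2 d u2"
      "far_field k (Omega f1) (\<lambda>x. u1 x - u_in k d x - u_re_D k d x) F1"
      "far_field k (Omega f2) (\<lambda>x. u2 x - u_in k d x - u_re_D k d x) F2"
      "\<forall>xh\<in>S2plus. F1 xh = F2 xh"
      using assms(4) by blast
    then show "\<exists>u1 u2 F1 F2.
           dirichlet_total_field k f2 d u1 \<and> dirichlet_total_field k f1 d u2 \<and>
           far_field k (Omega f2) (\<lambda>x. u1 x - u_in k d x - u_re_D k d x) F1 \<and>
           far_field k (Omega f1) (\<lambda>x. u2 x - u_in k d x - u_re_D k d x) F2 \<and>
           (\<forall>xh\<in>S2plus. F1 xh = F2 xh)"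
      by (intro exI[of _ u2] exI[of _ u1] exI[of _ F2] exI[of _ F1]) simp
  qed
  have "f1 y = f2 y" for y
    using surface_le[OF assms, of y] surface_le[OF assms(1,3,2) swap, of y] by simp
  then have "f1 = f2" by (rule ext)
  then show ?thesis by simp
qed

end
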